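(* Let $R$ be a ring and $R^{\mathrm e}=R\otimes_{\mathbb Z}R^{\mathrm{op}}$. Bialgebroids over $R$ are the bimonoids of the lax-strong duoidal category of $(R^{\mathrm e},R^{\mathrm e})$-bimodules with lax structure $\times_R$ and strong structure $\otimes_{R^{\mathrm e}}$. That is, for every $(R^{\mathrm e},R^{\mathrm e})$-bimodule $A$, the assignment $(\{m^n\}_{n\ge-1},\{d^n\}_{n\ge-1})\mapsto(\mu_A,\eta_A,\delta_A,\epsilon_A)=(m^1,m^{-1},d^1,d^{-1})$ is a bijection from bimonoid structures on $A$ to bialgebroid structures on $A$.
   Context: **Bimodules.** An $(R^{\mathrm e},R^{\mathrm e})$-bimodule carries commuting left actions of $r\in R$, $\bar r\in R^{\mathrm{op}}$ and right actions of $s\in R$, $\bar s\in R^{\mathrm{op}}$. $\otimes_{R^{\mathrm e}}$ is the usual tensor product of bimodules with unit $R^{\mathrm e}$, regarded as an unbiased (strong) monoidal structure with $(n+1)$-ary functors $\omega^n$ ($\omega^{-1}=R^{\mathrm e}$, $\omega^0=\mathrm{Id}$, $\omega^n$ the $(n+1)$-fold tensor product) and canonical invertible maps $\omega^{p+q}\to\omega^p(-,\omega^q,-)$. **$\times_R$.** For $n\ge0$, let $M^{(0)}\otimes_R\cdots\otimes_RM^{(n)}$ be the quotient of the tensor product of abelian groups by $\cdots\otimes\bar r m^{(j)}\otimes m^{(j+1)}\otimes\cdots=\cdots\otimes m^{(j)}\otimes r m^{(j+1)}\otimes\cdots$ ($r\in R$, $0\le j<n$), and $\lambda^n(M^{(0)},\dots,M^{(n)})=M^{(0)}\times_R\cdots\times_RM^{(n)}$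 the subgroup of elements $\sum_i m_i^{(0)}\otimes\cdots\otimes m_i^{(n)}$ with $\sum_i\cdots\otimes m_i^{(j)}\bar s\otimes m_i^{(j+1)}\otimes\cdots=\sum_i\cdots\otimes m_i^{(j)}\otimes m_i^{(j+1)}s\otimes\cdots$ ($s\in R$, $0\le j<n$), with bimodule structure $(r,s)\cdot(m^{(0)}\otimes\cdots\otimes m^{(n)})\cdot(r',s')=(r m^{(0)}r')\otimes\cdots\otimes(\bar s m^{(n)}\bar s')$; $\lambda^0=\mathrm{Id}$; $\lambda^{-1}=\mathrm{End}(R)=\mathrm{Hom}_{\mathbb Z}(R,R)$ with $[(r,r')f(s,s')](m)=r f(sms')r'$. The maps $\lambda^p(-,\lambda^q,-)\to\lambda^{p+q}$ are, for $q\ge0$, induced by the inclusions $M\times_R\cdots\times_RN\subset M\otimes_R\cdots\otimes_RN$, and for $q=-1$, $p\ge1$ send $\cdots\otimes\phi\otimes n\otimes\cdots$ to $\cdots\otimes\phi(1_R)\cdot n\otimes\cdots$, or $\cdots\otimes z\otimes\phi$ to $\cdots\otimes\overline{\phi(1_R)}\cdot z$ when $\mathrm{End}(R)$ is last. This is a lax monoidal structure. **Interchange.** $\chi^{-1,n}:R^{\mathrm e}\to\lambda^n(R^{\mathrm e},\dots,R^{\mathrm e})$ is the bimodule map with $(1,1)\mapsto(1,1)\otimes\cdots\otimes(1,1)$ ($n\ge0$), $(1,1)\mapsto\mathrm{id}_R$ ($n=-1$). $\chi^{1,n}:\lambda^n(\mathbf M)\otimes_{R^{\mathrm e}}\lambda^n(\mathbf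 N)\to\lambda^n(M^{(0)}\otimes_{R^{\mathrm e}}N^{(0)},\dots,M^{(n)}\otimes_{R^{\mathrm e}}N^{(n)})$ is composition of endomorphisms for $n=-1$, the identity for $n=0$, and is induced by the shuffle $(m^{(0)}\otimes\cdots\otimes m^{(n)})\otimes(n^{(0)}\otimes\cdots\otimes n^{(n)})\mapsto(m^{(0)}\otimes n^{(0)})\otimes\cdots\otimes(m^{(n)}\otimes n^{(n)})$ for $n\ge1$. For each $n$ these make $\lambda^n$ a lax monoidal functor for $\otimes_{R^{\mathrm e}}$, and $\chi^{p,n}:\omega^p\lambda^n\to\lambda^n\omega^p$ denotes the resulting (iterated) $p$-ary lax structure map. **Bimonoid.** A bimodule $A$ with maps $m^n:\omega^n(A,\dots,A)\to A$ and $d^n:A\to\lambda^n(A,\dots,A)$ ($n\ge-1$) such that: $m^0=\mathrm{id}$ and $m^{p+q}=m^p\circ\omega^p(-,m^q,-)\circ(\omega^{p+q}\to\omega^p(-,\omega^q,-))$ (monoid); $d^0=\mathrm{id}$ and $d^{p+q}=(\lambda^p(-,\lambda^q,-)\to\lambda^{p+q})\circ\lambda^p(-,d^q,-)\circ d^p$ (comonoid), for all $p\ge0,q\ge-1$ and positions; and for all $p,q\ge-1$, $d^q\circ m^p=\lambda^q(m^p,\dots,m^p)\circ\chi^{p,q}\circ\omega^p(d^q,\dots,d^q)$. **Bialgebroid.** A bimodule $A$ with bimodule maps $\mu_A:A\otimes_{R^{\mathrm e}}A\to A$, $\eta_A:R^{\mathrm e}\to A$, which are associative and unital; $\delta_A:A\to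 A\times_RA$, $\epsilon_A:A\to\mathrm{End}(R)$ such that the two composites $A\xrightarrow{\delta_A}A\times_RA\xrightarrow{\delta_A\times_R-}(A\times_RA)\times_RA\to A\times_RA\times_RA$ and $A\xrightarrow{\delta_A}A\times_RA\xrightarrow{-\times_R\delta_A}A\times_R(A\times_RA)\to A\times_RA\times_RA$ agree and the composites $A\xrightarrow{\delta_A}A\times_RA\xrightarrow{\epsilon_A\times_R-}\mathrm{End}(R)\times_RA\to A$ and $A\xrightarrow{\delta_A}A\times_RA\xrightarrow{-\times_R\epsilon_A}A\times_R\mathrm{End}(R)\to A$ are identities; and such that: $\delta_A\mu_A=(\mu_A\times_R\mu_A)\circ\chi^{1,1}\circ(\delta_A\otimes_{R^{\mathrm e}}\delta_A)$; $\epsilon_A\eta_A=\chi^{-1,-1}$; $\delta_A\eta_A=(\eta_A\times_R\eta_A)\circ\chi^{-1,1}$; $\epsilon_A\mu_A=\chi^{1,-1}\circ(\epsilon_A\otimes_{R^{\mathrm e}}\epsilon_A)$. *)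

theory Defs
  imports "HOL-Algebra.Generated_Groups" "HOL-Algebra.Free_Abelian_Groups" "HOL-Algebra.Ring"
begin

text \<open>
  The base ring is a type \<open>'r\<close> of sort \<open>{ring, monoid_mult}\<close>: an associative unital ring,
  possibly noncommutative, with \<open>0 = 1\<close> allowed (which \<open>ring_1\<close> would exclude).

  All indices \<open>n \<ge> -1\<close> are shifted to arities \<open>n + 1 :: nat\<close>: the functor \<open>\<omega>\<^sup>n\<close>
  takes lists of \<open>n + 1\<close> bimodules, \<open>m\<^sup>n\<close> is \<open>m (n + 1)\<close>, and so on.
\<close>

section \<open>A universe closed under tensor products\<close>

text \<open>
  Iterated tensor products of different depths have to be bimodules over one type. Every
  bimodule considered has its carrier inside the following type. \<open>Atom\<close> makes room
  for bimodules with arbitrary elements, \<open>Scal\<close> and \<open>Endo\<close> for \<open>R\<close> and \<open>End(R)\<close>, and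
  \<open>Tens\<close> for elements of tensor products, stored as finite formal integer combinations of words.
  A coset of formal combinations is encoded by one chosen member (\<open>enc\<close>).
\<close>

datatype ('r, 'a) univ =
    Atom 'a
  | Scal (the_scal: 'r)
  | Endo (the_endo: "'r \<Rightarrow> 'r")
  | Tens (the_tens: "(int \<times> ('r, 'a) univ list) list")

type_synonym ('r, 'a) chain = "('r, 'a) univ list \<Rightarrow>\<^sub>0 int"

definition chain_of :: "('r, 'a) univ \<Rightarrow> ('r, 'a) chain" where
  "chain_of x = (\<Sum>(k, w) \<leftarrow> the_tens x. frag_cmul k (frag_of w))"

definition enc :: "('r, 'a) chain set \<Rightarrow> ('r, 'a) univ" where
  "enc X = Tens (SOME ts. chain_of (Tens ts) \<in> X)"

lemma chain_of_Tens_surj: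
  fixes c :: "('r, 'a) chain"
  shows "\<exists>ts. chain_of (Tens ts) = c"
proof (rule frag_induction[where S = UNIV and P = "\<lambda>c. \<exists>ts. chain_of (Tens ts) = c"])
  show "\<exists>ts. chain_of (Tens ts) = (0 :: ('r, 'a) chain)"
    by (rule exI[of _ "[]"]) (simp add: chain_of_def)
  show "\<exists>ts. chain_of (Tens ts) = frag_of w" for w :: "('r, 'a) univ list"
    by (rule exI[of _ "[(1, w)]"]) (simp add: chain_of_def)
  fix a b :: "('r, 'a) chain"
  assume "\<exists>ts. chain_of (Tens ts) = a" "\<exists>ts. chain_of (Tens ts) = b"
  then obtain s t where st: "chain_of (Tens s) = a" "chain_of (Tens t) = b" by blast
  have neg: "chain_of (Tens (map (\<lambda>(k, w). (- k, w)) t)) = - chain_of (Tens t)"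
    by (induction t) (auto simp: chain_of_def)
  have "chain_of (Tens (s @ map (\<lambda>(k, w). (- k, w)) t)) = a - b"
    using st neg by (simp add: chain_of_def)
  then show "\<exists>ts. chain_of (Tens ts) = a - b" by blast
qed simp

lemma chain_of_enc:
  assumes "X \<noteq> {}"
  shows "chain_of (enc X) \<in> X"
proof -
  obtain ts where "chain_of (Tens ts) \<in> X"
    using assms chain_of_Tens_surj by (metis all_not_in_conv)
  then show ?thesis unfolding enc_def by (rule someI)
qed


section \<open>Bimodules\<close>

text \<open>
  The abelian group is the additive part of the library's \<open>ring\<close> record
  (as for the library's modules, \<open>mult\<close> and \<open>one\<close> are not used). The four actions are
  \<open>lact M r m = r m\<close>, \<open>lbact M r m = \<bar>r m\<close>, \<open>ract M m s = m s\<close>, \<open>rbact M m s = m \<bar>s\<close>,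
  where a bar marks an element of \<open>R\<^sup>o\<^sup>p\<close>.
\<close>

record ('r, 'u) bimod = "'u ring" +
  lact :: "'r \<Rightarrow> 'u \<Rightarrow> 'u"
  lbact :: "'r \<Rightarrow> 'u \<Rightarrow> 'u"
  ract :: "'u \<Rightarrow> 'r \<Rightarrow> 'u"
  rbact :: "'u \<Rightarrow> 'r \<Rightarrow> 'u"

type_synonym ('r, 'a) ubimod = "('r, ('r, 'a) univ) bimod"

locale bimodule = abelian_group M
  for M :: "('r::{ring, monoid_mult}, 'u) bimod" (structure) +
  assumes closed:
      "m \<in> carrier M \<Longrightarrow> lact M r m \<in> carrier M"
      "m \<in> carrier M \<Longrightarrow> lbact M r m \<in> carrier M"
      "m \<in> carrier M \<Longrightarrow> ract M m r \<in> carrier M"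
      "m \<in> carrier M \<Longrightarrow> rbact M m r \<in> carrier M"
    and act_add:
      "\<lbrakk>m \<in> carrier M; n \<in> carrier M\<rbrakk> \<Longrightarrow> lact M r (m \<oplus> n) = lact M r m \<oplus> lact M r n"
      "\<lbrakk>m \<in> carrier M; n \<in> carrier M\<rbrakk> \<Longrightarrow> lbact M r (m \<oplus> n) = lbact M r m \<oplus> lbact M r n"
      "\<lbrakk>m \<in> carrier M; n \<in> carrier M\<rbrakk> \<Longrightarrow> ract M (m \<oplus> n) r = ract M m r \<oplus> ract M n r"
      "\<lbrakk>m \<in> carrier M; n \<in> carrier M\<rbrakk> \<Longrightarrow> rbact M (m \<oplus> n) r = rbact M m r \<oplus> rbact M n r"
    and add_act:
      "m \<in> carrier M \<Longrightarrow> lact M (r + s) m = lact M r m \<oplus> lact M s m"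
      "m \<in> carrier M \<Longrightarrow> lbact M (r + s) m = lbact M r m \<oplus> lbact M s m"
      "m \<in> carrier M \<Longrightarrow> ract M m (r + s) = ract M m r \<oplus> ract M m s"
      "m \<in> carrier M \<Longrightarrow> rbact M m (r + s) = rbact M m r \<oplus> rbact M m s"
    and act_one:
      "m \<in> carrier M \<Longrightarrow> lact M 1 m = m"
      "m \<in> carrier M \<Longrightarrow> lbact M 1 m = m"
      "m \<in> carrier M \<Longrightarrow> ract M m 1 = m"
      "m \<in> carrier M \<Longrightarrow> rbact M m 1 = m"
    and act_mult:
      "m \<in> carrier M \<Longrightarrow> lact M (r * s) m = lact M r (lact M s m)"
      "m \<in> carrier M \<Longrightarrow> lbact M (s * r) m = lbact M r (lbact M s m)"
      "m \<in> carrier M \<Longrightarrow> ract M m (r * s) = ract M (ract M m r) s"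
      "m \<in> carrier M \<Longrightarrow> rbact M m (s * r) = rbact M (rbact M m r) s"
    and act_commute:
      "m \<in> carrier M \<Longrightarrow> lact M r (lbact M s m) = lbact M s (lact M r m)"
      "m \<in> carrier M \<Longrightarrow> ract M (rbact M m s) r = rbact M (ract M m r) s"
      "m \<in> carrier M \<Longrightarrow> lact M r (ract M m s) = ract M (lact M r m) s"
      "m \<in> carrier M \<Longrightarrow> lact M r (rbact M m s) = rbact M (lact M r m) s"
      "m \<in> carrier M \<Longrightarrow> lbact M r (ract M m s) = ract M (lbact M r m) s"
      "m \<in> carrier M \<Longrightarrow> lbact M r (rbact M m s) = rbact M (lbact M r m) s"

text \<open>Maps are extensional functions, so that equality of maps is equality on the carrier.\<close>

definition bim_hom :: "('r, 'u) bimod \<Rightarrow> ('r, 'v) bimod \<Rightarrow> ('u \<Rightarrow> 'v) set" where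
  "bim_hom M N = {f \<in> carrier M \<rightarrow>\<^sub>E carrier N.
     (\<forall>x\<in>carrier M. \<forall>y\<in>carrier M. f (x \<oplus>\<^bsub>M\<^esub> y) = f x \<oplus>\<^bsub>N\<^esub> f y) \<and>
     (\<forall>x\<in>carrier M. \<forall>r.
        f (lact M r x) = lact N r (f x) \<and> f (lbact M r x) = lbact N r (f x) \<and>
        f (ract M x r) = ract N (f x) r \<and> f (rbact M x r) = rbact N (f x) r)}"


section \<open>Tensor products\<close>

text \<open>
  For a list \<open>Gs\<close> of abelian groups and a set \<open>B\<close> of balancing relators, the tensor product is
  the free abelian group on words \<open>[x\<^sub>0, \<dots>, x\<^sub>n]\<close>, \<open>x\<^sub>j \<in> Gs ! j\<close>, modulo the subgroup
  generated by the multilinearity relators and \<open>B\<close>; \<open>tclass Gs B c\<close> is the class of \<open>c\<close>.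
\<close>

definition words :: "('u, 'm) ring_scheme list \<Rightarrow> 'u list set" where
  "words Gs = {w. list_all2 (\<lambda>x G. x \<in> carrier G) w Gs}"

definition multilinear :: "('u, 'm) ring_scheme list \<Rightarrow> ('u list \<Rightarrow>\<^sub>0 int) set" where
  "multilinear Gs = {frag_of (w[j := w ! j \<oplus>\<^bsub>Gs ! j\<^esub> y]) - frag_of w - frag_of (w[j := y]) |
     w j y. w \<in> words Gs \<and> j < length Gs \<and> y \<in> carrier (Gs ! j)}"

definition rel ::
  "('u, 'm) ring_scheme list \<Rightarrow> ('u list \<Rightarrow>\<^sub>0 int) set \<Rightarrow> ('u list \<Rightarrow>\<^sub>0 int) set" where
  "rel Gs B = generate (free_Abelian_group (words Gs)) (multilinear Gs \<union> B)"

definition tclass ::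
  "(('r, 'a) univ, 'm) ring_scheme list \<Rightarrow> ('r, 'a) chain set \<Rightarrow> ('r, 'a) chain \<Rightarrow> ('r, 'a) univ" where
  "tclass Gs B c = enc (rel Gs B #>\<^bsub>free_Abelian_group (words Gs)\<^esub> c)"

text \<open>The last four arguments give the actions on words; they are extended additively.\<close>

definition tensor ::
  "(('r, 'a) univ, 'm) ring_scheme list \<Rightarrow> ('r, 'a) chain set
   \<Rightarrow> ('r \<Rightarrow> ('r, 'a) univ list \<Rightarrow> ('r, 'a) univ list)
   \<Rightarrow> ('r \<Rightarrow> ('r, 'a) univ list \<Rightarrow> ('r, 'a) univ list)
   \<Rightarrow> (('r, 'a) univ list \<Rightarrow> 'r \<Rightarrow> ('r, 'a) univ list)
   \<Rightarrow> (('r, 'a) univ list \<Rightarrow> 'r \<Rightarrow> ('r, 'a) univ list) \<Rightarrow> ('r, 'a) ubimod" where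
  "tensor Gs B l lb rt rb = \<lparr>
     carrier = enc ` carrier (free_Abelian_group (words Gs) Mod rel Gs B),
     monoid.mult = undefined,
     one = undefined,
     zero = tclass Gs B 0,
     add = (\<lambda>x y. tclass Gs B (chain_of x + chain_of y)),
     lact = (\<lambda>r x. tclass Gs B (frag_extend (\<lambda>w. frag_of (l r w)) (chain_of x))),
     lbact = (\<lambda>r x. tclass Gs B (frag_extend (\<lambda>w. frag_of (lb r w)) (chain_of x))),
     ract = (\<lambda>x r. tclass Gs B (frag_extend (\<lambda>w. frag_of (rt w r)) (chain_of x))),
     rbact = (\<lambda>x r. tclass Gs B (frag_extend (\<lambda>w. frag_of (rb w r)) (chain_of x)))\<rparr>"

text \<open>
  \<open>addext N f x\<close> is \<open>\<Sum>\<^sub>k c\<^sub>k f(w\<^sub>k)\<close>, computed in \<open>N\<close>, where \<open>\<Sum>\<^sub>k c\<^sub>k w\<^sub>k\<close> is the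
  representative of \<open>x\<close>.
\<close>

definition addext ::
  "(('r, 'a) univ, 'm) ring_scheme \<Rightarrow> (('r, 'a) univ list \<Rightarrow> ('r, 'a) univ) \<Rightarrow> ('r, 'a) univ
   \<Rightarrow> ('r, 'a) univ" where
  "addext N f x =
     finsum N (\<lambda>w. [Poly_Mapping.lookup (chain_of x) w] \<cdot>\<^bsub>N\<^esub> f w) (Poly_Mapping.keys (chain_of x))"

text \<open>A one-fold tensor product is the module itself, and its pure tensor \<open>[x]\<close> is \<open>x\<close>.\<close>

definition lift ::
  "('r, 'a) ubimod list \<Rightarrow> ('r, 'a) ubimod \<Rightarrow> (('r, 'a) univ list \<Rightarrow> ('r, 'a) univ)
   \<Rightarrow> ('r, 'a) univ \<Rightarrow> ('r, 'a) univ" where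
  "lift Ms N f x = (if length Ms = 1 then f [x] else addext N f x)"


section \<open>The strong monoidal structure \<open>\<otimes>\<close> over the enveloping ring\<close>

definition ring_of_scalars :: "('r::{ring, monoid_mult}, 'a) univ ring" where
  "ring_of_scalars = \<lparr>
     carrier = range Scal,
     monoid.mult = (\<lambda>x y. Scal (the_scal x * the_scal y)),
     one = Scal 1,
     zero = Scal 0,
     add = (\<lambda>x y. Scal (the_scal x + the_scal y))\<rparr>"

text \<open>
  \<open>R\<^sup>e = R \<otimes>\<^sub>\<int> R\<^sup>o\<^sup>p\<close> as a bimodule over itself; note that \<open>\<bar>r \<bar>b\<close> is the bar of \<open>b * r\<close>.
\<close>

definition Renv :: "('r::{ring, monoid_mult}, 'a) ubimod" where
  "Renv = tensor [ring_of_scalars, ring_of_scalars] {}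
     (\<lambda>r w. [Scal (r * the_scal (w ! 0)), w ! 1])
     (\<lambda>r w. [w ! 0, Scal (the_scal (w ! 1) * r)])
     (\<lambda>w s. [Scal (the_scal (w ! 0) * s), w ! 1])
     (\<lambda>w s. [w ! 0, Scal (s * the_scal (w ! 1))])"

definition Renv_one :: "('r::{ring, monoid_mult}, 'a) univ" where
  "Renv_one = tclass [ring_of_scalars, ring_of_scalars] {} (frag_of [Scal 1, Scal 1])"

text \<open>Balancing over \<open>R\<^sup>e\<close> is imposed on its ring generators \<open>s\<close> and \<open>\<bar>s\<close>.\<close>

definition balE :: "('r, 'a) ubimod list \<Rightarrow> ('r, 'a) chain set" where
  "balE Ms =
     {frag_of (w[j := ract (Ms ! j) (w ! j) s]) -
      frag_of (w[Suc j := lact (Ms ! Suc j) s (w ! Suc j)]) |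
      w j s. w \<in> words Ms \<and> Suc j < length Ms} \<union>
     {frag_of (w[j := rbact (Ms ! j) (w ! j) s]) -
      frag_of (w[Suc j := lbact (Ms ! Suc j) s (w ! Suc j)]) |
      w j s. w \<in> words Ms \<and> Suc j < length Ms}"

definition omega :: "('r::{ring, monoid_mult}, 'a) ubimod list \<Rightarrow> ('r, 'a) ubimod" where
  "omega Ms =
    (if Ms = [] then Renv
     else if length Ms = 1 then hd Ms
     else let n = length Ms - 1 in tensor Ms (balE Ms)
       (\<lambda>r w. w[0 := lact (Ms ! 0) r (w ! 0)])
       (\<lambda>r w. w[0 := lbact (Ms ! 0) r (w ! 0)])
       (\<lambda>w s. w[n := ract (Ms ! n) (w ! n) s])
       (\<lambda>w s. w[n := rbact (Ms ! n) (w ! n) s]))"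

definition pureE ::
  "('r::{ring, monoid_mult}, 'a) ubimod list \<Rightarrow> ('r, 'a) univ list \<Rightarrow> ('r, 'a) univ" where
  "pureE Ms w =
    (if Ms = [] then Renv_one
     else if length Ms = 1 then hd w
     else tclass Ms (balE Ms) (frag_of w))"

text \<open>\<open>omega_map fs Ms Ns\<close> is the functorial action on maps \<open>fs ! j\<close> from \<open>Ms ! j\<close> to \<open>Ns ! j\<close>.\<close>

definition omega_map ::
  "(('r::{ring, monoid_mult}, 'a) univ \<Rightarrow> ('r, 'a) univ) list
   \<Rightarrow> ('r, 'a) ubimod list \<Rightarrow> ('r, 'a) ubimod list \<Rightarrow> ('r, 'a) univ \<Rightarrow> ('r, 'a) univ" where
  "omega_map fs Ms Ns = (\<lambda>x\<in>carrier (omega Ms).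
     if Ms = [] then x
     else lift Ms (omega Ns) (\<lambda>w. pureE Ns (map2 (\<lambda>f y. f y) fs w)) x)"

text \<open>
  The canonical map \<open>\<omega>\<^sup>p\<^sup>+\<^sup>q \<rightarrow> \<omega>\<^sup>p(-, \<omega>\<^sup>q, -)\<close>, bracketing the \<open>l = q + 1\<close> consecutive factors
  that start at position \<open>i\<close>. For \<open>l = 0\<close> it inserts the unit of \<open>R\<^sup>e\<close>.
\<close>

definition bracketing :: "('u list \<Rightarrow> 'u) \<Rightarrow> 'u list \<Rightarrow> nat \<Rightarrow> nat \<Rightarrow> 'u list" where
  "bracketing F Ms i l = take i Ms @ [F (take l (drop i Ms))] @ drop (i + l) Ms"

definition omega_split ::
  "('r::{ring, monoid_mult}, 'a) ubimod list \<Rightarrow> nat \<Rightarrow> nat \<Rightarrow> ('r, 'a) univ \<Rightarrow> ('r, 'a) univ" where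
  "omega_split Ms i l = (\<lambda>x\<in>carrier (omega Ms).
     if Ms = [] then x
     else lift Ms (omega (bracketing omega Ms i l))
       (\<lambda>w. pureE (bracketing omega Ms i l)
              (bracketing (pureE (take l (drop i Ms))) w i l)) x)"


section \<open>The lax monoidal structure \<open>\<times>\<^sub>R\<close>\<close>

definition balR :: "('r, 'a) ubimod list \<Rightarrow> ('r, 'a) chain set" where
  "balR Ms =
     {frag_of (w[j := lbact (Ms ! j) r (w ! j)]) -
      frag_of (w[Suc j := lact (Ms ! Suc j) r (w ! Suc j)]) |
      w j r. w \<in> words Ms \<and> Suc j < length Ms}"

text \<open>
  \<open>tensorR Ms\<close> is \<open>M\<^sub>0 \<otimes>\<^sub>R \<cdots> \<otimes>\<^sub>R M\<^sub>n\<close> for nonempty lists. It carries the four operations that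
  restrict to the bimodule structure of \<open>M\<^sub>0 \<times>\<^sub>R \<cdots> \<times>\<^sub>R M\<^sub>n\<close>.
\<close>

definition tensorR :: "('r::{ring, monoid_mult}, 'a) ubimod list \<Rightarrow> ('r, 'a) ubimod" where
  "tensorR Ms =
    (if length Ms = 1 then hd Ms
     else let n = length Ms - 1 in tensor Ms (balR Ms)
       (\<lambda>r w. w[0 := lact (Ms ! 0) r (w ! 0)])
       (\<lambda>s w. w[n := lbact (Ms ! n) s (w ! n)])
       (\<lambda>w r. w[0 := ract (Ms ! 0) (w ! 0) r])
       (\<lambda>w s. w[n := rbact (Ms ! n) (w ! n) s]))"

definition pureR ::
  "('r::{ring, monoid_mult}, 'a) ubimod list \<Rightarrow> ('r, 'a) univ list \<Rightarrow> ('r, 'a) univ" where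
  "pureR Ms w = (if length Ms = 1 then hd w else tclass Ms (balR Ms) (frag_of w))"

definition EndR :: "('r::{ring, monoid_mult}, 'a) ubimod" where
  "EndR = \<lparr>
     carrier = {Endo f | f. \<forall>x y. f (x + y) = f x + f y},
     monoid.mult = undefined,
     one = undefined,
     zero = Endo (\<lambda>_. 0),
     add = (\<lambda>f g. Endo (\<lambda>m. the_endo f m + the_endo g m)),
     lact = (\<lambda>r f. Endo (\<lambda>m. r * the_endo f m)),
     lbact = (\<lambda>r f. Endo (\<lambda>m. the_endo f m * r)),
     ract = (\<lambda>f s. Endo (\<lambda>m. the_endo f (s * m))),
     rbact = (\<lambda>f s. Endo (\<lambda>m. the_endo f (m * s)))\<rparr>"

definition lam :: "('r::{ring, monoid_mult}, 'a) ubimod list \<Rightarrow> ('r, 'a) ubimod" where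
  "lam Ms =
    (if Ms = [] then EndR
     else (tensorR Ms)\<lparr>carrier := {x \<in> carrier (tensorR Ms). \<forall>j s. Suc j < length Ms \<longrightarrow>
       tclass Ms (balR Ms)
         (frag_extend (\<lambda>w. frag_of (w[j := rbact (Ms ! j) (w ! j) s])) (chain_of x)) =
       tclass Ms (balR Ms)
         (frag_extend (\<lambda>w. frag_of (w[Suc j := ract (Ms ! Suc j) (w ! Suc j) s])) (chain_of x))}\<rparr>)"

definition lam_map ::
  "(('r::{ring, monoid_mult}, 'a) univ \<Rightarrow> ('r, 'a) univ) list
   \<Rightarrow> ('r, 'a) ubimod list \<Rightarrow> ('r, 'a) ubimod list \<Rightarrow> ('r, 'a) univ \<Rightarrow> ('r, 'a) univ" where
  "lam_map fs Ms Ns = (\<lambda>x\<in>carrier (lam Ms).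
     if Ms = [] then x
     else lift Ms (tensorR Ns) (\<lambda>w. pureR Ns (map2 (\<lambda>f y. f y) fs w)) x)"

text \<open>
  \<open>absorb\<close> removes the entry \<open>\<phi> \<in> End(R)\<close> at position \<open>i\<close> and lets \<open>\<phi>(1)\<close> act on the next entry,
  or its bar on the previous entry if \<open>\<phi>\<close> is last; \<open>Ms\<close> lists the remaining factors.
\<close>

definition absorb ::
  "('r::{ring, monoid_mult}, 'a) ubimod list \<Rightarrow> nat \<Rightarrow> ('r, 'a) univ list \<Rightarrow> ('r, 'a) univ list" where
  "absorb Ms i w =
    (let c = the_endo (w ! i) 1; v = take i w @ drop (Suc i) w in
     if i < length Ms then v[i := lact (Ms ! i) c (v ! i)]
     else v[i - 1 := lbact (Ms ! (i - 1)) c (v ! (i - 1))])"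

text \<open>
  The lax structure map \<open>\<lambda>\<^sup>p(-, \<lambda>\<^sup>q, -) \<rightarrow> \<lambda>\<^sup>p\<^sup>+\<^sup>q\<close>, where \<open>Ms\<close> lists the \<open>p + q + 1\<close> factors of the
  target and the inner \<open>\<lambda>\<^sup>q\<close> takes the \<open>l = q + 1\<close> of them that start at position \<open>i\<close>.
  The case \<open>l = length Ms\<close> is \<open>p = 0\<close>.
\<close>

definition lam_join ::
  "('r::{ring, monoid_mult}, 'a) ubimod list \<Rightarrow> nat \<Rightarrow> nat \<Rightarrow> ('r, 'a) univ \<Rightarrow> ('r, 'a) univ" where
  "lam_join Ms i l = (\<lambda>x\<in>carrier (lam (bracketing lam Ms i l)).
     if l = length Ms \<or> l = 1 then x
     else if l = 0 then addext (tensorR Ms) (\<lambda>w. pureR Ms (absorb Ms i w)) x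
     else addext (tensorR Ms)
       (\<lambda>w. tclass Ms (balR Ms)
          (frag_extend (\<lambda>v. frag_of (take i w @ v @ drop (Suc i) w)) (chain_of (w ! i)))) x)"


section \<open>The interchange maps\<close>

text \<open>
  The map \<open>\<chi>\<^sup>-\<^sup>1\<^sup>,\<^sup>n\<^sup>-\<^sup>1\<close> from \<open>R\<^sup>e\<close> to \<open>lam (replicate n Renv)\<close>: the bimodule map with the given value at
  the unit, so \<open>a \<otimes> \<bar>b\<close> goes to \<open>a \<bar>b\<close> applied to that value.
\<close>

definition chi_unit :: "nat \<Rightarrow> ('r::{ring, monoid_mult}, 'a) univ \<Rightarrow> ('r, 'a) univ" where
  "chi_unit n =
    (let N = lam (replicate n Renv);
         u = (if n = 0 then Endo id else pureR (replicate n Renv) (replicate n Renv_one)) in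
     (\<lambda>x\<in>carrier Renv.
       addext N (\<lambda>w. lact N (the_scal (w ! 0)) (lbact N (the_scal (w ! 1)) u)) x))"

text \<open>The binary map \<open>\<chi>\<^sup>1\<^sup>,\<^sup>n\<^sup>-\<^sup>1\<close> for lists \<open>Ms\<close>, \<open>Ns\<close> of length \<open>n\<close>.\<close>

definition chi2 ::
  "('r::{ring, monoid_mult}, 'a) ubimod list \<Rightarrow> ('r, 'a) ubimod list
   \<Rightarrow> ('r, 'a) univ \<Rightarrow> ('r, 'a) univ" where
  "chi2 Ms Ns =
    (let n = length Ms; Ps = map2 (\<lambda>M N. omega [M, N]) Ms Ns in
     (\<lambda>x\<in>carrier (omega [lam Ms, lam Ns]).
       if n = 0 then addext EndR (\<lambda>w. Endo (the_endo (w ! 0) \<circ> the_endo (w ! 1))) x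
       else if n = 1 then x
       else addext (tensorR Ps)
         (\<lambda>w. tclass Ps (balR Ps)
            (frag_extend (\<lambda>u. frag_extend
               (\<lambda>v. frag_of (map (\<lambda>j. pureE [Ms ! j, Ns ! j] [u ! j, v ! j]) [0..<n]))
               (chain_of (w ! 1))) (chain_of (w ! 0)))) x))"

text \<open>
  For a list \<open>Mss\<close> of rows, each of length \<open>n\<close>, the iterated map \<open>chi n Mss\<close> goes from
  \<open>omega (map lam Mss)\<close> to \<open>lam (columns n Mss)\<close>.
\<close>

definition columns ::
  "nat \<Rightarrow> ('r::{ring, monoid_mult}, 'a) ubimod list list \<Rightarrow> ('r, 'a) ubimod list" where
  "columns n Mss = map (\<lambda>j. omega (map (\<lambda>Ms. Ms ! j) Mss)) [0..<n]"

fun chi ::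
  "nat \<Rightarrow> ('r::{ring, monoid_mult}, 'a) ubimod list list \<Rightarrow> ('r, 'a) univ \<Rightarrow> ('r, 'a) univ" where
  "chi n [] = chi_unit n"
| "chi n [Ms] = (\<lambda>x\<in>carrier (lam Ms). x)"
| "chi n (Ms # Ns # Nss) =
    (let Mss = Ms # Ns # Nss; Ps = columns n (Ns # Nss); k = length (Ns # Nss);
         unsplit = (\<lambda>j. let col = map (\<lambda>Ls. Ls ! j) Mss
                        in inv_into (carrier (omega col)) (omega_split col 1 k)) in
     restrict
       (lam_map (map unsplit [0..<n]) (map2 (\<lambda>M P. omega [M, P]) Ms Ps) (columns n Mss)
        \<circ> chi2 Ms Ps
        \<circ> omega_map [id, chi n (Ns # Nss)] [lam Ms, omega (map lam (Ns # Nss))] [lam Ms, lam Ps]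
        \<circ> omega_split (map lam Mss) 1 k)
       (carrier (omega (map lam Mss))))"


section \<open>Bimonoids and bialgebroids\<close>

text \<open>\<open>at_pos i p f\<close> is the list of \<open>p + 1\<close> maps that are identities except for \<open>f\<close> at position \<open>i\<close>.\<close>

definition at_pos :: "nat \<Rightarrow> nat \<Rightarrow> ('u \<Rightarrow> 'u) \<Rightarrow> ('u \<Rightarrow> 'u) list" where
  "at_pos i p f = (replicate (Suc p) id)[i := f]"

definition monoid_structure ::
  "('r::{ring, monoid_mult}, 'a) ubimod \<Rightarrow> (nat \<Rightarrow> ('r, 'a) univ \<Rightarrow> ('r, 'a) univ) \<Rightarrow> bool" where
  "monoid_structure A m \<longleftrightarrow>
     (\<forall>n. m n \<in> bim_hom (omega (replicate n A)) A) \<and>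
     m 1 = (\<lambda>x\<in>carrier A. x) \<and>
     (\<forall>p l i. i \<le> p \<longrightarrow>
        m (p + l) =
          restrict
            (m (Suc p)
             \<circ> omega_map (at_pos i p (m l))
                 (bracketing omega (replicate (p + l) A) i l) (replicate (Suc p) A)
             \<circ> omega_split (replicate (p + l) A) i l)
            (carrier (omega (replicate (p + l) A))))"

definition comonoid_structure ::
  "('r::{ring, monoid_mult}, 'a) ubimod \<Rightarrow> (nat \<Rightarrow> ('r, 'a) univ \<Rightarrow> ('r, 'a) univ) \<Rightarrow> bool" where
  "comonoid_structure A d \<longleftrightarrow>
     (\<forall>n. d n \<in> bim_hom A (lam (replicate n A))) \<and>
     d 1 = (\<lambda>x\<in>carrier A. x) \<and>
     (\<forall>p l i. i \<le> p \<longrightarrow>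
        d (p + l) =
          restrict
            (lam_join (replicate (p + l) A) i l
             \<circ> lam_map (at_pos i p (d l))
                 (replicate (Suc p) A) (bracketing lam (replicate (p + l) A) i l)
             \<circ> d (Suc p))
            (carrier A))"

definition bimonoid ::
  "('r::{ring, monoid_mult}, 'a) ubimod \<Rightarrow> (nat \<Rightarrow> ('r, 'a) univ \<Rightarrow> ('r, 'a) univ)
   \<Rightarrow> (nat \<Rightarrow> ('r, 'a) univ \<Rightarrow> ('r, 'a) univ) \<Rightarrow> bool" where
  "bimonoid A m d \<longleftrightarrow>
     monoid_structure A m \<and> comonoid_structure A d \<and>
     (\<forall>p q.
        restrict (d q \<circ> m p) (carrier (omega (replicate p A))) =
        restrict
          (lam_map (replicate q (m p)) (replicate q (omega (replicate p A))) (replicate q A)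
           \<circ> chi q (replicate p (replicate q A))
           \<circ> omega_map (replicate p (d q)) (replicate p A) (replicate p (lam (replicate q A))))
          (carrier (omega (replicate p A))))"

definition bialgebroid ::
  "('r::{ring, monoid_mult}, 'a) ubimod
   \<Rightarrow> (('r, 'a) univ \<Rightarrow> ('r, 'a) univ) \<Rightarrow> (('r, 'a) univ \<Rightarrow> ('r, 'a) univ)
   \<Rightarrow> (('r, 'a) univ \<Rightarrow> ('r, 'a) univ) \<Rightarrow> (('r, 'a) univ \<Rightarrow> ('r, 'a) univ) \<Rightarrow> bool" where
  "bialgebroid A \<mu> \<eta> \<delta> \<epsilon> \<longleftrightarrow>
     \<mu> \<in> bim_hom (omega [A, A]) A \<and>
     \<eta> \<in> bim_hom Renv A \<and>
     \<delta> \<in> bim_hom A (lam [A, A]) \<and>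
     \<epsilon> \<in> bim_hom A EndR \<and>
     \<comment> \<open>associativity and unitality\<close>
     (\<forall>x\<in>carrier (omega [A, A, A]).
        \<mu> (omega_map [\<mu>, id] [omega [A, A], A] [A, A] (omega_split [A, A, A] 0 2 x)) =
        \<mu> (omega_map [id, \<mu>] [A, omega [A, A]] [A, A] (omega_split [A, A, A] 1 2 x))) \<and>
     (\<forall>a\<in>carrier A. \<mu> (omega_map [\<eta>, id] [Renv, A] [A, A] (omega_split [A] 0 0 a)) = a) \<and>
     (\<forall>a\<in>carrier A. \<mu> (omega_map [id, \<eta>] [A, Renv] [A, A] (omega_split [A] 1 0 a)) = a) \<and>
     \<comment> \<open>coassociativity and counitality\<close>
     (\<forall>a\<in>carrier A.
        lam_join [A, A, A] 0 2 (lam_map [\<delta>, id] [A, A] [lam [A, A], A] (\<delta> a)) =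
        lam_join [A, A, A] 1 2 (lam_map [id, \<delta>] [A, A] [A, lam [A, A]] (\<delta> a))) \<and>
     (\<forall>a\<in>carrier A. lam_join [A] 0 0 (lam_map [\<epsilon>, id] [A, A] [EndR, A] (\<delta> a)) = a) \<and>
     (\<forall>a\<in>carrier A. lam_join [A] 1 0 (lam_map [id, \<epsilon>] [A, A] [A, EndR] (\<delta> a)) = a) \<and>
     \<comment> \<open>compatibility\<close>
     (\<forall>x\<in>carrier (omega [A, A]).
        \<delta> (\<mu> x) =
        lam_map [\<mu>, \<mu>] [omega [A, A], omega [A, A]] [A, A]
          (chi2 [A, A] [A, A]
            (omega_map [\<delta>, \<delta>] [A, A] [lam [A, A], lam [A, A]] x))) \<and>
     (\<forall>x\<in>carrier Renv. \<epsilon> (\<eta> x) = chi_unit 0 x) \<and>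
     (\<forall>x\<in>carrier Renv. \<delta> (\<eta> x) = lam_map [\<eta>, \<eta>] [Renv, Renv] [A, A] (chi_unit 2 x)) \<and>
     (\<forall>x\<in>carrier (omega [A, A]).
        \<epsilon> (\<mu> x) = chi2 [] [] (omega_map [\<epsilon>, \<epsilon>] [A, A] [EndR, EndR] x))"

end

theory Submission
  imports Defs
begin

text \<open>
  The (co)associativity axioms with a binary inner operation determine \<open>m n\<close> and \<open>d n\<close> for
  \<open>n \<ge> 3\<close>, so a bimonoid is determined by its parts of arity 0 and 2, and these form a bialgebroid.
  Conversely, for a bialgebroid let \<open>m n\<close> multiply words of length \<open>n\<close> and let \<open>d n\<close> iterate
  \<open>\<delta>\<close> in the last factor. All identities are checked on chains of words modulo the tensor relations:
  \<open>\<delta>\<close> and \<open>\<epsilon>\<close> can be inserted into any letter of a chain, and coassociativity shifts an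
  insertion from one position to the next. For the compatibility of \<open>m p\<close> and \<open>d q\<close>, the
  Takeuchi condition makes the letterwise product of classes well defined; hence the iterated
  comultiplication is multiplicative by induction on \<open>q\<close>, and induction on \<open>p\<close> gives the rest.
\<close>


section \<open>Chains and additive extensions\<close>

text \<open>Elements of a tensor product are codes of cosets, and every map in the definitions is
  computed from a representative picked by \<open>SOME\<close>. Independence of representatives is
  thus never automatic: each map has to be redescribed on arbitrary chains, and the locale
  \<open>pres\<close> collects the few facts about codes used for this. Two obstacles determine the
  rest. A single word of a chain that represents an element of a Takeuchi product need not lie in
  that product; only the whole sum satisfies the condition. Shuffles and letterwise products are
  therefore formed in the ambient tensor product over \<open>R\<close>, with \<open>takeuchi\<close>
  carried along as a property of chains. Secondly, \<delta> takes values in classes, and its chosen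
  representatives respect sums and actions only modulo relations. Placing them beside other letters
  is legitimate only if balancing relators across the seam survive; the predicate \<open>mor\<close>
  records this. Since \<open>chi\<close> contains inverses of \<open>omega_split\<close>, that map
  must be bijective, but only where the first factor is split off.\<close>

definition wchains :: "('u, 'm) ring_scheme list \<Rightarrow> ('u list \<Rightarrow>\<^sub>0 int) set" where
  "wchains Gs = {c. Poly_Mapping.keys c \<subseteq> words Gs}"

lemma wchains_0 [simp]: "0 \<in> wchains Gs"
  by (simp add: wchains_def)

lemma wchains_of [simp]: "frag_of w \<in> wchains Gs \<longleftrightarrow> w \<in> words Gs"
  by (simp add: wchains_def)

lemma wchains_add [intro]: "c \<in> wchains Gs \<Longrightarrow> d \<in> wchains Gs \<Longrightarrow> c + d \<in> wchains Gs"
  using keys_add[of c d] by (auto simp: wchains_def)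

lemma wchains_diff [intro]: "c \<in> wchains Gs \<Longrightarrow> d \<in> wchains Gs \<Longrightarrow> c - d \<in> wchains Gs"
  using keys_diff[of c d] by (auto simp: wchains_def)

lemma wchains_uminus [intro]: "c \<in> wchains Gs \<Longrightarrow> - c \<in> wchains Gs"
  using wchains_diff[of 0 Gs c] by simp

lemma wchains_induct [consumes 1, case_names zero word diff]:
  assumes "c \<in> wchains Gs" and "P 0" and "\<And>w. w \<in> words Gs \<Longrightarrow> P (frag_of w)"
    and "\<And>a b. a \<in> wchains Gs \<Longrightarrow> b \<in> wchains Gs \<Longrightarrow> P a \<Longrightarrow> P b \<Longrightarrow> P (a - b)"
  shows "P c"
proof -
  have "Poly_Mapping.keys c \<subseteq> words Gs"
    using assms(1) by (simp add: wchains_def)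
  then show ?thesis
    by (rule free_Abelian_group_induct) (use assms in \<open>auto simp: wchains_def\<close>)
qed

lemma wchains_extend:
  assumes "c \<in> wchains Gs" "\<And>w. w \<in> words Gs \<Longrightarrow> g w \<in> wchains Hs"
  shows "frag_extend g c \<in> wchains Hs"
  using assms(1) by (induction rule: wchains_induct) (auto simp: frag_extend_diff assms(2))

lemma frag_extend_cong:
  assumes "c \<in> wchains Gs" "\<And>w. w \<in> words Gs \<Longrightarrow> g w = h w"
  shows "frag_extend g c = frag_extend h c"
  using assms by (auto intro!: frag_extend_eq simp: wchains_def)

lemma frag_extend_extend:
  "frag_extend f (frag_extend g c) = frag_extend (\<lambda>w. frag_extend f (g w)) c"
  by (rule frag_induction[where S = UNIV and c = c]) (auto simp: frag_extend_diff)

lemma frag_extend_plus_fun: "frag_extend (\<lambda>w. f w + g w) c = frag_extend f c + frag_extend g c"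
  by (rule frag_induction[where S = UNIV and c = c]) (auto simp: frag_extend_diff)

lemma frag_extend_diff_fun: "frag_extend (\<lambda>w. f w - g w) c = frag_extend f c - frag_extend g c"
  by (rule frag_induction[where S = UNIV and c = c]) (auto simp: frag_extend_diff)

text \<open>Interchange of two finite sums. It allows a relation in one argument of a two-variable
  construction to be treated with a fixed word in the other argument.\<close>

lemma frag_extend_swap:
  "frag_extend (\<lambda>u. frag_extend (\<lambda>v. f u v) d) c = frag_extend (\<lambda>v. frag_extend (\<lambda>u. f u v) c) d"
proof (rule frag_induction[where S = UNIV and c = c])
  show "frag_extend (\<lambda>u. frag_extend (f u) d) 0 = frag_extend (\<lambda>v. frag_extend (\<lambda>u. f u v) 0) d"
    by (rule frag_induction[where S = UNIV and c = d]) (auto simp: frag_extend_diff)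
qed (auto simp: frag_extend_diff frag_extend_diff_fun)

lemma frag_extend_frag_of [simp]: "frag_extend frag_of c = c"
  by (metis frag_expansion)

text \<open>The subgroup generated by \<open>X\<close>, built by adding or subtracting one generator
  at a time: an induction examines single generators, and no carrier conditions arise.\<close>

inductive_set span :: "'c::ab_group_add set \<Rightarrow> 'c set" for X where
  span_0: "0 \<in> span X"
| span_plus: "x \<in> X \<Longrightarrow> y \<in> span X \<Longrightarrow> x + y \<in> span X"
| span_minus: "x \<in> X \<Longrightarrow> y \<in> span X \<Longrightarrow> y - x \<in> span X"

lemma span_base: "x \<in> X \<Longrightarrow> x \<in> span X"
  using span_plus[OF _ span_0] by fastforce

lemma span_add: "a \<in> span X \<Longrightarrow> b \<in> span X \<Longrightarrow> a + b \<in> span X"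
proof (induction rule: span.induct)
  case (span_minus x y)
  then show ?case using span.span_minus[of x X "y + b"] by (simp add: algebra_simps)
qed (auto simp: add.assoc intro: span.intros)

lemma span_uminus: "a \<in> span X \<Longrightarrow> - a \<in> span X"
proof (induction rule: span.induct)
  case (span_plus x y)
  moreover have "- (x + y) = - y - x" by simp
  ultimately show ?case using span.span_minus[of x X "- y"] by metis
next
  case (span_minus x y)
  then show ?case using span.span_plus[of x X "- y"] by (simp add: algebra_simps)
qed (auto intro: span.intros)

lemma span_diff: "a \<in> span X \<Longrightarrow> b \<in> span X \<Longrightarrow> a - b \<in> span X"
  using span_add[of a X "- b"] span_uminus[of b X] by simp

text \<open>Since generators lie in the carrier, the group inverse of one is its negative. This
  matches the \<open>inv\<close> rule of \<open>generate\<close> with subtraction in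
  \<open>span\<close>.\<close>

lemma generate_eq_span:
  assumes "X \<subseteq> carrier (free_Abelian_group S)"
  shows "generate (free_Abelian_group S) X = span X"
proof (intro equalityI subsetI)
  fix c assume "c \<in> generate (free_Abelian_group S) X"
  then show "c \<in> span X"
  proof (induction rule: generate.induct)
    case (inv h)
    then have "Poly_Mapping.keys h \<subseteq> S" using assms by (metis carrier_free_Abelian_group_iff subsetD)
    then show ?case using inv span_uminus[OF span_base, of h X] by auto
  qed (auto intro: span_0 span_base span_add)
next
  fix c assume "c \<in> span X"
  then show "c \<in> generate (free_Abelian_group S) X"
  proof (induction rule: span.induct)
    case span_0
    then show ?case using generate.one[of "free_Abelian_group S" X] by simp
  next
    case (span_plus x y)
    then show ?case
      using generate.eng[of x "free_Abelian_group S" X y] generate.incl[of x X "free_Abelian_group S"]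
      by simp
  next
    case (span_minus x y)
    then have "Poly_Mapping.keys x \<subseteq> S" using assms by (metis carrier_free_Abelian_group_iff subsetD)
    then show ?case
      using span_minus generate.eng[of y "free_Abelian_group S" X "- x"] generate.inv[of x X "free_Abelian_group S"]
      by simp
  qed
qed

lemma frag_extend_span:
  assumes "c \<in> span X" "\<And>x. x \<in> X \<Longrightarrow> frag_extend g x \<in> span Y"
  shows "frag_extend g c \<in> span Y"
  using assms by (induction rule: span.induct)
    (auto simp: frag_extend_add frag_extend_diff intro: span_0 span_add span_diff)

lemma frag_extend_in_span:
  assumes "c \<in> wchains Gs" "\<And>w. w \<in> words Gs \<Longrightarrow> g w \<in> span Y"
  shows "frag_extend g c \<in> span Y"
  using assms(1) by (induction rule: wchains_induct) (auto simp: frag_extend_diff assms span_0 span_diff)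

section \<open>Additive extension of maps from words to chains\<close>

definition ext :: "('v, 'm) ring_scheme \<Rightarrow> ('w \<Rightarrow> 'v) \<Rightarrow> ('w \<Rightarrow>\<^sub>0 int) \<Rightarrow> 'v" where
  "ext N f c = finsum N (\<lambda>w. [Poly_Mapping.lookup c w] \<cdot>\<^bsub>N\<^esub> f w) (Poly_Mapping.keys c)"

lemma addext_eq_ext: "addext N f x = ext N f (chain_of x)"
  by (simp add: addext_def ext_def)

context abelian_group
begin

text \<open>Coefficients outside the support are zero. A common finite index set is what
  \<open>ext_add\<close> works with, because the support of a sum may be smaller than the union of
  the supports.\<close>

lemma ext_superset:
  assumes "finite K" "Poly_Mapping.keys c \<subseteq> K" "f \<in> K \<rightarrow> carrier G"
  shows "ext G f c = finsum G (\<lambda>w. [Poly_Mapping.lookup c w] \<cdot> f w) K"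
proof -
  have "[(0::int)] \<cdot> x = \<zero>" for x by (simp add: add_pow_def)
  then show ?thesis
    unfolding ext_def using assms
    by (intro add.finprod_mono_neutral_cong_left) (auto simp: in_keys_iff intro!: add.int_pow_closed)
qed

lemma ext_closed:
  assumes "Poly_Mapping.keys c \<subseteq> S" "f \<in> S \<rightarrow> carrier G"
  shows "ext G f c \<in> carrier G"
  unfolding ext_def using assms by (intro finsum_closed) auto

lemma ext_0 [simp]: "ext G f 0 = \<zero>"
  by (simp add: ext_def)

lemma ext_of [simp]: "f w \<in> carrier G \<Longrightarrow> ext G f (frag_of w) = f w"
  by (simp add: ext_def)

lemma ext_add:
  assumes "Poly_Mapping.keys c \<subseteq> S" "Poly_Mapping.keys d \<subseteq> S" "f \<in> S \<rightarrow> carrier G"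
  shows "ext G f (c + d) = ext G f c \<oplus> ext G f d"
proof -
  let ?K = "Poly_Mapping.keys c \<union> Poly_Mapping.keys d"
  have K: "finite ?K" "Poly_Mapping.keys (c + d) \<subseteq> ?K" "f \<in> ?K \<rightarrow> carrier G"
    using assms keys_add[of c d] by auto
  have "ext G f (c + d) = finsum G (\<lambda>w. [Poly_Mapping.lookup c w] \<cdot> f w \<oplus> [Poly_Mapping.lookup d w] \<cdot> f w) ?K"
    unfolding ext_superset[OF K]
    by (rule add.finprod_cong') (use K in \<open>auto simp: Poly_Mapping.lookup_add add.int_pow_mult Pi_iff\<close>)
  also have "\<dots> = ext G f c \<oplus> ext G f d"
    unfolding ext_superset[OF K(1) Un_upper1 K(3)] ext_superset[OF K(1) Un_upper2 K(3)]
    by (rule finsum_addf) (use K in \<open>auto simp: Pi_iff\<close>)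
  finally show ?thesis .
qed

lemma ext_minus:
  assumes "Poly_Mapping.keys c \<subseteq> S" "f \<in> S \<rightarrow> carrier G"
  shows "ext G f (- c) = \<ominus> ext G f c"
proof -
  have "ext G f (- c) \<oplus> ext G f c = \<zero>"
    using ext_add[of "- c" S c f] assms by simp
  then show ?thesis
    using assms ext_closed[of c S f] ext_closed[of "- c" S f] by (simp add: minus_equality)
qed

lemma ext_diff:
  assumes "Poly_Mapping.keys c \<subseteq> S" "Poly_Mapping.keys d \<subseteq> S" "f \<in> S \<rightarrow> carrier G"
  shows "ext G f (c - d) = ext G f c \<ominus> ext G f d"
  using ext_add[of c S "- d" f] ext_minus[of d S f] assms by (simp add: a_minus_def)

lemma eq_of_diff_zero: "a \<in> carrier G \<Longrightarrow> b \<in> carrier G \<Longrightarrow> a \<ominus> b = \<zero> \<Longrightarrow> a = b"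
  by (metis minus_minus minus_equality a_minus_def a_inv_closed)

end

lemma ext_cong:
  assumes "abelian_group N" "f \<in> Poly_Mapping.keys c \<rightarrow> carrier N" "\<And>w. w \<in> Poly_Mapping.keys c \<Longrightarrow> f w = g w"
  shows "ext N f c = ext N g c"
proof -
  interpret N: abelian_group N by fact
  show ?thesis
    unfolding ext_def using assms by (intro N.finsum_cong') (auto simp: Pi_iff intro!: N.add.int_pow_closed)
qed

text \<open>No extensionality is imposed, so composites and partially applied biadditive maps can
  enter as bare lambda terms.\<close>

definition ahom :: "('u, 'm) ring_scheme \<Rightarrow> ('v, 'n) ring_scheme \<Rightarrow> ('u \<Rightarrow> 'v) set" where
  "ahom T N = {f \<in> carrier T \<rightarrow> carrier N.
     \<forall>x\<in>carrier T. \<forall>y\<in>carrier T. f (x \<oplus>\<^bsub>T\<^esub> y) = f x \<oplus>\<^bsub>N\<^esub> f y}"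

lemma ahom_closed: "f \<in> ahom T N \<Longrightarrow> x \<in> carrier T \<Longrightarrow> f x \<in> carrier N"
  by (auto simp: ahom_def)

lemma ahom_add: "f \<in> ahom T N \<Longrightarrow> x \<in> carrier T \<Longrightarrow> y \<in> carrier T \<Longrightarrow> f (x \<oplus>\<^bsub>T\<^esub> y) = f x \<oplus>\<^bsub>N\<^esub> f y"
  by (auto simp: ahom_def)

lemma ahom_comp: "f \<in> ahom T N \<Longrightarrow> g \<in> ahom N P \<Longrightarrow> (\<lambda>x. g (f x)) \<in> ahom T P"
  by (auto simp: ahom_def Pi_iff)

lemma ahom_cong: "f \<in> ahom T N \<Longrightarrow> (\<And>x. x \<in> carrier T \<Longrightarrow> f x = g x) \<Longrightarrow> abelian_group T \<Longrightarrow> g \<in> ahom T N"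
  by (auto simp: ahom_def Pi_iff abelian_group.axioms(1)[THEN abelian_monoid.a_closed])

lemma ahom_zero:
  assumes "f \<in> ahom T N" "abelian_group T" "abelian_group N"
  shows "f \<zero>\<^bsub>T\<^esub> = \<zero>\<^bsub>N\<^esub>"
proof -
  interpret T: abelian_group T by fact
  interpret N: abelian_group N by fact
  have "f \<zero>\<^bsub>T\<^esub> \<oplus>\<^bsub>N\<^esub> f \<zero>\<^bsub>T\<^esub> = f \<zero>\<^bsub>T\<^esub> \<oplus>\<^bsub>N\<^esub> \<zero>\<^bsub>N\<^esub>"
    using ahom_add[OF assms(1), of "\<zero>\<^bsub>T\<^esub>" "\<zero>\<^bsub>T\<^esub>"] ahom_closed[OF assms(1)] by simp
  then show ?thesis
    using ahom_closed[OF assms(1)] N.add.r_cancel_one by (metis N.r_zero T.zero_closed)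
qed

lemma ahom_minus:
  assumes "f \<in> ahom T N" "abelian_group T" "abelian_group N" "x \<in> carrier T" "y \<in> carrier T"
  shows "f (x \<ominus>\<^bsub>T\<^esub> y) = f x \<ominus>\<^bsub>N\<^esub> f y"
proof -
  interpret T: abelian_group T by fact
  interpret N: abelian_group N by fact
  have "f (x \<ominus>\<^bsub>T\<^esub> y) \<oplus>\<^bsub>N\<^esub> f y = f x"
    using assms ahom_add[OF assms(1), of "x \<ominus>\<^bsub>T\<^esub> y" y]
    by (simp add: a_minus_def T.a_assoc T.l_neg)
  then show ?thesis
    using ahom_closed[OF assms(1)] assms(4,5)
    by (metis N.add.inv_solve_right T.minus_closed a_minus_def)
qed

lemma ahom_ext:
  assumes "abelian_group T" "abelian_group N" "g \<in> ahom T N" "f \<in> S \<rightarrow> carrier T" "Poly_Mapping.keys c \<subseteq> S"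
  shows "g (ext T f c) = ext N (\<lambda>w. g (f w)) c"
proof -
  interpret T: abelian_group T by fact
  interpret N: abelian_group N by fact
  have gf: "(\<lambda>w. g (f w)) \<in> S \<rightarrow> carrier N" using assms by (auto simp: ahom_def)
  show ?thesis
  proof (rule free_Abelian_group_induct[OF assms(5)])
    show "g (ext T f 0) = ext N (\<lambda>w. g (f w)) 0" using ahom_zero[OF assms(3,1,2)] by simp
  next
    fix x y
    assume "Poly_Mapping.keys x \<subseteq> S" "Poly_Mapping.keys y \<subseteq> S"
      "g (ext T f x) = ext N (\<lambda>w. g (f w)) x" "g (ext T f y) = ext N (\<lambda>w. g (f w)) y"
    then show "g (ext T f (x - y)) = ext N (\<lambda>w. g (f w)) (x - y)"
      using ahom_minus[OF assms(3,1,2)] T.ext_diff[OF _ _ assms(4)] N.ext_diff[OF _ _ gf]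
        T.ext_closed[OF _ assms(4)] by simp
  next
    fix a assume "a \<in> S"
    then show "g (ext T f (frag_of a)) = ext N (\<lambda>w. g (f w)) (frag_of a)"
      using assms gf by (auto simp: Pi_iff)
  qed
qed

text \<open>
  \<open>T\<close> is presented by the words over \<open>Gs\<close> modulo the relations \<open>R\<close>, with class map \<open>cl\<close> and
  choice of representatives \<open>rep\<close>.
\<close>

locale pres = T: abelian_group T
  for T :: "('t, 'k) ring_scheme" and Gs :: "('u, 'm) ring_scheme list" and R
    and cl :: "('u list \<Rightarrow>\<^sub>0 int) \<Rightarrow> 't" and rep +
  assumes cl_closed: "c \<in> wchains Gs \<Longrightarrow> cl c \<in> carrier T"
    and cl_add: "c \<in> wchains Gs \<Longrightarrow> d \<in> wchains Gs \<Longrightarrow> cl (c + d) = cl c \<oplus>\<^bsub>T\<^esub> cl d"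
    and rep_closed: "x \<in> carrier T \<Longrightarrow> rep x \<in> wchains Gs"
    and cl_rep: "x \<in> carrier T \<Longrightarrow> cl (rep x) = x"
    and cl_zero_iff: "c \<in> wchains Gs \<Longrightarrow> cl c = \<zero>\<^bsub>T\<^esub> \<longleftrightarrow> c \<in> R"
begin

lemma cl_0: "cl 0 = \<zero>\<^bsub>T\<^esub>"
  using cl_add[of 0 0] cl_closed[of 0]
  by (metis T.add.r_cancel_one wchains_0 add.right_neutral)

lemma cl_minus: "c \<in> wchains Gs \<Longrightarrow> cl (- c) = \<ominus>\<^bsub>T\<^esub> cl c"
  using cl_add[of "- c" c] cl_closed[of c] cl_closed[of "- c"] wchains_uminus[of c Gs]
  by (simp add: cl_0 T.minus_equality)

lemma cl_diff: "c \<in> wchains Gs \<Longrightarrow> d \<in> wchains Gs \<Longrightarrow> cl (c - d) = cl c \<ominus>\<^bsub>T\<^esub> cl d"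
  using cl_add[of c "- d"] cl_minus[of d] wchains_uminus[of d Gs] by (simp add: a_minus_def)

lemma cl_eq_iff: "c \<in> wchains Gs \<Longrightarrow> d \<in> wchains Gs \<Longrightarrow> cl c = cl d \<longleftrightarrow> c - d \<in> R"
  using cl_zero_iff[of "c - d"] cl_diff[of c d] wchains_diff[of c Gs d] cl_closed[of c] cl_closed[of d]
    T.eq_of_diff_zero[of "cl c" "cl d"]
  by (auto simp: a_minus_def T.r_neg)

lemma rep_cl: "c \<in> wchains Gs \<Longrightarrow> rep (cl c) - c \<in> R"
  using cl_eq_iff[of "rep (cl c)" c] cl_rep[of "cl c"] rep_closed[of "cl c"] cl_closed[of c] by auto

lemma rep_add: "x \<in> carrier T \<Longrightarrow> y \<in> carrier T \<Longrightarrow> rep (x \<oplus>\<^bsub>T\<^esub> y) - rep x - rep y \<in> R"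
  using rep_cl[of "rep x + rep y"] cl_add[of "rep x" "rep y"] rep_closed[of x] rep_closed[of y]
  by (auto simp: cl_rep diff_diff_eq)

text \<open>Pure tensors generate the tensor product. Most identities between maps out of a tensor
  product are reduced to words by this rule.\<close>

lemma eqI:
  assumes "abelian_group N" "f \<in> ahom T N" "g \<in> ahom T N"
    and "\<And>w. w \<in> words Gs \<Longrightarrow> f (cl (frag_of w)) = g (cl (frag_of w))" and "x \<in> carrier T"
  shows "f x = g x"
proof -
  interpret N: abelian_group N by fact
  have "f (cl c) = g (cl c)" if "c \<in> wchains Gs" for c
    using that
  proof (induction rule: wchains_induct)
    case zero
    show ?case unfolding cl_0 using ahom_zero[OF _ T.abelian_group_axioms assms(1)] assms(2,3) by metis
  next
    case (diff a b)
    then show ?case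
      using ahom_minus[OF assms(2) T.abelian_group_axioms assms(1)]
        ahom_minus[OF assms(3) T.abelian_group_axioms assms(1)] by (simp add: cl_diff cl_closed)
  qed (use assms in auto)
  from this[of "rep x"] show ?thesis
    using assms(5) by (simp add: rep_closed cl_rep)
qed

text \<open>Well-definedness of \<open>addext\<close>: the representative stored for the class of
  \<open>c\<close> differs from \<open>c\<close> by a relation, and the extension of
  \<open>h\<close> vanishes on relations.\<close>

lemma ext_cl:
  assumes N: "abelian_group N" and h: "h \<in> words Gs \<rightarrow> carrier N" and kill: "\<And>c. c \<in> R \<Longrightarrow> ext N h c = \<zero>\<^bsub>N\<^esub>"
    and c: "c \<in> wchains Gs"
  shows "ext N h (rep (cl c)) = ext N h c"
proof -
  interpret N: abelian_group N by fact
  have *: "Poly_Mapping.keys (rep (cl c)) \<subseteq> words Gs" "Poly_Mapping.keys c \<subseteq> words Gs"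
    using c rep_closed[OF cl_closed[OF c]] by (auto simp: wchains_def)
  show ?thesis
    using kill[OF rep_cl[OF c]] N.ext_diff[OF * h]
    by (intro N.eq_of_diff_zero[OF N.ext_closed[OF *(1) h] N.ext_closed[OF *(2) h]]) simp
qed

lemma ext_ahom:
  assumes N: "abelian_group N" and h: "h \<in> words Gs \<rightarrow> carrier N" and kill: "\<And>c. c \<in> R \<Longrightarrow> ext N h c = \<zero>\<^bsub>N\<^esub>"
  shows "(\<lambda>x. ext N h (rep x)) \<in> ahom T N"
proof -
  interpret N: abelian_group N by fact
  have k: "Poly_Mapping.keys (rep x) \<subseteq> words Gs" if "x \<in> carrier T" for x
    using rep_closed[OF that] by (simp add: wchains_def)
  have "ext N h (rep (x \<oplus>\<^bsub>T\<^esub> y)) = ext N h (rep x) \<oplus>\<^bsub>N\<^esub> ext N h (rep y)"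
    if "x \<in> carrier T" "y \<in> carrier T" for x y
    using ext_cl[OF assms, of "rep x + rep y"] that N.ext_add[OF k k h, of x y]
    by (simp add: cl_add rep_closed cl_rep wchains_add)
  moreover have "ext N h (rep x) \<in> carrier N" if "x \<in> carrier T" for x
    by (rule N.ext_closed[OF k[OF that] h])
  ultimately show ?thesis
    by (simp add: ahom_def)
qed

text \<open>Taking classes is additive, so a sum of classes in \<open>T\<close> is a single class.
  This turns the values of \<open>addext\<close>, which are sums in a module, into classes of
  explicit chains.\<close>

lemma cl_extend:
  assumes "\<And>w. w \<in> words Hs \<Longrightarrow> g w \<in> wchains Gs" and "c \<in> wchains Hs"
  shows "ext T (\<lambda>w. cl (g w)) c = cl (frag_extend g c)"
  using assms(2)
proof (induction rule: wchains_induct)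
  case (diff a b)
  then have "ext T (\<lambda>w. cl (g w)) (a - b) = ext T (\<lambda>w. cl (g w)) a \<ominus>\<^bsub>T\<^esub> ext T (\<lambda>w. cl (g w)) b"
    by (intro T.ext_diff[of _ "words Hs"]) (auto simp: wchains_def intro: cl_closed assms(1))
  then show ?case using diff assms by (simp add: frag_extend_diff cl_diff wchains_extend)
qed (auto simp: cl_0 cl_closed assms)

end


section \<open>Words and concatenation of chains\<close>

lemma words_Nil [simp]: "w \<in> words [] \<longleftrightarrow> w = []"
  by (auto simp: words_def)

lemma words_Cons: "w \<in> words (G # Gs) \<longleftrightarrow> (\<exists>x v. w = x # v \<and> x \<in> carrier G \<and> v \<in> words Gs)"
  by (auto simp: words_def list_all2_Cons2)

lemma words_Cons_iff [simp]: "x # v \<in> words (G # Gs) \<longleftrightarrow> x \<in> carrier G \<and> v \<in> words Gs"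
  by (simp add: words_Cons)

lemma words_Cons_E:
  assumes "w \<in> words (G # Gs)" obtains x v where "w = x # v" "x \<in> carrier G" "v \<in> words Gs"
  using assms by (auto simp: words_Cons)

lemma words_append: "w \<in> words (Gs @ Hs) \<longleftrightarrow> (\<exists>u v. w = u @ v \<and> u \<in> words Gs \<and> v \<in> words Hs)"
  by (auto simp: words_def list_all2_append2 dest: list_all2_lengthD)

lemma words_append_E:
  assumes "w \<in> words (Gs @ Hs)" obtains u v where "w = u @ v" "u \<in> words Gs" "v \<in> words Hs"
  using assms by (auto simp: words_append)

lemma words_length: "w \<in> words Gs \<Longrightarrow> length w = length Gs"
  by (auto simp: words_def list_all2_lengthD)

lemma words_append_iff [simp]: "u \<in> words Gs \<Longrightarrow> u @ v \<in> words (Gs @ Hs) \<longleftrightarrow> v \<in> words Hs"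
  by (metis words_append append_eq_append_conv words_length)

lemma words_nth: "w \<in> words Gs \<Longrightarrow> j < length Gs \<Longrightarrow> w ! j \<in> carrier (Gs ! j)"
  by (auto simp: words_def list_all2_conv_all_nth)

lemma words_iff_nth: "w \<in> words Gs \<longleftrightarrow> length w = length Gs \<and> (\<forall>j<length Gs. w ! j \<in> carrier (Gs ! j))"
  by (auto simp: words_def list_all2_conv_all_nth)

lemma words_update: "w \<in> words Gs \<Longrightarrow> x \<in> carrier (Gs ! j) \<Longrightarrow> w[j := x] \<in> words Gs"
  by (cases "j < length w") (auto simp: words_iff_nth nth_list_update)

text \<open>The product of the monoid ring of words: concatenation extended biadditively.\<close>

definition cat :: "('u list \<Rightarrow>\<^sub>0 int) \<Rightarrow> ('u list \<Rightarrow>\<^sub>0 int) \<Rightarrow> ('u list \<Rightarrow>\<^sub>0 int)" (infixl "\<odot>" 75) where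
  "c \<odot> d = frag_extend (\<lambda>u. frag_extend (\<lambda>v. frag_of (u @ v)) d) c"

lemma cat_of [simp]: "frag_of u \<odot> frag_of v = frag_of (u @ v)"
  by (simp add: cat_def)

lemma cat_add_left: "(c + c') \<odot> d = c \<odot> d + c' \<odot> d"
  by (simp add: cat_def frag_extend_add)

lemma cat_diff_left: "(c - c') \<odot> d = c \<odot> d - c' \<odot> d"
  by (simp add: cat_def frag_extend_diff)

lemma cat_add_right: "c \<odot> (d + d') = c \<odot> d + c \<odot> d'"
  by (simp add: cat_def frag_extend_add frag_extend_plus_fun)

lemma cat_diff_right: "c \<odot> (d - d') = c \<odot> d - c \<odot> d'"
  by (simp add: cat_def frag_extend_diff frag_extend_diff_fun)

lemma cat_0 [simp]: "0 \<odot> d = 0" "c \<odot> 0 = 0"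
  using cat_diff_left[of 0 0 d] cat_diff_right[of c 0 0] by auto

lemma cat_extend_left: "frag_extend f c \<odot> d = frag_extend (\<lambda>u. f u \<odot> d) c"
  by (simp add: cat_def frag_extend_extend)

lemma cat_extend_right: "c \<odot> frag_extend g d = frag_extend (\<lambda>v. c \<odot> g v) d"
  by (rule frag_induction[where S = UNIV and c = d]) (auto simp: frag_extend_diff cat_diff_right)

lemma cat_Nil [simp]: "frag_of [] \<odot> d = d" "c \<odot> frag_of [] = c"
  by (simp_all add: cat_def)

lemma cat_assoc: "(c \<odot> d) \<odot> e = c \<odot> (d \<odot> e)"
proof -
  have 1: "(frag_of u \<odot> frag_of v) \<odot> e = frag_of u \<odot> (frag_of v \<odot> e)" for u v
    by (rule frag_induction[where S = UNIV and c = e]) (auto simp: cat_diff_right)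
  have 2: "(frag_of u \<odot> d) \<odot> e = frag_of u \<odot> (d \<odot> e)" for u
    by (rule frag_induction[where S = UNIV and c = d]) (auto simp: cat_diff_right cat_diff_left 1 simp del: cat_of)
  show ?thesis
    by (rule frag_induction[where S = UNIV and c = c]) (auto simp: cat_diff_left 2)
qed

lemma cat_wchains: "c \<in> wchains Gs \<Longrightarrow> d \<in> wchains Hs \<Longrightarrow> c \<odot> d \<in> wchains (Gs @ Hs)"
  unfolding cat_def by (auto intro!: wchains_extend)


section \<open>Balanced relations\<close>

text \<open>
  A balancing datum \<open>K\<close> is a set of pairs \<open>(\<rho>, \<beta>)\<close>: the action \<open>\<rho>\<close> on a factor is identified with
  the action \<open>\<beta>\<close> on the next one. It is \<open>KR\<close> for the tensor product over \<open>R\<close> and \<open>KE\<close> over \<open>R\<^sup>e\<close>.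
\<close>

type_synonym ('r, 'u) action = "('r, 'u) bimod \<Rightarrow> 'r \<Rightarrow> 'u \<Rightarrow> 'u"

text \<open>The right actions are rewritten with the scalar first, so that all four actions have the
  type \<open>action\<close> and one lemma can range over them.\<close>

definition ra :: "('r, 'u) action" where "ra M r x = ract M x r"
definition rb :: "('r, 'u) action" where "rb M r x = rbact M x r"

definition wact :: "('r, 'u) action \<Rightarrow> ('r, 'u) bimod list \<Rightarrow> nat \<Rightarrow> 'r \<Rightarrow> 'u list \<Rightarrow> 'u list" where
  "wact \<alpha> Ms j r w = w[j := \<alpha> (Ms ! j) r (w ! j)]"

definition sact :: "('r, 'u) action \<Rightarrow> ('r, 'u) bimod list \<Rightarrow> nat \<Rightarrow> 'r \<Rightarrow> ('u list \<Rightarrow>\<^sub>0 int) \<Rightarrow> ('u list \<Rightarrow>\<^sub>0 int)" where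
  "sact \<alpha> Ms j r = frag_extend (\<lambda>w. frag_of (wact \<alpha> Ms j r w))"

lemma sact_of [simp]: "sact \<alpha> Ms j r (frag_of w) = frag_of (wact \<alpha> Ms j r w)"
  by (simp add: sact_def)

lemma sact_0 [simp]: "sact \<alpha> Ms j r 0 = 0"
  by (simp add: sact_def)

lemma sact_diff: "sact \<alpha> Ms j r (c - d) = sact \<alpha> Ms j r c - sact \<alpha> Ms j r d"
  by (simp add: sact_def frag_extend_diff)

lemma sact_add: "sact \<alpha> Ms j r (c + d) = sact \<alpha> Ms j r c + sact \<alpha> Ms j r d"
  by (simp add: sact_def frag_extend_add)

lemma wact_Cons_0 [simp]: "wact \<alpha> (M # Ms) 0 r (x # w) = \<alpha> M r x # w"
  by (simp add: wact_def)

lemma wact_Cons_Suc [simp]: "wact \<alpha> (M # Ms) (Suc j) r (x # w) = x # wact \<alpha> Ms j r w"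
  by (simp add: wact_def)

lemma wact_append_left:
  "length u = length Ls \<Longrightarrow> j < length Ls \<Longrightarrow> wact \<alpha> (Ls @ Hs) j r (u @ v) = wact \<alpha> Ls j r u @ v"
  by (simp add: wact_def nth_append list_update_append)

lemma wact_append_right:
  "length u = length Ls \<Longrightarrow> wact \<alpha> (Ls @ Hs) (length Ls + j) r (u @ v) = u @ wact \<alpha> Hs j r v"
  by (simp add: wact_def nth_append list_update_append)

lemma length_wact [simp]: "length (wact \<alpha> Ms j r w) = length w"
  by (simp add: wact_def)

type_synonym ('r, 'u) balancing = "(('r, 'u) action \<times> ('r, 'u) action) set"

text \<open>The relators of \<open>multilinear\<close>, with the position replaced by a splitting of
  the factor list. In this form, shared by \<open>bal\<close>, a relator is placed inside a longer
  word by associativity of append, without index arithmetic.\<close>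

definition mrel :: "('u, 'm) ring_scheme list \<Rightarrow> ('u list \<Rightarrow>\<^sub>0 int) set" where
  "mrel Ms = {frag_of (u @ (x \<oplus>\<^bsub>X\<^esub> y) # v) - frag_of (u @ x # v) - frag_of (u @ y # v) |
     Ps X Qs u x y v. Ms = Ps @ X # Qs \<and> u \<in> words Ps \<and> x \<in> carrier X \<and> y \<in> carrier X \<and> v \<in> words Qs}"

definition bal :: "('r, 'u) balancing \<Rightarrow> ('r, 'u) bimod list \<Rightarrow> ('u list \<Rightarrow>\<^sub>0 int) set" where
  "bal K Ms = {frag_of (u @ \<rho> X r x # y # v) - frag_of (u @ x # \<beta> Y r y # v) |
     Ps X Y Qs u x y v \<rho> \<beta> r. Ms = Ps @ X # Y # Qs \<and> u \<in> words Ps \<and> x \<in> carrier X \<and>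
       y \<in> carrier Y \<and> v \<in> words Qs \<and> (\<rho>, \<beta>) \<in> K}"

definition rl :: "('r, 'u) balancing \<Rightarrow> ('r, 'u) bimod list \<Rightarrow> ('u list \<Rightarrow>\<^sub>0 int) set" where
  "rl K Ms = span (mrel Ms \<union> bal K Ms)"

lemma mrelI: "Ms = Ps @ X # Qs \<Longrightarrow> u \<in> words Ps \<Longrightarrow> x \<in> carrier X \<Longrightarrow> y \<in> carrier X \<Longrightarrow> v \<in> words Qs \<Longrightarrow>
  frag_of (u @ (x \<oplus>\<^bsub>X\<^esub> y) # v) - frag_of (u @ x # v) - frag_of (u @ y # v) \<in> mrel Ms"
  unfolding mrel_def by blast

lemma balI: "Ms = Ps @ X # Y # Qs \<Longrightarrow> u \<in> words Ps \<Longrightarrow> x \<in> carrier X \<Longrightarrow> y \<in> carrier Y \<Longrightarrow> v \<in> words Qs \<Longrightarrow>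
  (\<rho>, \<beta>) \<in> K \<Longrightarrow> frag_of (u @ \<rho> X r x # y # v) - frag_of (u @ x # \<beta> Y r y # v) \<in> bal K Ms"
  unfolding bal_def by blast

lemma mrelE:
  assumes "z \<in> mrel Ms"
  obtains Ps X Qs u x y v where "z = frag_of (u @ (x \<oplus>\<^bsub>X\<^esub> y) # v) - frag_of (u @ x # v) - frag_of (u @ y # v)"
    "Ms = Ps @ X # Qs" "u \<in> words Ps" "x \<in> carrier X" "y \<in> carrier X" "v \<in> words Qs"
  using assms unfolding mrel_def by blast

lemma balE:
  assumes "z \<in> bal K Ms"
  obtains Ps X Y Qs u x y v \<rho> \<beta> r where "z = frag_of (u @ \<rho> X r x # y # v) - frag_of (u @ x # \<beta> Y r y # v)"
    "Ms = Ps @ X # Y # Qs" "u \<in> words Ps" "x \<in> carrier X" "y \<in> carrier Y" "v \<in> words Qs" "(\<rho>, \<beta>) \<in> K"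
  using assms unfolding bal_def by blast

lemma rl_0 [simp]: "0 \<in> rl K Ms"
  by (simp add: rl_def span_0)

lemma rl_add: "c \<in> rl K Ms \<Longrightarrow> d \<in> rl K Ms \<Longrightarrow> c + d \<in> rl K Ms"
  by (simp add: rl_def span_add)

lemma rl_diff: "c \<in> rl K Ms \<Longrightarrow> d \<in> rl K Ms \<Longrightarrow> c - d \<in> rl K Ms"
  by (simp add: rl_def span_diff)

lemma rl_uminus: "c \<in> rl K Ms \<Longrightarrow> - c \<in> rl K Ms"
  by (simp add: rl_def span_uminus)

lemma rl_sym: "a - b \<in> rl K Ms \<Longrightarrow> b - a \<in> rl K Ms"
  using rl_uminus[of "a - b" K Ms] by simp

lemma rl_trans: "a - b \<in> rl K Ms \<Longrightarrow> b - c \<in> rl K Ms \<Longrightarrow> a - c \<in> rl K Ms"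
  using rl_add[of "a - b" K Ms "b - c"] by simp

lemma rl_extend_fun:
  assumes "c \<in> wchains Gs" "\<And>w. w \<in> words Gs \<Longrightarrow> f w - g w \<in> rl K Ms"
  shows "frag_extend f c - frag_extend g c \<in> rl K Ms"
  using frag_extend_in_span[OF assms(1), of "\<lambda>w. f w - g w"] assms(2)
  by (simp add: rl_def frag_extend_diff_fun)

definition adm :: "('r, 'u) balancing \<Rightarrow> ('r, 'u) bimod \<Rightarrow> bool" where
  "adm K M \<longleftrightarrow> abelian_group M \<and> (\<forall>(\<rho>, \<beta>)\<in>K. \<forall>r. \<rho> M r \<in> ahom M M \<and> \<beta> M r \<in> ahom M M)"

lemma adm_group: "adm K M \<Longrightarrow> abelian_group M"
  by (simp add: adm_def)

lemma adm_act:
  assumes "adm K M" "(\<rho>, \<beta>) \<in> K"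
  shows "\<rho> M r \<in> ahom M M" "\<beta> M r \<in> ahom M M"
  using assms by (auto simp: adm_def)

lemma adm_closed:
  assumes "adm K M" "(\<rho>, \<beta>) \<in> K" "x \<in> carrier M"
  shows "\<rho> M r x \<in> carrier M" "\<beta> M r x \<in> carrier M"
  using adm_act[OF assms(1,2), of r] assms(3) by (auto intro: ahom_closed)

lemma adm_add: "adm K M \<Longrightarrow> x \<in> carrier M \<Longrightarrow> y \<in> carrier M \<Longrightarrow> x \<oplus>\<^bsub>M\<^esub> y \<in> carrier M"
  using adm_group[of K M] by (auto simp: abelian_group.axioms(1)[THEN abelian_monoid.a_closed])

lemma rels_wchains:
  assumes "\<forall>M\<in>set Ms. adm K M"
  shows "mrel Ms \<union> bal K Ms \<subseteq> wchains Ms"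
proof
  fix z assume "z \<in> mrel Ms \<union> bal K Ms"
  then show "z \<in> wchains Ms"
  proof
    assume "z \<in> mrel Ms"
    then obtain Ps X Qs u x y v where z: "z = frag_of (u @ (x \<oplus>\<^bsub>X\<^esub> y) # v) - frag_of (u @ x # v) - frag_of (u @ y # v)"
      and *: "Ms = Ps @ X # Qs" "u \<in> words Ps" "x \<in> carrier X" "y \<in> carrier X" "v \<in> words Qs"
      by (rule mrelE)
    have "adm K X" using assms *(1) by simp
    then have "x \<oplus>\<^bsub>X\<^esub> y \<in> carrier X" using *(3,4) by (rule adm_add)
    then show ?thesis unfolding z using * by (intro wchains_diff) simp_all
  next
    assume "z \<in> bal K Ms"
    then obtain Ps X Y Qs u x y v \<rho> \<beta> r where z: "z = frag_of (u @ \<rho> X r x # y # v) - frag_of (u @ x # \<beta> Y r y # v)"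
      and *: "Ms = Ps @ X # Y # Qs" "u \<in> words Ps" "x \<in> carrier X" "y \<in> carrier Y" "v \<in> words Qs" "(\<rho>, \<beta>) \<in> K"
      by (rule balE)
    have "adm K X" "adm K Y" using assms *(1) by simp_all
    then have "\<rho> X r x \<in> carrier X" "\<beta> Y r y \<in> carrier Y" using adm_closed *(3,4,6) by metis+
    then show ?thesis unfolding z using * by (intro wchains_diff) simp_all
  qed
qed

lemma span_wchains:
  assumes "X \<subseteq> wchains Ms" shows "span X \<subseteq> wchains Ms"
proof
  fix c assume "c \<in> span X"
  then show "c \<in> wchains Ms" using assms by (induction rule: span.induct) auto
qed

lemma rl_wchains: "\<forall>M\<in>set Ms. adm K M \<Longrightarrow> rl K Ms \<subseteq> wchains Ms"
  unfolding rl_def by (intro span_wchains rels_wchains)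

lemma multilinear_eq_mrel: "multilinear Ms = mrel Ms"
proof (intro equalityI subsetI)
  fix z assume "z \<in> multilinear Ms"
  then obtain w j y where z: "z = frag_of (w[j := w ! j \<oplus>\<^bsub>Ms ! j\<^esub> y]) - frag_of w - frag_of (w[j := y])"
    and w: "w \<in> words Ms" and j: "j < length Ms" and y: "y \<in> carrier (Ms ! j)"
    unfolding multilinear_def by auto
  have l: "length w = length Ms" using w by (rule words_length)
  have *: "w ! j \<in> carrier (Ms ! j)" "take j w \<in> words (take j Ms)" "drop (Suc j) w \<in> words (drop (Suc j) Ms)"
    using w j by (auto simp: words_iff_nth)
  have u: "w[j := x] = take j w @ x # drop (Suc j) w" for x
    using j l by (simp add: upd_conv_take_nth_drop)
  have Ms: "Ms = take j Ms @ Ms ! j # drop (Suc j) Ms"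
    using j by (simp add: id_take_nth_drop[symmetric])
  \<comment> \<open>Writing \<open>w\<close> as an update of itself brings all three words of the
    relator to the shape prefix, letter, suffix.\<close>
  have "frag_of w = frag_of (w[j := w ! j])" by simp
  then show "z \<in> mrel Ms"
    unfolding z u by (metis mrelI[OF Ms *(2) *(1) y *(3)])
next
  fix z assume "z \<in> mrel Ms"
  then obtain Ps X Qs u x y v where z: "z = frag_of (u @ (x \<oplus>\<^bsub>X\<^esub> y) # v) - frag_of (u @ x # v) - frag_of (u @ y # v)"
    and *: "Ms = Ps @ X # Qs" "u \<in> words Ps" "x \<in> carrier X" "y \<in> carrier X" "v \<in> words Qs"
    by (rule mrelE)
  have "length u = length Ps" using * by (auto dest: words_length)
  then show "z \<in> multilinear Ms"
    unfolding multilinear_def z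
    by (intro CollectI exI[of _ "u @ x # v"] exI[of _ "length Ps"] exI[of _ y])
      (use * in \<open>auto simp: nth_append list_update_append\<close>)
qed

text \<open>The positional form is the one in which \<open>balR\<close> and \<open>balE\<close> are
  given and in which the Takeuchi condition compares neighbouring letters.\<close>

lemma bal_eq_nth:
  "bal K Ms = {frag_of (wact \<rho> Ms j r w) - frag_of (wact \<beta> Ms (Suc j) r w) | w j r \<rho> \<beta>.
     w \<in> words Ms \<and> Suc j < length Ms \<and> (\<rho>, \<beta>) \<in> K}" (is "_ = ?S")
proof (intro equalityI subsetI)
  fix z assume "z \<in> bal K Ms"
  then obtain Ps X Y Qs u x y v \<rho> \<beta> r where z: "z = frag_of (u @ \<rho> X r x # y # v) - frag_of (u @ x # \<beta> Y r y # v)"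
    and *: "Ms = Ps @ X # Y # Qs" "u \<in> words Ps" "x \<in> carrier X" "y \<in> carrier Y" "v \<in> words Qs" "(\<rho>, \<beta>) \<in> K"
    by (rule balE)
  have l: "length u = length Ps" using * by (auto dest: words_length)
  have "wact \<rho> Ms (length Ps) r (u @ x # y # v) = u @ \<rho> X r x # y # v"
    "wact \<beta> Ms (Suc (length Ps)) r (u @ x # y # v) = u @ x # \<beta> Y r y # v"
    using wact_append_right[OF l, of \<rho> "X # Y # Qs" 0 r "x # y # v"]
      wact_append_right[OF l, of \<beta> "X # Y # Qs" 1 r "x # y # v"] * by auto
  then show "z \<in> ?S"
    unfolding z by (intro CollectI exI[of _ "u @ x # y # v"] exI[of _ "length Ps"] exI[of _ r] exI[of _ \<rho>] exI[of _ \<beta>])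
      (use * in auto)
next
  fix z assume "z \<in> ?S"
  then obtain w j r \<rho> \<beta> where z: "z = frag_of (wact \<rho> Ms j r w) - frag_of (wact \<beta> Ms (Suc j) r w)"
    and *: "w \<in> words Ms" "Suc j < length Ms" "(\<rho>, \<beta>) \<in> K" by blast
  define Ps X Y Qs where d: "Ps = take j Ms" "X = Ms ! j" "Y = Ms ! Suc j" "Qs = drop (Suc (Suc j)) Ms"
  have Ms: "Ms = Ps @ X # Y # Qs"
    using * unfolding d by (simp add: Cons_nth_drop_Suc)
  then obtain u x y v where w: "w = u @ x # y # v" "u \<in> words Ps" "x \<in> carrier X" "y \<in> carrier Y" "v \<in> words Qs"
    using *(1) by (auto elim!: words_append_E words_Cons_E)
  have l: "length u = length Ps" "length Ps = j" using w *(2) by (auto dest: words_length simp: d)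
  have "wact \<rho> Ms j r w = u @ \<rho> X r x # y # v"
    "wact \<beta> Ms (Suc j) r w = u @ x # \<beta> Y r y # v"
    using wact_append_right[OF l(1), of \<rho> "X # Y # Qs" 0 r "x # y # v"]
      wact_append_right[OF l(1), of \<beta> "X # Y # Qs" 1 r "x # y # v"] w(1) Ms l(2) by auto
  then show "z \<in> bal K Ms"
    unfolding z using balI[OF Ms w(2-5) *(3)] by simp
qed

lemma rel_eq_rl:
  assumes "\<forall>M\<in>set Ms. adm K M"
  shows "rel Ms (bal K Ms) = rl K Ms"
proof -
  have "mrel Ms \<union> bal K Ms \<subseteq> carrier (free_Abelian_group (words Ms))"
    using rels_wchains[OF assms] by (auto simp: wchains_def)
  then show ?thesis
    unfolding rel_def rl_def by (metis generate_eq_span multilinear_eq_mrel)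
qed

lemma rl_balI:
  assumes "w \<in> words Ms" "Suc j < length Ms" "(\<rho>, \<beta>) \<in> K"
  shows "frag_of (wact \<rho> Ms j r w) - frag_of (wact \<beta> Ms (Suc j) r w) \<in> rl K Ms"
  unfolding rl_def by (rule span_base) (use assms in \<open>auto simp: bal_eq_nth\<close>)

text \<open>A relator changes one letter or two adjacent ones, so it lies in the left block, in the
  right block, or is a balancing relator across the seam. Only the last kind couples the two
  blocks.\<close>

lemma rels_append_cases:
  assumes "z \<in> mrel (Ls @ Hs) \<union> bal K (Ls @ Hs)"
  obtains (left) z' v where "z' \<in> mrel Ls \<union> bal K Ls" "v \<in> words Hs" "z = z' \<odot> frag_of v"
  | (right) u z' where "u \<in> words Ls" "z' \<in> mrel Hs \<union> bal K Hs" "z = frag_of u \<odot> z'"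
  | (cross) u v \<rho> \<beta> r where "Ls \<noteq> []" "Hs \<noteq> []" "u \<in> words Ls" "v \<in> words Hs" "(\<rho>, \<beta>) \<in> K"
     "z = frag_of (wact \<rho> Ls (length Ls - 1) r u @ v) - frag_of (u @ wact \<beta> Hs 0 r v)"
  using assms
proof
  assume "z \<in> mrel (Ls @ Hs)"
  then obtain Ps X Qs u x y v where z: "z = frag_of (u @ (x \<oplus>\<^bsub>X\<^esub> y) # v) - frag_of (u @ x # v) - frag_of (u @ y # v)"
    and *: "Ls @ Hs = Ps @ X # Qs" "u \<in> words Ps" "x \<in> carrier X" "y \<in> carrier X" "v \<in> words Qs"
    by (rule mrelE)
  from *(1) consider us where "Ls = Ps @ X # us" "Qs = us @ Hs" | us where "Hs = us @ X # Qs" "Ps = Ls @ us"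
    by (auto simp: append_eq_append_conv2 append_eq_Cons_conv)
  then show thesis
  proof cases
    case 1
    then obtain v1 v2 where v: "v = v1 @ v2" "v1 \<in> words us" "v2 \<in> words Hs" using * by (auto elim!: words_append_E)
    show thesis
      using left[OF UnI1[OF mrelI[OF 1(1) *(2-4) v(2)]] v(3)] z v(1) by (simp add: cat_diff_left)
  next
    case 2
    then obtain v1 v2 where v: "u = v1 @ v2" "v1 \<in> words Ls" "v2 \<in> words us" using * by (auto elim!: words_append_E)
    show thesis
      using right[OF v(2) UnI1[OF mrelI[OF 2(1) v(3) *(3-5)]]] z v(1) by (simp add: cat_diff_right)
  qed
next
  assume "z \<in> bal K (Ls @ Hs)"
  then obtain Ps X Y Qs u x y v \<rho> \<beta> r where z: "z = frag_of (u @ \<rho> X r x # y # v) - frag_of (u @ x # \<beta> Y r y # v)"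
    and *: "Ls @ Hs = Ps @ X # Y # Qs" "u \<in> words Ps" "x \<in> carrier X" "y \<in> carrier Y" "v \<in> words Qs" "(\<rho>, \<beta>) \<in> K"
    by (rule balE)
  from *(1) consider us where "Ls = Ps @ X # Y # us" "Qs = us @ Hs" | us where "Hs = us @ X # Y # Qs" "Ps = Ls @ us"
    | "Ls = Ps @ [X]" "Hs = Y # Qs"
    by (auto simp: append_eq_append_conv2 append_eq_Cons_conv)
  then show thesis
  proof cases
    case 1
    then obtain v1 v2 where v: "v = v1 @ v2" "v1 \<in> words us" "v2 \<in> words Hs" using * by (auto elim!: words_append_E)
    show thesis
      using left[OF UnI2[OF balI[OF 1(1) *(2-4) v(2) *(6)]] v(3)] z v(1) by (simp add: cat_diff_left)
  next
    case 2
    then obtain v1 v2 where v: "u = v1 @ v2" "v1 \<in> words Ls" "v2 \<in> words us" using * by (auto elim!: words_append_E)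
    show thesis
      using right[OF v(2) UnI2[OF balI[OF 2(1) v(3) *(3-6)]]] z v(1) by (simp add: cat_diff_right)
  next
    case 3
    have "length u = length Ps" using * by (auto dest: words_length)
    then have "wact \<rho> Ls (length Ls - 1) r (u @ [x]) = u @ [\<rho> X r x]"
      using wact_append_right[of u Ps \<rho> "[X]" 0 r "[x]"] 3 by simp
    then show thesis
      by (intro cross[of "u @ [x]" "y # v" \<rho> \<beta> r]) (use 3 * z in auto)
  qed
qed

lemma rels_cat_left:
  assumes "z \<in> mrel Ls \<union> bal K Ls" "v \<in> words Hs"
  shows "z \<odot> frag_of v \<in> mrel (Ls @ Hs) \<union> bal K (Ls @ Hs)"
  using assms(1)
proof
  assume "z \<in> mrel Ls"
  then obtain Ps X Qs u x y w where z: "z = frag_of (u @ (x \<oplus>\<^bsub>X\<^esub> y) # w) - frag_of (u @ x # w) - frag_of (u @ y # w)"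
    and *: "Ls = Ps @ X # Qs" "u \<in> words Ps" "x \<in> carrier X" "y \<in> carrier X" "w \<in> words Qs"
    by (rule mrelE)
  have "Ls @ Hs = Ps @ X # (Qs @ Hs)" "w @ v \<in> words (Qs @ Hs)" using * assms(2) by auto
  from mrelI[OF this(1) *(2-4) this(2)] show ?thesis by (simp add: z cat_diff_left)
next
  assume "z \<in> bal K Ls"
  then obtain Ps X Y Qs u x y w \<rho> \<beta> r where z: "z = frag_of (u @ \<rho> X r x # y # w) - frag_of (u @ x # \<beta> Y r y # w)"
    and *: "Ls = Ps @ X # Y # Qs" "u \<in> words Ps" "x \<in> carrier X" "y \<in> carrier Y" "w \<in> words Qs" "(\<rho>, \<beta>) \<in> K"
    by (rule balE)
  have "Ls @ Hs = Ps @ X # Y # (Qs @ Hs)" "w @ v \<in> words (Qs @ Hs)" using * assms(2) by auto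
  from balI[OF this(1) *(2-4) this(2) *(6)] show ?thesis by (simp add: z cat_diff_left)
qed

lemma rels_cat_right:
  assumes "z \<in> mrel Hs \<union> bal K Hs" "v \<in> words Ls"
  shows "frag_of v \<odot> z \<in> mrel (Ls @ Hs) \<union> bal K (Ls @ Hs)"
  using assms(1)
proof
  assume "z \<in> mrel Hs"
  then obtain Ps X Qs u x y w where z: "z = frag_of (u @ (x \<oplus>\<^bsub>X\<^esub> y) # w) - frag_of (u @ x # w) - frag_of (u @ y # w)"
    and *: "Hs = Ps @ X # Qs" "u \<in> words Ps" "x \<in> carrier X" "y \<in> carrier X" "w \<in> words Qs"
    by (rule mrelE)
  have "Ls @ Hs = (Ls @ Ps) @ X # Qs" "v @ u \<in> words (Ls @ Ps)" using * assms(2) by auto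
  from mrelI[OF this(1,2) *(3-5)] show ?thesis by (simp add: z cat_diff_right)
next
  assume "z \<in> bal K Hs"
  then obtain Ps X Y Qs u x y w \<rho> \<beta> r where z: "z = frag_of (u @ \<rho> X r x # y # w) - frag_of (u @ x # \<beta> Y r y # w)"
    and *: "Hs = Ps @ X # Y # Qs" "u \<in> words Ps" "x \<in> carrier X" "y \<in> carrier Y" "w \<in> words Qs" "(\<rho>, \<beta>) \<in> K"
    by (rule balE)
  have "Ls @ Hs = (Ls @ Ps) @ X # Y # Qs" "v @ u \<in> words (Ls @ Ps)" using * assms(2) by auto
  from balI[OF this(1,2) *(3-6)] show ?thesis by (simp add: z cat_diff_right)
qed

lemma span_map:
  assumes "c \<in> span X" "h 0 = 0" "\<And>x y. h (x + y) = h x + h y" "\<And>x y. h (x - y) = h x - h y"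
    and "\<And>x. x \<in> X \<Longrightarrow> h x \<in> span Y"
  shows "h c \<in> span Y"
  using assms(1) by (induction rule: span.induct) (simp_all add: assms span_0 span_add span_diff)

lemma rl_cat_left:
  assumes "z \<in> rl K Ls" "d \<in> wchains Hs" shows "z \<odot> d \<in> rl K (Ls @ Hs)"
proof -
  have "z \<odot> frag_of v \<in> rl K (Ls @ Hs)" if "v \<in> words Hs" for v
    using assms(1) unfolding rl_def
    by (rule span_map) (simp_all add: cat_add_left cat_diff_left span_base rels_cat_left[OF _ that, simplified])
  then have "frag_extend (\<lambda>v. z \<odot> frag_of v) d \<in> rl K (Ls @ Hs)"
    using assms(2) unfolding rl_def by (intro frag_extend_in_span) auto
  then show ?thesis by (metis cat_extend_right frag_extend_frag_of)
qed

lemma rl_cat_right: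
  assumes "z \<in> rl K Hs" "d \<in> wchains Ls" shows "d \<odot> z \<in> rl K (Ls @ Hs)"
proof -
  have "frag_of v \<odot> z \<in> rl K (Ls @ Hs)" if "v \<in> words Ls" for v
    using assms(1) unfolding rl_def
    by (rule span_map) (simp_all add: cat_add_right cat_diff_right span_base rels_cat_right[OF _ that, simplified])
  then have "frag_extend (\<lambda>v. frag_of v \<odot> z) d \<in> rl K (Ls @ Hs)"
    using assms(2) unfolding rl_def by (intro frag_extend_in_span) auto
  then show ?thesis by (metis cat_extend_left frag_extend_frag_of)
qed

text \<open>On words this is a balancing relator across the seam; both sides are biadditive in the
  two chains, which gives the general case.\<close>

lemma rl_cross:
  assumes "c \<in> wchains Ls" "d \<in> wchains Hs" "Ls \<noteq> []" "Hs \<noteq> []" "(\<rho>, \<beta>) \<in> K"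
  shows "sact \<rho> Ls (length Ls - 1) r c \<odot> d - c \<odot> sact \<beta> Hs 0 r d \<in> rl K (Ls @ Hs)"
proof -
  have w: "sact \<rho> Ls (length Ls - 1) r (frag_of u) \<odot> frag_of v - frag_of u \<odot> sact \<beta> Hs 0 r (frag_of v) \<in> rl K (Ls @ Hs)"
    if "u \<in> words Ls" "v \<in> words Hs" for u v
  proof -
    have lu: "length u = length Ls" using that by (auto dest: words_length)
    then have "wact \<rho> Ls (length Ls - 1) r u @ v = wact \<rho> (Ls @ Hs) (length Ls - 1) r (u @ v)"
      "u @ wact \<beta> Hs 0 r v = wact \<beta> (Ls @ Hs) (Suc (length Ls - 1)) r (u @ v)"
      using wact_append_left[OF lu, of "length Ls - 1" \<rho> Hs r v] wact_append_right[OF lu, of \<beta> Hs 0 r v] assms(3)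
      by auto
    then show ?thesis
      using rl_balI[of "u @ v" "Ls @ Hs" "length Ls - 1" \<rho> \<beta> K r] that assms by (auto simp: Suc_lessI)
  qed
  have w2: "sact \<rho> Ls (length Ls - 1) r (frag_of u) \<odot> d - frag_of u \<odot> sact \<beta> Hs 0 r d \<in> rl K (Ls @ Hs)"
    if "u \<in> words Ls" for u
    using assms(2)
  proof (induction rule: wchains_induct)
    case (word v)
    then show ?case using w that by blast
  next
    case (diff a b)
    then show ?case
      using rl_diff[OF diff(3,4)] by (simp add: cat_diff_right sact_diff algebra_simps)
  qed auto
  show ?thesis
    using assms(1)
  proof (induction rule: wchains_induct)
    case (word v)
    then show ?case using w2 by blast
  next
    case (diff a b)
    then show ?case
      using rl_diff[OF diff(3,4)] by (simp add: cat_diff_left sact_diff algebra_simps)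
  qed auto
qed


section \<open>Bimodule morphisms between tensor products\<close>

text \<open>
  A map from words over \<open>Ls\<close> to chains over \<open>Hs\<close> that respects the relations; \<open>a\<close> and \<open>b\<close> say
  whether it also commutes, up to relations, with the balancing actions on the first and on the
  last factor, as is needed for placing it next to other factors.
\<close>

definition mor :: "bool \<Rightarrow> bool \<Rightarrow> ('r, 'u) balancing \<Rightarrow> ('r, 'u) bimod list \<Rightarrow> ('r, 'u) bimod list \<Rightarrow>
    ('u list \<Rightarrow> ('u list \<Rightarrow>\<^sub>0 int)) \<Rightarrow> bool" where
  "mor a b K Ls Hs G \<longleftrightarrow> Ls \<noteq> [] \<and> Hs \<noteq> [] \<and> (\<forall>M\<in>set Ls \<union> set Hs. adm K M) \<and>
     (\<forall>w\<in>words Ls. G w \<in> wchains Hs) \<and>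
     (\<forall>z\<in>mrel Ls \<union> bal K Ls. frag_extend G z \<in> rl K Hs) \<and>
     (a \<longrightarrow> (\<forall>(\<rho>, \<beta>)\<in>K. \<forall>r. \<forall>w\<in>words Ls. G (wact \<beta> Ls 0 r w) - sact \<beta> Hs 0 r (G w) \<in> rl K Hs)) \<and>
     (b \<longrightarrow> (\<forall>(\<rho>, \<beta>)\<in>K. \<forall>r. \<forall>w\<in>words Ls. G (wact \<rho> Ls (length Ls - 1) r w)
                - sact \<rho> Hs (length Hs - 1) r (G w) \<in> rl K Hs))"

lemma morD:
  assumes "mor a b K Ls Hs G"
  shows mor_ne: "Ls \<noteq> []" "Hs \<noteq> []" and mor_adm: "\<forall>M\<in>set Ls. adm K M" "\<forall>M\<in>set Hs. adm K M"
    and mor_wchains: "w \<in> words Ls \<Longrightarrow> G w \<in> wchains Hs"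
    and mor_rels: "z \<in> mrel Ls \<union> bal K Ls \<Longrightarrow> frag_extend G z \<in> rl K Hs"
    and mor_left: "a \<Longrightarrow> (\<rho>, \<beta>) \<in> K \<Longrightarrow> w \<in> words Ls \<Longrightarrow> G (wact \<beta> Ls 0 r w) - sact \<beta> Hs 0 r (G w) \<in> rl K Hs"
    and mor_right: "b \<Longrightarrow> (\<rho>, \<beta>) \<in> K \<Longrightarrow> w \<in> words Ls \<Longrightarrow>
      G (wact \<rho> Ls (length Ls - 1) r w) - sact \<rho> Hs (length Hs - 1) r (G w) \<in> rl K Hs"
  using assms unfolding mor_def by (blast+)

lemma mor_extend_wchains: "mor a b K Ls Hs G \<Longrightarrow> c \<in> wchains Ls \<Longrightarrow> frag_extend G c \<in> wchains Hs"
  by (rule wchains_extend) (auto dest: mor_wchains)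

lemma mor_rl: "mor a b K Ls Hs G \<Longrightarrow> c \<in> rl K Ls \<Longrightarrow> frag_extend G c \<in> rl K Hs"
  using frag_extend_span[of c "mrel Ls \<union> bal K Ls" G "mrel Hs \<union> bal K Hs"] mor_rels
  unfolding rl_def by blast

lemma mor_eqv: "mor a b K Ls Hs G \<Longrightarrow> c - d \<in> rl K Ls \<Longrightarrow> frag_extend G c - frag_extend G d \<in> rl K Hs"
  using mor_rl[of a b K Ls Hs G "c - d"] by (simp add: frag_extend_diff)

lemma wact_words:
  assumes "w \<in> words Ms" "j < length Ms" "\<alpha> (Ms ! j) r \<in> carrier (Ms ! j) \<rightarrow> carrier (Ms ! j)"
  shows "wact \<alpha> Ms j r w \<in> words Ms"
  unfolding wact_def using assms words_nth[OF assms(1,2)] by (auto intro: words_update)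

lemma sact_wchains:
  assumes "c \<in> wchains Ms" "j < length Ms" "\<alpha> (Ms ! j) r \<in> carrier (Ms ! j) \<rightarrow> carrier (Ms ! j)"
  shows "sact \<alpha> Ms j r c \<in> wchains Ms"
  unfolding sact_def using assms by (auto intro!: wchains_extend wact_words)

lemma adm_funcset:
  assumes "adm K M" "(\<rho>, \<beta>) \<in> K"
  shows "\<rho> M r \<in> carrier M \<rightarrow> carrier M" "\<beta> M r \<in> carrier M \<rightarrow> carrier M"
  using adm_act[OF assms, of r] by (auto simp: ahom_def)

lemma adm_wact:
  assumes "\<forall>M\<in>set Ms. adm K M" "w \<in> words Ms" "j < length Ms" "(\<rho>, \<beta>) \<in> K"
  shows "wact \<rho> Ms j r w \<in> words Ms" "wact \<beta> Ms j r w \<in> words Ms"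
proof -
  have "adm K (Ms ! j)" using assms by simp
  from adm_funcset[OF this assms(4)] show "wact \<rho> Ms j r w \<in> words Ms" "wact \<beta> Ms j r w \<in> words Ms"
    using wact_words[OF assms(2,3)] by metis+
qed

lemma adm_sact:
  assumes "\<forall>M\<in>set Ms. adm K M" "c \<in> wchains Ms" "j < length Ms" "(\<rho>, \<beta>) \<in> K"
  shows "sact \<rho> Ms j r c \<in> wchains Ms" "sact \<beta> Ms j r c \<in> wchains Ms"
proof -
  have "adm K (Ms ! j)" using assms by simp
  from adm_funcset[OF this assms(4)] show "sact \<rho> Ms j r c \<in> wchains Ms" "sact \<beta> Ms j r c \<in> wchains Ms"
    using sact_wchains[OF assms(2,3)] by metis+
qed

lemma mor_left_chain:
  assumes "mor a b K Ls Hs G" a "(\<rho>, \<beta>) \<in> K" "c \<in> wchains Ls"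
  shows "frag_extend G (sact \<beta> Ls 0 r c) - sact \<beta> Hs 0 r (frag_extend G c) \<in> rl K Hs"
proof -
  have "frag_extend (\<lambda>w. G (wact \<beta> Ls 0 r w)) c - frag_extend (\<lambda>w. sact \<beta> Hs 0 r (G w)) c \<in> rl K Hs"
    by (rule rl_extend_fun[OF assms(4)]) (rule mor_left[OF assms(1-3)])
  then show ?thesis by (simp add: sact_def frag_extend_extend)
qed

lemma mor_right_chain:
  assumes "mor a b K Ls Hs G" b "(\<rho>, \<beta>) \<in> K" "c \<in> wchains Ls"
  shows "frag_extend G (sact \<rho> Ls (length Ls - 1) r c) - sact \<rho> Hs (length Hs - 1) r (frag_extend G c) \<in> rl K Hs"
proof -
  have "frag_extend (\<lambda>w. G (wact \<rho> Ls (length Ls - 1) r w)) c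
      - frag_extend (\<lambda>w. sact \<rho> Hs (length Hs - 1) r (G w)) c \<in> rl K Hs"
    by (rule rl_extend_fun[OF assms(4)]) (rule mor_right[OF assms(1-3)])
  then show ?thesis by (simp add: sact_def frag_extend_extend)
qed

lemma sact_cat_left:
  assumes "c \<in> wchains Ls" "Ls \<noteq> []"
  shows "sact \<alpha> (Ls @ Hs) 0 r (c \<odot> d) = sact \<alpha> Ls 0 r c \<odot> d"
  using assms(1)
proof (induction rule: wchains_induct)
  case (word w)
  then have l: "length w = length Ls" by (rule words_length)
  have "sact \<alpha> (Ls @ Hs) 0 r (frag_of w \<odot> frag_of v) = sact \<alpha> Ls 0 r (frag_of w) \<odot> frag_of v" for v
    using wact_append_left[OF l, of 0] assms(2) by simp
  then show ?case
    by - (rule frag_induction[where S = UNIV and c = d], auto simp: cat_diff_right sact_diff simp del: cat_of sact_of)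
qed (auto simp: cat_diff_left sact_diff)

lemma sact_cat_right:
  assumes "c \<in> wchains Ls" "d \<in> wchains Hs"
  shows "sact \<alpha> (Ls @ Hs) (length Ls + j) r (c \<odot> d) = c \<odot> sact \<alpha> Hs j r d"
  using assms(1)
proof (induction rule: wchains_induct)
  case (word w)
  then have l: "length w = length Ls" by (rule words_length)
  have "sact \<alpha> (Ls @ Hs) (length Ls + j) r (frag_of w \<odot> frag_of v) = frag_of w \<odot> sact \<alpha> Hs j r (frag_of v)" for v
    using wact_append_right[OF l] by simp
  then show ?case
    by - (rule frag_induction[where S = UNIV and c = d], auto simp: cat_diff_right sact_diff simp del: cat_of sact_of)
qed (auto simp: cat_diff_left sact_diff)

text \<open>A relator within a block is handled by the map of that block. A balancing relator across
  the seam needs both maps to respect the actions there, which is why the inner flags are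
  \<open>True\<close>; the outer flags pass through.\<close>

lemma mor_tensor:
  assumes G: "mor a True K Ls Hs G" and F: "mor True b K Ls' Hs' F"
  shows "mor a b K (Ls @ Ls') (Hs @ Hs') (\<lambda>w. G (take (length Ls) w) \<odot> F (drop (length Ls) w))"
    (is "mor a b K _ _ ?P")
proof -
  have P: "?P (u @ v) = G u \<odot> F v" if "u \<in> words Ls" for u v
    using words_length[OF that] by simp
  have Pc: "frag_extend ?P (c \<odot> d) = frag_extend G c \<odot> frag_extend F d" if "c \<in> wchains Ls" for c d
  proof -
    have *: "frag_extend ?P (frag_of u \<odot> d) = G u \<odot> frag_extend F d" if u: "u \<in> words Ls" for u
    proof (rule frag_induction[where S = UNIV and c = d])
      show "frag_extend ?P (frag_of u \<odot> frag_of x) = G u \<odot> frag_extend F (frag_of x)" for x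
        using P[OF u] by simp
    qed (auto simp: cat_diff_right frag_extend_diff)
    show ?thesis
      using that by (induction rule: wchains_induct) (auto simp: cat_diff_left frag_extend_diff *)
  qed
  have W: "?P w \<in> wchains (Hs @ Hs')" if "w \<in> words (Ls @ Ls')" for w
    using that P by (elim words_append_E) (auto intro!: cat_wchains mor_wchains[OF G] mor_wchains[OF F])
  have R: "frag_extend ?P z \<in> rl K (Hs @ Hs')" if "z \<in> mrel (Ls @ Ls') \<union> bal K (Ls @ Ls')" for z
    using that
  proof (cases rule: rels_append_cases)
    case (left z' v)
    then have "z' \<in> wchains Ls" using rels_wchains[OF mor_adm(1)[OF G]] by auto
    then show ?thesis
      using left mor_rels[OF G left(1)] mor_wchains[OF F left(2)] by (auto simp: Pc intro: rl_cat_left)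
  next
    case (right u z')
    then show ?thesis
      using mor_rels[OF F right(2)] mor_wchains[OF G right(1)] by (auto simp: Pc intro: rl_cat_right)
  next
    case (cross u v \<rho> \<beta> r)
    let ?u = "wact \<rho> Ls (length Ls - 1) r u" and ?v = "wact \<beta> Ls' 0 r v"
    have u': "?u \<in> words Ls" using adm_wact(1)[OF mor_adm(1)[OF G] cross(3) _ cross(5)] cross(1) by simp
    have Fv: "F v \<in> wchains Hs'" and Gu: "G u \<in> wchains Hs"
      using cross mor_wchains[OF F] mor_wchains[OF G] by auto
    \<comment> \<open>The seam relator is resolved in three moves: the action leaves
      \<open>G\<close> at its right end, crosses the seam of the target by \<open>rl_cross\<close>,
      and enters \<open>F\<close> at its left end.\<close>
    have 1: "G ?u \<odot> F v - sact \<rho> Hs (length Hs - 1) r (G u) \<odot> F v \<in> rl K (Hs @ Hs')"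
      using rl_cat_left[OF mor_right[OF G _ cross(5,3), of r] Fv] by (simp add: cat_diff_left)
    have 2: "G u \<odot> F ?v - G u \<odot> sact \<beta> Hs' 0 r (F v) \<in> rl K (Hs @ Hs')"
      using rl_cat_right[OF mor_left[OF F _ cross(5,4), of r] Gu] by (simp add: cat_diff_right)
    have 3: "sact \<rho> Hs (length Hs - 1) r (G u) \<odot> F v - G u \<odot> sact \<beta> Hs' 0 r (F v) \<in> rl K (Hs @ Hs')"
      by (rule rl_cross[OF Gu Fv mor_ne(2)[OF G] mor_ne(2)[OF F] cross(5)])
    have "G ?u \<odot> F v - G u \<odot> F ?v \<in> rl K (Hs @ Hs')"
      using rl_trans[OF rl_trans[OF 1 3] rl_sym[OF 2]] .
    then show ?thesis
      using P[OF u', of v] P[OF cross(3), of ?v] by (simp add: cross(6) frag_extend_diff del: append_take_drop_id)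
  qed
  have L: "?P (wact \<beta> (Ls @ Ls') 0 r w) - sact \<beta> (Hs @ Hs') 0 r (?P w) \<in> rl K (Hs @ Hs')"
    if a and K: "(\<rho>, \<beta>) \<in> K" and w: "w \<in> words (Ls @ Ls')" for \<rho> \<beta> r w
  proof -
    obtain u v where uv: "w = u @ v" "u \<in> words Ls" "v \<in> words Ls'" using w by (rule words_append_E)
    have "wact \<beta> (Ls @ Ls') 0 r w = wact \<beta> Ls 0 r u @ v"
      using uv mor_ne(1)[OF G] by (simp add: wact_append_left words_length)
    moreover have "wact \<beta> Ls 0 r u \<in> words Ls"
      using adm_wact(2)[OF mor_adm(1)[OF G] uv(2) _ K] mor_ne(1)[OF G] by simp
    moreover have "sact \<beta> (Hs @ Hs') 0 r (G u \<odot> F v) = sact \<beta> Hs 0 r (G u) \<odot> F v"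
      by (rule sact_cat_left[OF mor_wchains[OF G uv(2)] mor_ne(2)[OF G]])
    ultimately show ?thesis
      using rl_cat_left[OF mor_left[OF G \<open>a\<close> K uv(2), of r] mor_wchains[OF F uv(3)]] uv P[of u v]
        P[of "wact \<beta> Ls 0 r u" v]
      by (simp add: cat_diff_left)
  qed
  have Rr: "?P (wact \<rho> (Ls @ Ls') (length (Ls @ Ls') - 1) r w)
      - sact \<rho> (Hs @ Hs') (length (Hs @ Hs') - 1) r (?P w) \<in> rl K (Hs @ Hs')"
    if b and K: "(\<rho>, \<beta>) \<in> K" and w: "w \<in> words (Ls @ Ls')" for \<rho> \<beta> r w
  proof -
    obtain u v where uv: "w = u @ v" "u \<in> words Ls" "v \<in> words Ls'" using w by (rule words_append_E)
    have i: "length (Ls @ Ls') - 1 = length Ls + (length Ls' - 1)" "length (Hs @ Hs') - 1 = length Hs + (length Hs' - 1)"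
      using mor_ne[OF F] by (cases Ls'; simp; cases Hs'; simp)+
    have "wact \<rho> (Ls @ Ls') (length (Ls @ Ls') - 1) r w = u @ wact \<rho> Ls' (length Ls' - 1) r v"
      using uv by (simp only: i wact_append_right words_length)
    moreover have "sact \<rho> (Hs @ Hs') (length (Hs @ Hs') - 1) r (G u \<odot> F v) = G u \<odot> sact \<rho> Hs' (length Hs' - 1) r (F v)"
      unfolding i by (rule sact_cat_right[OF mor_wchains[OF G uv(2)] mor_wchains[OF F uv(3)]])
    ultimately show ?thesis
      using rl_cat_right[OF mor_right[OF F \<open>b\<close> K uv(3), of r] mor_wchains[OF G uv(2)]] uv P[OF uv(2)]
      by (simp only: cat_diff_right)
  qed
  show ?thesis
    unfolding mor_def using mor_ne[OF G] mor_adm[OF G] mor_adm[OF F] W R L Rr by auto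
qed

lemma mor_comp:
  assumes G: "mor a b K Ls Hs G" and F: "mor a b K Hs Ps F"
  shows "mor a b K Ls Ps (\<lambda>w. frag_extend F (G w))"
proof -
  have "frag_extend F (G (wact \<beta> Ls 0 r w)) - sact \<beta> Ps 0 r (frag_extend F (G w)) \<in> rl K Ps"
    if "a" "(\<rho>, \<beta>) \<in> K" "w \<in> words Ls" for \<rho> \<beta> r w
    using rl_trans[OF mor_eqv[OF F mor_left[OF G that]] mor_left_chain[OF F that(1,2) mor_wchains[OF G that(3)]]] .
  moreover have "frag_extend F (G (wact \<rho> Ls (length Ls - 1) r w)) - sact \<rho> Ps (length Ps - 1) r (frag_extend F (G w)) \<in> rl K Ps"
    if "b" "(\<rho>, \<beta>) \<in> K" "w \<in> words Ls" for \<rho> \<beta> r w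
    using rl_trans[OF mor_eqv[OF F mor_right[OF G that]] mor_right_chain[OF F that(1,2) mor_wchains[OF G that(3)]]] .
  moreover have "frag_extend (\<lambda>w. frag_extend F (G w)) z \<in> rl K Ps" if "z \<in> mrel Ls \<union> bal K Ls" for z
    using mor_rl[OF F mor_rels[OF G that]] by (simp add: frag_extend_extend)
  moreover have "frag_extend F (G w) \<in> wchains Ps" if "w \<in> words Ls" for w
    using mor_extend_wchains[OF F mor_wchains[OF G that]] .
  ultimately show ?thesis
    unfolding mor_def using mor_ne(1)[OF G] mor_ne(2)[OF F] mor_adm(1)[OF G] mor_adm(2)[OF F] by auto
qed

lemma mor_cong:
  assumes G: "mor a b K Ls Hs G" and eq: "\<And>w. w \<in> words Ls \<Longrightarrow> G w = F w"
  shows "mor a b K Ls Hs F"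
proof -
  have "frag_extend F z = frag_extend G z" if "z \<in> mrel Ls \<union> bal K Ls" for z
    using that rels_wchains[OF mor_adm(1)[OF G]] eq by (intro frag_extend_cong) auto
  moreover have "wact \<beta> Ls 0 r w \<in> words Ls" "wact \<rho> Ls (length Ls - 1) r w \<in> words Ls"
    if "(\<rho>, \<beta>) \<in> K" "w \<in> words Ls" for \<rho> \<beta> r w
    using adm_wact[OF mor_adm(1)[OF G] that(2) _ that(1)] mor_ne(1)[OF G] by auto
  ultimately show ?thesis
    using G eq unfolding mor_def by (simp add: case_prod_unfold) (metis prod.collapse)
qed

lemma mor_weaken: "mor a b K Ls Hs G \<Longrightarrow> (a' \<Longrightarrow> a) \<Longrightarrow> (b' \<Longrightarrow> b) \<Longrightarrow> mor a' b' K Ls Hs G"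
  unfolding mor_def by auto

lemma mor_id: "Ls \<noteq> [] \<Longrightarrow> \<forall>M\<in>set Ls. adm K M \<Longrightarrow> mor a b K Ls Ls frag_of"
  unfolding mor_def rl_def by (auto simp: span_0 intro: span_base)

text \<open>A balancing relator involves two adjacent letters, so for one letter only additivity
  remains.\<close>

lemma rels_single: "mrel [X] \<union> bal K [X] = {frag_of [x \<oplus>\<^bsub>X\<^esub> y] - frag_of [x] - frag_of [y] | x y. x \<in> carrier X \<and> y \<in> carrier X}"
  by (auto simp: mrel_def bal_def append_eq_Cons_conv Cons_eq_append_conv) 

lemma rl_single_add: "x \<in> carrier X \<Longrightarrow> y \<in> carrier X \<Longrightarrow> frag_of [x \<oplus>\<^bsub>X\<^esub> y] - frag_of [x] - frag_of [y] \<in> rl K [X]"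
  unfolding rl_def rels_single by (rule span_base) auto

lemma mor_single:
  assumes "adm K X" "\<forall>M\<in>set Hs. adm K M" "Hs \<noteq> []"
    and "\<And>x. x \<in> carrier X \<Longrightarrow> f x \<in> wchains Hs"
    and "\<And>x y. x \<in> carrier X \<Longrightarrow> y \<in> carrier X \<Longrightarrow> f (x \<oplus>\<^bsub>X\<^esub> y) - f x - f y \<in> rl K Hs"
    and "\<And>\<rho> \<beta> r x. a \<Longrightarrow> (\<rho>, \<beta>) \<in> K \<Longrightarrow> x \<in> carrier X \<Longrightarrow> f (\<beta> X r x) - sact \<beta> Hs 0 r (f x) \<in> rl K Hs"
    and "\<And>\<rho> \<beta> r x. b \<Longrightarrow> (\<rho>, \<beta>) \<in> K \<Longrightarrow> x \<in> carrier X \<Longrightarrow> f (\<rho> X r x) - sact \<rho> Hs (length Hs - 1) r (f x) \<in> rl K Hs"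
  shows "mor a b K [X] Hs (\<lambda>w. f (hd w))"
  using assms unfolding mor_def rels_single
  by (auto simp: frag_extend_diff words_Cons)

text \<open>The one-letter counterpart of \<open>mor\<close>, with the same flags but with equations
  that hold exactly.\<close>

definition slotmap :: "bool \<Rightarrow> bool \<Rightarrow> ('r, 'u) balancing \<Rightarrow> ('r, 'u) bimod \<Rightarrow> ('r, 'u) bimod \<Rightarrow> ('u \<Rightarrow> 'u) \<Rightarrow> bool" where
  "slotmap a b K M N h \<longleftrightarrow> h \<in> ahom M N \<and>
     (a \<longrightarrow> (\<forall>(\<rho>, \<beta>)\<in>K. \<forall>r. \<forall>x\<in>carrier M. h (\<beta> M r x) = \<beta> N r (h x))) \<and>
     (b \<longrightarrow> (\<forall>(\<rho>, \<beta>)\<in>K. \<forall>r. \<forall>x\<in>carrier M. h (\<rho> M r x) = \<rho> N r (h x)))"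

lemma slotmap_weaken: "slotmap a b K M N h \<Longrightarrow> (a' \<Longrightarrow> a) \<Longrightarrow> (b' \<Longrightarrow> b) \<Longrightarrow> slotmap a' b' K M N h"
  unfolding slotmap_def by auto

lemma slotmap_id: "slotmap a b K M M id"
  by (auto simp: slotmap_def ahom_def)

lemma slotmap_ahom: "slotmap a b K M N h \<Longrightarrow> h \<in> ahom M N"
  by (simp add: slotmap_def)

lemma mor_slot:
  assumes "adm K M" "adm K N" "slotmap a b K M N h"
  shows "mor a b K [M] [N] (\<lambda>w. frag_of [h (hd w)])"
proof (rule mor_single[where f = "\<lambda>x. frag_of [h x]"])
  have h: "h \<in> ahom M N" using assms(3) by (rule slotmap_ahom)
  show "frag_of [h x] \<in> wchains [N]" if "x \<in> carrier M" for x
    using ahom_closed[OF h that] by simp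
  show "frag_of [h (x \<oplus>\<^bsub>M\<^esub> y)] - frag_of [h x] - frag_of [h y] \<in> rl K [N]"
    if "x \<in> carrier M" "y \<in> carrier M" for x y
    using rl_single_add[OF ahom_closed[OF h that(1)] ahom_closed[OF h that(2)]] ahom_add[OF h that] by simp
  show "frag_of [h (\<beta> M r x)] - sact \<beta> [N] 0 r (frag_of [h x]) \<in> rl K [N]"
    if a "(\<rho>, \<beta>) \<in> K" "x \<in> carrier M" for \<rho> \<beta> r x
    using assms(3) that unfolding slotmap_def by fastforce
  show "frag_of [h (\<rho> M r x)] - sact \<rho> [N] (length [N] - 1) r (frag_of [h x]) \<in> rl K [N]"
    if b "(\<rho>, \<beta>) \<in> K" "x \<in> carrier M" for \<rho> \<beta> r x
    using assms(3) that unfolding slotmap_def by fastforce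
qed (use assms in auto)

abbreviation smap :: "('u \<Rightarrow> 'v) list \<Rightarrow> 'u list \<Rightarrow> 'v list" where
  "smap \<equiv> map2 (\<lambda>f y. f y)"

text \<open>A letter must respect the balancing action towards each of its neighbours. An interior
  letter has neighbours on both sides; at the two ends this is asked only if the flag
  \<open>a\<close> or \<open>b\<close> is set.\<close>

lemma mor_smap:
  assumes "length hs = length Ms" "length Ms = length Ns" "Ms \<noteq> []"
    and "\<forall>M\<in>set Ms. adm K M" "\<forall>M\<in>set Ns. adm K M"
    and "\<And>i. i < length Ms \<Longrightarrow> slotmap (0 < i \<or> a) (Suc i < length Ms \<or> b) K (Ms ! i) (Ns ! i) (hs ! i)"
  shows "mor a b K Ms Ns (\<lambda>w. frag_of (smap hs w))"
  using assms
proof (induction hs Ms Ns arbitrary: a rule: list_induct3)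
  case Nil
  then show ?case by simp
next
  case (Cons h hs M Ms N Ns)
  show ?case
  proof (cases "Ms = []")
    case True
    then have n: "hs = []" "Ns = []" using Cons.hyps by auto
    have "slotmap a b K M N h" using Cons.prems(4)[of 0] True by simp
    then have "mor a b K [M] [N] (\<lambda>w. frag_of [h (hd w)])" using Cons.prems by (intro mor_slot) auto
    then show ?thesis
      unfolding True n by (rule mor_cong) (auto simp: words_Cons)
  next
    case False
    have "slotmap a True K M N h" using Cons.prems(4)[of 0] False by simp
    then have 1: "mor a True K [M] [N] (\<lambda>w. frag_of [h (hd w)])" using Cons.prems by (intro mor_slot) auto
    \<comment> \<open>The first letter of the tail now has a left neighbour, so the induction
      hypothesis is taken with left flag \<open>True\<close>; this is why \<open>a\<close> is
      generalised.\<close>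
    have "slotmap (0 < i \<or> True) (Suc i < length Ms \<or> b) K (Ms ! i) (Ns ! i) (hs ! i)" if "i < length Ms" for i
      using Cons.prems(4)[of "Suc i"] that by simp
    then have 2: "mor True b K Ms Ns (\<lambda>w. frag_of (smap hs w))"
      using Cons.IH[of True] Cons.prems False by simp
    have "mor a b K (M # Ms) (N # Ns) (\<lambda>w. frag_of [h (hd (take 1 w))] \<odot> frag_of (smap hs (drop 1 w)))"
      using mor_tensor[OF 1 2] by simp
    then show ?thesis
      by (rule mor_cong) (auto simp: words_Cons)
  qed
qed

lemma smap_update:
  assumes "length w = n" "j < n"
  shows "smap ((replicate n id)[j := h]) w = w[j := h (w ! j)]"
  by (rule nth_equalityI) (use assms in \<open>auto simp: nth_list_update\<close>)

lemma mor_wact: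
  assumes "\<forall>M\<in>set Ms. adm K M" "j < length Ms"
    and "slotmap (0 < j \<or> a) (Suc j < length Ms \<or> b) K (Ms ! j) (Ms ! j) (\<alpha> (Ms ! j) r)"
  shows "mor a b K Ms Ms (\<lambda>w. frag_of (wact \<alpha> Ms j r w))"
proof -
  have "mor a b K Ms Ms (\<lambda>w. frag_of (smap ((replicate (length Ms) id)[j := \<alpha> (Ms ! j) r]) w))"
    by (rule mor_smap) (use assms in \<open>auto simp: nth_list_update slotmap_id\<close>)
  then show ?thesis
    by (rule mor_cong) (use assms in \<open>auto simp: smap_update words_length wact_def\<close>)
qed

text \<open>The free abelian group on the elements of \<open>Z\<close> modulo additivity is
  \<open>Z\<close> again: a formal sum of one-letter words collapses to the word of its
  value.\<close>

lemma one_slot: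
  assumes "abelian_group Z" "h \<in> words Ls \<rightarrow> carrier Z" "c \<in> wchains Ls"
  shows "frag_extend (\<lambda>w. frag_of [h w]) c - frag_of [ext Z h c] \<in> rl K [Z]"
proof -
  interpret Z: abelian_group Z by fact
  show ?thesis
    using assms(3)
  proof (induction rule: wchains_induct)
    case zero
    have "frag_of [\<zero>\<^bsub>Z\<^esub>] - frag_of [\<zero>\<^bsub>Z\<^esub>] - frag_of [\<zero>\<^bsub>Z\<^esub>] \<in> rl K [Z]"
      using rl_single_add[of "\<zero>\<^bsub>Z\<^esub>" Z "\<zero>\<^bsub>Z\<^esub>" K] by simp
    then show ?case by simp
  next
    case (word w)
    then show ?case using assms by (simp add: Z.ext_of Pi_iff)
  next
    case (diff a b)
    have k: "Poly_Mapping.keys a \<subseteq> words Ls" "Poly_Mapping.keys b \<subseteq> words Ls"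
      using diff by (auto simp: wchains_def)
    have e: "ext Z h a \<in> carrier Z" "ext Z h b \<in> carrier Z" "ext Z h (a - b) = ext Z h a \<ominus>\<^bsub>Z\<^esub> ext Z h b"
      using Z.ext_closed[OF _ assms(2)] Z.ext_diff[OF _ _ assms(2)] k by auto
    have "(ext Z h a \<ominus>\<^bsub>Z\<^esub> ext Z h b) \<oplus>\<^bsub>Z\<^esub> ext Z h b = ext Z h a"
      using e by (simp add: a_minus_def Z.a_assoc Z.l_neg)
    then have "frag_of [ext Z h a] - frag_of [ext Z h (a - b)] - frag_of [ext Z h b] \<in> rl K [Z]"
      using rl_single_add[of "ext Z h (a - b)" Z "ext Z h b" K] e by simp
    from rl_add[OF rl_diff[OF diff(3,4)] this] show ?case
      by (simp add: frag_extend_diff algebra_simps)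
  qed
qed


section \<open>Presentations of tensor products\<close>

text \<open>Everything follows from two facts about codes: the chosen member of a coset differs from
  any given member by a relation, and two chains that differ by a relation get the same
  code.\<close>

lemma tensor_pres:
  assumes X: "multilinear Gs \<union> B \<subseteq> wchains Gs"
  shows "pres (tensor Gs B l lb rt rb') Gs (rel Gs B) (tclass Gs B) chain_of"
proof -
  let ?R = "rel Gs B" and ?F = "free_Abelian_group (words Gs)" and ?T = "tensor Gs B l lb rt rb'"
  have R: "?R = span (multilinear Gs \<union> B)"
    using X unfolding rel_def by (intro generate_eq_span) (auto simp: wchains_def)
  have coset: "?R #>\<^bsub>?F\<^esub> c = {h + c |h. h \<in> ?R}" for c
    by (auto simp: r_coset_def)
  have z: "0 \<in> ?R" by (simp add: R span_0)
  have rep: "chain_of (tclass Gs B c) - c \<in> ?R" for c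
  proof -
    have "0 + c \<in> ?R #>\<^bsub>?F\<^esub> c" using z unfolding coset by blast
    then have "chain_of (tclass Gs B c) \<in> ?R #>\<^bsub>?F\<^esub> c"
      unfolding tclass_def by (intro chain_of_enc) auto
    then show ?thesis by (auto simp: coset)
  qed
  \<comment> \<open>Equality of codes is reduced to equality of cosets as sets, since the choice
    made by \<open>enc\<close> depends on the set alone.\<close>
  have eq: "tclass Gs B c = tclass Gs B d" if "c - d \<in> ?R" for c d
  proof -
    have "{h + c |h. h \<in> ?R} = {h + d |h. h \<in> ?R}"
    proof (intro equalityI subsetI)
      fix x assume "x \<in> {h + c |h. h \<in> ?R}"
      then obtain h where "x = h + c" "h \<in> ?R" by blast
      then show "x \<in> {h + d |h. h \<in> ?R}"
        using that span_add unfolding R by (intro CollectI exI[of _ "h + (c - d)"]) auto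
    next
      fix x assume "x \<in> {h + d |h. h \<in> ?R}"
      then obtain h where "x = h + d" "h \<in> ?R" by blast
      then show "x \<in> {h + c |h. h \<in> ?R}"
        using that span_diff unfolding R by (intro CollectI exI[of _ "h - (c - d)"]) auto
    qed
    then show ?thesis by (simp add: tclass_def coset)
  qed
  have eq_iff: "tclass Gs B c = tclass Gs B d \<longleftrightarrow> c - d \<in> ?R" for c d
  proof
    assume "tclass Gs B c = tclass Gs B d"
    then have "chain_of (tclass Gs B c) - d \<in> ?R" using rep[of d] by simp
    then have "(chain_of (tclass Gs B c) - d) - (chain_of (tclass Gs B c) - c) \<in> ?R"
      using rep[of c] unfolding R by (rule span_diff)
    then show "c - d \<in> ?R" by (simp add: algebra_simps)
  qed (rule eq)
  have carr: "carrier ?T = tclass Gs B ` wchains Gs"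
  proof -
    have "carrier (?F Mod ?R) = (\<lambda>c. ?R #>\<^bsub>?F\<^esub> c) ` wchains Gs"
      by (simp add: FactGroup_def RCOSETS_def wchains_def free_Abelian_group_def image_def) blast
    then show ?thesis by (simp add: tensor_def image_image tclass_def)
  qed
  have Rw: "?R \<subseteq> wchains Gs" unfolding R by (rule span_wchains[OF X])
  have repw: "chain_of (tclass Gs B c) \<in> wchains Gs" if "c \<in> wchains Gs" for c
  proof -
    have "(chain_of (tclass Gs B c) - c) + c \<in> wchains Gs" using rep[of c] that Rw by (intro wchains_add) auto
    then show ?thesis by simp
  qed
  have add: "tclass Gs B c \<oplus>\<^bsub>?T\<^esub> tclass Gs B d = tclass Gs B (c + d)" for c d
  proof -
    have "(chain_of (tclass Gs B c) - c) + (chain_of (tclass Gs B d) - d) \<in> ?R"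
      using rep unfolding R by (intro span_add)
    then show ?thesis by (simp add: tensor_def eq_iff algebra_simps)
  qed
  have zero: "\<zero>\<^bsub>?T\<^esub> = tclass Gs B 0" by (simp add: tensor_def)
  have "abelian_group ?T"
  proof (rule abelian_groupI)
    fix x y assume "x \<in> carrier ?T" "y \<in> carrier ?T"
    then show "x \<oplus>\<^bsub>?T\<^esub> y \<in> carrier ?T" "x \<oplus>\<^bsub>?T\<^esub> y = y \<oplus>\<^bsub>?T\<^esub> x"
      by (auto simp: carr add add.commute)
  next
    fix x assume "x \<in> carrier ?T"
    then obtain c where c: "x = tclass Gs B c" "c \<in> wchains Gs" by (auto simp: carr)
    then show "\<exists>y\<in>carrier ?T. y \<oplus>\<^bsub>?T\<^esub> x = \<zero>\<^bsub>?T\<^esub>"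
      by (intro bexI[of _ "tclass Gs B (- c)"]) (auto simp: add zero carr)
  qed (auto simp: carr add zero add.assoc)
  then show ?thesis
    by (intro pres.intro pres_axioms.intro) (auto simp: carr add zero eq_iff repw intro!: eq rep)
qed

text \<open>A one-fold tensor product is the factor itself, so its representatives are one-letter words.\<close>

definition cls :: "('r, 'a) chain set \<Rightarrow> ('r, 'a) ubimod list \<Rightarrow> ('r, 'a) chain \<Rightarrow> ('r, 'a) univ" where
  "cls B Ms c = (if length Ms = 1 then ext (hd Ms) hd c else tclass Ms B c)"

definition repw :: "('r, 'a) ubimod list \<Rightarrow> ('r, 'a) univ \<Rightarrow> ('r, 'a) chain" where
  "repw Ms x = (if length Ms = 1 then frag_of [x] else chain_of x)"

text \<open>A module is presented by all its elements modulo additivity. A chain is congruent to the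
  one-letter word of its value, and the word of zero is a relation; hence the kernel of evaluation
  is the relation group.\<close>

lemma single_pres:
  assumes "adm K M"
  shows "pres M [M] (rl K [M]) (ext M hd) (\<lambda>x. frag_of [x])"
proof -
  interpret M: abelian_group M using assms by (rule adm_group)
  have hd: "hd \<in> words [M] \<rightarrow> carrier M" by (auto simp: words_Cons)
  have k: "Poly_Mapping.keys c \<subseteq> words [M]" if "c \<in> wchains [M]" for c using that by (simp add: wchains_def)
  have "c - frag_of [ext M hd c] \<in> rl K [M]" if "c \<in> wchains [M]" for c
  proof -
    have "frag_extend (\<lambda>w. frag_of [hd w]) c = frag_extend frag_of c"
      using that by (rule frag_extend_cong) (auto simp: words_Cons)
    then show ?thesis using one_slot[OF M.abelian_group_axioms hd that] by simp
  qed
  note 0 = this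
  \<comment> \<open>Minus this word is the additivity relator for zero plus zero.\<close>
  have "frag_of [\<zero>\<^bsub>M\<^esub>] \<in> rl K [M]"
    using rl_uminus[OF rl_single_add[of "\<zero>\<^bsub>M\<^esub>" M "\<zero>\<^bsub>M\<^esub>" K]] by simp
  note 0 = 0 this
  have 1: "c \<in> rl K [M]" if "c \<in> wchains [M]" "ext M hd c = \<zero>\<^bsub>M\<^esub>" for c
  proof -
    have "c - frag_of [\<zero>\<^bsub>M\<^esub>] + frag_of [\<zero>\<^bsub>M\<^esub>] \<in> rl K [M]"
      using 0(1)[OF that(1)] 0(2) that(2) by (intro rl_add) simp_all
    then show ?thesis by simp
  qed
  have 2: "c \<in> wchains [M] \<and> ext M hd c = \<zero>\<^bsub>M\<^esub>" if "c \<in> rl K [M]" for c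
    using that unfolding rl_def
  proof (induction rule: span.induct)
    case (span_plus z c)
    then obtain x y where z: "z = frag_of [x \<oplus>\<^bsub>M\<^esub> y] - frag_of [x] - frag_of [y]" "x \<in> carrier M" "y \<in> carrier M"
      unfolding rels_single by blast
    then have w: "z \<in> wchains [M]" by (auto intro!: wchains_diff)
    have "ext M hd z = \<zero>\<^bsub>M\<^esub>"
      unfolding z diff_diff_eq using z
      by (simp add: M.ext_diff[OF k k hd] M.ext_add[OF k k hd] wchains_add M.ext_of a_minus_def M.r_neg)
    then show ?case using span_plus w M.ext_add[OF k k hd] by auto
  next
    case (span_minus z c)
    then obtain x y where z: "z = frag_of [x \<oplus>\<^bsub>M\<^esub> y] - frag_of [x] - frag_of [y]" "x \<in> carrier M" "y \<in> carrier M"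
      unfolding rels_single by blast
    then have w: "z \<in> wchains [M]" by (auto intro!: wchains_diff)
    have "ext M hd z = \<zero>\<^bsub>M\<^esub>"
      unfolding z diff_diff_eq using z
      by (simp add: M.ext_diff[OF k k hd] M.ext_add[OF k k hd] wchains_add M.ext_of a_minus_def M.r_neg)
    then show ?case using span_minus w M.ext_diff[OF k k hd] by (auto simp: a_minus_def)
  qed simp
  show ?thesis
    by (intro pres.intro pres_axioms.intro)
      (use 1 2 k hd M.ext_closed[OF _ hd] M.ext_add[OF _ _ hd] in \<open>auto simp: M.abelian_group_axioms\<close>)
qed

lemma tensor_or_single_pres:
  assumes "\<forall>M\<in>set Ms. adm K M" "length Ms = 1 \<Longrightarrow> T = hd Ms"
    and "length Ms \<noteq> 1 \<Longrightarrow> T = tensor Ms (bal K Ms) l lb rt rb'"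
  shows "pres T Ms (rl K Ms) (cls (bal K Ms) Ms) (repw Ms)"
proof (cases "length Ms = 1")
  case True
  then obtain M where M: "Ms = [M]" by (auto simp: length_Suc_conv)
  then have "cls (bal K Ms) Ms = ext M hd" "repw Ms = (\<lambda>x. frag_of [x])" by (auto simp: cls_def repw_def)
  then show ?thesis using single_pres[of K M] assms M by simp
next
  case False
  then have "cls (bal K Ms) Ms = tclass Ms (bal K Ms)" "repw Ms = chain_of" by (auto simp: cls_def repw_def)
  moreover have "multilinear Ms \<union> bal K Ms \<subseteq> wchains Ms"
    unfolding multilinear_eq_mrel by (rule rels_wchains[OF assms(1)])
  ultimately show ?thesis
    using tensor_pres[of Ms "bal K Ms" l lb rt rb'] assms False by (simp add: rel_eq_rl)
qed

lemma cls_of: "length Ms = 1 \<Longrightarrow> abelian_group (hd Ms) \<Longrightarrow> w \<in> words Ms \<Longrightarrow> cls B Ms (frag_of w) = hd w"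
  by (cases Ms) (auto simp: cls_def words_Cons abelian_group.ext_of)

section \<open>Actions on one factor and their transfer to tensor products\<close>

definition slaw :: "('r::{ring, monoid_mult}, 'u) action \<Rightarrow> ('r, 'u) bimod \<Rightarrow> bool" where
  "slaw \<alpha> M \<longleftrightarrow> (\<forall>r. \<alpha> M r \<in> ahom M M) \<and>
     (\<forall>r s. \<forall>x\<in>carrier M. \<alpha> M (r + s) x = \<alpha> M r x \<oplus>\<^bsub>M\<^esub> \<alpha> M s x) \<and> (\<forall>x\<in>carrier M. \<alpha> M 1 x = x)"

definition smul :: "('r::{ring, monoid_mult}, 'u) action \<Rightarrow> ('r, 'u) bimod \<Rightarrow> bool" where
  "smul \<alpha> M \<longleftrightarrow> (\<forall>r s. \<forall>x\<in>carrier M. \<alpha> M (r * s) x = \<alpha> M r (\<alpha> M s x))"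

text \<open>With the scalar written first, \<open>lact\<close> and \<open>rb\<close> are
  multiplicative, while \<open>lbact\<close> and \<open>ra\<close> reverse products:
  \<open>lbact\<close> is a left action of the opposite ring, and \<open>ra\<close> is a right
  action of \<open>R\<close>.\<close>

definition sopp :: "('r::{ring, monoid_mult}, 'u) action \<Rightarrow> ('r, 'u) bimod \<Rightarrow> bool" where
  "sopp \<alpha> M \<longleftrightarrow> (\<forall>r s. \<forall>x\<in>carrier M. \<alpha> M (s * r) x = \<alpha> M r (\<alpha> M s x))"

definition scomm :: "('r, 'u) action \<Rightarrow> ('r, 'u) action \<Rightarrow> ('r, 'u) bimod \<Rightarrow> bool" where
  "scomm \<alpha> \<beta> M \<longleftrightarrow> (\<forall>r s. \<forall>x\<in>carrier M. \<alpha> M r (\<beta> M s x) = \<beta> M s (\<alpha> M r x))"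

lemma rl_wact_add:
  assumes "w \<in> words Ms" "p < length Ms" "slaw \<alpha> (Ms ! p)"
  shows "frag_of (wact \<alpha> Ms p (r + s) w) - frag_of (wact \<alpha> Ms p r w) - frag_of (wact \<alpha> Ms p s w) \<in> rl K Ms"
proof -
  have x: "w ! p \<in> carrier (Ms ! p)" using assms by (simp add: words_nth)
  have "\<alpha> (Ms ! p) r \<in> ahom (Ms ! p) (Ms ! p)" for r using assms(3) by (simp add: slaw_def)
  then have y: "\<alpha> (Ms ! p) r (w ! p) \<in> carrier (Ms ! p)" for r using x by (metis ahom_closed)
  \<comment> \<open>The multilinearity relator is based at the word already acted on by
    \<open>r\<close>: adding the \<open>s\<close>-translate to its letter gives the translate by
    \<open>r + s\<close>.\<close>
  let ?w = "w[p := \<alpha> (Ms ! p) r (w ! p)]"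
  have l: "length w = length Ms" using assms(1) by (rule words_length)
  have "frag_of (?w[p := ?w ! p \<oplus>\<^bsub>Ms ! p\<^esub> \<alpha> (Ms ! p) s (w ! p)]) - frag_of ?w - frag_of (?w[p := \<alpha> (Ms ! p) s (w ! p)]) \<in> multilinear Ms"
    unfolding multilinear_def using words_update[OF assms(1) y] assms(2) y by blast
  then show ?thesis
    using x assms l unfolding multilinear_eq_mrel rl_def wact_def slaw_def by (intro span_base) simp
qed

lemma sact_commute:
  assumes c: "c \<in> wchains Ms" and p: "p' < length Ms" and "p \<noteq> p' \<or> scomm \<alpha> \<alpha>' (Ms ! p)"
  shows "sact \<alpha> Ms p r (sact \<alpha>' Ms p' s c) = sact \<alpha>' Ms p' s (sact \<alpha> Ms p r c)"
  unfolding sact_def frag_extend_extend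
proof (rule frag_extend_cong[OF c])
  fix w assume w: "w \<in> words Ms"
  have "wact \<alpha> Ms p r (wact \<alpha>' Ms p' s w) = wact \<alpha>' Ms p' s (wact \<alpha> Ms p r w)"
  proof (cases "p = p'")
    case True
    then show ?thesis
      using assms(3) w p by (simp add: wact_def scomm_def words_nth words_length)
  next
    case False
    then show ?thesis by (simp add: wact_def list_update_swap)
  qed
  then show "frag_extend (\<lambda>w. frag_of (wact \<alpha> Ms p r w)) (frag_of (wact \<alpha>' Ms p' s w)) =
      frag_extend (\<lambda>w. frag_of (wact \<alpha>' Ms p' s w)) (frag_of (wact \<alpha> Ms p r w))" by simp
qed

text \<open>The operations of both tensor products have this shape. Over \<open>R\<close> the
  unbarred actions work in the first slot and the barred ones in the last; over \<open>R^e\<close>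
  the left actions work in the first slot and the right actions in the last.\<close>

locale slot_action = pres T Ms "rl K Ms" cl rep
  for T :: "('r::{ring, monoid_mult}, 'u) bimod" and Ms :: "('r, 'u) bimod list" and K cl rep +
  fixes act :: "'r \<Rightarrow> 'u \<Rightarrow> 'u" and \<alpha> :: "('r, 'u) action" and p :: nat
  assumes pos: "p < length Ms" and law: "slaw \<alpha> (Ms ! p)"
    and act_cl: "c \<in> wchains Ms \<Longrightarrow> act r (cl c) = cl (sact \<alpha> Ms p r c)"
begin

lemma slot_funcset: "\<alpha> (Ms ! p) r \<in> carrier (Ms ! p) \<rightarrow> carrier (Ms ! p)"
  using law by (auto simp: slaw_def ahom_def)

lemma sact_closed: "c \<in> wchains Ms \<Longrightarrow> sact \<alpha> Ms p r c \<in> wchains Ms"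
  using sact_wchains[of c Ms p \<alpha> r] pos slot_funcset by auto

lemma act_closed: "x \<in> carrier T \<Longrightarrow> act r x \<in> carrier T"
  using act_cl[of "rep x" r] by (simp add: rep_closed cl_rep cl_closed sact_closed)

lemma act_plus: "x \<in> carrier T \<Longrightarrow> y \<in> carrier T \<Longrightarrow> act r (x \<oplus>\<^bsub>T\<^esub> y) = act r x \<oplus>\<^bsub>T\<^esub> act r y"
  using act_cl[of "rep x + rep y" r] act_cl[of "rep x" r] act_cl[of "rep y" r]
  by (simp add: rep_closed cl_rep wchains_add cl_add sact_add sact_closed)

lemma act_scal: assumes "x \<in> carrier T" shows "act (r + s) x = act r x \<oplus>\<^bsub>T\<^esub> act s x"
proof -
  let ?c = "rep x"
  have c: "?c \<in> wchains Ms" using assms by (rule rep_closed)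
  have "frag_extend (\<lambda>w. frag_of (wact \<alpha> Ms p (r + s) w)) ?c
      - frag_extend (\<lambda>w. frag_of (wact \<alpha> Ms p r w) + frag_of (wact \<alpha> Ms p s w)) ?c \<in> rl K Ms"
    using rl_wact_add[OF _ pos law] by (intro rl_extend_fun[OF c]) (simp add: diff_diff_eq)
  then have "sact \<alpha> Ms p (r + s) ?c - (sact \<alpha> Ms p r ?c + sact \<alpha> Ms p s ?c) \<in> rl K Ms"
    by (simp add: sact_def frag_extend_plus_fun)
  then have "cl (sact \<alpha> Ms p (r + s) ?c) = cl (sact \<alpha> Ms p r ?c + sact \<alpha> Ms p s ?c)"
    using c by (subst cl_eq_iff) (auto intro: sact_closed)
  then show ?thesis
    using act_cl[OF c] assms c by (simp add: cl_rep cl_add sact_closed)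
qed

lemma sact_fun_cong:
  assumes "c \<in> wchains Ms" "\<And>w. w \<in> words Ms \<Longrightarrow> f w = frag_of w"
  shows "frag_extend f c = c"
  using frag_extend_cong[of c Ms f frag_of] assms by simp

lemma act_1: assumes "x \<in> carrier T" shows "act 1 x = x"
proof -
  have "wact \<alpha> Ms p 1 w = w" if "w \<in> words Ms" for w
    using law that pos by (simp add: wact_def slaw_def words_nth words_length)
  then have "sact \<alpha> Ms p 1 (rep x) = rep x"
    unfolding sact_def by (intro sact_fun_cong[OF rep_closed[OF assms]]) simp
  then show ?thesis
    using act_cl[OF rep_closed[OF assms], of 1] by (simp add: cl_rep assms)
qed

lemma act_rule:
  assumes "x \<in> carrier T" "\<And>y. y \<in> carrier (Ms ! p) \<Longrightarrow> \<alpha> (Ms ! p) t y = \<alpha> (Ms ! p) r (\<alpha> (Ms ! p) s y)"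
  shows "act t x = act r (act s x)"
proof -
  let ?c = "rep x"
  have c: "?c \<in> wchains Ms" using assms by (intro rep_closed)
  have "sact \<alpha> Ms p t ?c = sact \<alpha> Ms p r (sact \<alpha> Ms p s ?c)"
    unfolding sact_def frag_extend_extend
    using assms(2) pos by (intro frag_extend_cong[OF c]) (simp add: wact_def words_nth words_length)
  then show ?thesis
    using act_cl[OF c] act_cl[OF sact_closed[OF c]] assms(1) by (metis cl_rep)
qed

end

lemma slot_action_commute:
  assumes "slot_action T Ms K cl rep act \<alpha> p" "slot_action T Ms K cl rep act' \<alpha>' p'" "p \<noteq> p' \<or> scomm \<alpha> \<alpha>' (Ms ! p)"
    and x: "x \<in> carrier T"
  shows "act r (act' s x) = act' s (act r x)"
proof -
  interpret a: slot_action T Ms K cl rep act \<alpha> p by fact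
  interpret b: slot_action T Ms K cl rep act' \<alpha>' p' by fact
  let ?c = "rep x"
  have c: "?c \<in> wchains Ms" using x by (rule a.rep_closed)
  have "sact \<alpha> Ms p r (sact \<alpha>' Ms p' s ?c) = sact \<alpha>' Ms p' s (sact \<alpha> Ms p r ?c)"
    by (rule sact_commute[OF c b.pos assms(3)])
  then show ?thesis
    using a.act_cl[OF c] b.act_cl[OF c] a.act_cl[OF b.sact_closed[OF c]] b.act_cl[OF a.sact_closed[OF c]] x
    by (metis a.cl_rep)
qed

text \<open>Each axiom concerns one or two actions and is inherited from the slots in which they
  work. Actions in different slots commute already on words, so commutation in the factor is
  demanded only where slots coincide.\<close>

lemma pres_bimodule:
  assumes L: "slot_action T Ms K cl rep (lact T) lact p1" and B: "slot_action T Ms K cl rep (lbact T) lbact p2"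
    and R: "slot_action T Ms K cl rep (ra T) ra p3" and S: "slot_action T Ms K cl rep (rb T) rb p4"
    and mult: "smul lact (Ms ! p1)" "sopp lbact (Ms ! p2)" "sopp ra (Ms ! p3)" "smul rb (Ms ! p4)"
    and comm: "p1 \<noteq> p2 \<or> scomm lact lbact (Ms ! p1)" "p3 \<noteq> p4 \<or> scomm ra rb (Ms ! p3)"
      "p1 \<noteq> p3 \<or> scomm lact ra (Ms ! p1)" "p1 \<noteq> p4 \<or> scomm lact rb (Ms ! p1)"
      "p2 \<noteq> p3 \<or> scomm lbact ra (Ms ! p2)" "p2 \<noteq> p4 \<or> scomm lbact rb (Ms ! p2)"
  shows "bimodule T"
proof -
  interpret l: slot_action T Ms K cl rep "lact T" lact p1 by fact
  interpret b: slot_action T Ms K cl rep "lbact T" lbact p2 by fact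
  interpret r: slot_action T Ms K cl rep "ra T" ra p3 by fact
  interpret s: slot_action T Ms K cl rep "rb T" rb p4 by fact
  show ?thesis
  proof (unfold_locales, goal_cases)
    case 3 then show ?case using r.act_closed by (simp add: ra_def)
  next
    case 4 then show ?case using s.act_closed by (simp add: rb_def)
  next
    case 7 then show ?case using r.act_plus by (simp add: ra_def)
  next
    case 8 then show ?case using s.act_plus by (simp add: rb_def)
  next
    case 11 then show ?case using r.act_scal by (simp add: ra_def)
  next
    case 12 then show ?case using s.act_scal by (simp add: rb_def)
  next
    case 15 then show ?case using r.act_1 by (simp add: ra_def)
  next
    case 16 then show ?case using s.act_1 by (simp add: rb_def)
  next
    case 17 then show ?case using mult(1) by (intro l.act_rule) (auto simp: smul_def)
  next
    case 18 then show ?case using mult(2) by (intro b.act_rule) (auto simp: sopp_def)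
  next
    case (19 m r s)
    then have "ra T (r * s) m = ra T s (ra T r m)" using mult(3) by (intro r.act_rule) (auto simp: sopp_def)
    then show ?case by (simp add: ra_def)
  next
    case (20 m s r)
    then have "rb T (s * r) m = rb T s (rb T r m)" using mult(4) by (intro s.act_rule) (auto simp: smul_def)
    then show ?case by (simp add: rb_def)
  next
    case 21 then show ?case by (intro slot_action_commute[OF L B comm(1)])
  next
    case 22 then show ?case using slot_action_commute[OF R S comm(2)] by (simp add: ra_def rb_def)
  next
    case 23 then show ?case using slot_action_commute[OF L R comm(3)] by (simp add: ra_def)
  next
    case 24 then show ?case using slot_action_commute[OF L S comm(4)] by (simp add: rb_def)
  next
    case 25 then show ?case using slot_action_commute[OF B R comm(5)] by (simp add: ra_def)
  next
    case 26 then show ?case using slot_action_commute[OF B S comm(6)] by (simp add: rb_def)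
  qed (auto intro: l.act_closed b.act_closed l.act_plus b.act_plus l.act_scal b.act_scal l.act_1 b.act_1)
qed


section \<open>The two tensor products of bimodules\<close>

definition KR :: "('r, 'u) balancing" where "KR = {(lbact, lact)}"
definition KE :: "('r, 'u) balancing" where "KE = {(ra, lact), (rb, lbact)}"

lemma balR_eq: "balR Ms = bal KR Ms"
  unfolding balR_def bal_eq_nth KR_def wact_def by simp

lemma bal_mono:
  assumes "K \<subseteq> K'" shows "bal K Ms \<subseteq> bal K' Ms"
proof
  fix z assume "z \<in> bal K Ms"
  then obtain Ps X Y Qs u x y v \<rho> \<beta> r where z: "z = frag_of (u @ \<rho> X r x # y # v) - frag_of (u @ x # \<beta> Y r y # v)"
    and *: "Ms = Ps @ X # Y # Qs" "u \<in> words Ps" "x \<in> carrier X" "y \<in> carrier Y" "v \<in> words Qs" "(\<rho>, \<beta>) \<in> K"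
    by (rule balE)
  then show "z \<in> bal K' Ms" using balI[OF *(1-5), of \<rho> \<beta> K'] assms by auto
qed

lemma balE_eq: "balE Ms = bal KE Ms"
proof -
  have "bal KE Ms = bal {(ra, lact)} Ms \<union> bal {(rb, lbact)} Ms"
  proof (intro equalityI subsetI)
    fix z assume "z \<in> bal KE Ms"
    then obtain Ps X Y Qs u x y v \<rho> \<beta> r where "z = frag_of (u @ \<rho> X r x # y # v) - frag_of (u @ x # \<beta> Y r y # v)"
      and *: "Ms = Ps @ X # Y # Qs" "u \<in> words Ps" "x \<in> carrier X" "y \<in> carrier Y" "v \<in> words Qs" "(\<rho>, \<beta>) \<in> KE"
      by (rule balE)
    moreover have "(\<rho>, \<beta>) \<in> {(ra, lact)} \<or> (\<rho>, \<beta>) \<in> {(rb, lbact)}" using *(6) by (auto simp: KE_def)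
    ultimately show "z \<in> bal {(ra, lact)} Ms \<union> bal {(rb, lbact)} Ms"
      using balI[OF *(1-5)] by blast
  next
    fix z assume "z \<in> bal {(ra, lact)} Ms \<union> bal {(rb, lbact)} Ms"
    moreover have "bal {(ra, lact)} Ms \<subseteq> bal KE Ms" "bal {(rb, lbact)} Ms \<subseteq> bal KE Ms"
      by (rule bal_mono; simp add: KE_def)+
    ultimately show "z \<in> bal KE Ms" by blast
  qed
  then show ?thesis
    unfolding balE_def bal_eq_nth wact_def by (simp add: ra_def rb_def)
qed

lemma bimodule_slaw:
  assumes "bimodule M"
  shows "slaw lact M" "slaw lbact M" "slaw ra M" "slaw rb M"
  using bimodule.closed[OF assms] bimodule.act_add[OF assms] bimodule.add_act[OF assms] bimodule.act_one[OF assms]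
  by (auto simp: slaw_def ahom_def ra_def rb_def)

lemma bimodule_smul:
  assumes "bimodule M"
  shows "smul lact M" "sopp lbact M" "sopp ra M" "smul rb M"
  using bimodule.act_mult[OF assms] by (auto simp: smul_def sopp_def ra_def rb_def)

lemma bimodule_scomm:
  assumes "bimodule M"
  shows "scomm lact lbact M" "scomm ra rb M" "scomm lact ra M" "scomm lact rb M" "scomm lbact ra M" "scomm lbact rb M"
  using bimodule.act_commute[OF assms] by (auto simp: scomm_def ra_def rb_def)

lemma slaw_ahom: "slaw \<alpha> M \<Longrightarrow> \<alpha> M r \<in> ahom M M"
  by (simp add: slaw_def)

lemmas bimodule_ahom = bimodule_slaw[THEN slaw_ahom]

lemma bimodule_group: "bimodule M \<Longrightarrow> abelian_group M"
  by (simp add: bimodule_def)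

lemma bimodule_adm:
  assumes "bimodule M" shows "adm KR M" "adm KE M"
  using bimodule_ahom[OF assms] bimodule_group[OF assms] by (auto simp: adm_def KR_def KE_def)

text \<open>The right actions commute with both actions in \<open>KR\<close> and may be applied in
  any slot. \<open>lact\<close> is compatible only with a neighbour to its right and
  \<open>lbact\<close> only with one to its left, which confines them to the first and the last
  slot.\<close>

lemma slotmap_KR:
  assumes "bimodule M"
  shows "slotmap False True KR M M (lact M r)" "slotmap True False KR M M (lbact M r)"
    "slotmap True True KR M M (ra M r)" "slotmap True True KR M M (rb M r)"
  using bimodule_ahom[OF assms] bimodule_scomm[OF assms] by (auto simp: slotmap_def KR_def scomm_def)

lemma slotmap_KE:
  assumes "bimodule M"
  shows "slotmap False True KE M M (lact M r)" "slotmap False True KE M M (lbact M r)"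
    "slotmap True False KE M M (ra M r)" "slotmap True False KE M M (rb M r)"
  using bimodule_ahom[OF assms] bimodule_scomm[OF assms] by (auto simp: slotmap_def KE_def scomm_def)

definition bims :: "('r::{ring, monoid_mult}, 'u) bimod list \<Rightarrow> bool" where
  "bims Ms \<longleftrightarrow> (\<forall>M\<in>set Ms. bimodule M)"

lemma bims_adm: "bims Ms \<Longrightarrow> \<forall>M\<in>set Ms. adm KR M" "bims Ms \<Longrightarrow> \<forall>M\<in>set Ms. adm KE M"
  by (auto simp: bims_def bimodule_adm)

lemma bims_nth: "bims Ms \<Longrightarrow> j < length Ms \<Longrightarrow> bimodule (Ms ! j)"
  by (simp add: bims_def)

lemma bims_simps [simp]: "bims []" "bims (M # Ms) \<longleftrightarrow> bimodule M \<and> bims Ms" "bims (Ms @ Ns) \<longleftrightarrow> bims Ms \<and> bims Ns"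
  "bims (replicate n M) \<longleftrightarrow> n = 0 \<or> bimodule M"
  by (auto simp: bims_def)

text \<open>A slot operation preserves relations and so descends to classes. With one factor a class
  is the value of a formal sum, and additivity of the action plays the same part.\<close>

lemma cls_slot_action:
  fixes Ms :: "('r::{ring, monoid_mult}, 'a) ubimod list"
  assumes P: "pres T Ms (rl K Ms) (cls (bal K Ms) Ms) (repw Ms)" and adm: "\<forall>M\<in>set Ms. adm K M"
    and j: "j < length Ms" and law: "slaw \<alpha> (Ms ! j)"
    and slot: "\<And>r. slotmap (0 < j) (Suc j < length Ms) K (Ms ! j) (Ms ! j) (\<alpha> (Ms ! j) r)"
    and one: "\<And>r x. length Ms = 1 \<Longrightarrow> act r x = \<alpha> (hd Ms) r x"
    and more: "\<And>r x. length Ms \<noteq> 1 \<Longrightarrow> act r x = tclass Ms (bal K Ms) (frag_extend (\<lambda>w. frag_of (w[j := \<alpha> (Ms ! j) r (w ! j)])) (chain_of x))"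
  shows "slot_action T Ms K (cls (bal K Ms) Ms) (repw Ms) act \<alpha> j"
proof -
  interpret pres T Ms "rl K Ms" "cls (bal K Ms) Ms" "repw Ms" by fact
  show ?thesis
  proof (intro slot_action.intro slot_action_axioms.intro P j law)
    fix c r assume c: "c \<in> wchains Ms"
    have fs: "\<alpha> (Ms ! j) r \<in> carrier (Ms ! j) \<rightarrow> carrier (Ms ! j)" using law by (auto simp: slaw_def ahom_def)
    show "act r (cls (bal K Ms) Ms c) = cls (bal K Ms) Ms (sact \<alpha> Ms j r c)"
    proof (cases "length Ms = 1")
      case True
      then obtain M where M: "Ms = [M]" by (auto simp: length_Suc_conv)
      then have j0: "j = 0" using j by simp
      interpret M: abelian_group M using adm M by (auto dest: adm_group)
      have cM: "c \<in> wchains [M]" using c M by simp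
      have hc: "hd w \<in> carrier M" if "w \<in> Poly_Mapping.keys c" for w
      proof -
        have "w \<in> words [M]" using that cM unfolding wchains_def by blast
        then show ?thesis by (rule words_Cons_E) simp
      qed
      have cl: "cls (bal K Ms) Ms = ext M hd" using M by (auto simp: cls_def)
      have ah: "\<alpha> M r \<in> ahom M M" using law M j0 by (simp add: slaw_def)
      have "frag_extend (\<lambda>w. frag_of (wact \<alpha> [M] 0 r w)) c = frag_extend (\<lambda>w. frag_of [\<alpha> M r (hd w)]) c"
        by (rule frag_extend_cong[OF cM]) (auto simp: words_Cons)
      moreover have "\<alpha> M r (ext M hd c) = ext M (\<lambda>w. \<alpha> M r (hd w)) c"
        by (rule ahom_ext[OF M.abelian_group_axioms M.abelian_group_axioms ah _ order_refl]) (use hc in auto)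
      moreover have "ext M (\<lambda>w. \<alpha> M r (hd w)) c = ext M hd (frag_extend (\<lambda>w. frag_of [\<alpha> M r (hd w)]) c)"
      proof -
        interpret M1: pres M "[M]" "rl K [M]" "ext M hd" "\<lambda>x. frag_of [x]"
          by (rule single_pres) (use adm M in auto)
        have "ext M (\<lambda>w. ext M hd (frag_of [\<alpha> M r (hd w)])) c = ext M hd (frag_extend (\<lambda>w. frag_of [\<alpha> M r (hd w)]) c)"
          by (rule M1.cl_extend[OF _ cM]) (use ahom_closed[OF ah] in \<open>auto simp: words_Cons\<close>)
        moreover have "ext M (\<lambda>w. \<alpha> M r (hd w)) c = ext M (\<lambda>w. ext M hd (frag_of [\<alpha> M r (hd w)])) c"
          by (rule ext_cong) (use ahom_closed[OF ah] hc in \<open>auto simp: M.abelian_group_axioms\<close>)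
        ultimately show ?thesis by simp
      qed
      ultimately show ?thesis
        using one[of r] True M j0 unfolding cl sact_def by simp
    next
      case False
      have cl: "cls (bal K Ms) Ms = tclass Ms (bal K Ms)" "repw Ms = chain_of" using False by (auto simp: cls_def repw_def)
      have ne: "Ms \<noteq> []" using j by auto
      have m: "mor False False K Ms Ms (\<lambda>w. frag_of (wact \<alpha> Ms j r w))"
        by (rule mor_wact[OF adm j]) (use slot[of r] in simp)
      have "chain_of (tclass Ms (bal K Ms) c) - c \<in> rl K Ms" using rep_cl[OF c] by (simp add: cl)
      then have "sact \<alpha> Ms j r (chain_of (tclass Ms (bal K Ms) c)) - sact \<alpha> Ms j r c \<in> rl K Ms"
        unfolding sact_def by (rule mor_eqv[OF m])
      moreover have "sact \<alpha> Ms j r c \<in> wchains Ms" "sact \<alpha> Ms j r (chain_of (tclass Ms (bal K Ms) c)) \<in> wchains Ms"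
        using sact_wchains[of _ Ms j \<alpha> r, OF _ j fs] c rep_closed[OF cl_closed[OF c]] by (auto simp: cl)
      ultimately show ?thesis
        using more[OF False] cl_eq_iff unfolding cl by (simp add: sact_def wact_def)
    qed
  qed
qed

abbreviation clR :: "('r::{ring, monoid_mult}, 'a) ubimod list \<Rightarrow> ('r, 'a) chain \<Rightarrow> ('r, 'a) univ" where
  "clR Ms \<equiv> cls (bal KR Ms) Ms"
abbreviation clE :: "('r::{ring, monoid_mult}, 'a) ubimod list \<Rightarrow> ('r, 'a) chain \<Rightarrow> ('r, 'a) univ" where
  "clE Ms \<equiv> cls (bal KE Ms) Ms"

lemma tensorR_pres:
  assumes "bims Ms" "Ms \<noteq> []"
  shows "pres (tensorR Ms) Ms (rl KR Ms) (clR Ms) (repw Ms)"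
  by (rule tensor_or_single_pres[OF bims_adm(1)[OF assms(1)]])
    (auto simp: tensorR_def Let_def balR_eq)

lemma omega_pres:
  assumes "bims Ms" "Ms \<noteq> []"
  shows "pres (omega Ms) Ms (rl KE Ms) (clE Ms) (repw Ms)"
  by (rule tensor_or_single_pres[OF bims_adm(2)[OF assms(1)]])
    (use assms(2) in \<open>auto simp: omega_def Let_def balE_eq\<close>)

lemma tensorR_ops:
  assumes "bims Ms" "Ms \<noteq> []"
  shows "slot_action (tensorR Ms) Ms KR (clR Ms) (repw Ms) (lact (tensorR Ms)) lact 0"
    "slot_action (tensorR Ms) Ms KR (clR Ms) (repw Ms) (lbact (tensorR Ms)) lbact (length Ms - 1)"
    "slot_action (tensorR Ms) Ms KR (clR Ms) (repw Ms) (ra (tensorR Ms)) ra 0"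
    "slot_action (tensorR Ms) Ms KR (clR Ms) (repw Ms) (rb (tensorR Ms)) rb (length Ms - 1)"
proof -
  note P = tensorR_pres[OF assms] bims_adm(1)[OF assms(1)]
  have b: "bimodule (Ms ! 0)" "bimodule (Ms ! (length Ms - 1))" and l: "0 < length Ms" "length Ms - 1 < length Ms"
    using assms by (auto intro!: bims_nth)
  show "slot_action (tensorR Ms) Ms KR (clR Ms) (repw Ms) (lact (tensorR Ms)) lact 0"
    by (rule cls_slot_action[OF P l(1)])
      (use b in \<open>auto simp: tensorR_def tensor_def Let_def balR_eq intro: bimodule_slaw slotmap_weaken[OF slotmap_KR(1)]\<close>)
  show "slot_action (tensorR Ms) Ms KR (clR Ms) (repw Ms) (lbact (tensorR Ms)) lbact (length Ms - 1)"
    by (rule cls_slot_action[OF P l(2)])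
      (use b in \<open>auto simp: tensorR_def tensor_def Let_def balR_eq intro: bimodule_slaw slotmap_weaken[OF slotmap_KR(2)]\<close>)
  show "slot_action (tensorR Ms) Ms KR (clR Ms) (repw Ms) (ra (tensorR Ms)) ra 0"
    by (rule cls_slot_action[OF P l(1)])
      (use b in \<open>auto simp: tensorR_def tensor_def Let_def balR_eq ra_def intro: bimodule_slaw slotmap_weaken[OF slotmap_KR(3)]\<close>)
  show "slot_action (tensorR Ms) Ms KR (clR Ms) (repw Ms) (rb (tensorR Ms)) rb (length Ms - 1)"
    by (rule cls_slot_action[OF P l(2)])
      (use b in \<open>auto simp: tensorR_def tensor_def Let_def balR_eq rb_def intro: bimodule_slaw slotmap_weaken[OF slotmap_KR(4)]\<close>)
qed

lemma omega_ops:
  assumes "bims Ms" "Ms \<noteq> []"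
  shows "slot_action (omega Ms) Ms KE (clE Ms) (repw Ms) (lact (omega Ms)) lact 0"
    "slot_action (omega Ms) Ms KE (clE Ms) (repw Ms) (lbact (omega Ms)) lbact 0"
    "slot_action (omega Ms) Ms KE (clE Ms) (repw Ms) (ra (omega Ms)) ra (length Ms - 1)"
    "slot_action (omega Ms) Ms KE (clE Ms) (repw Ms) (rb (omega Ms)) rb (length Ms - 1)"
proof -
  note P = omega_pres[OF assms] bims_adm(2)[OF assms(1)]
  have b: "bimodule (Ms ! 0)" "bimodule (Ms ! (length Ms - 1))" and l: "0 < length Ms" "length Ms - 1 < length Ms"
    using assms by (auto intro!: bims_nth)
  show "slot_action (omega Ms) Ms KE (clE Ms) (repw Ms) (lact (omega Ms)) lact 0"
    by (rule cls_slot_action[OF P l(1)])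
      (use b assms(2) in \<open>auto simp: omega_def tensor_def Let_def balE_eq intro: bimodule_slaw slotmap_weaken[OF slotmap_KE(1)]\<close>)
  show "slot_action (omega Ms) Ms KE (clE Ms) (repw Ms) (lbact (omega Ms)) lbact 0"
    by (rule cls_slot_action[OF P l(1)])
      (use b assms(2) in \<open>auto simp: omega_def tensor_def Let_def balE_eq intro: bimodule_slaw slotmap_weaken[OF slotmap_KE(2)]\<close>)
  show "slot_action (omega Ms) Ms KE (clE Ms) (repw Ms) (ra (omega Ms)) ra (length Ms - 1)"
    by (rule cls_slot_action[OF P l(2)])
      (use b assms(2) in \<open>auto simp: omega_def tensor_def Let_def balE_eq ra_def intro: bimodule_slaw slotmap_weaken[OF slotmap_KE(3)]\<close>)
  show "slot_action (omega Ms) Ms KE (clE Ms) (repw Ms) (rb (omega Ms)) rb (length Ms - 1)"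
    by (rule cls_slot_action[OF P l(2)])
      (use b assms(2) in \<open>auto simp: omega_def tensor_def Let_def balE_eq rb_def intro: bimodule_slaw slotmap_weaken[OF slotmap_KE(4)]\<close>)
qed

lemma tensorR_bimodule:
  assumes "bims Ms" "Ms \<noteq> []" shows "bimodule (tensorR Ms)"
proof -
  have b: "bimodule (Ms ! 0)" "bimodule (Ms ! (length Ms - 1))"
    using assms by (auto intro!: bims_nth)
  show ?thesis
    by (rule pres_bimodule[OF tensorR_ops[OF assms]]) (use b in \<open>auto intro: bimodule_smul bimodule_scomm\<close>)
qed

lemma omega_bimodule_ne:
  assumes "bims Ms" "Ms \<noteq> []" shows "bimodule (omega Ms)"
proof -
  have b: "bimodule (Ms ! 0)" "bimodule (Ms ! (length Ms - 1))"
    using assms by (auto intro!: bims_nth)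
  show ?thesis
    by (rule pres_bimodule[OF omega_ops[OF assms]]) (use b in \<open>auto intro: bimodule_smul bimodule_scomm\<close>)
qed

lemma pureR_eq: "bims Ms \<Longrightarrow> Ms \<noteq> [] \<Longrightarrow> w \<in> words Ms \<Longrightarrow> pureR Ms w = clR Ms (frag_of w)"
  by (cases Ms) (auto simp: pureR_def balR_eq cls_def words_Cons bimodule_group abelian_group.ext_of)

lemma pureE_eq: "bims Ms \<Longrightarrow> Ms \<noteq> [] \<Longrightarrow> w \<in> words Ms \<Longrightarrow> pureE Ms w = clE Ms (frag_of w)"
  by (cases Ms) (auto simp: pureE_def balE_eq cls_def words_Cons bimodule_group abelian_group.ext_of)


section \<open>Takeuchi products\<close>

text \<open>A condition on whole chains and modulo relations: the individual words of such a chain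
  need not satisfy it.\<close>

definition takeuchi :: "('r::{ring, monoid_mult}, 'u) bimod list \<Rightarrow> ('u list \<Rightarrow>\<^sub>0 int) \<Rightarrow> bool" where
  "takeuchi Ms c \<longleftrightarrow> (\<forall>j s. Suc j < length Ms \<longrightarrow> sact rb Ms j s c - sact ra Ms (Suc j) s c \<in> rl KR Ms)"

lemma bims_funcset:
  assumes "bims Ms" "j < length Ms"
  shows "lact (Ms ! j) r \<in> carrier (Ms ! j) \<rightarrow> carrier (Ms ! j)" "lbact (Ms ! j) r \<in> carrier (Ms ! j) \<rightarrow> carrier (Ms ! j)"
    "ra (Ms ! j) r \<in> carrier (Ms ! j) \<rightarrow> carrier (Ms ! j)" "rb (Ms ! j) r \<in> carrier (Ms ! j) \<rightarrow> carrier (Ms ! j)"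
  using bimodule_ahom[OF bims_nth[OF assms], of r] by (auto simp: ahom_def)

lemma bims_sact:
  assumes "bims Ms" "j < length Ms" "c \<in> wchains Ms"
  shows "sact lact Ms j r c \<in> wchains Ms" "sact lbact Ms j r c \<in> wchains Ms"
    "sact ra Ms j r c \<in> wchains Ms" "sact rb Ms j r c \<in> wchains Ms"
  using sact_wchains[OF assms(3,2)] bims_funcset[OF assms(1,2)] by auto

lemma bims_wact:
  assumes "bims Ms" "j < length Ms" "w \<in> words Ms"
  shows "wact lact Ms j r w \<in> words Ms" "wact lbact Ms j r w \<in> words Ms"
    "wact ra Ms j r w \<in> words Ms" "wact rb Ms j r w \<in> words Ms"
  using wact_words[OF assms(3,2)] bims_funcset[OF assms(1,2)] by auto

lemma mor_wact_KR:
  assumes "bims Ms" "j < length Ms"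
  shows "j = 0 \<Longrightarrow> mor False True KR Ms Ms (\<lambda>w. frag_of (wact lact Ms j r w))"
    "Suc j = length Ms \<Longrightarrow> mor True False KR Ms Ms (\<lambda>w. frag_of (wact lbact Ms j r w))"
    "mor True True KR Ms Ms (\<lambda>w. frag_of (wact ra Ms j r w))"
    "mor True True KR Ms Ms (\<lambda>w. frag_of (wact rb Ms j r w))"
  by (rule mor_wact[OF bims_adm(1)[OF assms(1)] assms(2)],
      use slotmap_KR[OF bims_nth[OF assms], of r] in \<open>auto intro: slotmap_weaken\<close>)+

lemma sact_rl_KR:
  assumes "bims Ms" "j < length Ms" "c \<in> rl KR Ms"
  shows "j = 0 \<Longrightarrow> sact lact Ms j r c \<in> rl KR Ms" "Suc j = length Ms \<Longrightarrow> sact lbact Ms j r c \<in> rl KR Ms"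
    "sact ra Ms j r c \<in> rl KR Ms" "sact rb Ms j r c \<in> rl KR Ms"
  unfolding sact_def using mor_rl[OF _ assms(3)] mor_wact_KR[OF assms(1,2)] by blast+

lemma takeuchi_0: "takeuchi Ms 0"
  by (simp add: takeuchi_def)

lemma takeuchi_diff: "takeuchi Ms c \<Longrightarrow> takeuchi Ms d \<Longrightarrow> takeuchi Ms (c - d)"
  unfolding takeuchi_def using rl_diff by (fastforce simp: sact_diff algebra_simps)

lemma takeuchi_uminus: "takeuchi Ms c \<Longrightarrow> takeuchi Ms (- c)"
  using takeuchi_diff[OF takeuchi_0, of Ms c] by simp

lemma takeuchi_add: "takeuchi Ms c \<Longrightarrow> takeuchi Ms d \<Longrightarrow> takeuchi Ms (c + d)"
  using takeuchi_diff[OF _ takeuchi_uminus, of Ms c d] by simp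

text \<open>The right actions preserve relations in every slot, so both terms of the difference are
  relations. Consequently the condition depends only on the class of a chain.\<close>

lemma takeuchi_rl:
  assumes "bims Ms" "c \<in> rl KR Ms" shows "takeuchi Ms c"
  unfolding takeuchi_def using sact_rl_KR[OF assms(1) _ assms(2)] by (auto intro!: rl_diff)

lemma takeuchi_cong:
  assumes "bims Ms" "c - d \<in> rl KR Ms" shows "takeuchi Ms c \<longleftrightarrow> takeuchi Ms d"
  using takeuchi_rl[OF assms] takeuchi_diff[of Ms c "c - d"] takeuchi_add[of Ms "c - d" d] by auto

text \<open>The operation can be pulled out of both terms of the condition. In slot \<open>p\<close>
  the condition applies \<open>rb\<close> if a factor follows and \<open>ra\<close> if one precedes;
  in other slots operations commute for free.\<close>

lemma takeuchi_sact:
  assumes b: "bims Ms" and c: "c \<in> wchains Ms" "takeuchi Ms c" and p: "p < length Ms"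
    and m: "\<And>d. d \<in> rl KR Ms \<Longrightarrow> sact \<alpha> Ms p r d \<in> rl KR Ms"
    and comm: "Suc p < length Ms \<Longrightarrow> scomm rb \<alpha> (Ms ! p)" "0 < p \<Longrightarrow> scomm ra \<alpha> (Ms ! p)"
  shows "takeuchi Ms (sact \<alpha> Ms p r c)"
  unfolding takeuchi_def
proof (intro allI impI)
  fix j s assume j: "Suc j < length Ms"
  have "sact rb Ms j s (sact \<alpha> Ms p r c) = sact \<alpha> Ms p r (sact rb Ms j s c)"
    by (rule sact_commute[OF c(1) p]) (use j comm in auto)
  moreover have "sact ra Ms (Suc j) s (sact \<alpha> Ms p r c) = sact \<alpha> Ms p r (sact ra Ms (Suc j) s c)"
    by (rule sact_commute[OF c(1) p]) (use j comm in auto)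
  ultimately show "sact rb Ms j s (sact \<alpha> Ms p r c) - sact ra Ms (Suc j) s (sact \<alpha> Ms p r c) \<in> rl KR Ms"
    using m c(2) j unfolding takeuchi_def by (metis sact_diff)
qed

lemma scomm_sym: "scomm \<alpha> \<beta> M \<Longrightarrow> scomm \<beta> \<alpha> M"
  by (simp add: scomm_def)

lemma takeuchi_acts:
  assumes b: "bims Ms" "Ms \<noteq> []" and c: "c \<in> wchains Ms" "takeuchi Ms c"
  shows "takeuchi Ms (sact lact Ms 0 r c)" "takeuchi Ms (sact lbact Ms (length Ms - 1) r c)"
    "takeuchi Ms (sact ra Ms 0 r c)" "takeuchi Ms (sact rb Ms (length Ms - 1) r c)"
proof -
  have "bimodule (Ms ! 0)" "bimodule (Ms ! (length Ms - 1))" and l: "0 < length Ms" "length Ms - 1 < length Ms"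
    using b by (auto intro!: bims_nth)
  note s = this(1,2)[THEN bimodule_scomm(1)] this(1,2)[THEN bimodule_scomm(2)] this(1,2)[THEN bimodule_scomm(3)]
    this(1,2)[THEN bimodule_scomm(4)] this(1,2)[THEN bimodule_scomm(5)] this(1,2)[THEN bimodule_scomm(6)]
  note s = s s[THEN scomm_sym]
  show "takeuchi Ms (sact lact Ms 0 r c)"
    by (rule takeuchi_sact[OF b(1) c l(1)]) (use sact_rl_KR(1)[OF b(1) l(1)] s in auto)
  show "takeuchi Ms (sact lbact Ms (length Ms - 1) r c)"
    by (rule takeuchi_sact[OF b(1) c l(2)]) (use sact_rl_KR(2)[OF b(1) l(2)] s l in auto)
  show "takeuchi Ms (sact ra Ms 0 r c)"
    by (rule takeuchi_sact[OF b(1) c l(1)]) (use sact_rl_KR(3)[OF b(1) l(1)] s in auto)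
  show "takeuchi Ms (sact rb Ms (length Ms - 1) r c)"
    by (rule takeuchi_sact[OF b(1) c l(2)]) (use sact_rl_KR(4)[OF b(1) l(2)] s l in auto)
qed

lemma lam_eq:
  assumes "bims Ms" "Ms \<noteq> []"
  shows "lam Ms = (tensorR Ms)\<lparr>carrier := {x \<in> carrier (tensorR Ms). takeuchi Ms (repw Ms x)}\<rparr>"
proof -
  interpret P: pres "tensorR Ms" Ms "rl KR Ms" "clR Ms" "repw Ms" by (rule tensorR_pres[OF assms])
  have "(\<forall>j s. Suc j < length Ms \<longrightarrow>
       tclass Ms (balR Ms) (frag_extend (\<lambda>w. frag_of (w[j := rbact (Ms ! j) (w ! j) s])) (chain_of x)) =
       tclass Ms (balR Ms) (frag_extend (\<lambda>w. frag_of (w[Suc j := ract (Ms ! Suc j) (w ! Suc j) s])) (chain_of x)))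
     \<longleftrightarrow> takeuchi Ms (repw Ms x)" if "x \<in> carrier (tensorR Ms)" for x
  proof (cases "length Ms = 1")
    \<comment> \<open>With one factor no \<open>j\<close> is admissible, and both conditions hold
      vacuously.\<close>
    case True
    then show ?thesis by (simp add: takeuchi_def)
  next
    case False
    then have e: "clR Ms = tclass Ms (balR Ms)" "repw Ms x = chain_of x" by (auto simp: cls_def repw_def balR_eq)
    have s: "frag_extend (\<lambda>w. frag_of (w[j := rbact (Ms ! j) (w ! j) s])) c = sact rb Ms j s c"
      "frag_extend (\<lambda>w. frag_of (w[Suc j := ract (Ms ! Suc j) (w ! Suc j) s])) c = sact ra Ms (Suc j) s c" for j s c
      by (simp_all add: sact_def wact_def ra_def rb_def)
    have c: "chain_of x \<in> wchains Ms" using P.rep_closed[OF that] e by simp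
    show ?thesis
      unfolding s takeuchi_def e using P.cl_eq_iff[unfolded e] bims_sact[OF assms(1) _ c] by (metis Suc_lessD)
  qed
  then show ?thesis
    using assms(2) unfolding lam_def by (auto intro!: arg_cong[where f = "\<lambda>C. (tensorR Ms)\<lparr>carrier := C\<rparr>"])
qed

lemma sub_bimodule:
  assumes T: "bimodule T" and S: "S \<subseteq> carrier T" "\<zero>\<^bsub>T\<^esub> \<in> S" "\<And>x. x \<in> S \<Longrightarrow> \<ominus>\<^bsub>T\<^esub> x \<in> S"
    "\<And>x y. x \<in> S \<Longrightarrow> y \<in> S \<Longrightarrow> x \<oplus>\<^bsub>T\<^esub> y \<in> S"
    "\<And>x r. x \<in> S \<Longrightarrow> lact T r x \<in> S" "\<And>x r. x \<in> S \<Longrightarrow> lbact T r x \<in> S"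
    "\<And>x r. x \<in> S \<Longrightarrow> ract T x r \<in> S" "\<And>x r. x \<in> S \<Longrightarrow> rbact T x r \<in> S"
  shows "bimodule (T\<lparr>carrier := S\<rparr>)"
proof -
  interpret T: bimodule T by fact
  have c: "x \<in> carrier T" if "x \<in> S" for x using that S(1) by auto
  have "abelian_group (T\<lparr>carrier := S\<rparr>)"
  proof (rule abelian_groupI)
    fix x assume "x \<in> carrier (T\<lparr>carrier := S\<rparr>)"
    then show "\<exists>y\<in>carrier (T\<lparr>carrier := S\<rparr>). y \<oplus>\<^bsub>T\<lparr>carrier := S\<rparr>\<^esub> x = \<zero>\<^bsub>T\<lparr>carrier := S\<rparr>\<^esub>"
      using S(3) c by (intro bexI[of _ "\<ominus>\<^bsub>T\<^esub> x"]) (auto simp: T.l_neg)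
  qed (use S c in \<open>auto simp: T.a_ac\<close>)
  then show ?thesis
    by (intro bimodule.intro bimodule_axioms.intro)
      (simp_all add: S c T.closed T.act_add T.add_act T.act_one T.act_mult T.act_commute)
qed

lemma lam_carrier:
  assumes "bims Ms" "Ms \<noteq> []"
  shows "carrier (lam Ms) = {x \<in> carrier (tensorR Ms). takeuchi Ms (repw Ms x)}"
    and "c \<in> wchains Ms \<Longrightarrow> clR Ms c \<in> carrier (lam Ms) \<longleftrightarrow> takeuchi Ms c"
proof -
  interpret P: pres "tensorR Ms" Ms "rl KR Ms" "clR Ms" "repw Ms" by (rule tensorR_pres[OF assms])
  show *: "carrier (lam Ms) = {x \<in> carrier (tensorR Ms). takeuchi Ms (repw Ms x)}" by (simp add: lam_eq[OF assms])
  show "clR Ms c \<in> carrier (lam Ms) \<longleftrightarrow> takeuchi Ms c" if "c \<in> wchains Ms"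
    using that takeuchi_cong[OF assms(1) P.rep_cl[OF that]] unfolding * by (simp add: P.cl_closed)
qed

lemma lam_sel:
  assumes "bims Ms" "Ms \<noteq> []"
  shows "add (lam Ms) = add (tensorR Ms)" "zero (lam Ms) = zero (tensorR Ms)" "lact (lam Ms) = lact (tensorR Ms)"
    "lbact (lam Ms) = lbact (tensorR Ms)" "ract (lam Ms) = ract (tensorR Ms)" "rbact (lam Ms) = rbact (tensorR Ms)"
  by (simp_all add: lam_eq[OF assms])

lemma lam_rep:
  assumes "bims Ms" "Ms \<noteq> []" "x \<in> carrier (lam Ms)"
  shows "repw Ms x \<in> wchains Ms" "takeuchi Ms (repw Ms x)" "clR Ms (repw Ms x) = x" "x \<in> carrier (tensorR Ms)"
proof -
  interpret P: pres "tensorR Ms" Ms "rl KR Ms" "clR Ms" "repw Ms" by (rule tensorR_pres[OF assms(1,2)])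
  show "takeuchi Ms (repw Ms x)" and *: "x \<in> carrier (tensorR Ms)" using assms lam_carrier(1)[OF assms(1,2)] by auto
  show "repw Ms x \<in> wchains Ms" "clR Ms (repw Ms x) = x" using P.rep_closed[OF *] P.cl_rep[OF *] .
qed

lemma lam_act_cl:
  assumes "bims Ms" "Ms \<noteq> []" "c \<in> wchains Ms"
  shows "lact (lam Ms) r (clR Ms c) = clR Ms (sact lact Ms 0 r c)"
    "lbact (lam Ms) r (clR Ms c) = clR Ms (sact lbact Ms (length Ms - 1) r c)"
    "ract (lam Ms) (clR Ms c) r = clR Ms (sact ra Ms 0 r c)"
    "rbact (lam Ms) (clR Ms c) r = clR Ms (sact rb Ms (length Ms - 1) r c)"
  using slot_action.act_cl[OF tensorR_ops(1)[OF assms(1,2)] assms(3)] slot_action.act_cl[OF tensorR_ops(2)[OF assms(1,2)] assms(3)]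
    slot_action.act_cl[OF tensorR_ops(3)[OF assms(1,2)] assms(3)] slot_action.act_cl[OF tensorR_ops(4)[OF assms(1,2)] assms(3)]
  by (simp_all add: lam_sel[OF assms(1,2)] ra_def[of "tensorR Ms"] rb_def[of "tensorR Ms"])

lemma lam_bimodule_ne:
  assumes "bims Ms" "Ms \<noteq> []" shows "bimodule (lam Ms)"
proof -
  interpret P: pres "tensorR Ms" Ms "rl KR Ms" "clR Ms" "repw Ms" by (rule tensorR_pres[OF assms])
  let ?S = "{x \<in> carrier (tensorR Ms). takeuchi Ms (repw Ms x)}"
  have S: "x \<in> ?S \<longleftrightarrow> (\<exists>c\<in>wchains Ms. takeuchi Ms c \<and> x = clR Ms c)" for x
    using lam_carrier[OF assms] P.rep_closed P.cl_rep P.cl_closed by auto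
  note ops = tensorR_ops[OF assms]
  have l: "0 < length Ms" "length Ms - 1 < length Ms" using assms(2) by auto
  show ?thesis
    unfolding lam_eq[OF assms]
  proof (rule sub_bimodule[OF tensorR_bimodule[OF assms]])
    show "\<zero>\<^bsub>tensorR Ms\<^esub> \<in> ?S" unfolding S by (intro bexI[of _ 0]) (auto simp: P.cl_0 takeuchi_0)
  next
    fix x r assume "x \<in> ?S"
    then obtain c where c: "c \<in> wchains Ms" "takeuchi Ms c" "x = clR Ms c" unfolding S by blast
    show "\<ominus>\<^bsub>tensorR Ms\<^esub> x \<in> ?S" unfolding S using c by (intro bexI[of _ "- c"]) (auto simp: P.cl_minus takeuchi_uminus)
    show "lact (tensorR Ms) r x \<in> ?S" unfolding S using c slot_action.act_cl[OF ops(1) c(1)] takeuchi_acts(1)[OF assms c(1,2)]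
      bims_sact(1)[OF assms(1) l(1) c(1)] by blast
    show "lbact (tensorR Ms) r x \<in> ?S" unfolding S using c slot_action.act_cl[OF ops(2) c(1)] takeuchi_acts(2)[OF assms c(1,2)]
      bims_sact(2)[OF assms(1) l(2) c(1)] by blast
    show "ract (tensorR Ms) x r \<in> ?S" unfolding S ra_def[symmetric] using c slot_action.act_cl[OF ops(3) c(1)] takeuchi_acts(3)[OF assms c(1,2)]
      bims_sact(3)[OF assms(1) l(1) c(1)] by blast
    show "rbact (tensorR Ms) x r \<in> ?S" unfolding S rb_def[symmetric] using c slot_action.act_cl[OF ops(4) c(1)] takeuchi_acts(4)[OF assms c(1,2)]
      bims_sact(4)[OF assms(1) l(2) c(1)] by blast
  next
    fix x y assume "x \<in> ?S" "y \<in> ?S"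
    then obtain c d where "c \<in> wchains Ms" "takeuchi Ms c" "x = clR Ms c" "d \<in> wchains Ms" "takeuchi Ms d" "y = clR Ms d"
      unfolding S by blast
    then show "x \<oplus>\<^bsub>tensorR Ms\<^esub> y \<in> ?S"
      unfolding S by (intro bexI[of _ "c + d"]) (auto simp: P.cl_add takeuchi_add)
  qed auto
qed

lemma EndR_bimodule: "bimodule (EndR :: ('r::{ring, monoid_mult}, 'a) ubimod)"
proof -
  let ?E = "EndR :: ('r, 'a) ubimod"
  have "abelian_group ?E"
  proof (rule abelian_groupI)
    fix x assume "x \<in> carrier ?E"
    then obtain f where f: "x = Endo f" "\<forall>x y. f (x + y) = f x + f y" by (auto simp: EndR_def)
    then show "\<exists>y\<in>carrier ?E. y \<oplus>\<^bsub>?E\<^esub> x = \<zero>\<^bsub>?E\<^esub>"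
      by (intro bexI[of _ "Endo (\<lambda>m. - f m)"]) (auto simp: EndR_def)
  qed (auto simp: EndR_def algebra_simps)
  then show ?thesis
    by (intro bimodule.intro bimodule_axioms.intro) (auto simp: EndR_def algebra_simps)
qed

lemma lam_bimodule: "bims Ms \<Longrightarrow> bimodule (lam Ms)"
  by (cases "Ms = []") (auto simp: lam_bimodule_ne EndR_bimodule lam_def[of "[]"])


section \<open>The enveloping ring\<close>

text \<open>
  Giving the ring of scalars its regular actions makes \<open>R\<^sup>e\<close> an instance of the general
  construction, with an empty balancing.
\<close>

definition scalM :: "('r::{ring, monoid_mult}, 'a) ubimod" where
  "scalM = \<lparr>carrier = range Scal, monoid.mult = undefined, one = undefined, zero = Scal 0,
     add = (\<lambda>x y. Scal (the_scal x + the_scal y)),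
     lact = (\<lambda>r x. Scal (r * the_scal x)), lbact = (\<lambda>r x. Scal (the_scal x * r)),
     ract = (\<lambda>x s. Scal (the_scal x * s)), rbact = (\<lambda>x s. Scal (s * the_scal x))\<rparr>"

abbreviation SS :: "('r::{ring, monoid_mult}, 'a) ubimod list" where "SS \<equiv> [scalM, scalM]"

abbreviation clS :: "('r::{ring, monoid_mult}, 'a) chain \<Rightarrow> ('r, 'a) univ" where
  "clS \<equiv> tclass [ring_of_scalars, ring_of_scalars] {}"

lemma words_SS: "w \<in> words SS \<longleftrightarrow> (\<exists>a b. w = [Scal a, Scal b])"
  by (auto simp: words_Cons scalM_def)

lemma adm_scalM: "adm {} (scalM :: ('r::{ring, monoid_mult}, 'a) ubimod)"
proof -
  have "abelian_group (scalM :: ('r::{ring, monoid_mult}, 'a) ubimod)"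
  proof (rule abelian_groupI)
    fix x :: "('r, 'a) univ" assume "x \<in> carrier scalM"
    then obtain a where "x = Scal a" by (auto simp: scalM_def)
    then show "\<exists>y\<in>carrier scalM. y \<oplus>\<^bsub>scalM\<^esub> x = \<zero>\<^bsub>scalM\<^esub>"
      by (intro bexI[of _ "Scal (- a)"]) (auto simp: scalM_def)
  qed (auto simp: scalM_def algebra_simps)
  then show ?thesis by (simp add: adm_def)
qed

lemma slaw_scalM: "slaw lact scalM" "slaw lbact scalM" "slaw ra scalM" "slaw rb scalM"
  by (auto simp: slaw_def ahom_def scalM_def ra_def rb_def algebra_simps)

text \<open>\<open>ring_of_scalars\<close> and \<open>scalM\<close> share carrier and addition, and
  words and multilinearity relators see nothing else, so the two presentations coincide.\<close>

lemma Renv_pres: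
  "pres (Renv :: ('r::{ring, monoid_mult}, 'a) ubimod) SS (rl {} SS) clS chain_of"
proof -
  let ?G = "[ring_of_scalars, ring_of_scalars] :: ('r::{ring, monoid_mult}, 'a) univ ring list"
  let ?S = "SS :: ('r, 'a) ubimod list"
  have w: "words ?G = words ?S"
    by (auto simp: words_Cons scalM_def ring_of_scalars_def)
  then have c: "wchains ?G = wchains ?S" by (simp add: wchains_def)
  have "carrier (?G ! j) = carrier (?S ! j) \<and> add (?G ! j) = add (?S ! j)" if "j < 2" for j
    using that by (auto simp: less_2_cases_iff scalM_def ring_of_scalars_def)
  then have m: "multilinear ?G = multilinear ?S"
    unfolding multilinear_def w by (intro Collect_cong ex_cong1) (auto simp: numeral_2_eq_2)
  have s: "mrel ?S \<union> bal {} ?S \<subseteq> wchains ?S"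
    by (rule rels_wchains) (auto simp: adm_scalM)
  have b: "bal {} ?S = {}" by (auto simp: bal_def)
  have "rel ?G {} = rel ?S (bal {} ?S)" by (simp add: rel_def m w b)
  also have "\<dots> = rl {} ?S" by (rule rel_eq_rl) (auto simp: adm_scalM)
  finally have r: "rel ?G {} = rl {} ?S" .
  have "pres Renv ?G (rel ?G {}) clS chain_of"
    unfolding Renv_def by (rule tensor_pres) (use s in \<open>simp add: c m multilinear_eq_mrel[of ?S]\<close>)
  then show ?thesis by (simp add: pres_def pres_axioms_def c r)
qed

lemma slot_action_of_rep:
  assumes P: "pres T Ms (rl K Ms) cl rep" and adm: "\<forall>M\<in>set Ms. adm K M"
    and j: "j < length Ms" and law: "slaw \<alpha> (Ms ! j)"
    and slot: "\<And>r. slotmap (0 < j) (Suc j < length Ms) K (Ms ! j) (Ms ! j) (\<alpha> (Ms ! j) r)"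
    and act: "\<And>r x. x \<in> carrier T \<Longrightarrow> act r x = cl (sact \<alpha> Ms j r (rep x))"
  shows "slot_action T Ms K cl rep act \<alpha> j"
proof -
  interpret pres T Ms "rl K Ms" cl rep by fact
  show ?thesis
  proof (intro slot_action.intro slot_action_axioms.intro P j law)
    fix c r assume c: "c \<in> wchains Ms"
    have fs: "\<alpha> (Ms ! j) r \<in> carrier (Ms ! j) \<rightarrow> carrier (Ms ! j)" using law by (auto simp: slaw_def ahom_def)
    have m: "mor False False K Ms Ms (\<lambda>w. frag_of (wact \<alpha> Ms j r w))"
      by (rule mor_wact[OF adm j]) (use slot[of r] in simp)
    have "sact \<alpha> Ms j r (rep (cl c)) - sact \<alpha> Ms j r c \<in> rl K Ms"
      unfolding sact_def by (rule mor_eqv[OF m rep_cl[OF c]])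
    then show "act r (cl c) = cl (sact \<alpha> Ms j r c)"
      using sact_wchains[of _ Ms j \<alpha> r, OF _ j fs] c rep_closed[OF cl_closed[OF c]] act[OF cl_closed[OF c]]
      by (simp add: cl_eq_iff)
  qed
qed

text \<open>The first slot is \<open>R\<close>, the second the opposite ring, whose reversed product
  is built into the barred actions of \<open>scalM\<close>. The explicit formulas of
  \<open>Renv\<close> agree with the slot operations on words of scalars.\<close>

lemma Renv_ops:
  "slot_action Renv SS {} clS chain_of (lact Renv) lact 0" "slot_action Renv SS {} clS chain_of (lbact Renv) lbact 1"
  "slot_action Renv SS {} clS chain_of (ra Renv) ra 0" "slot_action Renv SS {} clS chain_of (rb Renv) rb 1"
proof -
  note P = Renv_pres
  interpret P: pres Renv SS "rl {} SS" clS chain_of by (rule P)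
  have adm: "\<forall>M\<in>set SS. adm {} M" by (auto simp: adm_scalM)
  have sl: "slotmap a b {} scalM scalM (\<alpha> scalM r)" if "slaw \<alpha> scalM" for a b \<alpha> r
    using that by (auto simp: slotmap_def slaw_def)
  have e: "clS (frag_extend (\<lambda>w. frag_of (f w)) (chain_of x)) = clS (sact \<alpha> SS j r (chain_of x))"
    if "x \<in> carrier Renv" "\<And>a b. f [Scal a, Scal b] = wact \<alpha> SS j r [Scal a, Scal b]" for f \<alpha> j r x
    unfolding sact_def
    by (rule arg_cong[where f = clS], rule frag_extend_cong[OF P.rep_closed[OF that(1)]])
      (use that(2) in \<open>auto simp: words_SS\<close>)
  have d: "lact Renv r x = clS (frag_extend (\<lambda>w. frag_of [Scal (r * the_scal (w ! 0)), w ! 1]) (chain_of x))"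
    "lbact Renv r x = clS (frag_extend (\<lambda>w. frag_of [w ! 0, Scal (the_scal (w ! 1) * r)]) (chain_of x))"
    "ra Renv r x = clS (frag_extend (\<lambda>w. frag_of [Scal (the_scal (w ! 0) * r), w ! 1]) (chain_of x))"
    "rb Renv r x = clS (frag_extend (\<lambda>w. frag_of [w ! 0, Scal (r * the_scal (w ! 1))]) (chain_of x))" for r x
    by (simp_all add: Renv_def tensor_def ra_def rb_def)
  show "slot_action Renv SS {} clS chain_of (lact Renv) lact 0"
  proof (rule slot_action_of_rep[OF P adm])
    fix r x assume x: "x \<in> carrier Renv"
    show "lact Renv r x = clS (sact lact SS 0 r (chain_of x))"
      unfolding d(1) by (rule e[OF x]) (simp add: wact_def scalM_def)
  qed (simp_all add: slaw_scalM sl)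
  show "slot_action Renv SS {} clS chain_of (lbact Renv) lbact 1"
  proof (rule slot_action_of_rep[OF P adm])
    fix r x assume x: "x \<in> carrier Renv"
    show "lbact Renv r x = clS (sact lbact SS 1 r (chain_of x))"
      unfolding d(2) by (rule e[OF x]) (simp add: wact_def scalM_def)
  qed (simp_all add: slaw_scalM sl)
  show "slot_action Renv SS {} clS chain_of (ra Renv) ra 0"
  proof (rule slot_action_of_rep[OF P adm])
    fix r x assume x: "x \<in> carrier Renv"
    show "ra Renv r x = clS (sact ra SS 0 r (chain_of x))"
      unfolding d(3) by (rule e[OF x]) (simp add: wact_def scalM_def ra_def)
  qed (simp_all add: slaw_scalM sl)
  show "slot_action Renv SS {} clS chain_of (rb Renv) rb 1"
  proof (rule slot_action_of_rep[OF P adm])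
    fix r x assume x: "x \<in> carrier Renv"
    show "rb Renv r x = clS (sact rb SS 1 r (chain_of x))"
      unfolding d(4) by (rule e[OF x]) (simp add: wact_def scalM_def rb_def)
  qed (simp_all add: slaw_scalM sl)
qed

lemma Renv_bimodule: "bimodule Renv"
  by (rule pres_bimodule[OF Renv_ops])
    (auto simp: smul_def sopp_def scomm_def scalM_def ra_def rb_def mult.assoc)

lemma omega_Nil: "omega [] = Renv"
  by (simp add: omega_def)

lemma lam_Nil: "lam [] = EndR"
  by (simp add: lam_def)

lemma omega_bimodule: "bims Ms \<Longrightarrow> bimodule (omega Ms)"
  by (cases "Ms = []") (auto simp: omega_bimodule_ne Renv_bimodule omega_Nil)

abbreviation pureS :: "'r \<Rightarrow> 'r \<Rightarrow> ('r::{ring, monoid_mult}, 'a) univ" where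
  "pureS a b \<equiv> clS (frag_of [Scal a, Scal b])"

lemma pureS_closed: "pureS a b \<in> carrier Renv"
  by (rule pres.cl_closed[OF Renv_pres]) (simp add: words_SS)

lemma Renv_act:
  "lact Renv r (pureS a b) = pureS (r * a) b" "lbact Renv r (pureS a b) = pureS a (b * r)"
  "ract Renv (pureS a b) r = pureS (a * r) b" "rbact Renv (pureS a b) r = pureS a (r * b)"
proof -
  have c: "frag_of [Scal a, Scal b] \<in> wchains SS" by (simp add: words_SS)
  show "lact Renv r (pureS a b) = pureS (r * a) b" "lbact Renv r (pureS a b) = pureS a (b * r)"
    "ract Renv (pureS a b) r = pureS (a * r) b" "rbact Renv (pureS a b) r = pureS a (r * b)"
    using slot_action.act_cl[OF Renv_ops(1) c, of r] slot_action.act_cl[OF Renv_ops(2) c, of r]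
      slot_action.act_cl[OF Renv_ops(3) c, of r] slot_action.act_cl[OF Renv_ops(4) c, of r]
    by (simp_all add: wact_def scalM_def ra_def rb_def)
qed

lemma Renv_one_eq: "Renv_one = pureS 1 1"
  by (simp add: Renv_one_def)

text \<open>The unit generates \<open>R^e\<close> under the two left actions, so bimodule maps out
  of \<open>R^e\<close> are controlled by their value there.\<close>

lemma pureS_eq: "pureS a b = lact Renv a (lbact Renv b Renv_one)"
  by (simp add: Renv_one_eq Renv_act)


section \<open>Functoriality\<close>

text \<open>\<open>bim_hom\<close> without extensionality; it contains \<open>id\<close> and is
  closed under plain composition.\<close>

definition bhom :: "('r, 'u) bimod \<Rightarrow> ('r, 'v) bimod \<Rightarrow> ('u \<Rightarrow> 'v) set" where
  "bhom M N = {f \<in> ahom M N. \<forall>x\<in>carrier M. \<forall>r.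
     f (lact M r x) = lact N r (f x) \<and> f (lbact M r x) = lbact N r (f x) \<and>
     f (ract M x r) = ract N (f x) r \<and> f (rbact M x r) = rbact N (f x) r}"

lemma bim_hom_iff: "f \<in> bim_hom M N \<longleftrightarrow> f \<in> bhom M N \<and> f \<in> extensional (carrier M)"
  by (auto simp: bim_hom_def bhom_def ahom_def PiE_def)

lemma bim_hom_bhom: "f \<in> bim_hom M N \<Longrightarrow> f \<in> bhom M N"
  by (simp add: bim_hom_iff)

lemma bhom_ahom: "f \<in> bhom M N \<Longrightarrow> f \<in> ahom M N"
  by (simp add: bhom_def)

lemma bhom_closed: "f \<in> bhom M N \<Longrightarrow> x \<in> carrier M \<Longrightarrow> f x \<in> carrier N"
  by (rule ahom_closed[OF bhom_ahom])

lemma bhom_acts: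
  assumes "f \<in> bhom M N" "x \<in> carrier M"
  shows "f (lact M r x) = lact N r (f x)" "f (lbact M r x) = lbact N r (f x)"
    "f (ract M x r) = ract N (f x) r" "f (rbact M x r) = rbact N (f x) r"
    "f (ra M r x) = ra N r (f x)" "f (rb M r x) = rb N r (f x)"
  using assms by (auto simp: bhom_def ra_def rb_def)

lemma bhom_cong:
  assumes "bimodule M" "f \<in> bhom M N" "\<And>x. x \<in> carrier M \<Longrightarrow> g x = f x"
  shows "g \<in> bhom M N"
proof -
  interpret bimodule M by fact
  have "g \<in> ahom M N" using assms(3) by (intro ahom_cong[OF bhom_ahom[OF assms(2)]]) (auto intro: abelian_group_axioms)
  then show ?thesis
    unfolding bhom_def using assms(3) bhom_acts[OF assms(2)] closed by auto
qed

lemma bhom_id: "id \<in> bhom M M"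
  by (auto simp: bhom_def ahom_def)

lemma bhom_comp: "f \<in> bhom M N \<Longrightarrow> g \<in> bhom N P \<Longrightarrow> g \<circ> f \<in> bhom M P"
  by (auto simp: bhom_def ahom_def Pi_iff)

lemma restrict_bim_hom: "bimodule M \<Longrightarrow> f \<in> bhom M N \<Longrightarrow> restrict f (carrier M) \<in> bim_hom M N"
  by (auto simp: bim_hom_iff intro: bhom_cong)

lemma bhom_slotmap:
  assumes "f \<in> bhom M N"
  shows "slotmap a b KR M N f" "slotmap a b KE M N f"
  using assms bhom_acts[OF assms] by (auto simp: slotmap_def KR_def KE_def bhom_ahom)

definition bhoms :: "('u \<Rightarrow> 'v) list \<Rightarrow> ('r, 'u) bimod list \<Rightarrow> ('r, 'v) bimod list \<Rightarrow> bool" where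
  "bhoms fs Ms Ns \<longleftrightarrow> length fs = length Ms \<and> length Ns = length Ms \<and> (\<forall>i<length Ms. fs ! i \<in> bhom (Ms ! i) (Ns ! i))"

lemma bhoms_Nil [simp]: "bhoms [] [] []"
  by (simp add: bhoms_def)

lemma bhoms_Cons [simp]: "bhoms (f # fs) (M # Ms) (N # Ns) \<longleftrightarrow> f \<in> bhom M N \<and> bhoms fs Ms Ns"
  unfolding bhoms_def by (auto simp: nth_Cons split: nat.split)

lemma bhoms_smap_words:
  assumes "bhoms fs Ms Ns" "w \<in> words Ms" shows "smap fs w \<in> words Ns"
proof -
  have "(fs ! i) (w ! i) \<in> carrier (Ns ! i)" if "i < length Ms" for i
    using bhom_closed[of "fs ! i" "Ms ! i" "Ns ! i" "w ! i"] assms words_nth[OF assms(2) that] that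
    by (simp add: bhoms_def)
  then show ?thesis
    using assms by (simp add: bhoms_def words_iff_nth)
qed

lemma bhoms_mor:
  assumes "bhoms fs Ms Ns" "bims Ms" "bims Ns" "Ms \<noteq> []"
  shows "mor True True KR Ms Ns (\<lambda>w. frag_of (smap fs w))" "mor True True KE Ms Ns (\<lambda>w. frag_of (smap fs w))"
  by (rule mor_smap; use assms in \<open>auto simp: bhoms_def bims_adm(1)[rule_format] bims_adm(2)[rule_format] intro!: bhom_slotmap\<close>)+

lemma smap_sact:
  assumes c: "c \<in> wchains Ms" and l: "length fs = length Ms" "length Ns = length Ms" "p < length Ms"
    and comm: "\<And>x. x \<in> carrier (Ms ! p) \<Longrightarrow> (fs ! p) (\<alpha> (Ms ! p) r x) = \<alpha>' (Ns ! p) r ((fs ! p) x)"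
  shows "frag_extend (\<lambda>w. frag_of (smap fs w)) (sact \<alpha> Ms p r c) = sact \<alpha>' Ns p r (frag_extend (\<lambda>w. frag_of (smap fs w)) c)"
  unfolding sact_def frag_extend_extend
proof (rule frag_extend_cong[OF c])
  fix w assume w: "w \<in> words Ms"
  have "smap fs (wact \<alpha> Ms p r w) = wact \<alpha>' Ns p r (smap fs w)"
    by (rule nth_equalityI) (use w l comm in \<open>auto simp: wact_def words_length words_nth nth_list_update\<close>)
  then show "frag_extend (\<lambda>w. frag_of (smap fs w)) (frag_of (wact \<alpha> Ms p r w)) =
    frag_extend (\<lambda>w. frag_of (wact \<alpha>' Ns p r w)) (frag_of (smap fs w))" by simp
qed

lemma bhoms_sact:
  assumes "bhoms fs Ms Ns" "c \<in> wchains Ms" "p < length Ms"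
  shows "frag_extend (\<lambda>w. frag_of (smap fs w)) (sact lact Ms p r c) = sact lact Ns p r (frag_extend (\<lambda>w. frag_of (smap fs w)) c)"
    "frag_extend (\<lambda>w. frag_of (smap fs w)) (sact lbact Ms p r c) = sact lbact Ns p r (frag_extend (\<lambda>w. frag_of (smap fs w)) c)"
    "frag_extend (\<lambda>w. frag_of (smap fs w)) (sact ra Ms p r c) = sact ra Ns p r (frag_extend (\<lambda>w. frag_of (smap fs w)) c)"
    "frag_extend (\<lambda>w. frag_of (smap fs w)) (sact rb Ms p r c) = sact rb Ns p r (frag_extend (\<lambda>w. frag_of (smap fs w)) c)"
  using assms bhom_acts[of "fs ! p" "Ms ! p" "Ns ! p"] by (auto simp: bhoms_def intro!: smap_sact[OF assms(2)])

lemma lift_eq: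
  assumes "abelian_group N" "length Ms = 1 \<Longrightarrow> f [x] \<in> carrier N"
  shows "lift Ms N f x = ext N f (repw Ms x)"
  using assms by (auto simp: lift_def repw_def addext_eq_ext abelian_group.ext_of)

text \<open>Applying bimodule maps letterwise preserves relations by \<open>bhoms_mor\<close>. Hence
  the functor may be computed on any chain that represents a class, not just on the stored
  one.\<close>

lemma omega_map_cl:
  assumes fs: "bhoms fs Ms Ns" and b: "bims Ms" "bims Ns" "Ms \<noteq> []"
  shows "x \<in> carrier (omega Ms) \<Longrightarrow> omega_map fs Ms Ns x = clE Ns (frag_extend (\<lambda>w. frag_of (smap fs w)) (repw Ms x))"
    and "c \<in> wchains Ms \<Longrightarrow> omega_map fs Ms Ns (clE Ms c) = clE Ns (frag_extend (\<lambda>w. frag_of (smap fs w)) c)"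
proof -
  have Ns: "Ns \<noteq> []" using fs b(3) by (auto simp: bhoms_def)
  interpret P: pres "omega Ms" Ms "rl KE Ms" "clE Ms" "repw Ms" by (rule omega_pres[OF b(1,3)])
  interpret Q: pres "omega Ns" Ns "rl KE Ns" "clE Ns" "repw Ns" by (rule omega_pres[OF b(2) Ns])
  note m = bhoms_mor(2)[OF fs b]
  show 1: "omega_map fs Ms Ns x = clE Ns (frag_extend (\<lambda>w. frag_of (smap fs w)) (repw Ms x))"
    if x: "x \<in> carrier (omega Ms)" for x
  proof -
    let ?f = "\<lambda>w. pureE Ns (smap fs w)" and ?g = "\<lambda>w. clE Ns (frag_of (smap fs w))"
    have pair_word: "?f w = ?g w" "?g w \<in> carrier (omega Ns)" if "w \<in> words Ms" for w
      using pureE_eq[OF b(2) Ns bhoms_smap_words[OF fs that]] Q.cl_closed[of "frag_of (smap fs w)"]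
        bhoms_smap_words[OF fs that] by auto
    have r: "repw Ms x \<in> wchains Ms" by (rule P.rep_closed[OF x])
    then have k: "Poly_Mapping.keys (repw Ms x) \<subseteq> words Ms" by (simp add: wchains_def)
    have "[x] \<in> words Ms" if "length Ms = 1" using r that by (simp add: repw_def)
    then have "omega_map fs Ms Ns x = ext (omega Ns) ?f (repw Ms x)"
      using x b(3) lift_eq[OF Q.T.abelian_group_axioms, of Ms ?f x] pair_word by (simp add: omega_map_def)
    also have "\<dots> = ext (omega Ns) ?g (repw Ms x)"
      by (rule ext_cong[OF Q.T.abelian_group_axioms]) (use pair_word k in auto)
    also have "\<dots> = clE Ns (frag_extend (\<lambda>w. frag_of (smap fs w)) (repw Ms x))"
      by (rule Q.cl_extend[OF _ r]) (use bhoms_smap_words[OF fs] in auto)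
    finally show ?thesis .
  qed
  show "omega_map fs Ms Ns (clE Ms c) = clE Ns (frag_extend (\<lambda>w. frag_of (smap fs w)) c)" if c: "c \<in> wchains Ms"
    using 1[OF P.cl_closed[OF c]] mor_eqv[OF m P.rep_cl[OF c]]
      mor_extend_wchains[OF m c] mor_extend_wchains[OF m P.rep_closed[OF P.cl_closed[OF c]]]
    by (simp add: Q.cl_eq_iff)
qed

lemma omega_act_cl:
  assumes "bims Ms" "Ms \<noteq> []" "c \<in> wchains Ms"
  shows "lact (omega Ms) r (clE Ms c) = clE Ms (sact lact Ms 0 r c)"
    "lbact (omega Ms) r (clE Ms c) = clE Ms (sact lbact Ms 0 r c)"
    "ract (omega Ms) (clE Ms c) r = clE Ms (sact ra Ms (length Ms - 1) r c)"
    "rbact (omega Ms) (clE Ms c) r = clE Ms (sact rb Ms (length Ms - 1) r c)"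
  using slot_action.act_cl[OF omega_ops(1)[OF assms(1,2)] assms(3)] slot_action.act_cl[OF omega_ops(2)[OF assms(1,2)] assms(3)]
    slot_action.act_cl[OF omega_ops(3)[OF assms(1,2)] assms(3)] slot_action.act_cl[OF omega_ops(4)[OF assms(1,2)] assms(3)]
  by (simp_all add: ra_def[of "omega Ms"] rb_def[of "omega Ms"])

lemma cl_bhom:
  assumes P: "pres T Ms (rl K Ms) cl rep" and Q: "pres U Ns R' cl' rep'"
    and f: "\<And>c. c \<in> wchains Ms \<Longrightarrow> f (cl c) = cl' (frag_extend G c)"
    and G: "\<And>w. w \<in> words Ms \<Longrightarrow> G w \<in> wchains Ns"
  shows "f \<in> ahom T U"
proof -
  interpret P: pres T Ms "rl K Ms" cl rep by fact
  interpret Q: pres U Ns R' cl' rep' by fact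
  have cx: "x = cl (rep x)" "rep x \<in> wchains Ms" if "x \<in> carrier T" for x
    using that by (simp_all add: P.cl_rep P.rep_closed)
  have G': "frag_extend G c \<in> wchains Ns" if "c \<in> wchains Ms" for c
    using wchains_extend[OF that G] .
  show ?thesis
    unfolding ahom_def
  proof (intro CollectI conjI ballI Pi_I)
    fix x assume "x \<in> carrier T"
    then show "f x \<in> carrier U" using f[OF cx(2)] cx(1) Q.cl_closed[OF G'[OF cx(2)]] by metis
  next
    fix x y assume xy: "x \<in> carrier T" "y \<in> carrier T"
    then have "x \<oplus>\<^bsub>T\<^esub> y = cl (rep x + rep y)" using cx P.cl_add by metis
    then have "f (x \<oplus>\<^bsub>T\<^esub> y) = cl' (frag_extend G (rep x) + frag_extend G (rep y))"
      using f[of "rep x + rep y"] cx xy by (simp add: frag_extend_add wchains_add)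
    also have "\<dots> = f x \<oplus>\<^bsub>U\<^esub> f y"
      using f[OF cx(2)] cx(1) xy Q.cl_add[OF G'[OF cx(2)] G'[OF cx(2)]] by metis
    finally show "f (x \<oplus>\<^bsub>T\<^esub> y) = f x \<oplus>\<^bsub>U\<^esub> f y" .
  qed
qed

lemma omega_map_hom:
  assumes fs: "bhoms fs Ms Ns" and b: "bims Ms" "bims Ns"
  shows "omega_map fs Ms Ns \<in> bim_hom (omega Ms) (omega Ns)"
proof (cases "Ms = []")
  case True
  then have "Ns = []" using fs by (auto simp: bhoms_def)
  then show ?thesis
    using True restrict_bim_hom[OF Renv_bimodule bhom_id] by (simp add: omega_map_def omega_Nil id_def)
next
  case False
  have Ns: "Ns \<noteq> []" using fs False by (auto simp: bhoms_def)
  interpret P: pres "omega Ms" Ms "rl KE Ms" "clE Ms" "repw Ms" by (rule omega_pres[OF b(1) False])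
  interpret Q: pres "omega Ns" Ns "rl KE Ns" "clE Ns" "repw Ns" by (rule omega_pres[OF b(2) Ns])
  let ?f = "omega_map fs Ms Ns" and ?G = "frag_extend (\<lambda>w. frag_of (smap fs w))"
  note f = omega_map_cl(2)[OF fs b False]
  have G: "?G c \<in> wchains Ns" if "c \<in> wchains Ms" for c
    using wchains_extend[OF that, of "\<lambda>w. frag_of (smap fs w)" Ns] bhoms_smap_words[OF fs] by simp
  have ah: "?f \<in> ahom (omega Ms) (omega Ns)"
    by (rule cl_bhom[OF P.pres_axioms Q.pres_axioms f]) (use bhoms_smap_words[OF fs] in auto)
  have l: "length Ns = length Ms" "0 < length Ms" "length Ms - 1 < length Ms" using fs False by (auto simp: bhoms_def)
  have "?f (lact (omega Ms) r x) = lact (omega Ns) r (?f x) \<and> ?f (lbact (omega Ms) r x) = lbact (omega Ns) r (?f x) \<and>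
     ?f (ract (omega Ms) x r) = ract (omega Ns) (?f x) r \<and> ?f (rbact (omega Ms) x r) = rbact (omega Ns) (?f x) r"
    if "x \<in> carrier (omega Ms)" for x r
  proof -
    define c where "c = repw Ms x"
    have c: "c \<in> wchains Ms" "x = clE Ms c"
      unfolding c_def using P.rep_closed[OF that] P.cl_rep[OF that] by simp_all
    show ?thesis
      unfolding c(2) omega_act_cl[OF b(1) False c(1)] f[OF c(1)] omega_act_cl[OF b(2) Ns G[OF c(1)]]
      using f bims_sact[OF b(1) _ c(1)] bhoms_sact[OF fs c(1)] l by simp
  qed
  then show ?thesis
    using ah unfolding bim_hom_iff bhom_def by (auto simp: omega_map_def)
qed

text \<open>Bimodule maps commute exactly with the right actions, so each difference in the
  condition for \<open>Ms\<close> is carried to the one for \<open>Ns\<close>.\<close>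

lemma takeuchi_smap:
  fixes Ms Ns :: "('r::{ring, monoid_mult}, 'u) bimod list"
  assumes fs: "bhoms fs Ms Ns" and b: "bims Ms" "bims Ns" "Ms \<noteq> []" and c: "c \<in> wchains Ms" "takeuchi Ms c"
  shows "takeuchi Ns (frag_extend (\<lambda>w. frag_of (smap fs w)) c)"
  unfolding takeuchi_def
proof (intro allI impI)
  fix j s assume "Suc j < length Ns"
  then have j: "Suc j < length Ms" using fs by (simp add: bhoms_def)
  show "sact rb Ns j s (frag_extend (\<lambda>w. frag_of (smap fs w)) c)
      - sact ra Ns (Suc j) s (frag_extend (\<lambda>w. frag_of (smap fs w)) c) \<in> rl KR Ns"
    using mor_eqv[OF bhoms_mor(1)[OF fs b], of "sact rb Ms j s c" "sact ra Ms (Suc j) s c"]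
      bhoms_sact(4)[OF fs c(1), of j s] bhoms_sact(3)[OF fs c(1), of "Suc j" s] c(2) j
    unfolding takeuchi_def by auto
qed

text \<open>The argument of \<open>omega_map_cl\<close> for the tensor product over
  \<open>R\<close>. The Takeuchi hypothesis places the class in the carrier to which
  \<open>lam_map\<close> is restricted.\<close>

lemma lam_map_cl:
  assumes fs: "bhoms fs Ms Ns" and b: "bims Ms" "bims Ns" "Ms \<noteq> []"
  shows "x \<in> carrier (lam Ms) \<Longrightarrow> lam_map fs Ms Ns x = clR Ns (frag_extend (\<lambda>w. frag_of (smap fs w)) (repw Ms x))"
    and "c \<in> wchains Ms \<Longrightarrow> takeuchi Ms c \<Longrightarrow> lam_map fs Ms Ns (clR Ms c) = clR Ns (frag_extend (\<lambda>w. frag_of (smap fs w)) c)"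
proof -
  have Ns: "Ns \<noteq> []" using fs b(3) by (auto simp: bhoms_def)
  interpret P: pres "tensorR Ms" Ms "rl KR Ms" "clR Ms" "repw Ms" by (rule tensorR_pres[OF b(1,3)])
  interpret Q: pres "tensorR Ns" Ns "rl KR Ns" "clR Ns" "repw Ns" by (rule tensorR_pres[OF b(2) Ns])
  note m = bhoms_mor(1)[OF fs b]
  show 1: "lam_map fs Ms Ns x = clR Ns (frag_extend (\<lambda>w. frag_of (smap fs w)) (repw Ms x))"
    if x: "x \<in> carrier (lam Ms)" for x
  proof -
    let ?f = "\<lambda>w. pureR Ns (smap fs w)" and ?g = "\<lambda>w. clR Ns (frag_of (smap fs w))"
    have pair_word: "?f w = ?g w" "?g w \<in> carrier (tensorR Ns)" if "w \<in> words Ms" for w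
      using pureR_eq[OF b(2) Ns bhoms_smap_words[OF fs that]] Q.cl_closed[of "frag_of (smap fs w)"]
        bhoms_smap_words[OF fs that] by auto
    have r: "repw Ms x \<in> wchains Ms" by (rule lam_rep[OF b(1,3) x])
    then have k: "Poly_Mapping.keys (repw Ms x) \<subseteq> words Ms" by (simp add: wchains_def)
    have "[x] \<in> words Ms" if "length Ms = 1" using r that by (simp add: repw_def)
    then have "lam_map fs Ms Ns x = ext (tensorR Ns) ?f (repw Ms x)"
      using x b(3) lift_eq[OF Q.T.abelian_group_axioms, of Ms ?f x] pair_word by (simp add: lam_map_def)
    also have "\<dots> = ext (tensorR Ns) ?g (repw Ms x)"
      by (rule ext_cong[OF Q.T.abelian_group_axioms]) (use pair_word k in auto)
    also have "\<dots> = clR Ns (frag_extend (\<lambda>w. frag_of (smap fs w)) (repw Ms x))"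
      by (rule Q.cl_extend[OF _ r]) (use bhoms_smap_words[OF fs] in auto)
    finally show ?thesis .
  qed
  show "lam_map fs Ms Ns (clR Ms c) = clR Ns (frag_extend (\<lambda>w. frag_of (smap fs w)) c)"
    if c: "c \<in> wchains Ms" "takeuchi Ms c"
    using 1[of "clR Ms c"] lam_carrier(2)[OF b(1,3) c(1)] c(2) mor_eqv[OF m P.rep_cl[OF c(1)]]
      mor_extend_wchains[OF m c(1)] mor_extend_wchains[OF m P.rep_closed[OF P.cl_closed[OF c(1)]]]
    by (simp add: Q.cl_eq_iff)
qed

lemma lam_ex:
  assumes "bims Ms" "Ms \<noteq> []" "x \<in> carrier (lam Ms)"
  obtains c where "c \<in> wchains Ms" "takeuchi Ms c" "x = clR Ms c"
  using lam_rep[OF assms] by metis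

lemma lam_map_hom:
  assumes fs: "bhoms fs Ms Ns" and b: "bims Ms" "bims Ns"
  shows "lam_map fs Ms Ns \<in> bim_hom (lam Ms) (lam Ns)"
proof (cases "Ms = []")
  case True
  then have "Ns = []" using fs by (auto simp: bhoms_def)
  then show ?thesis
    using True restrict_bim_hom[OF EndR_bimodule bhom_id] by (simp add: lam_map_def lam_Nil id_def)
next
  case False
  have Ns: "Ns \<noteq> []" using fs False by (auto simp: bhoms_def)
  interpret P: pres "tensorR Ms" Ms "rl KR Ms" "clR Ms" "repw Ms" by (rule tensorR_pres[OF b(1) False])
  interpret Q: pres "tensorR Ns" Ns "rl KR Ns" "clR Ns" "repw Ns" by (rule tensorR_pres[OF b(2) Ns])
  let ?f = "lam_map fs Ms Ns" and ?G = "frag_extend (\<lambda>w. frag_of (smap fs w))"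
  note f = lam_map_cl(2)[OF fs b False]
  have G: "?G c \<in> wchains Ns" if "c \<in> wchains Ms" for c
    using wchains_extend[OF that, of "\<lambda>w. frag_of (smap fs w)" Ns] bhoms_smap_words[OF fs] by simp
  note t = takeuchi_smap[OF fs b False]
  have l: "length Ns = length Ms" "0 < length Ms" "length Ms - 1 < length Ms" using fs False by (auto simp: bhoms_def)
  have ah: "?f x \<in> carrier (lam Ns)" "?f (x \<oplus>\<^bsub>lam Ms\<^esub> y) = ?f x \<oplus>\<^bsub>lam Ns\<^esub> ?f y"
    if "x \<in> carrier (lam Ms)" "y \<in> carrier (lam Ms)" for x y
  proof -
    note xy = that
    obtain c where c1: "c \<in> wchains Ms" "takeuchi Ms c" "x = clR Ms c" using lam_ex[OF b(1) False xy(1)] .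
    obtain d where cd: "d \<in> wchains Ms" "takeuchi Ms d" "y = clR Ms d" using lam_ex[OF b(1) False xy(2)] .
    note c = c1 cd
    show "?f x \<in> carrier (lam Ns)"
      unfolding c f[OF c(1,2)] using lam_carrier(2)[OF b(2) Ns G[OF c(1)]] t[OF c(1,2)] by simp
    show "?f (x \<oplus>\<^bsub>lam Ms\<^esub> y) = ?f x \<oplus>\<^bsub>lam Ns\<^esub> ?f y"
      unfolding c lam_sel[OF b(1) False] lam_sel[OF b(2) Ns]
      using c f[of "c + d"] takeuchi_add[OF c(2,5)] G
      by (simp add: P.cl_add[symmetric] wchains_add f frag_extend_add Q.cl_add)
  qed
  have "?f (lact (lam Ms) r x) = lact (lam Ns) r (?f x) \<and> ?f (lbact (lam Ms) r x) = lbact (lam Ns) r (?f x) \<and>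
     ?f (ract (lam Ms) x r) = ract (lam Ns) (?f x) r \<and> ?f (rbact (lam Ms) x r) = rbact (lam Ns) (?f x) r"
    if "x \<in> carrier (lam Ms)" for x r
  proof -
    note x = that
    obtain c where c: "c \<in> wchains Ms" "takeuchi Ms c" "x = clR Ms c" using lam_ex[OF b(1) False x] .
    show ?thesis
      unfolding c(3) lam_act_cl[OF b(1) False c(1)] f[OF c(1,2)] lam_act_cl[OF b(2) Ns G[OF c(1)]]
      using f[OF bims_sact(1)[OF b(1) l(2) c(1)] takeuchi_acts(1)[OF b(1) False c(1,2)], of r]
        f[OF bims_sact(2)[OF b(1) l(3) c(1)] takeuchi_acts(2)[OF b(1) False c(1,2)], of r]
        f[OF bims_sact(3)[OF b(1) l(2) c(1)] takeuchi_acts(3)[OF b(1) False c(1,2)], of r]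
        f[OF bims_sact(4)[OF b(1) l(3) c(1)] takeuchi_acts(4)[OF b(1) False c(1,2)], of r]
        bhoms_sact[OF fs c(1)] l by simp
  qed
  then show ?thesis
    using ah unfolding bim_hom_iff bhom_def ahom_def by (auto simp: lam_map_def)
qed

lemma smap_ident:
  assumes "length fs = length Ms" "\<And>i x. i < length Ms \<Longrightarrow> x \<in> carrier (Ms ! i) \<Longrightarrow> (fs ! i) x = x" "w \<in> words Ms"
  shows "smap fs w = w"
  by (rule nth_equalityI) (use assms words_length[OF assms(3)] words_nth[OF assms(3)] in auto)

lemma ident_bhoms:
  assumes "bims Ms" "length fs = length Ms" "\<And>i x. i < length Ms \<Longrightarrow> x \<in> carrier (Ms ! i) \<Longrightarrow> (fs ! i) x = x"
  shows "bhoms fs Ms Ms"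
  using assms bhom_cong[OF bims_nth[OF assms(1)] bhom_id] by (auto simp: bhoms_def)

lemma omega_map_ident:
  assumes "bims Ms" "length fs = length Ms" "\<And>i x. i < length Ms \<Longrightarrow> x \<in> carrier (Ms ! i) \<Longrightarrow> (fs ! i) x = x"
    and x: "x \<in> carrier (omega Ms)"
  shows "omega_map fs Ms Ms x = x"
proof (cases "Ms = []")
  case False
  interpret P: pres "omega Ms" Ms "rl KE Ms" "clE Ms" "repw Ms" by (rule omega_pres[OF assms(1) False])
  have "frag_extend (\<lambda>w. frag_of (smap fs w)) (repw Ms x) = frag_extend frag_of (repw Ms x)"
    by (rule frag_extend_cong[OF P.rep_closed[OF x]]) (use smap_ident[OF assms(2,3)] in auto)
  then show ?thesis
    using omega_map_cl(1)[OF ident_bhoms[OF assms(1-3)] assms(1,1) False x] P.cl_rep[OF x] by simp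
qed (use x in \<open>auto simp: omega_map_def\<close>)

lemma lam_map_ident:
  assumes "bims Ms" "length fs = length Ms" "\<And>i x. i < length Ms \<Longrightarrow> x \<in> carrier (Ms ! i) \<Longrightarrow> (fs ! i) x = x"
    and x: "x \<in> carrier (lam Ms)"
  shows "lam_map fs Ms Ms x = x"
proof (cases "Ms = []")
  case False
  have "frag_extend (\<lambda>w. frag_of (smap fs w)) (repw Ms x) = frag_extend frag_of (repw Ms x)"
    by (rule frag_extend_cong[OF lam_rep(1)[OF assms(1) False x]]) (use smap_ident[OF assms(2,3)] in auto)
  then show ?thesis
    using lam_map_cl(1)[OF ident_bhoms[OF assms(1-3)] assms(1,1) False x] lam_rep(3)[OF assms(1) False x] by simp
qed (use x in \<open>auto simp: lam_map_def\<close>)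

text \<open>A block of letters may be replaced by its class as one letter: a relation of the block
  becomes a formal sum with value zero in \<open>T\<close>, and \<open>one_slot\<close> shows that
  such a sum is a relation.\<close>

lemma mor_contract:
  assumes P: "pres T Ls (rl K Ls) cl rep" and adm: "\<forall>M\<in>set Ls. adm K M" "adm K T" and ne: "Ls \<noteq> []"
    and l: "\<And>\<rho> \<beta> r w. a \<Longrightarrow> (\<rho>, \<beta>) \<in> K \<Longrightarrow> w \<in> words Ls \<Longrightarrow> \<beta> T r (cl (frag_of w)) = cl (frag_of (wact \<beta> Ls 0 r w))"
    and r: "\<And>\<rho> \<beta> r w. b \<Longrightarrow> (\<rho>, \<beta>) \<in> K \<Longrightarrow> w \<in> words Ls \<Longrightarrow> \<rho> T r (cl (frag_of w)) = cl (frag_of (wact \<rho> Ls (length Ls - 1) r w))"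
  shows "mor a b K Ls [T] (\<lambda>w. frag_of [cl (frag_of w)])"
proof -
  interpret P: pres T Ls "rl K Ls" cl rep by fact
  have "frag_extend (\<lambda>w. frag_of [cl (frag_of w)]) z \<in> rl K [T]" if "z \<in> mrel Ls \<union> bal K Ls" for z
  proof -
    have z: "z \<in> wchains Ls" "z \<in> rl K Ls"
      using that rels_wchains[OF adm(1)] by (auto simp: rl_def intro: span_base)
    have "ext T (\<lambda>w. cl (frag_of w)) z = \<zero>\<^bsub>T\<^esub>"
      using P.cl_extend[of Ls frag_of z] z by (simp add: P.cl_zero_iff)
    then have "frag_extend (\<lambda>w. frag_of [cl (frag_of w)]) z - frag_of [\<zero>\<^bsub>T\<^esub>] \<in> rl K [T]"
      using one_slot[OF P.T.abelian_group_axioms, of "\<lambda>w. cl (frag_of w)" Ls z K] z(1) by (simp add: P.cl_closed)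
    moreover have "frag_of [\<zero>\<^bsub>T\<^esub>] \<in> rl K [T]"
      using rl_uminus[OF rl_single_add[of "\<zero>\<^bsub>T\<^esub>" T "\<zero>\<^bsub>T\<^esub>" K]] by simp
    ultimately show ?thesis using rl_add by fastforce
  qed
  then show ?thesis
    unfolding mor_def using adm ne l r by (auto simp: P.cl_closed)
qed

text \<open>The reverse of \<open>mor_contract\<close>: one letter is expanded into its chosen
  representative. The choice is neither additive nor equivariant, but its defects are
  relations.\<close>

lemma mor_rep:
  assumes P: "pres T Ls (rl K Ls) cl rep" and adm: "\<forall>M\<in>set Ls. adm K M" "adm K T" and ne: "Ls \<noteq> []"
    and l: "\<And>\<rho> \<beta> r c. a \<Longrightarrow> (\<rho>, \<beta>) \<in> K \<Longrightarrow> c \<in> wchains Ls \<Longrightarrow> \<beta> T r (cl c) = cl (sact \<beta> Ls 0 r c)"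
    and r: "\<And>\<rho> \<beta> r c. b \<Longrightarrow> (\<rho>, \<beta>) \<in> K \<Longrightarrow> c \<in> wchains Ls \<Longrightarrow> \<rho> T r (cl c) = cl (sact \<rho> Ls (length Ls - 1) r c)"
  shows "mor a b K [T] Ls (\<lambda>w. rep (hd w))"
proof -
  interpret P: pres T Ls "rl K Ls" cl rep by fact
  have len: "0 < length Ls" "length Ls - 1 < length Ls" using ne by auto
  show ?thesis
  proof (rule mor_single[OF adm(2,1) ne])
    fix \<rho> \<beta> r x assume "a" and K: "(\<rho>, \<beta>) \<in> K" and x: "x \<in> carrier T"
    then show "rep (\<beta> T r x) - sact \<beta> Ls 0 r (rep x) \<in> rl K Ls"
      using l[OF \<open>a\<close> K P.rep_closed[OF x], of r] P.rep_cl[OF adm_sact(2)[OF adm(1) P.rep_closed[OF x] len(1) K, of r]]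
      by (simp add: P.cl_rep)
  next
    fix \<rho> \<beta> r x assume "b" and K: "(\<rho>, \<beta>) \<in> K" and x: "x \<in> carrier T"
    then show "rep (\<rho> T r x) - sact \<rho> Ls (length Ls - 1) r (rep x) \<in> rl K Ls"
      using r[OF \<open>b\<close> K P.rep_closed[OF x], of r] P.rep_cl[OF adm_sact(1)[OF adm(1) P.rep_closed[OF x] len(2) K, of r]]
      by (simp add: P.cl_rep)
  qed (auto simp: P.rep_closed P.rep_add)
qed

lemma KE_iff: "(\<rho>, \<beta>) \<in> KE \<longleftrightarrow> \<rho> = ra \<and> \<beta> = lact \<or> \<rho> = rb \<and> \<beta> = lbact"
  by (auto simp: KE_def)

lemma omega_contract:
  assumes "bims Ls" "Ls \<noteq> []"
  shows "mor True True KE Ls [omega Ls] (\<lambda>w. frag_of [clE Ls (frag_of w)])"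
    "mor True True KE [omega Ls] Ls (\<lambda>w. repw Ls (hd w))"
proof -
  note P = omega_pres[OF assms] bims_adm(2)[OF assms(1)] bimodule_adm(2)[OF omega_bimodule[OF assms(1)]] assms(2)
  note a = omega_act_cl[OF assms]
  show "mor True True KE Ls [omega Ls] (\<lambda>w. frag_of [clE Ls (frag_of w)])"
    by (rule mor_contract[OF P]) (auto simp: KE_iff ra_def[of "omega Ls"] rb_def[of "omega Ls"] a)
  show "mor True True KE [omega Ls] Ls (\<lambda>w. repw Ls (hd w))"
    by (rule mor_rep[OF P]) (auto simp: KE_iff ra_def[of "omega Ls"] rb_def[of "omega Ls"] a)
qed


section \<open>Bracketing\<close>

lemma pureE_closed: "bims Ms \<Longrightarrow> w \<in> words Ms \<Longrightarrow> pureE Ms w \<in> carrier (omega Ms)"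
proof (cases "Ms = []")
  case True
  then show ?thesis by (simp add: pureE_def omega_Nil Renv_one_eq pureS_closed)
next
  case False
  assume "bims Ms" "w \<in> words Ms"
  then show ?thesis
    using pureE_eq[of Ms w] pres.cl_closed[OF omega_pres[of Ms], of "frag_of w"] False by simp
qed

lemma words_take_drop:
  assumes "w \<in> words Ms"
  shows "take i w \<in> words (take i Ms)" "drop i w \<in> words (drop i Ms)"
  using assms by (auto simp: words_iff_nth)

lemma bims_take_drop: "bims Ms \<Longrightarrow> bims (take i Ms)" "bims Ms \<Longrightarrow> bims (drop i Ms)"
  by (auto simp: bims_def dest: in_set_takeD in_set_dropD)

lemma bracketing_words:
  assumes "bims Ms" "w \<in> words Ms"
  shows "bracketing (pureE (take l (drop i Ms))) w i l \<in> words (bracketing omega Ms i l)"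
  unfolding bracketing_def using assms
  by (auto simp: words_take_drop bims_take_drop intro!: pureE_closed)

lemma bracketing_bims: "bims Ms \<Longrightarrow> bims (bracketing omega Ms i l)"
  unfolding bracketing_def by (auto simp: bims_take_drop omega_bimodule)

lemma omega_split_rep:
  assumes b: "bims Ms" "Ms \<noteq> []" and x: "x \<in> carrier (omega Ms)"
  shows "omega_split Ms i l x = clE (bracketing omega Ms i l)
    (frag_extend (\<lambda>w. frag_of (bracketing (pureE (take l (drop i Ms))) w i l)) (repw Ms x))"
proof -
  let ?B = "bracketing omega Ms i l"
  have B: "bims ?B" "?B \<noteq> []" using bracketing_bims[OF b(1)] by (auto simp: bracketing_def)
  interpret P: pres "omega Ms" Ms "rl KE Ms" "clE Ms" "repw Ms" by (rule omega_pres[OF b])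
  interpret Q: pres "omega ?B" ?B "rl KE ?B" "clE ?B" "repw ?B" by (rule omega_pres[OF B])
  let ?b = "\<lambda>w. bracketing (pureE (take l (drop i Ms))) w i l"
  note bw = bracketing_words[OF b(1), of _ l i]
  have pair_word: "pureE ?B (?b w) = clE ?B (frag_of (?b w))" "clE ?B (frag_of (?b w)) \<in> carrier (omega ?B)"
    if "w \<in> words Ms" for w
    using pureE_eq[OF B bw[OF that]] Q.cl_closed[of "frag_of (?b w)"] bw[OF that] by auto
  have r: "repw Ms x \<in> wchains Ms" by (rule P.rep_closed[OF x])
  then have k: "Poly_Mapping.keys (repw Ms x) \<subseteq> words Ms" by (simp add: wchains_def)
  have "[x] \<in> words Ms" if "length Ms = 1" using r that by (simp add: repw_def)
  then have "omega_split Ms i l x = ext (omega ?B) (\<lambda>w. pureE ?B (?b w)) (repw Ms x)"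
    using x b(2) lift_eq[OF Q.T.abelian_group_axioms, of Ms "\<lambda>w. pureE ?B (?b w)" x] pair_word by (simp add: omega_split_def)
  also have "\<dots> = ext (omega ?B) (\<lambda>w. clE ?B (frag_of (?b w))) (repw Ms x)"
    by (rule ext_cong[OF Q.T.abelian_group_axioms]) (use pair_word k in auto)
  also have "\<dots> = clE ?B (frag_extend (\<lambda>w. frag_of (?b w)) (repw Ms x))"
    by (rule Q.cl_extend[OF _ r]) (use bw in auto)
  finally show ?thesis .
qed

text \<open>\<open>cut\<close> collapses all letters after the first into one class and
  \<open>glue\<close> expands it again. They are mutually inverse modulo relations, which makes this
  associativity constraint invertible.\<close>

definition cut :: "('r::{ring, monoid_mult}, 'a) ubimod list \<Rightarrow> ('r, 'a) univ list \<Rightarrow> ('r, 'a) chain" where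
  "cut Ls w = frag_of [hd w, clE Ls (frag_of (tl w))]"

definition glue :: "('r::{ring, monoid_mult}, 'a) ubimod list \<Rightarrow> ('r, 'a) univ list \<Rightarrow> ('r, 'a) chain" where
  "glue Ls w = frag_of [w ! 0] \<odot> repw Ls (w ! 1)"

section \<open>Splitting off the first factor is an isomorphism\<close>

context
  fixes M :: "('r::{ring, monoid_mult}, 'a) ubimod" and Ls :: "('r, 'a) ubimod list"
  assumes M: "bimodule M" and L: "bims Ls" "Ls \<noteq> []"
begin

lemma first_slot_mor: "mor True True KE [M] [M] frag_of"
  by (rule mor_id) (auto simp: M bimodule_adm)

lemma cut_mor: "mor True True KE (M # Ls) [M, omega Ls] (cut Ls)"
proof -
  have "mor True True KE ([M] @ Ls) ([M] @ [omega Ls])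
      (\<lambda>w. frag_of (take (length [M]) w) \<odot> frag_of [clE Ls (frag_of (drop (length [M]) w))])"
    by (rule mor_tensor[OF first_slot_mor omega_contract(1)[OF L]])
  then show ?thesis
    unfolding append.simps by (rule mor_cong) (auto simp: cut_def words_Cons)
qed

lemma glue_mor: "mor True True KE [M, omega Ls] (M # Ls) (glue Ls)"
proof -
  have "mor True True KE ([M] @ [omega Ls]) ([M] @ Ls)
      (\<lambda>w. frag_of (take (length [M]) w) \<odot> repw Ls (hd (drop (length [M]) w)))"
    by (rule mor_tensor[OF first_slot_mor omega_contract(2)[OF L]])
  then show ?thesis
    unfolding append.simps by (rule mor_cong) (auto simp: glue_def words_Cons)
qed

interpretation L: pres "omega Ls" Ls "rl KE Ls" "clE Ls" "repw Ls"
  by (rule omega_pres[OF L])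

lemma glue_cut:
  assumes "c \<in> wchains (M # Ls)" shows "frag_extend (glue Ls) (frag_extend (cut Ls) c) - c \<in> rl KE (M # Ls)"
proof -
  have "glue Ls [a, clE Ls (frag_of p)] - frag_of (a # p) \<in> rl KE (M # Ls)" if "a \<in> carrier M" "p \<in> words Ls" for a p
    using rl_cat_right[OF L.rep_cl[of "frag_of p"], of "frag_of [a]" "[M]"] that by (simp add: glue_def cat_diff_right)
  then have "frag_extend (\<lambda>w. frag_extend (glue Ls) (cut Ls w)) c - frag_extend frag_of c \<in> rl KE (M # Ls)"
    by (intro rl_extend_fun[OF assms]) (auto simp: words_Cons cut_def)
  then show ?thesis by (simp add: frag_extend_extend)
qed

text \<open>Expanding the second letter and collapsing the resulting words one by one gives a formal
  sum of one-letter words, which \<open>one_slot\<close> merges into the original letter.\<close>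

lemma cut_glue:
  assumes "c \<in> wchains [M, omega Ls]" shows "frag_extend (cut Ls) (frag_extend (glue Ls) c) - c \<in> rl KE [M, omega Ls]"
proof -
  have "frag_extend (cut Ls) (glue Ls [a, y]) - frag_of [a, y] \<in> rl KE [M, omega Ls]"
    if a: "a \<in> carrier M" and y: "y \<in> carrier (omega Ls)" for a y
  proof -
    have "frag_extend (cut Ls) (glue Ls [a, y]) = frag_extend (\<lambda>p. frag_of [a] \<odot> frag_of [clE Ls (frag_of p)]) (repw Ls y)"
      by (simp add: glue_def cat_def frag_extend_extend cut_def)
    also have "\<dots> = frag_of [a] \<odot> frag_extend (\<lambda>p. frag_of [clE Ls (frag_of p)]) (repw Ls y)"
      by (rule cat_extend_right[symmetric])
    finally have e: "frag_extend (cut Ls) (glue Ls [a, y]) = frag_of [a] \<odot> frag_extend (\<lambda>p. frag_of [clE Ls (frag_of p)]) (repw Ls y)" .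
    have "frag_extend (\<lambda>p. frag_of [clE Ls (frag_of p)]) (repw Ls y) - frag_of [y] \<in> rl KE [omega Ls]"
      using one_slot[OF L.T.abelian_group_axioms, of "\<lambda>p. clE Ls (frag_of p)" Ls "repw Ls y" KE]
        L.cl_extend[of Ls frag_of "repw Ls y"] L.rep_closed[OF y] L.cl_rep[OF y] by (simp add: L.cl_closed)
    from rl_cat_right[OF this, of "frag_of [a]" "[M]"] show ?thesis
      using a unfolding e by (simp add: cat_diff_right)
  qed
  then have "frag_extend (\<lambda>w. frag_extend (cut Ls) (glue Ls w)) c - frag_extend frag_of c \<in> rl KE [M, omega Ls]"
    by (intro rl_extend_fun[OF assms]) (auto simp: words_Cons)
  then show ?thesis by (simp add: frag_extend_extend)
qed

interpretation P: pres "omega (M # Ls)" "M # Ls" "rl KE (M # Ls)" "clE (M # Ls)" "repw (M # Ls)"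
  by (rule omega_pres) (use M L in auto)

interpretation Q: pres "omega [M, omega Ls]" "[M, omega Ls]" "rl KE [M, omega Ls]" "clE [M, omega Ls]" "repw [M, omega Ls]"
  by (rule omega_pres) (use M L omega_bimodule in auto)

lemma split_cl:
  assumes c: "c \<in> wchains (M # Ls)"
  shows "omega_split (M # Ls) 1 (length Ls) (clE (M # Ls) c) = clE [M, omega Ls] (frag_extend (cut Ls) c)"
proof -
  let ?x = "clE (M # Ls) c"
  have r: "repw (M # Ls) ?x \<in> wchains (M # Ls)" by (rule P.rep_closed[OF P.cl_closed[OF c]])
  have B: "bracketing omega (M # Ls) 1 (length Ls) = [M, omega Ls]" by (simp add: bracketing_def)
  have "frag_extend (\<lambda>w. frag_of (bracketing (pureE (take (length Ls) (drop 1 (M # Ls)))) w 1 (length Ls))) (repw (M # Ls) ?x)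
      = frag_extend (cut Ls) (repw (M # Ls) ?x)"
    by (rule frag_extend_cong[OF r]) (auto simp: words_Cons bracketing_def cut_def pureE_eq[OF L] words_length)
  then have "omega_split (M # Ls) 1 (length Ls) ?x = clE [M, omega Ls] (frag_extend (cut Ls) (repw (M # Ls) ?x))"
    using omega_split_rep[of "M # Ls" ?x 1 "length Ls"] M L P.cl_closed[OF c] B by simp
  also have "\<dots> = clE [M, omega Ls] (frag_extend (cut Ls) c)"
    using mor_eqv[OF cut_mor P.rep_cl[OF c]] mor_extend_wchains[OF cut_mor r] mor_extend_wchains[OF cut_mor c]
    by (simp add: Q.cl_eq_iff)
  finally show ?thesis .
qed

text \<open>Injectivity comes from \<open>glue_cut\<close>, surjectivity from
  \<open>cut_glue\<close>. This gives the \<open>inv_into\<close> in the definition of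
  \<open>chi\<close> its intended meaning.\<close>

lemma split_bij: "bij_betw (omega_split (M # Ls) 1 (length Ls)) (carrier (omega (M # Ls))) (carrier (omega [M, omega Ls]))"
proof (rule bij_betw_imageI)
  let ?f = "omega_split (M # Ls) 1 (length Ls)"
  show "inj_on ?f (carrier (omega (M # Ls)))"
  proof (rule inj_onI)
    fix x y assume x: "x \<in> carrier (omega (M # Ls))" and y: "y \<in> carrier (omega (M # Ls))" and e: "?f x = ?f y"
    let ?c = "repw (M # Ls) x" and ?d = "repw (M # Ls) y"
    have c: "?c \<in> wchains (M # Ls)" "?d \<in> wchains (M # Ls)" using P.rep_closed x y by auto
    have "clE [M, omega Ls] (frag_extend (cut Ls) ?c) = clE [M, omega Ls] (frag_extend (cut Ls) ?d)"
      using e split_cl[OF c(1)] split_cl[OF c(2)] P.cl_rep[OF x] P.cl_rep[OF y] by simp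
    then have "frag_extend (cut Ls) ?c - frag_extend (cut Ls) ?d \<in> rl KE [M, omega Ls]"
      using mor_extend_wchains[OF cut_mor c(1)] mor_extend_wchains[OF cut_mor c(2)] by (simp add: Q.cl_eq_iff)
    from mor_eqv[OF glue_mor this] have "?c - ?d \<in> rl KE (M # Ls)"
      using rl_trans[OF rl_trans[OF rl_sym[OF glue_cut[OF c(1)]]] glue_cut[OF c(2)]] by blast
    then show "x = y" using P.cl_eq_iff[OF c] P.cl_rep x y by simp
  qed
  show "?f ` carrier (omega (M # Ls)) = carrier (omega [M, omega Ls])"
  proof (intro equalityI subsetI)
    fix y assume "y \<in> ?f ` carrier (omega (M # Ls))"
    then obtain x where x: "x \<in> carrier (omega (M # Ls))" "y = ?f x" by blast
    then show "y \<in> carrier (omega [M, omega Ls])"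
      using split_cl[OF P.rep_closed[OF x(1)]] mor_extend_wchains[OF cut_mor P.rep_closed[OF x(1)]]
      by (simp add: P.cl_rep Q.cl_closed)
  next
    fix y assume y: "y \<in> carrier (omega [M, omega Ls])"
    let ?c = "frag_extend (glue Ls) (repw [M, omega Ls] y)"
    have r: "repw [M, omega Ls] y \<in> wchains [M, omega Ls]" by (rule Q.rep_closed[OF y])
    have c: "?c \<in> wchains (M # Ls)" by (rule mor_extend_wchains[OF glue_mor r])
    have "?f (clE (M # Ls) ?c) = y"
      using split_cl[OF c] cut_glue[OF r] r mor_extend_wchains[OF cut_mor c] Q.cl_eq_iff Q.cl_rep[OF y] by metis
    then show "y \<in> ?f ` carrier (omega (M # Ls))" using P.cl_closed[OF c] by (metis imageI)
  qed
qed

lemma split_bhom: "omega_split (M # Ls) 1 (length Ls) \<in> bhom (omega (M # Ls)) (omega [M, omega Ls])"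
proof -
  let ?f = "omega_split (M # Ls) 1 (length Ls)" and ?N = "[M, omega Ls]"
  have ah: "?f \<in> ahom (omega (M # Ls)) (omega ?N)"
    by (rule cl_bhom[OF P.pres_axioms Q.pres_axioms split_cl mor_wchains[OF cut_mor]])
  have bl: "bims (M # Ls)" "bims ?N" "M # Ls \<noteq> []" "?N \<noteq> []" using M L omega_bimodule by auto
  \<comment> \<open>The right actions work in the last slot of \<open>Ls\<close>, which after
    \<open>cut\<close> is a right action on the second letter; the successor form of the index
    exposes this.\<close>
  have LL: "length (M # Ls) - 1 = Suc (length Ls - 1)" using L(2) by (cases Ls) auto
  have e: "frag_extend (cut Ls) (sact lact (M # Ls) 0 r c) = sact lact ?N 0 r (frag_extend (cut Ls) c)"
    "frag_extend (cut Ls) (sact lbact (M # Ls) 0 r c) = sact lbact ?N 0 r (frag_extend (cut Ls) c)"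
    "frag_extend (cut Ls) (sact ra (M # Ls) (length (M # Ls) - 1) r c) = sact ra ?N (length ?N - 1) r (frag_extend (cut Ls) c)"
    "frag_extend (cut Ls) (sact rb (M # Ls) (length (M # Ls) - 1) r c) = sact rb ?N (length ?N - 1) r (frag_extend (cut Ls) c)"
    if "c \<in> wchains (M # Ls)" for c r
    using omega_act_cl[OF L, of "frag_of p" r for p]
    unfolding sact_def frag_extend_extend LL
    by (intro frag_extend_cong[OF that]; auto simp: words_Cons cut_def ra_def[of "omega Ls"] rb_def[of "omega Ls"])+
  have "?f (lact (omega (M # Ls)) r x) = lact (omega ?N) r (?f x) \<and> ?f (lbact (omega (M # Ls)) r x) = lbact (omega ?N) r (?f x) \<and>
     ?f (ract (omega (M # Ls)) x r) = ract (omega ?N) (?f x) r \<and> ?f (rbact (omega (M # Ls)) x r) = rbact (omega ?N) (?f x) r"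
    if "x \<in> carrier (omega (M # Ls))" for x r
  proof -
    define c where "c = repw (M # Ls) x"
    have c: "c \<in> wchains (M # Ls)" "x = clE (M # Ls) c"
      unfolding c_def using P.rep_closed[OF that] P.cl_rep[OF that] by simp_all
    have i: "0 < length (M # Ls)" "length (M # Ls) - 1 < length (M # Ls)" by simp_all
    show ?thesis
      unfolding c(2) omega_act_cl[OF bl(1,3) c(1)] split_cl[OF c(1)] omega_act_cl[OF bl(2,4) mor_extend_wchains[OF cut_mor c(1)]]
      using split_cl[OF bims_sact(1)[OF bl(1) i(1) c(1)]] split_cl[OF bims_sact(2)[OF bl(1) i(1) c(1)]]
        split_cl[OF bims_sact(3)[OF bl(1) i(2) c(1)]] split_cl[OF bims_sact(4)[OF bl(1) i(2) c(1)]] e[OF c(1)] by simp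
  qed
  then show ?thesis using ah by (auto simp: bhom_def)
qed

end

lemma inv_bhom:
  assumes f: "f \<in> bhom M N" "bij_betw f (carrier M) (carrier N)" and M: "bimodule M"
  shows "inv_into (carrier M) f \<in> bhom N M"
proof -
  interpret M: bimodule M by fact
  let ?g = "inv_into (carrier M) f"
  have g: "?g y \<in> carrier M" "f (?g y) = y" if "y \<in> carrier N" for y
    using that f(2) by (auto simp: bij_betw_def inv_into_into f_inv_into_f)
  have i: "?g (f x) = x" if "x \<in> carrier M" for x
    using that f(2) by (simp add: bij_betw_def)
  have "?g (y \<oplus>\<^bsub>N\<^esub> z) = ?g y \<oplus>\<^bsub>M\<^esub> ?g z" if "y \<in> carrier N" "z \<in> carrier N" for y z
    using i[of "?g y \<oplus>\<^bsub>M\<^esub> ?g z"] g[OF that(1)] g[OF that(2)] ahom_add[OF bhom_ahom[OF f(1)]] by simp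
  moreover have "?g (lact N r y) = lact M r (?g y) \<and> ?g (lbact N r y) = lbact M r (?g y) \<and>
      ?g (ract N y r) = ract M (?g y) r \<and> ?g (rbact N y r) = rbact M (?g y) r" if "y \<in> carrier N" for y r
    using i[of "lact M r (?g y)"] i[of "lbact M r (?g y)"] i[of "ract M (?g y) r"] i[of "rbact M (?g y) r"]
      g[OF that] bhom_acts[OF f(1) g(1)[OF that]] M.closed by simp
  ultimately show ?thesis using g by (auto simp: bhom_def ahom_def)
qed

section \<open>The universal property of the twofold tensor product\<close>

definition biadd :: "('r, 'u) bimod \<Rightarrow> ('r, 'u) bimod \<Rightarrow> ('r, 'v) bimod \<Rightarrow> ('u \<Rightarrow> 'u \<Rightarrow> 'v) \<Rightarrow> bool" where
  "biadd X Y N h \<longleftrightarrow> (\<forall>a\<in>carrier X. h a \<in> ahom Y N) \<and> (\<forall>b\<in>carrier Y. (\<lambda>a. h a b) \<in> ahom X N) \<and>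
    (\<forall>a\<in>carrier X. \<forall>b\<in>carrier Y. \<forall>r. h (ract X a r) b = h a (lact Y r b) \<and> h (rbact X a r) b = h a (lbact Y r b) \<and>
      h (lact X r a) b = lact N r (h a b) \<and> h (lbact X r a) b = lbact N r (h a b) \<and>
      h a (ract Y b r) = ract N (h a b) r \<and> h a (rbact Y b r) = rbact N (h a b) r)"

abbreviation pr :: "('r::{ring, monoid_mult}, 'a) ubimod \<Rightarrow> ('r, 'a) ubimod \<Rightarrow> ('r, 'a) univ \<Rightarrow> ('r, 'a) univ \<Rightarrow> ('r, 'a) univ" where
  "pr X Y a b \<equiv> clE [X, Y] (frag_of [a, b])"

lemma pr_biadd:
  assumes "bimodule X" "bimodule Y" shows "biadd X Y (omega [X, Y]) (pr X Y)"
proof -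
  have b: "bims [X, Y]" "[X, Y] \<noteq> []" using assms by auto
  interpret P: pres "omega [X, Y]" "[X, Y]" "rl KE [X, Y]" "clE [X, Y]" "repw [X, Y]" by (rule omega_pres[OF b])
  interpret X: bimodule X by fact
  interpret Y: bimodule Y by fact
  have c: "frag_of [a, b] \<in> wchains [X, Y]" if "a \<in> carrier X" "b \<in> carrier Y" for a b using that by simp
  have bal: "clE [X, Y] (frag_of [\<rho> X r a, b]) = clE [X, Y] (frag_of [a, \<beta> Y r b])"
    if "(\<rho>, \<beta>) \<in> KE" "a \<in> carrier X" "b \<in> carrier Y" for \<rho> \<beta> r a b
    using rl_balI[of "[a, b]" "[X, Y]" 0 \<rho> \<beta> KE r] that adm_closed[OF bimodule_adm(2)[OF assms(1)] that(1)]
      adm_closed[OF bimodule_adm(2)[OF assms(2)] that(1)] by (subst P.cl_eq_iff) auto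
  have add1: "pr X Y (a \<oplus>\<^bsub>X\<^esub> a') b = pr X Y a b \<oplus>\<^bsub>omega [X, Y]\<^esub> pr X Y a' b"
    if "a \<in> carrier X" "a' \<in> carrier X" "b \<in> carrier Y" for a a' b
  proof -
    have "frag_of ([] @ (a \<oplus>\<^bsub>X\<^esub> a') # [b]) - frag_of ([] @ a # [b]) - frag_of ([] @ a' # [b]) \<in> mrel [X, Y]"
      by (rule mrelI[where Ps = "[]" and Qs = "[Y]"]) (use that in auto)
    then have "frag_of [a \<oplus>\<^bsub>X\<^esub> a', b] - (frag_of [a, b] + frag_of [a', b]) \<in> rl KE [X, Y]"
      unfolding rl_def by (intro span_base) (simp add: diff_diff_eq)
    then have "clE [X, Y] (frag_of [a \<oplus>\<^bsub>X\<^esub> a', b]) = clE [X, Y] (frag_of [a, b] + frag_of [a', b])"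
      using that by (subst P.cl_eq_iff) auto
    then show ?thesis using that by (simp add: P.cl_add)
  qed
  have add2: "pr X Y a (b \<oplus>\<^bsub>Y\<^esub> b') = pr X Y a b \<oplus>\<^bsub>omega [X, Y]\<^esub> pr X Y a b'"
    if "a \<in> carrier X" "b \<in> carrier Y" "b' \<in> carrier Y" for a b b'
  proof -
    have "frag_of ([a] @ (b \<oplus>\<^bsub>Y\<^esub> b') # []) - frag_of ([a] @ b # []) - frag_of ([a] @ b' # []) \<in> mrel [X, Y]"
      by (rule mrelI[where Ps = "[X]" and Qs = "[]"]) (use that in auto)
    then have "frag_of [a, b \<oplus>\<^bsub>Y\<^esub> b'] - (frag_of [a, b] + frag_of [a, b']) \<in> rl KE [X, Y]"
      unfolding rl_def by (intro span_base) (simp add: diff_diff_eq)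
    then have "clE [X, Y] (frag_of [a, b \<oplus>\<^bsub>Y\<^esub> b']) = clE [X, Y] (frag_of [a, b] + frag_of [a, b'])"
      using that by (subst P.cl_eq_iff) auto
    then show ?thesis using that by (simp add: P.cl_add)
  qed
  show ?thesis
    unfolding biadd_def ahom_def
    using add1 add2 P.cl_closed bal[of ra lact] bal[of rb lbact] omega_act_cl[OF b c]
    by (auto simp: KE_def ra_def rb_def)
qed

lemma biaddD:
  assumes "biadd X Y N h" "a \<in> carrier X" "b \<in> carrier Y"
  shows "h a b \<in> carrier N" "h (ract X a r) b = h a (lact Y r b)" "h (rbact X a r) b = h a (lbact Y r b)"
    "h (lact X r a) b = lact N r (h a b)" "h (lbact X r a) b = lbact N r (h a b)"
    "h a (ract Y b r) = ract N (h a b) r" "h a (rbact Y b r) = rbact N (h a b) r"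
    "a' \<in> carrier X \<Longrightarrow> h (a \<oplus>\<^bsub>X\<^esub> a') b = h a b \<oplus>\<^bsub>N\<^esub> h a' b"
    "b' \<in> carrier Y \<Longrightarrow> h a (b \<oplus>\<^bsub>Y\<^esub> b') = h a b \<oplus>\<^bsub>N\<^esub> h a b'"
  using assms unfolding biadd_def by (auto simp: ahom_def)

text \<open>Balanced biadditive maps kill the relators, hence factor through
  \<open>omega [X, Y]\<close>. The factorisation is written as the very sum used in
  \<open>chi2\<close>, so the binary interchange maps become instances.\<close>

lemma biadd_bhom:
  assumes h: "biadd X Y N h" and b: "bimodule X" "bimodule Y" and N: "bimodule N"
  defines "f \<equiv> \<lambda>x. ext N (\<lambda>w. h (w ! 0) (w ! 1)) (repw [X, Y] x)"
  shows "f \<in> bhom (omega [X, Y]) N" "a \<in> carrier X \<Longrightarrow> b' \<in> carrier Y \<Longrightarrow> f (pr X Y a b') = h a b'"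
proof -
  have bb: "bims [X, Y]" "[X, Y] \<noteq> []" using b by auto
  interpret P: pres "omega [X, Y]" "[X, Y]" "rl KE [X, Y]" "clE [X, Y]" "repw [X, Y]" by (rule omega_pres[OF bb])
  interpret N: bimodule N by fact
  interpret O: bimodule "omega [X, Y]" by (rule omega_bimodule[OF bb(1)])
  let ?h = "\<lambda>w. h (w ! 0) (w ! 1)"
  have hw: "?h \<in> words [X, Y] \<rightarrow> carrier N"
    using biaddD(1)[OF h] by (auto simp: words_Cons)
  have k: "Poly_Mapping.keys c \<subseteq> words [X, Y]" if "c \<in> wchains [X, Y]" for c using that by (simp add: wchains_def)
  have of: "ext N ?h (frag_of [a, b']) = h a b'" if "a \<in> carrier X" "b' \<in> carrier Y" for a b'
    using N.ext_of[of ?h "[a, b']"] biaddD(1)[OF h that] by simp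
  have rels: "ext N ?h z = \<zero>\<^bsub>N\<^esub>" if "z \<in> mrel [X, Y] \<union> bal KE [X, Y]" for z
    using that
  proof
    assume "z \<in> mrel [X, Y]"
    then obtain Ps Z Qs u x y v where z: "z = frag_of (u @ (x \<oplus>\<^bsub>Z\<^esub> y) # v) - frag_of (u @ x # v) - frag_of (u @ y # v)"
      and *: "[X, Y] = Ps @ Z # Qs" "u \<in> words Ps" "x \<in> carrier Z" "y \<in> carrier Z" "v \<in> words Qs"
      by (rule mrelE)
    have ab: "abelian_group Z" using *(1) b bimodule_group by (auto simp: Cons_eq_append_conv)
    interpret Z: abelian_group Z by fact
    have w: "u @ t # v \<in> words [X, Y]" if "t \<in> carrier Z" for t using * that by simp
    have "ext N ?h z = ?h (u @ (x \<oplus>\<^bsub>Z\<^esub> y) # v) \<ominus>\<^bsub>N\<^esub> (?h (u @ x # v) \<oplus>\<^bsub>N\<^esub> ?h (u @ y # v))"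
      unfolding z diff_diff_eq using w[OF *(3)] w[OF *(4)] w[OF Z.a_closed[OF *(3,4)]]
      by (subst N.ext_diff[OF k k hw])
        (auto intro!: wchains_add simp: N.ext_add[OF k k hw] N.ext_of funcset_mem[OF hw] simp del: One_nat_def)
    moreover have "?h (u @ (x \<oplus>\<^bsub>Z\<^esub> y) # v) = ?h (u @ x # v) \<oplus>\<^bsub>N\<^esub> ?h (u @ y # v)"
    proof (cases Ps)
      case Nil
      then have "u = []" "Z = X" "Qs = [Y]" using * by auto
      then show ?thesis using *(3-5) biaddD(8)[OF h] by (auto simp: words_Cons)
    next
      case (Cons P Ps')
      then have "Ps = [X]" "Z = Y" "Qs = []" using *(1) by (auto simp: Cons_eq_append_conv)
      then show ?thesis using *(2-5) biaddD(9)[OF h] by (auto simp: words_Cons)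
    qed
    ultimately show ?thesis
      using funcset_mem[OF hw w[OF *(3)]] funcset_mem[OF hw w[OF *(4)]] by (simp add: a_minus_def N.r_neg)
  next
    assume "z \<in> bal KE [X, Y]"
    then obtain w r \<rho> \<beta> where z: "z = frag_of (wact \<rho> [X, Y] 0 r w) - frag_of (wact \<beta> [X, Y] (Suc 0) r w)"
      and w: "w \<in> words [X, Y]" and K: "(\<rho>, \<beta>) \<in> KE"
      unfolding bal_eq_nth by (auto simp: less_Suc_eq)
    then obtain x y where xy: "w = [x, y]" "x \<in> carrier X" "y \<in> carrier Y" by (auto simp: words_Cons)
    have *: "\<rho> X r x \<in> carrier X" "\<beta> Y r y \<in> carrier Y"
      using adm_closed[OF bimodule_adm(2)[OF b(1)] K xy(2)] adm_closed[OF bimodule_adm(2)[OF b(2)] K xy(3)] by auto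
    have "ext N ?h z = h (\<rho> X r x) y \<ominus>\<^bsub>N\<^esub> h x (\<beta> Y r y)"
      unfolding z using xy * by (simp add: N.ext_diff[OF k k hw] of del: One_nat_def)
    moreover have "h (\<rho> X r x) y = h x (\<beta> Y r y)"
      using K biaddD(2,3)[OF h xy(2,3)] by (auto simp: KE_def ra_def rb_def)
    ultimately show ?thesis using biaddD(1)[OF h xy(2) *(2)] by (simp add: a_minus_def N.r_neg)
  qed
  have kill: "ext N ?h c = \<zero>\<^bsub>N\<^esub>" if "c \<in> rl KE [X, Y]" for c
  proof -
    have s: "mrel [X, Y] \<union> bal KE [X, Y] \<subseteq> wchains [X, Y]" by (rule rels_wchains[OF bims_adm(2)[OF bb(1)]])
    from that have "c \<in> wchains [X, Y] \<and> ext N ?h c = \<zero>\<^bsub>N\<^esub>"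
      unfolding rl_def
    proof (induction rule: span.induct)
      case (span_plus x y)
      then have "x \<in> wchains [X, Y]" using s by auto
      then show ?case using rels[OF span_plus(1)] span_plus(3) by (auto simp: N.ext_add[OF k k hw] simp del: One_nat_def)
    next
      case (span_minus x y)
      then have "x \<in> wchains [X, Y]" using s by auto
      then show ?case using rels[OF span_minus(1)] span_minus(3) by (auto simp: N.ext_diff[OF k k hw] a_minus_def simp del: One_nat_def)
    qed simp
    then show ?thesis by simp
  qed
  have ah: "f \<in> ahom (omega [X, Y]) N"
    unfolding f_def by (rule P.ext_ahom[OF N.abelian_group_axioms hw kill])
  show pure: "f (pr X Y a b') = h a b'" if "a \<in> carrier X" "b' \<in> carrier Y" for a b'
    unfolding f_def using P.ext_cl[OF N.abelian_group_axioms hw kill, of "frag_of [a, b']"] of[OF that] that by simp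
  \<comment> \<open>Compatibility with each action is tested on pure tensors, where it is a clause
    of \<open>biadd\<close>.\<close>
  have eq: "f (A x) = B (f x)" if "A \<in> ahom (omega [X, Y]) (omega [X, Y])" "B \<in> ahom N N" "x \<in> carrier (omega [X, Y])"
    "\<And>a b. a \<in> carrier X \<Longrightarrow> b \<in> carrier Y \<Longrightarrow> f (A (pr X Y a b)) = B (h a b)" for A B x
    by (rule P.eqI[OF N.abelian_group_axioms ahom_comp[OF that(1) ah] ahom_comp[OF ah that(2)] _ that(3)])
      (use that(4) pure in \<open>auto simp: words_Cons\<close>)
  note oa = bimodule_ahom[OF O.bimodule_axioms] and na = bimodule_ahom[OF N.bimodule_axioms]
  note p = biaddD[OF pr_biadd[OF b]] and X = bimodule.closed[OF b(1)] and Y = bimodule.closed[OF b(2)]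
  have "f (lact (omega [X, Y]) r x) = lact N r (f x) \<and> f (lbact (omega [X, Y]) r x) = lbact N r (f x) \<and>
     f (ra (omega [X, Y]) r x) = ra N r (f x) \<and> f (rb (omega [X, Y]) r x) = rb N r (f x)"
    if x: "x \<in> carrier (omega [X, Y])" for x r
  proof (intro conjI)
    show "f (lact (omega [X, Y]) r x) = lact N r (f x)"
      by (rule eq[OF oa(1) na(1) x]) (simp add: p(4)[symmetric] pure X biaddD(4)[OF h])
    show "f (lbact (omega [X, Y]) r x) = lbact N r (f x)"
      by (rule eq[OF oa(2) na(2) x]) (simp add: p(5)[symmetric] pure X biaddD(5)[OF h])
    show "f (ra (omega [X, Y]) r x) = ra N r (f x)"
      by (rule eq[OF oa(3) na(3) x]) (simp add: ra_def p(6)[symmetric] pure Y biaddD(6)[OF h])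
    show "f (rb (omega [X, Y]) r x) = rb N r (f x)"
      by (rule eq[OF oa(4) na(4) x]) (simp add: rb_def p(7)[symmetric] pure Y biaddD(7)[OF h])
  qed
  then show "f \<in> bhom (omega [X, Y]) N" using ah by (auto simp: bhom_def ra_def rb_def)
qed


section \<open>The interchange maps\<close>

definition pair_word :: "('r::{ring, monoid_mult}, 'a) ubimod list \<Rightarrow> ('r, 'a) ubimod list \<Rightarrow>
    ('r, 'a) univ list \<Rightarrow> ('r, 'a) univ list \<Rightarrow> ('r, 'a) univ list" where
  "pair_word Ms Ns u v = map (\<lambda>j. pureE [Ms ! j, Ns ! j] [u ! j, v ! j]) [0..<length Ms]"

definition pair_chain :: "('r::{ring, monoid_mult}, 'a) ubimod list \<Rightarrow> ('r, 'a) ubimod list \<Rightarrow>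
    ('r, 'a) chain \<Rightarrow> ('r, 'a) chain \<Rightarrow> ('r, 'a) chain" where
  "pair_chain Ms Ns c d = frag_extend (\<lambda>u. frag_extend (\<lambda>v. frag_of (pair_word Ms Ns u v)) d) c"

abbreviation prods :: "('r::{ring, monoid_mult}, 'a) ubimod list \<Rightarrow> ('r, 'a) ubimod list \<Rightarrow> ('r, 'a) ubimod list" where
  "prods Ms Ns \<equiv> map2 (\<lambda>M N. omega [M, N]) Ms Ns"

lemma pair_chain_of [simp]: "pair_chain Ms Ns (frag_of u) (frag_of v) = frag_of (pair_word Ms Ns u v)"
  by (simp add: pair_chain_def)

lemma pair_chain_diff_left: "pair_chain Ms Ns (c - c') d = pair_chain Ms Ns c d - pair_chain Ms Ns c' d"
  by (simp add: pair_chain_def frag_extend_diff)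

lemma pair_chain_diff_right: "pair_chain Ms Ns c (d - d') = pair_chain Ms Ns c d - pair_chain Ms Ns c d'"
  by (simp add: pair_chain_def frag_extend_diff frag_extend_diff_fun)

lemma pair_chain_0 [simp]: "pair_chain Ms Ns 0 d = 0" "pair_chain Ms Ns c 0 = 0"
  using pair_chain_diff_left[of Ms Ns 0 0 d] pair_chain_diff_right[of Ms Ns c 0 0] by auto

lemma pair_chain_add_left: "pair_chain Ms Ns (c + c') d = pair_chain Ms Ns c d + pair_chain Ms Ns c' d"
  by (simp add: pair_chain_def frag_extend_add)

lemma pair_chain_add_right: "pair_chain Ms Ns c (d + d') = pair_chain Ms Ns c d + pair_chain Ms Ns c d'"
  by (simp add: pair_chain_def frag_extend_add frag_extend_plus_fun)

lemma rl_mono: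
  assumes "K \<subseteq> K'" shows "rl K Ms \<subseteq> rl K' Ms"
proof
  fix c assume "c \<in> rl K Ms"
  then have "c \<in> span (mrel Ms \<union> bal K Ms)" by (simp add: rl_def)
  then show "c \<in> rl K' Ms"
    unfolding rl_def
    by (rule span_map[where h = "\<lambda>x. x"]) (use bal_mono[OF assms, of Ms] in \<open>auto intro: span_base\<close>)
qed

section \<open>The shuffle of two chains, modulo relations\<close>

context
  fixes Ms Ns :: "('r::{ring, monoid_mult}, 'a) ubimod list"
  assumes bM: "bims Ms" and bN: "bims Ns" and len: "length Ns = length Ms" and ne: "Ms \<noteq> []"
begin

lemma pr_nth:
  assumes "j < length Ms"
  shows "bimodule (Ms ! j)" "bimodule (Ns ! j)" "biadd (Ms ! j) (Ns ! j) (prods Ms Ns ! j) (pr (Ms ! j) (Ns ! j))"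
  using assms len bims_nth[OF bM, of j] bims_nth[OF bN, of j] pr_biadd[of "Ms ! j" "Ns ! j"] by auto

lemma prods_bims: "bims (prods Ms Ns)" "length (prods Ms Ns) = length Ms" "prods Ms Ns \<noteq> []"
proof -
  show "bims (prods Ms Ns)"
    unfolding bims_def
  proof
    fix P assume "P \<in> set (prods Ms Ns)"
    then obtain j where "j < length Ms" "P = omega [Ms ! j, Ns ! j]" using len by (auto simp: in_set_conv_nth)
    then show "bimodule P" using pr_nth by (simp add: omega_bimodule)
  qed
qed (use len ne in auto)

lemma pair_word_nth:
  assumes "u \<in> words Ms" "v \<in> words Ns" "j < length Ms"
  shows "pair_word Ms Ns u v ! j = pr (Ms ! j) (Ns ! j) (u ! j) (v ! j)"
  using assms pureE_eq[of "[Ms ! j, Ns ! j]" "[u ! j, v ! j]"] pr_nth[OF assms(3)] len by (simp add: pair_word_def words_nth)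

lemma pair_word_words: "u \<in> words Ms \<Longrightarrow> v \<in> words Ns \<Longrightarrow> pair_word Ms Ns u v \<in> words (prods Ms Ns)"
  unfolding words_iff_nth[of "pair_word Ms Ns u v"]
  using biaddD(1)[OF pr_nth(3)] pair_word_nth len by (auto simp: pair_word_def words_nth)

lemma pair_chain_wchains:
  assumes "c \<in> wchains Ms" "d \<in> wchains Ns" shows "pair_chain Ms Ns c d \<in> wchains (prods Ms Ns)"
  unfolding pair_chain_def by (intro wchains_extend[OF assms(1)] wchains_extend[OF assms(2)]) (simp add: pair_word_words)

text \<open>In each slot the pairing is balanced over \<open>R^e\<close>. The last two equations
  turn right actions on the first word into left actions on the second, the link between the
  Takeuchi condition on \<open>Ms\<close> and balancing in \<open>Ns\<close>.\<close>

lemma pair_word_acts: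
  assumes u: "u \<in> words Ms" and v: "v \<in> words Ns" and j: "j < length Ms"
  shows "pair_word Ms Ns (wact lact Ms j r u) v = wact lact (prods Ms Ns) j r (pair_word Ms Ns u v)"
    "pair_word Ms Ns (wact lbact Ms j r u) v = wact lbact (prods Ms Ns) j r (pair_word Ms Ns u v)"
    "pair_word Ms Ns u (wact ra Ns j r v) = wact ra (prods Ms Ns) j r (pair_word Ms Ns u v)"
    "pair_word Ms Ns u (wact rb Ns j r v) = wact rb (prods Ms Ns) j r (pair_word Ms Ns u v)"
    "pair_word Ms Ns (wact ra Ms j r u) v = pair_word Ms Ns u (wact lact Ns j r v)"
    "pair_word Ms Ns (wact rb Ms j r u) v = pair_word Ms Ns u (wact lbact Ns j r v)"
proof -
  have jN: "j < length Ns" using j len by simp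
  have l: "length (pair_word Ms Ns u' v') = length Ms" for u' v' by (simp add: pair_word_def)
  have lu: "length u = length Ms" "length v = length Ms" using words_length[OF u] words_length[OF v] len by auto
  note h = biaddD[OF pr_nth(3)[OF j] words_nth[OF u j] words_nth[OF v jN]]
  note wu = bims_wact[OF bM j u] and wv = bims_wact[OF bN jN v]
  show "pair_word Ms Ns (wact lact Ms j r u) v = wact lact (prods Ms Ns) j r (pair_word Ms Ns u v)"
    by (rule nth_equalityI, simp add: l, simp only: l pair_word_nth[OF wu(1) v])
      (auto simp: l pair_word_nth[OF u v] wact_def nth_list_update lu h(4) j jN)
  show "pair_word Ms Ns (wact lbact Ms j r u) v = wact lbact (prods Ms Ns) j r (pair_word Ms Ns u v)"
    by (rule nth_equalityI, simp add: l, simp only: l pair_word_nth[OF wu(2) v])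
      (auto simp: l pair_word_nth[OF u v] wact_def nth_list_update lu h(5) j jN)
  show "pair_word Ms Ns u (wact ra Ns j r v) = wact ra (prods Ms Ns) j r (pair_word Ms Ns u v)"
    by (rule nth_equalityI, simp add: l, simp only: l pair_word_nth[OF u wv(3)])
      (auto simp: l pair_word_nth[OF u v] wact_def nth_list_update lu h(6) j jN ra_def)
  show "pair_word Ms Ns u (wact rb Ns j r v) = wact rb (prods Ms Ns) j r (pair_word Ms Ns u v)"
    by (rule nth_equalityI, simp add: l, simp only: l pair_word_nth[OF u wv(4)])
      (auto simp: l pair_word_nth[OF u v] wact_def nth_list_update lu h(7) j jN rb_def)
  show "pair_word Ms Ns (wact ra Ms j r u) v = pair_word Ms Ns u (wact lact Ns j r v)"
    by (rule nth_equalityI, simp add: l, simp only: l pair_word_nth[OF wu(3) v] pair_word_nth[OF u wv(1)])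
      (auto simp: l wact_def nth_list_update lu h(2) j jN ra_def)
  show "pair_word Ms Ns (wact rb Ms j r u) v = pair_word Ms Ns u (wact lbact Ns j r v)"
    by (rule nth_equalityI, simp add: l, simp only: l pair_word_nth[OF wu(4) v] pair_word_nth[OF u wv(2)])
      (auto simp: l wact_def nth_list_update lu h(3) j jN rb_def)
qed

lemma pair_chain_lift:
  assumes "c \<in> wchains Ms" "d \<in> wchains Ns"
    and "\<And>u v. u \<in> words Ms \<Longrightarrow> v \<in> words Ns \<Longrightarrow> pair_word Ms Ns (f u) (g v) = h (pair_word Ms Ns (f' u) (g' v))"
  shows "pair_chain Ms Ns (frag_extend (\<lambda>u. frag_of (f u)) c) (frag_extend (\<lambda>v. frag_of (g v)) d)
    = frag_extend (\<lambda>w. frag_of (h w)) (pair_chain Ms Ns (frag_extend (\<lambda>u. frag_of (f' u)) c) (frag_extend (\<lambda>v. frag_of (g' v)) d))"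
  unfolding pair_chain_def frag_extend_extend frag_extend_of
  by (intro frag_extend_cong[OF assms(1)] frag_extend_cong[OF assms(2)]) (simp add: assms(3))

lemma pair_chain_acts:
  assumes c: "c \<in> wchains Ms" "d \<in> wchains Ns" and j: "j < length Ms"
  shows "pair_chain Ms Ns (sact lact Ms j r c) d = sact lact (prods Ms Ns) j r (pair_chain Ms Ns c d)"
    "pair_chain Ms Ns (sact lbact Ms j r c) d = sact lbact (prods Ms Ns) j r (pair_chain Ms Ns c d)"
    "pair_chain Ms Ns c (sact ra Ns j r d) = sact ra (prods Ms Ns) j r (pair_chain Ms Ns c d)"
    "pair_chain Ms Ns c (sact rb Ns j r d) = sact rb (prods Ms Ns) j r (pair_chain Ms Ns c d)"
    "pair_chain Ms Ns (sact ra Ms j r c) d = pair_chain Ms Ns c (sact lact Ns j r d)"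
    "pair_chain Ms Ns (sact rb Ms j r c) d = pair_chain Ms Ns c (sact lbact Ns j r d)"
  unfolding sact_def
  using pair_chain_lift[OF c, of "wact lact Ms j r" "\<lambda>v. v" "wact lact (prods Ms Ns) j r" "\<lambda>v. v" "\<lambda>v. v"]
    pair_chain_lift[OF c, of "wact lbact Ms j r" "\<lambda>v. v" "wact lbact (prods Ms Ns) j r" "\<lambda>v. v" "\<lambda>v. v"]
    pair_chain_lift[OF c, of "\<lambda>v. v" "wact ra Ns j r" "wact ra (prods Ms Ns) j r" "\<lambda>v. v" "\<lambda>v. v"]
    pair_chain_lift[OF c, of "\<lambda>v. v" "wact rb Ns j r" "wact rb (prods Ms Ns) j r" "\<lambda>v. v" "\<lambda>v. v"]
    pair_chain_lift[OF c, of "wact ra Ms j r" "\<lambda>v. v" "\<lambda>v. v" "\<lambda>v. v" "wact lact Ns j r"]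
    pair_chain_lift[OF c, of "wact rb Ms j r" "\<lambda>v. v" "\<lambda>v. v" "\<lambda>v. v" "wact lbact Ns j r"]
    pair_word_acts[OF _ _ j, of _ _ r] by simp_all

text \<open>With the second word fixed, the pairing is a letterwise map of the first. The actions in
  \<open>KR\<close> are left actions and reach the products from the outside, so this map respects
  them in every slot.\<close>

lemma pair_chain_rl_left:
  assumes c: "c \<in> rl KR Ms" and d: "d \<in> wchains Ns"
  shows "pair_chain Ms Ns c d \<in> rl KR (prods Ms Ns)"
proof -
  have "frag_extend (\<lambda>u. frag_of (pair_word Ms Ns u v)) c \<in> rl KR (prods Ms Ns)" if v: "v \<in> words Ns" for v
  proof -
    let ?hs = "map (\<lambda>j x. pr (Ms ! j) (Ns ! j) x (v ! j)) [0..<length Ms]"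
    have "slotmap True True KR (Ms ! j) (prods Ms Ns ! j) (?hs ! j)" if j: "j < length Ms" for j
    proof -
      have y: "v ! j \<in> carrier (Ns ! j)" using words_nth[OF v] j len by simp
      have "(\<lambda>x. pr (Ms ! j) (Ns ! j) x (v ! j)) \<in> ahom (Ms ! j) (prods Ms Ns ! j)"
        using pr_nth(3)[OF j] y by (simp add: biadd_def)
      then show ?thesis
        using biaddD(4,5)[OF pr_nth(3)[OF j] _ y] j by (auto simp: slotmap_def KR_def)
    qed
    then have "mor True True KR Ms (prods Ms Ns) (\<lambda>u. frag_of (smap ?hs u))"
      using prods_bims bims_adm(1)[OF bM] bims_adm(1)[OF prods_bims(1)] by (intro mor_smap) (auto simp: ne)
    then have m: "mor True True KR Ms (prods Ms Ns) (\<lambda>u. frag_of (pair_word Ms Ns u v))"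
    proof (rule mor_cong)
      fix u assume u: "u \<in> words Ms"
      have "smap ?hs u = pair_word Ms Ns u v"
        by (rule nth_equalityI) (use u in \<open>auto simp: pair_word_nth[OF u v] words_length, simp add: pair_word_def\<close>)
      then show "frag_of (smap ?hs u) = frag_of (pair_word Ms Ns u v)" by simp
    qed
    show ?thesis by (rule mor_rl[OF m c])
  qed
  then have "frag_extend (\<lambda>v. frag_extend (\<lambda>u. frag_of (pair_word Ms Ns u v)) c) d \<in> rl KR (prods Ms Ns)"
    unfolding rl_def by (intro frag_extend_in_span[OF d])
  then show ?thesis unfolding pair_chain_def by (subst frag_extend_swap)
qed

text \<open>
  A balancing relator of the second factor moves, through the balancing over \<open>R\<^sup>e\<close>, to right
  actions on neighbouring letters of the first factor, which the Takeuchi condition on \<open>c\<close> equates.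
\<close>

lemma pair_chain_rl_right:
  assumes c: "c \<in> wchains Ms" "takeuchi Ms c" and d: "d \<in> rl KR Ns"
  shows "pair_chain Ms Ns c d \<in> rl KR (prods Ms Ns)"
proof -
  have 1: "pair_chain Ms Ns c z \<in> rl KR (prods Ms Ns)" if z: "z \<in> mrel Ns" for z
  proof -
    have "frag_extend (\<lambda>v. frag_of (pair_word Ms Ns u v)) z \<in> rl KR (prods Ms Ns)" if u: "u \<in> words Ms" for u
    proof -
      let ?hs = "map (\<lambda>j. pr (Ms ! j) (Ns ! j) (u ! j)) [0..<length Ms]"
      \<comment> \<open>For additivity relators of the second word the empty balancing suffices, and
        the first chain may be treated word by word.\<close>
      have "slotmap True True {} (Ns ! j) (prods Ms Ns ! j) (?hs ! j)" if j: "j < length Ms" for j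
        using pr_nth(3)[OF j] words_nth[OF u j] j by (simp add: biadd_def slotmap_def)
      moreover have "\<forall>M\<in>set Ns. adm {} M" "\<forall>M\<in>set (prods Ms Ns). adm {} M"
        using bN prods_bims(1) by (auto simp: adm_def bims_def bimodule_group)
      ultimately have "mor True True {} Ns (prods Ms Ns) (\<lambda>v. frag_of (smap ?hs v))"
        using prods_bims len ne by (intro mor_smap) auto
      then have m: "mor True True {} Ns (prods Ms Ns) (\<lambda>v. frag_of (pair_word Ms Ns u v))"
      proof (rule mor_cong)
        fix v assume v: "v \<in> words Ns"
        have "smap ?hs v = pair_word Ms Ns u v"
          by (rule nth_equalityI) (use v len in \<open>auto simp: pair_word_nth[OF u v] words_length, simp add: pair_word_def\<close>)
        then show "frag_of (smap ?hs v) = frag_of (pair_word Ms Ns u v)" by simp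
      qed
      have "frag_extend (\<lambda>v. frag_of (pair_word Ms Ns u v)) z \<in> rl {} (prods Ms Ns)"
        by (rule mor_rels[OF m]) (use z in simp)
      then show ?thesis using rl_mono[of "{}" KR] by blast
    qed
    then show ?thesis
      unfolding pair_chain_def rl_def by (intro frag_extend_in_span[OF c(1)])
  qed
  have 2: "pair_chain Ms Ns c z \<in> rl KR (prods Ms Ns)" if zb: "z \<in> bal KR Ns" for z
  proof -
    obtain w j r where z: "z = frag_of (wact lbact Ns j r w) - frag_of (wact lact Ns (Suc j) r w)"
      and w: "w \<in> words Ns" "Suc j < length Ns"
      using zb unfolding bal_eq_nth KR_def by auto
    have j: "Suc j < length Ms" "j < length Ms" using w(2) len by auto
    have fw: "frag_of w \<in> wchains Ns" using w(1) by simp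
    have "pair_chain Ms Ns c z = pair_chain Ms Ns (sact rb Ms j r c - sact ra Ms (Suc j) r c) (frag_of w)"
      unfolding z pair_chain_diff_right pair_chain_diff_left
      using pair_chain_acts(6)[OF c(1) fw j(2), of r] pair_chain_acts(5)[OF c(1) fw j(1), of r] by simp
    then show ?thesis using pair_chain_rl_left[OF _ fw] c(2) j by (simp add: takeuchi_def)
  qed
  show ?thesis
    using d unfolding rl_def
    by (rule span_map) (use 1 2 in \<open>auto simp: pair_chain_add_right pair_chain_diff_right rl_def\<close>)
qed

text \<open>The second argument is exchanged first, while the Takeuchi chain \<open>c\<close> stands
  in the first place; then \<open>c\<close> is exchanged against the fixed chain
  \<open>d'\<close>.\<close>

lemma pair_chain_eqv:
  assumes "c \<in> wchains Ms" "takeuchi Ms c" "d' \<in> wchains Ns" "c - c' \<in> rl KR Ms" "d - d' \<in> rl KR Ns"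
  shows "pair_chain Ms Ns c d - pair_chain Ms Ns c' d' \<in> rl KR (prods Ms Ns)"
  using rl_add[OF pair_chain_rl_right[OF assms(1,2,5)] pair_chain_rl_left[OF assms(4,3)]]
  by (simp add: pair_chain_diff_left pair_chain_diff_right)

text \<open>Right actions on the products fall on the second letters, where their difference is a
  relation by the condition on \<open>d\<close>. The condition on \<open>c\<close> ensures that
  pairing preserves this relation.\<close>

lemma takeuchi_pair_chain:
  assumes c: "c \<in> wchains Ms" "takeuchi Ms c" and d: "d \<in> wchains Ns" "takeuchi Ns d"
  shows "takeuchi (prods Ms Ns) (pair_chain Ms Ns c d)"
  unfolding takeuchi_def
proof (intro allI impI)
  fix j s assume "Suc j < length (prods Ms Ns)"
  then have j: "Suc j < length Ms" "j < length Ms" using len by auto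
  have "pair_chain Ms Ns c (sact rb Ns j s d - sact ra Ns (Suc j) s d) \<in> rl KR (prods Ms Ns)"
    using pair_chain_rl_right[OF c] d(2) j len by (simp add: takeuchi_def)
  then show "sact rb (prods Ms Ns) j s (pair_chain Ms Ns c d) - sact ra (prods Ms Ns) (Suc j) s (pair_chain Ms Ns c d) \<in> rl KR (prods Ms Ns)"
    by (simp add: pair_chain_diff_right pair_chain_acts(3)[OF c(1) d(1) j(1)] pair_chain_acts(4)[OF c(1) d(1) j(2)])
qed

definition lpair :: "('r, 'a) univ \<Rightarrow> ('r, 'a) univ \<Rightarrow> ('r, 'a) univ" where
  "lpair x y = clR (prods Ms Ns) (pair_chain Ms Ns (repw Ms x) (repw Ns y))"

lemma neN: "Ns \<noteq> []" using len ne by auto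

lemma lpair_cl:
  assumes "c \<in> wchains Ms" "takeuchi Ms c" "d \<in> wchains Ns"
  shows "lpair (clR Ms c) (clR Ns d) = clR (prods Ms Ns) (pair_chain Ms Ns c d)"
proof -
  interpret P: pres "tensorR Ms" Ms "rl KR Ms" "clR Ms" "repw Ms" by (rule tensorR_pres[OF bM ne])
  interpret Q: pres "tensorR Ns" Ns "rl KR Ns" "clR Ns" "repw Ns" by (rule tensorR_pres[OF bN neN])
  interpret S: pres "tensorR (prods Ms Ns)" "prods Ms Ns" "rl KR (prods Ms Ns)" "clR (prods Ms Ns)" "repw (prods Ms Ns)"
    by (rule tensorR_pres[OF prods_bims(1,3)])
  note r = P.rep_closed[OF P.cl_closed[OF assms(1)]] Q.rep_closed[OF Q.cl_closed[OF assms(3)]]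
  have "pair_chain Ms Ns c d - pair_chain Ms Ns (repw Ms (clR Ms c)) (repw Ns (clR Ns d)) \<in> rl KR (prods Ms Ns)"
    by (rule pair_chain_eqv[OF assms(1,2) r(2) rl_sym[OF P.rep_cl[OF assms(1)]] rl_sym[OF Q.rep_cl[OF assms(3)]]])
  then show ?thesis
    unfolding lpair_def using pair_chain_wchains[OF assms(1,3)] pair_chain_wchains[OF r] by (metis S.cl_eq_iff)
qed

text \<open>Together with \<open>biadd_bhom\<close> this makes the binary interchange a well-defined
  bimodule map with values in the Takeuchi product.\<close>

lemma lpair_biadd: "biadd (lam Ms) (lam Ns) (lam (prods Ms Ns)) lpair"
proof -
  interpret P: pres "tensorR Ms" Ms "rl KR Ms" "clR Ms" "repw Ms" by (rule tensorR_pres[OF bM ne])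
  interpret Q: pres "tensorR Ns" Ns "rl KR Ns" "clR Ns" "repw Ns" by (rule tensorR_pres[OF bN neN])
  interpret S: pres "tensorR (prods Ms Ns)" "prods Ms Ns" "rl KR (prods Ms Ns)" "clR (prods Ms Ns)" "repw (prods Ms Ns)"
    by (rule tensorR_pres[OF prods_bims(1,3)])
  let ?c = "repw Ms" and ?d = "repw Ns"
  have closed: "lpair x y \<in> carrier (lam (prods Ms Ns))" if "x \<in> carrier (lam Ms)" "y \<in> carrier (lam Ns)" for x y
    unfolding lpair_def using lam_rep[OF bM ne that(1)] lam_rep[OF bN neN that(2)]
    by (subst lam_carrier(2)[OF prods_bims(1,3)]) (auto intro: pair_chain_wchains takeuchi_pair_chain)
  have add1: "lpair (x \<oplus>\<^bsub>lam Ms\<^esub> x') y = lpair x y \<oplus>\<^bsub>lam (prods Ms Ns)\<^esub> lpair x' y"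
    if "x \<in> carrier (lam Ms)" "x' \<in> carrier (lam Ms)" "y \<in> carrier (lam Ns)" for x x' y
  proof -
    note c = lam_rep[OF bM ne that(1)] and c' = lam_rep[OF bM ne that(2)] and d = lam_rep[OF bN neN that(3)]
    have "x \<oplus>\<^bsub>lam Ms\<^esub> x' = clR Ms (?c x + ?c x')"
      by (simp add: lam_sel[OF bM ne] P.cl_add c c')
    then show ?thesis
      using lpair_cl[OF wchains_add[OF c(1) c'(1)] takeuchi_add[OF c(2) c'(2)] d(1)]
      by (simp add: d lpair_def pair_chain_add_left lam_sel[OF prods_bims(1,3)] S.cl_add pair_chain_wchains c c')
  qed
  have add2: "lpair x (y \<oplus>\<^bsub>lam Ns\<^esub> y') = lpair x y \<oplus>\<^bsub>lam (prods Ms Ns)\<^esub> lpair x y'"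
    if "x \<in> carrier (lam Ms)" "y \<in> carrier (lam Ns)" "y' \<in> carrier (lam Ns)" for x y y'
  proof -
    note c = lam_rep[OF bM ne that(1)] and d = lam_rep[OF bN neN that(2)] and d' = lam_rep[OF bN neN that(3)]
    have "y \<oplus>\<^bsub>lam Ns\<^esub> y' = clR Ns (?d y + ?d y')"
      by (simp add: lam_sel[OF bN neN] Q.cl_add d d')
    then show ?thesis
      using lpair_cl[OF c(1,2) wchains_add[OF d(1) d'(1)]]
      by (simp add: c lpair_def pair_chain_add_right lam_sel[OF prods_bims(1,3)] S.cl_add pair_chain_wchains d d')
  qed
  have acts: "lpair (ract (lam Ms) x r) y = lpair x (lact (lam Ns) r y) \<and> lpair (rbact (lam Ms) x r) y = lpair x (lbact (lam Ns) r y) \<and>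
      lpair (lact (lam Ms) r x) y = lact (lam (prods Ms Ns)) r (lpair x y) \<and> lpair (lbact (lam Ms) r x) y = lbact (lam (prods Ms Ns)) r (lpair x y) \<and>
      lpair x (ract (lam Ns) y r) = ract (lam (prods Ms Ns)) (lpair x y) r \<and> lpair x (rbact (lam Ns) y r) = rbact (lam (prods Ms Ns)) (lpair x y) r"
    if "x \<in> carrier (lam Ms)" "y \<in> carrier (lam Ns)" for x y r
  proof -
    note c = lam_rep[OF bM ne that(1)] and d = lam_rep[OF bN neN that(2)]
    have l: "0 < length Ms" "length Ms - 1 < length Ms" "0 < length Ns" "length Ns - 1 < length Ns"
      "length Ns - 1 = length Ms - 1" "length (prods Ms Ns) - 1 = length Ms - 1"
      using ne len neN by auto
    note a = lam_act_cl[OF bM ne c(1), unfolded c(3)] lam_act_cl[OF bN neN d(1), unfolded d(3)]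
    note t = takeuchi_acts[OF bM ne c(1,2)] and s = bims_sact[OF bM l(1) c(1)] bims_sact[OF bM l(2) c(1)]
      bims_sact[OF bN l(3) d(1)] bims_sact[OF bN l(4) d(1)]
    have x: "lpair (clR Ms c') y = clR (prods Ms Ns) (pair_chain Ms Ns c' (?d y))" if "c' \<in> wchains Ms" "takeuchi Ms c'" for c'
      using lpair_cl[OF that d(1)] d(3) by simp
    have y: "lpair x (clR Ns d') = clR (prods Ms Ns) (pair_chain Ms Ns (?c x) d')" if "d' \<in> wchains Ns" for d'
      using lpair_cl[OF c(1,2) that] c(3) by simp
    show ?thesis
      unfolding a x[OF s(1) t(1)] x[OF s(6) t(2)] x[OF s(3) t(3)] x[OF s(8) t(4)]
        y[OF s(9)] y[OF s(14)] y[OF s(11)] y[OF s(16)]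
      using pair_chain_acts[OF c(1) d(1) l(1), of r] pair_chain_acts[OF c(1) d(1) l(2), of r]
      unfolding lpair_def lam_act_cl[OF prods_bims(1,3) pair_chain_wchains[OF c(1) d(1)]] l(5,6) by simp
  qed
  show ?thesis
    unfolding biadd_def ahom_def using closed add1 add2 acts by auto
qed

end

lemma EndR_biadd:
  "biadd EndR EndR EndR (\<lambda>f g. Endo (the_endo f \<circ> the_endo g))"
  by (auto simp: biadd_def ahom_def EndR_def)

lemma chi2_bhom_0:
  "chi2 [] [] \<in> bhom (omega [EndR, EndR]) EndR"
  "f \<in> carrier EndR \<Longrightarrow> g \<in> carrier EndR \<Longrightarrow> chi2 [] [] (pr EndR EndR f g) = Endo (the_endo f \<circ> the_endo g)"
proof -
  have E: "bimodule EndR" by (rule EndR_bimodule)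
  have O: "bimodule (omega [EndR, EndR])" by (rule omega_bimodule) (simp add: E)
  note h = biadd_bhom[OF EndR_biadd E E E]
  have e: "chi2 [] [] x = ext EndR (\<lambda>w. Endo (the_endo (w ! 0) \<circ> the_endo (w ! 1))) (repw [EndR, EndR] x)"
    if "x \<in> carrier (omega [EndR, EndR])" for x
    using that by (simp add: chi2_def lam_Nil addext_eq_ext repw_def)
  show b: "chi2 [] [] \<in> bhom (omega [EndR, EndR]) EndR"
    by (rule bhom_cong[OF O h(1) e])
  show "chi2 [] [] (pr EndR EndR f g) = Endo (the_endo f \<circ> the_endo g)" if "f \<in> carrier EndR" "g \<in> carrier EndR"
    using h(2)[OF that] e[OF biaddD(1)[OF pr_biadd[OF E E] that]] by simp
qed

text \<open>\<open>chi2\<close> is identified with the map given by the universal property for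
  \<open>lpair\<close>. One factor is a separate case because \<open>chi2\<close> is the identity
  there.\<close>

lemma chi2_bhom_ne:
  assumes b: "bims Ms" "bims Ns" "length Ns = length Ms" "Ms \<noteq> []"
  shows "chi2 Ms Ns \<in> bhom (omega [lam Ms, lam Ns]) (lam (prods Ms Ns))"
    "x \<in> carrier (lam Ms) \<Longrightarrow> y \<in> carrier (lam Ns) \<Longrightarrow> chi2 Ms Ns (pr (lam Ms) (lam Ns) x y) = lpair Ms Ns x y"
proof -
  let ?Ps = "prods Ms Ns"
  note pb = prods_bims[OF b]
  have L: "bimodule (lam Ms)" "bimodule (lam Ns)" "bimodule (lam ?Ps)" using b pb by (auto simp: lam_bimodule)
  have O: "bimodule (omega [lam Ms, lam Ns])" by (rule omega_bimodule) (simp add: L)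
  note h = biadd_bhom[OF lpair_biadd[OF b] L]
  interpret T: bimodule "tensorR ?Ps" by (rule tensorR_bimodule[OF pb(1,3)])
  interpret Q: pres "omega [lam Ms, lam Ns]" "[lam Ms, lam Ns]" "rl KE [lam Ms, lam Ns]" "clE [lam Ms, lam Ns]" "repw [lam Ms, lam Ns]"
    by (rule omega_pres) (use L in auto)
  interpret S: pres "tensorR ?Ps" ?Ps "rl KR ?Ps" "clR ?Ps" "repw ?Ps" by (rule tensorR_pres[OF pb(1,3)])
  have e: "chi2 Ms Ns x = ext (lam ?Ps) (\<lambda>w. lpair Ms Ns (w ! 0) (w ! 1)) (repw [lam Ms, lam Ns] x)"
    if x: "x \<in> carrier (omega [lam Ms, lam Ns])" for x
  proof -
    have k: "Poly_Mapping.keys (repw [lam Ms, lam Ns] x) \<subseteq> words [lam Ms, lam Ns]"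
      using Q.rep_closed[OF x] by (simp add: wchains_def)
    have hw: "(\<lambda>w. lpair Ms Ns (w ! 0) (w ! 1)) \<in> words [lam Ms, lam Ns] \<rightarrow> carrier (lam ?Ps)"
      using biaddD(1)[OF lpair_biadd[OF b]] by (auto simp: words_Cons)
    \<comment> \<open>\<open>chi2\<close> sums in the ambient tensor product, the universal property
      in the Takeuchi product; the inclusion is additive, so the sums agree.\<close>
    have "(\<lambda>x. x) \<in> ahom (lam ?Ps) (tensorR ?Ps)"
      using lam_carrier(1)[OF pb(1,3)] by (auto simp: ahom_def lam_sel[OF pb(1,3)])
    from ahom_ext[OF bimodule_group[OF L(3)] T.abelian_group_axioms this hw k]
    have lt: "ext (lam ?Ps) (\<lambda>w. lpair Ms Ns (w ! 0) (w ! 1)) (repw [lam Ms, lam Ns] x) =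
      ext (tensorR ?Ps) (\<lambda>w. lpair Ms Ns (w ! 0) (w ! 1)) (repw [lam Ms, lam Ns] x)" .
    show ?thesis
    proof (cases "length Ms = 1")
      \<comment> \<open>Here \<open>lpair\<close> is the pure tensor in \<open>omega [M, N]\<close>,
        and summing the pure tensors of a representative of \<open>x\<close> gives back
        \<open>x\<close>.\<close>
      case True
      then obtain M N where MN: "Ms = [M]" "Ns = [N]" using b(3) by (auto simp: length_Suc_conv)
      have l1: "lam [M] = M" "lam [N] = N" by (auto simp: lam_def tensorR_def)
      have bb: "bimodule M" "bimodule N" using b MN by auto
      have P1: "?Ps = [omega [M, N]]" by (simp add: MN)
      have "lpair Ms Ns (w ! 0) (w ! 1) = clE [M, N] (frag_of w)" if "w \<in> words [M, N]" for w
      proof -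
        obtain a b' where w: "w = [a, b']" "a \<in> carrier M" "b' \<in> carrier N" using \<open>w \<in> words [M, N]\<close> by (auto simp: words_Cons)
        have pc: "pr M N a b' \<in> carrier (omega [M, N])" by (rule biaddD(1)[OF pr_biadd[OF bb] w(2,3)])
        have "pureE [M, N] [a, b'] = pr M N a b'" by (rule pureE_eq) (use bb w in auto)
        then show ?thesis
          unfolding lpair_def[OF b]
          using w pc cls_of[of ?Ps "[pr M N a b']" "bal KR ?Ps"] omega_bimodule[of "[M, N]"] bb
          by (simp add: MN repw_def pair_word_def bimodule_group)
      qed
      then have "ext (tensorR ?Ps) (\<lambda>w. lpair Ms Ns (w ! 0) (w ! 1)) (repw [lam Ms, lam Ns] x)
        = ext (tensorR ?Ps) (\<lambda>w. clE [M, N] (frag_of w)) (repw [lam Ms, lam Ns] x)"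
        using k hw lam_carrier(1)[OF pb(1,3)]
        by (intro ext_cong[OF T.abelian_group_axioms]) (auto simp: MN l1 simp del: One_nat_def)
      also have T1: "tensorR ?Ps = omega [M, N]" by (simp add: P1 tensorR_def)
      also have "ext (omega [M, N]) (\<lambda>w. clE [M, N] (frag_of w)) (repw [lam Ms, lam Ns] x) = x"
        using Q.cl_extend[of "[lam Ms, lam Ns]" frag_of "repw [lam Ms, lam Ns] x"] Q.rep_closed[OF x] Q.cl_rep[OF x]
        by (simp add: MN l1)
      finally show ?thesis unfolding lt T1 using x True by (simp add: chi2_def)
    next
      case False
      have "tclass ?Ps (balR ?Ps) (frag_extend (\<lambda>u. frag_extend
               (\<lambda>v. frag_of (map (\<lambda>j. pureE [Ms ! j, Ns ! j] [u ! j, v ! j]) [0..<length Ms]))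
               (chain_of (w ! 1))) (chain_of (w ! 0))) = lpair Ms Ns (w ! 0) (w ! 1)" for w
        using False b(3) unfolding lpair_def[OF b] pair_chain_def pair_word_def cls_def repw_def balR_eq by simp
      then show ?thesis
        unfolding lt using x False b(4) by (simp add: chi2_def Let_def addext_eq_ext repw_def)
    qed
  qed
  show bh: "chi2 Ms Ns \<in> bhom (omega [lam Ms, lam Ns]) (lam ?Ps)"
    by (rule bhom_cong[OF O h(1) e])
  show "chi2 Ms Ns (pr (lam Ms) (lam Ns) x y) = lpair Ms Ns x y" if "x \<in> carrier (lam Ms)" "y \<in> carrier (lam Ns)"
    using h(2)[OF that] e[OF biaddD(1)[OF pr_biadd[OF L(1,2)] that]] by simp
qed

lemma chi2_bhom:
  assumes "bims Ms" "bims Ns" "length Ns = length Ms"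
  shows "chi2 Ms Ns \<in> bhom (omega [lam Ms, lam Ns]) (lam (prods Ms Ns))"
  using chi2_bhom_ne(1)[OF assms] chi2_bhom_0(1) assms(3) by (cases "Ms = []") (auto simp: lam_Nil)

lemma at_pos_nth: "length (at_pos i p f) = Suc p" "j < Suc p \<Longrightarrow> at_pos i p f ! j = (if j = i then f else id)"
  by (auto simp: at_pos_def nth_list_update simp del: replicate_Suc)

lemma smap_at_pos:
  assumes "length u = i" "length v = p - i" "i \<le> p" shows "smap (at_pos i p f) (u @ x # v) = u @ f x # v"
  by (rule nth_equalityI) (use assms in \<open>auto simp: at_pos_nth nth_append nth_Cons split: nat.split\<close>)

text \<open>The map \<open>unsplit\<close> inside \<open>chi\<close>, for a column of equal
  factors.\<close>

definition unsp :: "('r::{ring, monoid_mult}, 'a) ubimod \<Rightarrow> nat \<Rightarrow> ('r, 'a) univ \<Rightarrow> ('r, 'a) univ" where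
  "unsp A p = inv_into (carrier (omega (replicate (Suc p) A))) (omega_split (replicate (Suc p) A) 1 p)"

lemma omega_single: "omega [M] = M"
  by (simp add: omega_def)

lemma lam_single: "lam [M] = M"
  by (simp add: lam_def tensorR_def)

lemma omega_map_pr:
  assumes "bimodule M" "bimodule N" "bimodule M'" "bimodule N'" "f \<in> bhom M M'" "g \<in> bhom N N'" "a \<in> carrier M" "b \<in> carrier N"
  shows "omega_map [f, g] [M, N] [M', N'] (pr M N a b) = pr M' N' (f a) (g b)"
  using omega_map_cl(2)[of "[f, g]" "[M, N]" "[M', N']" "frag_of [a, b]"] assms by simp

lemma split_pure:
  assumes "bimodule M" "bims Ls" "Ls \<noteq> []" "x \<in> carrier M" "ys \<in> words Ls"
  shows "omega_split (M # Ls) 1 (length Ls) (pureE (M # Ls) (x # ys)) = pr M (omega Ls) x (pureE Ls ys)"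
proof -
  have "pureE (M # Ls) (x # ys) = clE (M # Ls) (frag_of (x # ys))" "pureE Ls ys = clE Ls (frag_of ys)"
    using assms by (auto intro!: pureE_eq)
  then show ?thesis using split_cl[OF assms(1-3), of "frag_of (x # ys)"] assms by (simp add: cut_def)
qed

lemma split_last_ident:
  assumes "bimodule M" "bimodule N" "x \<in> carrier (omega [M, N])"
  shows "omega_split [M, N] 1 1 x = x"
proof -
  interpret P: pres "omega [M, N]" "[M, N]" "rl KE [M, N]" "clE [M, N]" "repw [M, N]"
    by (rule omega_pres) (use assms in auto)
  have r: "repw [M, N] x \<in> wchains [M, N]" by (rule P.rep_closed[OF assms(3)])
  have "frag_extend (cut [N]) (repw [M, N] x) = frag_extend frag_of (repw [M, N] x)"
  proof (rule frag_extend_cong[OF r])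
    fix w assume "w \<in> words [M, N]"
    then obtain a b where "w = [a, b]" "a \<in> carrier M" "b \<in> carrier N" by (auto simp: words_Cons)
    then show "cut [N] w = frag_of w"
      using cls_of[of "[N]" "[b]" "bal KE [N]"] bimodule_group[OF assms(2)] by (simp add: cut_def)
  qed
  then show ?thesis
    using split_cl[of M "[N]" "repw [M, N] x"] r P.cl_rep[OF assms(3)] assms(1,2) by (simp add: omega_single)
qed

section \<open>Iterated interchange for equal rows\<close>

context
  fixes A :: "('r::{ring, monoid_mult}, 'a) ubimod"
  assumes A: "bimodule A"
begin

lemma unsp_bhom:
  assumes "p > 0" shows "unsp A p \<in> bhom (omega [A, omega (replicate p A)]) (omega (replicate (Suc p) A))"
  unfolding unsp_def
  using inv_bhom[OF split_bhom[of A "replicate p A"] split_bij[of A "replicate p A"]] assms A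
    omega_bimodule[of "replicate (Suc p) A"] by simp

lemma unsp_pure:
  assumes "p > 0" "a \<in> carrier A" "w \<in> words (replicate p A)"
  shows "unsp A p (pr A (omega (replicate p A)) a (pureE (replicate p A) w)) = pureE (replicate (Suc p) A) (a # w)"
proof -
  have "omega_split (replicate (Suc p) A) 1 p (pureE (replicate (Suc p) A) (a # w)) = pr A (omega (replicate p A)) a (pureE (replicate p A) w)"
    using split_pure[of A "replicate p A" a w] assms A by simp
  moreover have "pureE (replicate (Suc p) A) (a # w) \<in> carrier (omega (replicate (Suc p) A))"
    by (rule pureE_closed) (use assms A in auto)
  moreover have "inj_on (omega_split (replicate (Suc p) A) 1 p) (carrier (omega (replicate (Suc p) A)))"
    using split_bij[of A "replicate p A"] assms A by (simp add: bij_betw_def)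
  ultimately show ?thesis unfolding unsp_def by (metis inv_into_f_f)
qed

text \<open>The block collapsed by the splitting has one letter, and a one-letter class is that
  letter.\<close>

lemma unsp_1:
  assumes "x \<in> carrier (omega [A, A])" shows "unsp A 1 x = x"
proof -
  have i: "omega_split [A, A] 1 1 y = y" if "y \<in> carrier (omega [A, A])" for y
    by (rule split_last_ident[OF A A that])
  have "inv_into (carrier (omega [A, A])) (omega_split [A, A] 1 1) (omega_split [A, A] 1 1 x) = x"
    by (rule inv_into_f_f[OF _ assms]) (auto simp: inj_on_def i simp del: One_nat_def)
  then show ?thesis unfolding unsp_def i[OF assms] by simp
qed

lemma prods_replicate: "prods (replicate q A) (replicate q P) = replicate q (omega [A, P])"
  by (simp add: zip_replicate)

lemma columns_replicate: "columns q (replicate p (replicate q A)) = replicate q (omega (replicate p A))"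
  unfolding columns_def by (rule nth_equalityI) auto

text \<open>The recursive equation of \<open>chi\<close> for identical rows. It covers two or more
  rows, hence \<open>p > 0\<close>; a single row is the identity and not an interchange with the
  unit.\<close>

lemma chi_Suc:
  assumes "p > 0"
  shows "chi q (replicate (Suc p) (replicate q A)) =
    restrict (lam_map (replicate q (unsp A p)) (replicate q (omega [A, omega (replicate p A)])) (replicate q (omega (replicate (Suc p) A)))
      \<circ> chi2 (replicate q A) (replicate q (omega (replicate p A)))
      \<circ> omega_map [id, chi q (replicate p (replicate q A))] [lam (replicate q A), omega (replicate p (lam (replicate q A)))]
          [lam (replicate q A), lam (replicate q (omega (replicate p A)))]
      \<circ> omega_split (replicate (Suc p) (lam (replicate q A))) 1 p)
     (carrier (omega (replicate (Suc p) (lam (replicate q A)))))"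
proof -
  let ?As = "replicate q A"
  obtain p' where p': "p = Suc p'" using assms by (cases p) auto
  have c: "columns q (?As # replicate p' ?As) = replicate q (omega (replicate p A))"
    "columns q (?As # ?As # replicate p' ?As) = replicate q (omega (replicate (Suc p) A))"
    using columns_replicate[of q p] columns_replicate[of q "Suc p"] p' by auto
  have u: "map (\<lambda>j. let col = map (\<lambda>Ls. Ls ! j) (?As # ?As # replicate p' ?As)
      in inv_into (carrier (omega col)) (omega_split col 1 p)) [0..<q] = replicate q (unsp A p)"
    by (rule nth_equalityI) (auto simp: unsp_def p' Let_def)
  have l: "length (?As # replicate p' ?As) = p" by (simp add: p')
  have e: "replicate (Suc p) ?As = ?As # ?As # replicate p' ?As" "replicate p ?As = ?As # replicate p' ?As" by (simp_all add: p')
  show ?thesis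
    unfolding e chi.simps Let_def l c u[unfolded Let_def] prods_replicate
    by (simp add: p' del: chi.simps)
qed

lemma chi_hom:
  assumes "p > 0"
  shows "chi q (replicate p (replicate q A)) \<in>
    bim_hom (omega (replicate p (lam (replicate q A)))) (lam (replicate q (omega (replicate p A))))"
  using assms
proof (induction p rule: nat_induct_non_zero)
  case 1
  have "bimodule (lam (replicate q A))" by (rule lam_bimodule) (simp add: A)
  from restrict_bim_hom[OF this bhom_id] show ?case by (simp add: omega_single id_def restrict_def)
next
  case (Suc p)
  let ?L = "lam (replicate q A)" and ?B = "omega (replicate p A)"
  have L: "bimodule ?L" by (rule lam_bimodule) (simp add: A)
  have B: "bimodule ?B" "bimodule (omega (replicate (Suc p) A))" "bimodule (omega [A, ?B])"
    "bimodule (omega (replicate p ?L))" "bimodule (lam (replicate q ?B))" "bimodule (omega (replicate (Suc p) ?L))"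
    using L A by (auto intro!: omega_bimodule lam_bimodule)
  have 1: "omega_split (replicate (Suc p) ?L) 1 p \<in> bhom (omega (replicate (Suc p) ?L)) (omega [?L, omega (replicate p ?L)])"
    using split_bhom[of ?L "replicate p ?L"] L Suc(1) by simp
  have 2: "omega_map [id, chi q (replicate p (replicate q A))] [?L, omega (replicate p ?L)] [?L, lam (replicate q ?B)]
    \<in> bhom (omega [?L, omega (replicate p ?L)]) (omega [?L, lam (replicate q ?B)])"
    using Suc(2) L B by (intro bim_hom_bhom omega_map_hom) (auto simp: bhom_id bim_hom_bhom)
  have 3: "chi2 (replicate q A) (replicate q ?B) \<in> bhom (omega [?L, lam (replicate q ?B)]) (lam (replicate q (omega [A, ?B])))"
    using chi2_bhom[of "replicate q A" "replicate q ?B"] A B by (simp add: prods_replicate)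
  have 4: "lam_map (replicate q (unsp A p)) (replicate q (omega [A, ?B])) (replicate q (omega (replicate (Suc p) A)))
    \<in> bhom (lam (replicate q (omega [A, ?B]))) (lam (replicate q (omega (replicate (Suc p) A))))"
    using unsp_bhom[OF Suc(1)] B by (intro bim_hom_bhom lam_map_hom) (auto simp: bhoms_def)
  show ?case
    unfolding chi_Suc[OF Suc(1)]
    by (rule restrict_bim_hom[OF B(6) bhom_comp[OF 1 bhom_comp[OF 2 bhom_comp[OF 3 4]], unfolded comp_assoc[symmetric]]])
qed

lemma chi_step:
  assumes p: "p > 0" and x: "x \<in> carrier (lam (replicate q A))" and ys: "ys \<in> words (replicate p (lam (replicate q A)))"
  shows "chi q (replicate (Suc p) (replicate q A)) (pureE (replicate (Suc p) (lam (replicate q A))) (x # ys)) =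
    lam_map (replicate q (unsp A p)) (replicate q (omega [A, omega (replicate p A)])) (replicate q (omega (replicate (Suc p) A)))
      (chi2 (replicate q A) (replicate q (omega (replicate p A)))
        (pr (lam (replicate q A)) (lam (replicate q (omega (replicate p A)))) x
          (chi q (replicate p (replicate q A)) (pureE (replicate p (lam (replicate q A))) ys))))"
proof -
  let ?L = "lam (replicate q A)" and ?B = "omega (replicate p A)"
  have L: "bimodule ?L" by (rule lam_bimodule) (simp add: A)
  have B: "bimodule (omega (replicate p ?L))" "bimodule (lam (replicate q ?B))"
    using L A by (auto intro!: omega_bimodule lam_bimodule)
  have c: "pureE (replicate (Suc p) ?L) (x # ys) \<in> carrier (omega (replicate (Suc p) ?L))"
    by (rule pureE_closed) (use L x ys in auto)
  have y: "pureE (replicate p ?L) ys \<in> carrier (omega (replicate p ?L))"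
    by (rule pureE_closed) (use L ys in auto)
  have "omega_split (replicate (Suc p) ?L) 1 p (pureE (replicate (Suc p) ?L) (x # ys)) = pr ?L (omega (replicate p ?L)) x (pureE (replicate p ?L) ys)"
    using split_pure[of ?L "replicate p ?L" x ys] L p x ys by simp
  then show ?thesis
    using c omega_map_pr[OF L B(1) L B(2) bhom_id bim_hom_bhom[OF chi_hom[OF p]] x y]
    unfolding chi_Suc[OF p] by simp
qed

text \<open>For two rows the recursion reaches the one-row identity, and the splitting and
  unsplitting maps concern one-letter blocks, so only \<open>chi2\<close> is left.\<close>

lemma chi_two:
  assumes x: "x \<in> carrier (omega [lam (replicate q A), lam (replicate q A)])"
  shows "chi q [replicate q A, replicate q A] x = chi2 (replicate q A) (replicate q A) x"
proof -
  let ?L = "lam (replicate q A)"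
  have L: "bimodule ?L" by (rule lam_bimodule) (simp add: A)
  have O: "bimodule (omega [A, A])" using A by (intro omega_bimodule) auto
  have m: "omega_map [id, \<lambda>x\<in>carrier ?L. x] [?L, ?L] [?L, ?L] x = x"
    by (rule omega_map_ident) (use L x in \<open>auto simp: nth_Cons split: nat.split\<close>)
  have "chi2 (replicate q A) (replicate q A) x \<in> carrier (lam (replicate q (omega [A, A])))"
    using bhom_closed[OF chi2_bhom[of "replicate q A" "replicate q A"] x] A by (simp add: prods_replicate)
  then have l: "lam_map (replicate q (unsp A 1)) (replicate q (omega [A, A])) (replicate q (omega [A, A]))
     (chi2 (replicate q A) (replicate q A) x) = chi2 (replicate q A) (replicate q A) x"
    by (intro lam_map_ident) (use O unsp_1 in auto)
  show ?thesis
    using chi_Suc[of 1 q] x split_last_ident[OF L L x] m l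
    by (simp add: omega_single)
qed

end


section \<open>Products of words\<close>

lemma ext_kill:
  assumes N: "abelian_group N" and h: "h \<in> words Ms \<rightarrow> carrier N" and adm: "\<forall>M\<in>set Ms. adm K M"
    and rels: "\<And>z. z \<in> mrel Ms \<union> bal K Ms \<Longrightarrow> ext N h z = \<zero>\<^bsub>N\<^esub>" and c: "c \<in> rl K Ms"
  shows "ext N h c = \<zero>\<^bsub>N\<^esub>"
proof -
  interpret N: abelian_group N by fact
  have s: "mrel Ms \<union> bal K Ms \<subseteq> wchains Ms" by (rule rels_wchains[OF adm])
  have k: "Poly_Mapping.keys c \<subseteq> words Ms" if "c \<in> wchains Ms" for c using that by (simp add: wchains_def)
  from c have "c \<in> wchains Ms \<and> ext N h c = \<zero>\<^bsub>N\<^esub>"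
    unfolding rl_def
  proof (induction rule: span.induct)
    case (span_plus x y)
    then have "x \<in> wchains Ms" using s by auto
    then show ?case using rels[OF span_plus(1)] span_plus(3) by (auto simp: N.ext_add[OF k k h])
  next
    case (span_minus x y)
    then have "x \<in> wchains Ms" using s by auto
    then show ?case using rels[OF span_minus(1)] span_minus(3) by (auto simp: N.ext_diff[OF k k h] a_minus_def)
  qed simp
  then show ?thesis by simp
qed

lemma ext_extend_of:
  assumes N: "abelian_group N" and h: "h \<in> words Hs \<rightarrow> carrier N" and g: "\<And>w. w \<in> words Ms \<Longrightarrow> g w \<in> words Hs"
    and c: "c \<in> wchains Ms"
  shows "ext N h (frag_extend (\<lambda>w. frag_of (g w)) c) = ext N (\<lambda>w. h (g w)) c"
proof -
  interpret N: abelian_group N by fact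
  have k: "Poly_Mapping.keys c \<subseteq> words Ms" if "c \<in> wchains Ms" for c using that by (simp add: wchains_def)
  have k': "Poly_Mapping.keys (frag_extend (\<lambda>w. frag_of (g w)) c) \<subseteq> words Hs" if "c \<in> wchains Ms" for c
    using wchains_extend[OF that, of "\<lambda>w. frag_of (g w)" Hs] g by (simp add: wchains_def)
  have hg: "(\<lambda>w. h (g w)) \<in> words Ms \<rightarrow> carrier N" using h g by (auto simp: Pi_iff)
  show ?thesis
    using c
  proof (induction rule: wchains_induct)
    case (word w)
    then show ?case using h hg g by (simp add: N.ext_of Pi_iff)
  next
    case (diff a b)
    then show ?case by (simp add: frag_extend_diff N.ext_diff[OF k' k' h] N.ext_diff[OF k k hg])
  qed simp
qed

section \<open>The multiplication of a bialgebroid\<close>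

locale balg =
  fixes A :: "('r::{ring, monoid_mult}, 'a) ubimod" and \<mu> \<eta> \<delta> \<epsilon>
  assumes A: "bimodule A" and balg: "bialgebroid A \<mu> \<eta> \<delta> \<epsilon>"
begin

sublocale A: bimodule A by (rule A)

definition mul where "mul a b = \<mu> (pr A A a b)"
definition e where "e = \<eta> Renv_one"
text \<open>Nested to the right and closed by the unit, so that the empty word has value
  \<open>e\<close> and inserted empty blocks need no special treatment.\<close>

definition mulw where "mulw w = foldr mul w e"

abbreviation "An n \<equiv> replicate n A"

lemma homs: "\<mu> \<in> bim_hom (omega [A, A]) A" "\<eta> \<in> bim_hom Renv A" "\<delta> \<in> bim_hom A (lam [A, A])" "\<epsilon> \<in> bim_hom A EndR"
  using balg by (auto simp: bialgebroid_def)

lemma bAn: "bims (An n)" by (simp add: A)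

lemma e_closed: "e \<in> carrier A"
  using bhom_closed[OF bim_hom_bhom[OF homs(2)], of Renv_one] pureS_closed[of 1 1] by (simp add: e_def Renv_one_eq)

lemma mul_biadd: "biadd A A A mul"
proof -
  note m = bim_hom_bhom[OF homs(1)] and p = biaddD[OF pr_biadd[OF A A]]
  show ?thesis
    unfolding biadd_def ahom_def mul_def
    using p bhom_closed[OF m] bhom_acts[OF m p(1)] ahom_add[OF bhom_ahom[OF m]] A.closed by auto
qed

lemmas mulD = biaddD[OF mul_biadd]

lemma mul_unit: "a \<in> carrier A \<Longrightarrow> mul e a = a" "a \<in> carrier A \<Longrightarrow> mul a e = a"
proof -
  assume a: "a \<in> carrier A"
  have one: "Renv_one \<in> carrier Renv" by (simp add: Renv_one_eq pureS_closed)
  have rp: "repw [A] a = frag_of [a]" by (simp add: repw_def)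
  have "omega_split [A] 0 0 a = pr Renv A Renv_one a"
    using omega_split_rep[of "[A]" a 0 0] a A by (simp add: omega_single rp bracketing_def omega_Nil pureE_def)
  moreover have "omega_split [A] 1 0 a = pr A Renv a Renv_one"
    using omega_split_rep[of "[A]" a 1 0] a A by (simp add: omega_single rp bracketing_def omega_Nil pureE_def)
  moreover have "omega_map [\<eta>, id] [Renv, A] [A, A] (pr Renv A Renv_one a) = pr A A e a"
    using omega_map_pr[OF Renv_bimodule A A A bim_hom_bhom[OF homs(2)] bhom_id one a] by (simp add: e_def)
  moreover have "omega_map [id, \<eta>] [A, Renv] [A, A] (pr A Renv a Renv_one) = pr A A a e"
    using omega_map_pr[OF A Renv_bimodule A A bhom_id bim_hom_bhom[OF homs(2)] a one] by (simp add: e_def)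
  ultimately show "mul e a = a" "mul a e = a"
    using balg a by (auto simp: bialgebroid_def mul_def)
qed

text \<open>The axiom is evaluated at a pure tensor of three letters. Bracketing the last two is an
  instance of \<open>split_pure\<close>; bracketing the first two is computed directly.\<close>

lemma mul_assoc:
  assumes abc: "a \<in> carrier A" "b \<in> carrier A" "c \<in> carrier A"
  shows "mul (mul a b) c = mul a (mul b c)"
proof -
  have O: "bimodule (omega [A, A])" using A by (intro omega_bimodule) auto
  have b3: "bims [A, A, A]" "[A, A, A] \<noteq> []" and b2: "bims [A, A]" "[A, A] \<noteq> []" using A by auto
  let ?x = "clE [A, A, A] (frag_of [a, b, c])"
  interpret P: pres "omega [A, A, A]" "[A, A, A]" "rl KE [A, A, A]" "clE [A, A, A]" "repw [A, A, A]"
    by (rule omega_pres[OF b3])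
  interpret Q: pres "omega [omega [A, A], A]" "[omega [A, A], A]" "rl KE [omega [A, A], A]" "clE [omega [A, A], A]" "repw [omega [A, A], A]"
    by (rule omega_pres) (use A O in auto)
  have x: "?x \<in> carrier (omega [A, A, A])" and fx: "frag_of [a, b, c] \<in> wchains [A, A, A]"
    using abc P.cl_closed[of "frag_of [a, b, c]"] by auto
  have pe: "pureE [A, A] [y, z] = pr A A y z" if "y \<in> carrier A" "z \<in> carrier A" for y z
    using pureE_eq[OF b2, of "[y, z]"] that by simp
  have "omega_split [A, A, A] 1 2 ?x = pr A (omega [A, A]) a (pr A A b c)"
    using split_pure[of A "[A, A]" a "[b, c]"] A abc pureE_eq[OF b3, of "[a, b, c]"] pe by (simp add: numeral_2_eq_2)
  then have r: "\<mu> (omega_map [id, \<mu>] [A, omega [A, A]] [A, A] (omega_split [A, A, A] 1 2 ?x)) = mul a (mul b c)"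
    using omega_map_pr[OF A O A A bhom_id bim_hom_bhom[OF homs(1)] abc(1)] biaddD(1)[OF pr_biadd[OF A A] abc(2,3)]
    by (simp add: mul_def)
  \<comment> \<open>The word map that contracts the first two letters to their class; it respects
    relations as a contraction next to an identity.\<close>
  let ?g = "\<lambda>w. frag_of [pr A A (w ! 0) (w ! 1), w ! 2]"
  have "mor True True KE ([A, A] @ [A]) ([omega [A, A]] @ [A])
      (\<lambda>w. frag_of [clE [A, A] (frag_of (take (length [A, A]) w))] \<odot> frag_of (drop (length [A, A]) w))"
    by (rule mor_tensor[OF omega_contract(1)[OF b2] mor_id]) (use A in \<open>auto simp: bimodule_adm\<close>)
  then have m: "mor True True KE [A, A, A] [omega [A, A], A] ?g"
    unfolding append.simps by (rule mor_cong) (auto simp: words_Cons)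
  have rc: "repw [A, A, A] ?x \<in> wchains [A, A, A]" by (rule P.rep_closed[OF x])
  have "frag_extend (\<lambda>w. frag_of (bracketing (pureE (take 2 (drop 0 [A, A, A]))) w 0 2)) (repw [A, A, A] ?x)
      = frag_extend ?g (repw [A, A, A] ?x)"
    by (rule frag_extend_cong[OF rc]) (auto simp: words_Cons bracketing_def pe numeral_2_eq_2)
  moreover have "bracketing omega [A, A, A] 0 2 = [omega [A, A], A]" by (simp add: bracketing_def numeral_2_eq_2)
  ultimately have "omega_split [A, A, A] 0 2 ?x = clE [omega [A, A], A] (frag_extend ?g (repw [A, A, A] ?x))"
    using omega_split_rep[OF b3 x, of 0 2] by simp
  also have "\<dots> = clE [omega [A, A], A] (?g [a, b, c])"
    using mor_eqv[OF m P.rep_cl[OF fx]] mor_extend_wchains[OF m rc] mor_extend_wchains[OF m fx]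
    by (simp add: Q.cl_eq_iff)
  finally have "omega_split [A, A, A] 0 2 ?x = pr (omega [A, A]) A (pr A A a b) c" by simp
  then have "\<mu> (omega_map [\<mu>, id] [omega [A, A], A] [A, A] (omega_split [A, A, A] 0 2 ?x)) = mul (mul a b) c"
    using omega_map_pr[OF O A A A bim_hom_bhom[OF homs(1)] bhom_id _ abc(3)] biaddD(1)[OF pr_biadd[OF A A] abc(1,2)]
    by (simp add: mul_def)
  then show ?thesis using r balg x by (auto simp: bialgebroid_def)
qed

lemma mulw_Nil [simp]: "mulw [] = e" and mulw_Cons [simp]: "mulw (a # w) = mul a (mulw w)"
  by (simp_all add: mulw_def)

lemma mulw_closed: "w \<in> words (An n) \<Longrightarrow> mulw w \<in> carrier A"
  by (induction n arbitrary: w) (auto simp: e_closed words_Cons mulD(1))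

lemma mulw_append:
  assumes "u \<in> words (An n)" "v \<in> words (An k)" shows "mulw (u @ v) = mul (mulw u) (mulw v)"
  using assms(1)
proof (induction n arbitrary: u)
  case 0
  then show ?case using mulw_closed[OF assms(2)] by (simp add: mul_unit)
next
  case (Suc n)
  then obtain a u' where u: "u = a # u'" "a \<in> carrier A" "u' \<in> words (An n)" by (auto simp: words_Cons)
  then show ?case using Suc.IH[OF u(3)] mulw_closed[OF u(3)] mulw_closed[OF assms(2)] by (simp add: mul_assoc)
qed

lemma mulw_single: "a \<in> carrier A \<Longrightarrow> mulw [a] = a"
  by (simp add: mul_unit)

lemma mulw_mid:
  assumes "u \<in> words (An n)" "x \<in> carrier A" "v \<in> words (An k)"
  shows "mulw (u @ x # v) = mul (mulw u) (mul x (mulw v))"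
  using mulw_append[of u n "x # v" "Suc k"] assms by simp

lemma replicate_split:
  assumes "replicate n A = Ps @ X # Qs" obtains i k where "Ps = An i" "X = A" "Qs = An k"
proof -
  have "set (Ps @ X # Qs) \<subseteq> {A}" unfolding assms[symmetric] by auto
  then have "Ps = An (length Ps)" "X = A" "Qs = An (length Qs)"
    by (auto simp: subset_iff intro!: replicate_eqI)
  then show ?thesis using that by blast
qed

lemma mulw_funcset: "mulw \<in> words (An n) \<rightarrow> carrier A"
  using mulw_closed by auto

text \<open>By associativity the product of a word isolates any letter or any adjacent pair, so
  additivity and balancing of the binary product kill the relators.\<close>

lemma mulw_rels:
  assumes "z \<in> mrel (An n) \<union> bal KE (An n)"
  shows "ext A mulw z = \<zero>\<^bsub>A\<^esub>"
  using assms
proof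
  have k: "Poly_Mapping.keys c \<subseteq> words (An n)" if "c \<in> wchains (An n)" for c using that by (simp add: wchains_def)
  note ed = A.ext_diff[OF k k mulw_funcset] and ea = A.ext_add[OF k k mulw_funcset]
  have eo: "ext A mulw (frag_of w) = mulw w" if "w \<in> words (An n)" for w
    using that mulw_closed by (intro A.ext_of)
  {
    assume "z \<in> mrel (An n)"
    then obtain Ps X Qs u x y v where z: "z = frag_of (u @ (x \<oplus>\<^bsub>X\<^esub> y) # v) - frag_of (u @ x # v) - frag_of (u @ y # v)"
      and *: "An n = Ps @ X # Qs" "u \<in> words Ps" "x \<in> carrier X" "y \<in> carrier X" "v \<in> words Qs"
      by (rule mrelE)
    obtain i j where r: "Ps = An i" "X = A" "Qs = An j" using replicate_split[OF *(1)] .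
    note m = mulw_mid[OF *(2)[unfolded r] _ *(5)[unfolded r]]
    have mc: "mulw u \<in> carrier A" "mulw v \<in> carrier A" using * r mulw_closed by auto
    have w: "u @ t # v \<in> words (An n)" if "t \<in> carrier A" for t using * r that by simp
    have xy: "x \<in> carrier A" "y \<in> carrier A" "x \<oplus>\<^bsub>A\<^esub> y \<in> carrier A" using * r by auto
    have "ext A mulw z = mulw (u @ (x \<oplus>\<^bsub>A\<^esub> y) # v) \<ominus>\<^bsub>A\<^esub> (mulw (u @ x # v) \<oplus>\<^bsub>A\<^esub> mulw (u @ y # v))"
      unfolding z r(2) diff_diff_eq using w xy by (simp add: ed ea wchains_add eo)
    also have "mulw (u @ (x \<oplus>\<^bsub>A\<^esub> y) # v) = mulw (u @ x # v) \<oplus>\<^bsub>A\<^esub> mulw (u @ y # v)"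
      using xy mc by (simp add: m mulD)
    finally show "ext A mulw z = \<zero>\<^bsub>A\<^esub>" using mulw_closed[OF w] xy by (simp add: a_minus_def A.r_neg)
  next
    assume "z \<in> bal KE (An n)"
    then obtain Ps X Y Qs u x y v \<rho> \<beta> s where z: "z = frag_of (u @ \<rho> X s x # y # v) - frag_of (u @ x # \<beta> Y s y # v)"
      and *: "An n = Ps @ X # Y # Qs" "u \<in> words Ps" "x \<in> carrier X" "y \<in> carrier Y" "v \<in> words Qs" "(\<rho>, \<beta>) \<in> KE"
      by (rule balE)
    obtain i j where r: "Ps = An i" "X = A" "Y # Qs = An j" using replicate_split[OF *(1)] .
    then obtain j' where r': "Y = A" "Qs = An j'" "j = Suc j'" by (cases j) auto
    have xy: "x \<in> carrier A" "y \<in> carrier A" "\<rho> A s x \<in> carrier A" "\<beta> A s y \<in> carrier A"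
      using * r r' adm_closed[OF bimodule_adm(2)[OF A] *(6)] by auto
    have w: "u @ t # t' # v \<in> words (An n)" if "t \<in> carrier A" "t' \<in> carrier A" for t t' using * r r' that by simp
    have mc: "mulw v \<in> carrier A" using * r' mulw_closed by auto
    \<comment> \<open>The two letters of a balancing relator are bracketed together, so that it
      becomes an equation for one binary product.\<close>
    have m: "mulw (u @ t # t' # v) = mul (mulw u) (mul (mul t t') (mulw v))" if "t \<in> carrier A" "t' \<in> carrier A" for t t'
      using mulw_mid[of u i t "t' # v" "Suc j'"] * r r' that mc by (simp add: mul_assoc)
    have "mul (\<rho> A s x) y = mul x (\<beta> A s y)"
      using *(6) mulD(2,3)[OF xy(1,2), of s] by (auto simp: KE_iff ra_def rb_def)
    then have "mulw (u @ \<rho> A s x # y # v) = mulw (u @ x # \<beta> A s y # v)" using xy by (simp add: m)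
    moreover have "ext A mulw z = mulw (u @ \<rho> A s x # y # v) \<ominus>\<^bsub>A\<^esub> mulw (u @ x # \<beta> A s y # v)"
      unfolding z r(2) r'(1) using w xy by (simp add: ed eo)
    ultimately show "ext A mulw z = \<zero>\<^bsub>A\<^esub>" using mulw_closed[OF w] xy by (simp add: a_minus_def A.r_neg)
  }
qed

lemma mulw_kill: "c \<in> rl KE (An n) \<Longrightarrow> ext A mulw c = \<zero>\<^bsub>A\<^esub>"
  by (rule ext_kill[OF A.abelian_group_axioms mulw_funcset bims_adm(2)[OF bAn] mulw_rels])

text \<open>Arity 0 is separate because \<open>omega []\<close> is \<open>Renv\<close> and not a
  quotient of words over the empty list; \<open>mulw []\<close> only gives the value of \<eta> at
  the unit.\<close>

definition nmult where
  "nmult n = (if n = 0 then \<eta> else (\<lambda>x\<in>carrier (omega (An n)). ext A mulw (repw (An n) x)))"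

lemma An_pres: "n > 0 \<Longrightarrow> pres (omega (An n)) (An n) (rl KE (An n)) (clE (An n)) (repw (An n))"
  by (rule omega_pres[OF bAn]) simp

lemma nmult_cl:
  assumes "n > 0" "c \<in> wchains (An n)" shows "nmult n (clE (An n) c) = ext A mulw c"
  using pres.ext_cl[OF An_pres[OF assms(1)] A.abelian_group_axioms mulw_funcset mulw_kill assms(2)]
    pres.cl_closed[OF An_pres[OF assms(1)] assms(2)] assms(1) by (simp add: nmult_def)

lemma nmult_pure: "w \<in> words (An n) \<Longrightarrow> nmult n (pureE (An n) w) = mulw w"
proof (cases "n = 0")
  case True
  then show "w \<in> words (An n) \<Longrightarrow> ?thesis" by (simp add: nmult_def pureE_def e_def)
next
  case False
  assume w: "w \<in> words (An n)"
  have "pureE (An n) w = clE (An n) (frag_of w)" by (rule pureE_eq[OF bAn _ w]) (use False in simp)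
  then show ?thesis using nmult_cl[of n "frag_of w"] w False mulw_closed[OF w] by simp
qed

text \<open>Left actions touch the first letter and right actions the last. Since
  \<open>mulw\<close> is nested to the right, the last letter is reached through
  \<open>mulw_append\<close>.\<close>

lemma nmult_hom: "nmult n \<in> bim_hom (omega (An n)) A"
proof (cases "n = 0")
  case True
  then show ?thesis using homs(2) by (simp add: nmult_def omega_Nil)
next
  case False
  then have n: "n > 0" "An n \<noteq> []" by auto
  interpret P: pres "omega (An n)" "An n" "rl KE (An n)" "clE (An n)" "repw (An n)" by (rule An_pres[OF n(1)])
  interpret O: bimodule "omega (An n)" by (rule omega_bimodule[OF bAn])
  have ah: "nmult n \<in> ahom (omega (An n)) A"
    by (rule ahom_cong[OF P.ext_ahom[OF A.abelian_group_axioms mulw_funcset mulw_kill] _ P.T.abelian_group_axioms])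
      (use n in \<open>simp_all add: nmult_def\<close>)
  have pure: "nmult n (clE (An n) (frag_of w)) = mulw w" if "w \<in> words (An n)" for w
    using nmult_cl[OF n(1), of "frag_of w"] that mulw_closed[OF that] by simp
  have eq: "nmult n (F x) = G (nmult n x)" if "F \<in> ahom (omega (An n)) (omega (An n))" "G \<in> ahom A A" "x \<in> carrier (omega (An n))"
    "\<And>w. w \<in> words (An n) \<Longrightarrow> nmult n (F (clE (An n) (frag_of w))) = G (mulw w)" for F G x
    by (rule P.eqI[OF A.abelian_group_axioms ahom_comp[OF that(1) ah] ahom_comp[OF ah that(2)] _ that(3)])
      (use that(4) pure in simp)
  note oa = bimodule_ahom[OF O.bimodule_axioms] and na = bimodule_ahom[OF A]
  have fst_w: "\<exists>a v. w = a # v \<and> a \<in> carrier A \<and> v \<in> words (An (n - 1)) \<and> An n = A # An (n - 1)" if "w \<in> words (An n)" for w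
    using that n by (cases n) (auto simp: words_Cons)
  have An_snoc: "An n = An (n - 1) @ [A]" using n by (cases n) (simp_all add: replicate_append_same)
  have lst_w: "\<exists>u a. w = u @ [a] \<and> a \<in> carrier A \<and> u \<in> words (An (n - 1))" if "w \<in> words (An n)" for w
    using that unfolding An_snoc by (auto simp: words_append words_Cons)
  have la: "nmult n (lact (omega (An n)) r x) = lact A r (nmult n x)" "nmult n (lbact (omega (An n)) r x) = lbact A r (nmult n x)"
    if "x \<in> carrier (omega (An n))" for x r
  proof -
    have "mulw (wact lact (An n) 0 r w) = lact A r (mulw w) \<and> mulw (wact lbact (An n) 0 r w) = lbact A r (mulw w)"
      if w: "w \<in> words (An n)" for w
    proof -
      obtain a v where "w = a # v" "a \<in> carrier A" "v \<in> words (An (n - 1))" "An n = A # An (n - 1)"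
        using fst_w[OF w] by blast
      then show ?thesis using mulD(4,5)[of a "mulw v" r] mulw_closed[of v "n - 1"] by simp
    qed
    then show "nmult n (lact (omega (An n)) r x) = lact A r (nmult n x)" "nmult n (lbact (omega (An n)) r x) = lbact A r (nmult n x)"
      using n bims_wact[OF bAn, of 0 n] omega_act_cl[OF bAn n(2)] pure
      by (intro eq[OF oa(1) na(1) that] eq[OF oa(2) na(2) that]; simp)+
  qed
  have ra: "nmult n (ra (omega (An n)) r x) = ra A r (nmult n x)" "nmult n (rb (omega (An n)) r x) = rb A r (nmult n x)"
    if "x \<in> carrier (omega (An n))" for x r
  proof -
    have "mulw (wact \<alpha> (An n) (n - 1) r w) = \<alpha> A r (mulw w)"
      if w: "w \<in> words (An n)" and al: "\<alpha> = ra \<or> \<alpha> = rb" for w \<alpha>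
    proof -
      obtain u a where ua: "w = u @ [a]" "a \<in> carrier A" "u \<in> words (An (n - 1))" using lst_w[OF w] by blast
      have "wact \<alpha> (An n) (n - 1) r w = u @ [\<alpha> A r a]"
        unfolding An_snoc ua(1) using wact_append_right[of u "An (n - 1)" \<alpha> "[A]" 0 r "[a]"] words_length[OF ua(3)] by simp
      moreover have "\<alpha> A r a \<in> carrier A" using al ua(2) A.closed by (auto simp: ra_def rb_def)
      ultimately show ?thesis
        using al ua mulw_append[OF ua(3), of "[a]" 1] mulw_append[OF ua(3), of "[\<alpha> A r a]" 1] mulw_closed[OF ua(3)]
          mulD(6,7)[OF mulw_closed[OF ua(3)] ua(2), of r] by (auto simp: mul_unit ra_def rb_def)
    qed
    then show "nmult n (ra (omega (An n)) r x) = ra A r (nmult n x)" "nmult n (rb (omega (An n)) r x) = rb A r (nmult n x)"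
      using n bims_wact[OF bAn, of "n - 1" n] omega_act_cl[OF bAn n(2)] pure
      by (intro eq[OF oa(3) na(3) that] eq[OF oa(4) na(4) that];
        simp add: ra_def[of "omega (An n)"] rb_def[of "omega (An n)"])+
  qed
  show ?thesis
    unfolding bim_hom_iff bhom_def using ah la ra n by (auto simp: nmult_def ra_def rb_def)
qed

lemma nmult_1: "nmult 1 = (\<lambda>x\<in>carrier A. x)"
  using mulw_single by (auto simp: nmult_def omega_single repw_def A.ext_of mul_unit intro!: restrict_ext)

lemma nmult_2: "nmult 2 = \<mu>"
proof (rule extensionalityI)
  show "nmult 2 \<in> extensional (carrier (omega [A, A]))" "\<mu> \<in> extensional (carrier (omega [A, A]))"
    using homs(1) nmult_hom[of 2] by (auto simp: bim_hom_iff numeral_2_eq_2)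
  fix x assume x: "x \<in> carrier (omega [A, A])"
  interpret P: pres "omega [A, A]" "[A, A]" "rl KE [A, A]" "clE [A, A]" "repw [A, A]" by (rule omega_pres) (use A in auto)
  have mh: "nmult 2 \<in> ahom (omega [A, A]) A" using bhom_ahom[OF bim_hom_bhom[OF nmult_hom[of 2]]] by (simp add: numeral_2_eq_2)
  show "nmult 2 x = \<mu> x"
    by (rule P.eqI[OF A.abelian_group_axioms mh bhom_ahom[OF bim_hom_bhom[OF homs(1)]] _ x])
      (use nmult_cl[of 2] in \<open>auto simp: numeral_2_eq_2 words_Cons A.ext_of mul_unit mulD(1), simp add: mul_def\<close>)
qed

lemma bracketing_An:
  assumes "i \<le> p" shows "bracketing F (An (p + l)) i l = An i @ [F (An l)] @ An (p - i)"
  using assms by (simp add: bracketing_def)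

text \<open>On words, bracketing a block and multiplying it first does not change the total product.
  Both sides are extensions of this common value along the same chain.\<close>

lemma nmult_monoid: "monoid_structure A nmult"
  unfolding monoid_structure_def
proof (intro conjI allI impI nmult_hom nmult_1)
  fix p l i :: nat assume i: "i \<le> p"
  let ?B = "bracketing omega (An (p + l)) i l"
  have B: "?B = An i @ [omega (An l)] @ An (p - i)" by (rule bracketing_An[OF i])
  have bB: "bims ?B" using bAn by (intro bracketing_bims)
  have nth: "?B ! j = (if j = i then omega (An l) else A)" if "j < Suc p" for j
    using that i by (auto simp: B nth_append nth_Cons split: nat.split)
  have fs: "bhoms (at_pos i p (nmult l)) ?B (An (Suc p))"
    unfolding bhoms_def
  proof (intro conjI allI impI)
    show "length (at_pos i p (nmult l)) = length ?B" "length (An (Suc p)) = length ?B"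
      using i by (simp_all add: B at_pos_nth)
    fix j assume "j < length ?B"
    then have j: "j < Suc p" using i by (simp add: B)
    show "at_pos i p (nmult l) ! j \<in> bhom (?B ! j) (An (Suc p) ! j)"
      unfolding nth[OF j] at_pos_nth(2)[OF j] List.nth_replicate[OF j]
      using bim_hom_bhom[OF nmult_hom[of l]] by (simp add: bhom_id)
  qed
  have "nmult (p + l) x = nmult (Suc p) (omega_map (at_pos i p (nmult l)) ?B (An (Suc p)) (omega_split (An (p + l)) i l x))"
    if x: "x \<in> carrier (omega (An (p + l)))" for x
  proof (cases "p + l = 0")
    \<comment> \<open>Only here is the source \<open>Renv\<close> itself. Splitting is the identity,
      and both sides reduce to \<eta> because \<open>nmult 1\<close> is the identity.\<close>
    case True
    then have z: "p = 0" "l = 0" "i = 0" using i by auto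
    have "\<eta> x \<in> carrier A" using bhom_closed[OF bim_hom_bhom[OF homs(2)]] x z by (simp add: omega_Nil)
    then show ?thesis
      using x nmult_1 unfolding z by (simp add: omega_split_def omega_map_def bracketing_def omega_Nil omega_single at_pos_def lift_def pureE_def)
        (simp add: nmult_def)
  next
    case False
    then have n: "p + l > 0" "An (p + l) \<noteq> []" by auto
    interpret P: pres "omega (An (p + l))" "An (p + l)" "rl KE (An (p + l))" "clE (An (p + l))" "repw (An (p + l))"
      by (rule An_pres[OF n(1)])
    let ?c = "repw (An (p + l)) x" and ?b = "\<lambda>w. bracketing (pureE (take l (drop i (An (p + l))))) w i l"
    let ?s = "smap (at_pos i p (nmult l))"
    have c: "?c \<in> wchains (An (p + l))" by (rule P.rep_closed[OF x])
    note bw = bracketing_words[OF bAn, of _ "p + l" l i]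
    have bc: "frag_extend (\<lambda>w. frag_of (?b w)) ?c \<in> wchains ?B" by (rule wchains_extend[OF c]) (use bw in simp)
    have sw: "?s (?b w) \<in> words (An (Suc p))" if "w \<in> words (An (p + l))" for w
      by (rule bhoms_smap_words[OF fs bw[OF that]])
    \<comment> \<open>Generalised associativity. For \<open>l = 0\<close> the block is empty, its
      pure tensor is the unit of \<open>R^e\<close>, and its product is \<open>e\<close>.\<close>
    have val: "mulw (?s (?b w)) = mulw w" if w: "w \<in> words (An (p + l))" for w
    proof -
      have "An (p + l) = An i @ An l @ An (p - i)" using i by (simp add: replicate_add[symmetric])
      then obtain u t v where uv: "w = u @ t @ v" "u \<in> words (An i)" "t \<in> words (An l)" "v \<in> words (An (p - i))"
        using w by (auto elim!: words_append_E)
      have "?b w = u @ pureE (An l) t # v"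
        using uv i by (simp add: bracketing_def words_length)
      then have "?s (?b w) = u @ mulw t # v"
        using smap_at_pos[of u i v p "nmult l" "pureE (An l) t"] uv i by (simp add: words_length nmult_pure)
      then show ?thesis
        using uv mulw_mid[OF uv(2) mulw_closed[OF uv(3)] uv(4)] mulw_append[OF uv(3,4)]
          mulw_append[OF uv(2), of "t @ v" "l + (p - i)"] by (simp add: replicate_add)
    qed
    have "nmult (Suc p) (omega_map (at_pos i p (nmult l)) ?B (An (Suc p)) (omega_split (An (p + l)) i l x))
        = nmult (Suc p) (clE (An (Suc p)) (frag_extend (\<lambda>w. frag_of (?s w)) (frag_extend (\<lambda>w. frag_of (?b w)) ?c)))"
      using omega_split_rep[OF bAn n(2) x, of i l] omega_map_cl(2)[OF fs bB bAn _ bc] B by simp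
    also have "frag_extend (\<lambda>w. frag_of (?s w)) (frag_extend (\<lambda>w. frag_of (?b w)) ?c) = frag_extend (\<lambda>w. frag_of (?s (?b w))) ?c"
      by (simp add: frag_extend_extend)
    also have "nmult (Suc p) (clE (An (Suc p)) \<dots>) = ext A mulw (frag_extend (\<lambda>w. frag_of (?s (?b w))) ?c)"
      by (rule nmult_cl[OF zero_less_Suc], rule wchains_extend[OF c], simp only: wchains_of, rule sw)
    also have "\<dots> = ext A (\<lambda>w. mulw (?s (?b w))) ?c"
      by (rule ext_extend_of[OF A.abelian_group_axioms mulw_funcset sw c])
    also have "\<dots> = ext A mulw ?c"
    proof (rule ext_cong[OF A.abelian_group_axioms])
      have kw: "w \<in> words (An (p + l))" if "w \<in> Poly_Mapping.keys ?c" for w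
        using c that unfolding wchains_def by blast
      show "(\<lambda>w. mulw (?s (?b w))) \<in> Poly_Mapping.keys ?c \<rightarrow> carrier A"
        by (rule Pi_I) (rule mulw_closed[OF sw[OF kw]])
      show "mulw (?s (?b w)) = mulw w" if "w \<in> Poly_Mapping.keys ?c" for w by (rule val[OF kw[OF that]])
    qed
    also have "\<dots> = nmult (p + l) x" unfolding nmult_def if_not_P[OF False] using x by simp
    finally show ?thesis by simp
  qed
  then show "nmult (p + l) = restrict (nmult (Suc p) \<circ> omega_map (at_pos i p (nmult l)) ?B (An (Suc p)) \<circ> omega_split (An (p + l)) i l)
      (carrier (omega (An (p + l))))"
    using nmult_hom[of "p + l"] by (intro extensionalityI[where A = "carrier (omega (An (p + l)))"]) (auto simp: bim_hom_iff)
qed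

end


section \<open>Iterated comultiplication\<close>

lemma KR_iff: "(\<rho>, \<beta>) \<in> KR \<longleftrightarrow> \<rho> = lbact \<and> \<beta> = lact"
  by (auto simp: KR_def)

text \<open>A map inserted into a word may have neighbours on both sides, so both flags of
  \<open>G\<close> are set. Empty contexts are treated apart because \<open>mor\<close> demands
  nonempty lists.\<close>

lemma mor_ctx:
  assumes G: "mor True True K Ls Hs G" and adm: "\<forall>M\<in>set Ps \<union> set Qs. adm K M"
  shows "mor False False K (Ps @ Ls @ Qs) (Ps @ Hs @ Qs)
    (\<lambda>w. frag_of (take (length Ps) w) \<odot> (G (take (length Ls) (drop (length Ps) w)) \<odot> frag_of (drop (length Ps + length Ls) w)))"
proof -
  have 1: "mor True True K (Ls @ Qs) (Hs @ Qs) (\<lambda>w. G (take (length Ls) w) \<odot> frag_of (drop (length Ls) w))"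
  proof (cases "Qs = []")
    case True
    have "mor True True K Ls Hs (\<lambda>w. G (take (length Ls) w) \<odot> frag_of (drop (length Ls) w))"
      by (rule mor_cong[OF G]) (simp add: words_length)
    then show ?thesis using True by simp
  next
    case False
    show ?thesis by (rule mor_tensor[OF G mor_id[OF False]]) (use adm in auto)
  qed
  have 2: "mor True True K (Ps @ Ls @ Qs) (Ps @ Hs @ Qs) (\<lambda>w. frag_of (take (length Ps) w) \<odot>
      (G (take (length Ls) (drop (length Ps) w)) \<odot> frag_of (drop (length Ls) (drop (length Ps) w))))"
  proof (cases "Ps = []")
    case True
    then show ?thesis using 1 by simp
  next
    case False
    show ?thesis by (rule mor_tensor[OF mor_id[OF False] 1]) (use adm in auto)
  qed
  show ?thesis
    using mor_weaken[OF 2, of False False] by (simp add: add.commute)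
qed

text \<open>Two letters are merged into one; used for an endomorphism acting on an adjacent letter.
  Relators are additive in one letter or cross the seam, and the hypothesis \<open>bal\<close>
  settles the latter.\<close>

lemma mor_pair:
  assumes X: "bimodule X" and Y: "bimodule Y" and Z: "bimodule Z"
    and h: "\<And>x. x \<in> carrier X \<Longrightarrow> h x \<in> ahom Y Z" "\<And>y. y \<in> carrier Y \<Longrightarrow> (\<lambda>x. h x y) \<in> ahom X Z"
    and bal: "\<And>x y r. x \<in> carrier X \<Longrightarrow> y \<in> carrier Y \<Longrightarrow> h (lbact X r x) y = h x (lact Y r y)"
    and eq: "\<And>x y r. x \<in> carrier X \<Longrightarrow> y \<in> carrier Y \<Longrightarrow> h (lact X r x) y = lact Z r (h x y)"
      "\<And>x y r. x \<in> carrier X \<Longrightarrow> y \<in> carrier Y \<Longrightarrow> h x (lbact Y r y) = lbact Z r (h x y)"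
  shows "mor True True KR [X, Y] [Z] (\<lambda>w. frag_of [h (w ! 0) (w ! 1)])"
proof -
  let ?G = "\<lambda>w. frag_of [h (w ! 0) (w ! 1)]"
  have hc: "h x y \<in> carrier Z" if "x \<in> carrier X" "y \<in> carrier Y" for x y
    using ahom_closed[OF h(1)[OF that(1)] that(2)] .
  have "frag_extend ?G z \<in> rl KR [Z]" if "z \<in> mrel ([X] @ [Y]) \<union> bal KR ([X] @ [Y])" for z
    using that
  proof (cases rule: rels_append_cases)
    case (left z' v)
    then obtain x x' y where z': "z' = frag_of [x \<oplus>\<^bsub>X\<^esub> x'] - frag_of [x] - frag_of [x']" "x \<in> carrier X" "x' \<in> carrier X"
      and y: "v = [y]" "y \<in> carrier Y" unfolding rels_single by (auto simp: words_Cons)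
    show ?thesis
      using rl_single_add[OF hc[OF z'(2) y(2)] hc[OF z'(3) y(2)], of KR] ahom_add[OF h(2)[OF y(2)] z'(2,3)]
      by (simp add: left(3) z'(1) y cat_diff_left frag_extend_diff)
  next
    case (right u z')
    then obtain x y y' where z': "z' = frag_of [y \<oplus>\<^bsub>Y\<^esub> y'] - frag_of [y] - frag_of [y']" "y \<in> carrier Y" "y' \<in> carrier Y"
      and x: "u = [x]" "x \<in> carrier X" unfolding rels_single by (auto simp: words_Cons)
    show ?thesis
      using rl_single_add[OF hc[OF x(2) z'(2)] hc[OF x(2) z'(3)], of KR] ahom_add[OF h(1)[OF x(2)] z'(2,3)]
      by (simp add: right(3) z'(1) x cat_diff_right frag_extend_diff)
  next
    case (cross u v \<rho> \<beta> r)
    then show ?thesis using bal by (auto simp: words_Cons KR_iff frag_extend_diff)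
  qed
  then show ?thesis
    unfolding mor_def using X Y Z hc eq by (auto simp: bimodule_adm words_Cons KR_iff)
qed

text \<open>A letter from a Takeuchi product can be expanded inside a longer word: its actions
  \<open>lact\<close> and \<open>lbact\<close> are those of the first and the last factor, exactly
  the ones through which it is balanced with its neighbours.\<close>

lemma lam_rep_mor:
  fixes Ls :: "('r::{ring, monoid_mult}, 'a) ubimod list"
  assumes b: "bims Ls" "Ls \<noteq> []"
  shows "mor True True KR [lam Ls] Ls (\<lambda>w. repw Ls (hd w))"
proof -
  interpret P: pres "tensorR Ls" Ls "rl KR Ls" "clR Ls" "repw Ls" by (rule tensorR_pres[OF b])
  have len: "0 < length Ls" "length Ls - 1 < length Ls" using b(2) by auto
  show ?thesis
  proof (rule mor_single[OF bimodule_adm(1)[OF lam_bimodule[OF b(1)]] bims_adm(1)[OF b(1)] b(2)])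
    fix x y assume "x \<in> carrier (lam Ls)" "y \<in> carrier (lam Ls)"
    then show "repw Ls (x \<oplus>\<^bsub>lam Ls\<^esub> y) - repw Ls x - repw Ls y \<in> rl KR Ls"
      using P.rep_add lam_rep(4)[OF b] by (simp add: lam_sel[OF b])
  next
    fix \<rho> \<beta> :: "('r, ('r, 'a) univ) action" and r x assume K: "(\<rho>, \<beta>) \<in> KR" and x: "x \<in> carrier (lam Ls)"
    note c = lam_rep[OF b x]
    show "repw Ls (\<beta> (lam Ls) r x) - sact \<beta> Ls 0 r (repw Ls x) \<in> rl KR Ls"
      using K lam_act_cl(1)[OF b c(1), of r] P.rep_cl[OF bims_sact(1)[OF b(1) len(1) c(1)], of r] c(3) by (auto simp: KR_iff)
    show "repw Ls (\<rho> (lam Ls) r x) - sact \<rho> Ls (length Ls - 1) r (repw Ls x) \<in> rl KR Ls"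
      using K lam_act_cl(2)[OF b c(1), of r] P.rep_cl[OF bims_sact(2)[OF b(1) len(2) c(1)], of r] c(3) by (auto simp: KR_iff)
  qed (use lam_rep(1)[OF b] in auto)
qed

definition subst_at :: "nat \<Rightarrow> ('u \<Rightarrow> ('u list \<Rightarrow>\<^sub>0 int)) \<Rightarrow> 'u list \<Rightarrow> ('u list \<Rightarrow>\<^sub>0 int)" where
  "subst_at i f w = frag_of (take i w) \<odot> (f (w ! i) \<odot> frag_of (drop (Suc i) w))"

lemma subst_at_0: "subst_at 0 f (x # v) = f x \<odot> frag_of v"
  by (simp add: subst_at_def)

lemma subst_at_Suc: "subst_at (Suc i) f (x # v) = frag_of [x] \<odot> subst_at i f v"
  by (simp add: subst_at_def cat_assoc[symmetric])

lemma subst_at_eqv: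
  assumes "i \<le> p" "\<And>a. a \<in> carrier A \<Longrightarrow> f a - g a \<in> rl KR (replicate l A)" "c \<in> wchains (replicate (Suc p) A)"
  shows "frag_extend (subst_at i f) c - frag_extend (subst_at i g) c \<in> rl KR (replicate (p + l) A)"
proof (rule rl_extend_fun[OF assms(3)])
  fix w assume w: "w \<in> words (replicate (Suc p) A)"
  have r: "replicate (p + l) A = replicate i A @ replicate l A @ replicate (p - i) A"
    using assms(1) by (simp add: replicate_add[symmetric])
  have tk: "take i w \<in> words (replicate i A)" "drop (Suc i) w \<in> words (replicate (p - i) A)" "w ! i \<in> carrier A"
    using words_take_drop[OF w, of i] words_take_drop[OF w, of "Suc i"] words_nth[OF w, of i] assms(1)
    by (simp_all add: min_def del: replicate_Suc)
  have "frag_of (take i w) \<odot> ((f (w ! i) - g (w ! i)) \<odot> frag_of (drop (Suc i) w)) \<in> rl KR (replicate (p + l) A)"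
    unfolding r by (rule rl_cat_right[OF rl_cat_left[OF assms(2)[OF tk(3)]]]) (use tk in auto)
  then show "subst_at i f w - subst_at i g w \<in> rl KR (replicate (p + l) A)"
    by (simp add: subst_at_def cat_diff_left cat_diff_right)
qed

section \<open>The lax structure maps in the comonoid axioms, on chains\<close>

context
  fixes A :: "('r::{ring, monoid_mult}, 'a) ubimod"
  assumes A: "bimodule A"
begin

abbreviation "Br l i p \<equiv> bracketing lam (replicate (p + l) A) i l"

lemma Br_eq: "i \<le> p \<Longrightarrow> Br l i p = replicate i A @ [lam (replicate l A)] @ replicate (p - i) A"
  by (simp add: bracketing_def)

lemma Br_bims: "i \<le> p \<Longrightarrow> bims (Br l i p)"
  using A lam_bimodule[of "replicate l A"] by (simp add: Br_eq)

lemma at_pos_bhoms: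
  assumes i: "i \<le> p" and f: "f \<in> bhom A (lam (replicate l A))"
  shows "bhoms (at_pos i p f) (replicate (Suc p) A) (Br l i p)"
  unfolding bhoms_def
proof (intro conjI allI impI)
  show "length (at_pos i p f) = length (replicate (Suc p) A)" "length (Br l i p) = length (replicate (Suc p) A)"
    using i by (simp_all add: at_pos_nth(1) Br_eq)
  fix j assume "j < length (replicate (Suc p) A)"
  then have j: "j < Suc p" by simp
  have "Br l i p ! j = (if j = i then lam (replicate l A) else A)"
    using i j by (auto simp: Br_eq nth_append nth_Cons split: nat.split)
  then show "at_pos i p f ! j \<in> bhom (replicate (Suc p) A ! j) (Br l i p ! j)"
    unfolding at_pos_nth(2)[OF j] List.nth_replicate[OF j] using f by (simp add: bhom_id)
qed

lemma smap_at_pos':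
  assumes "length w = Suc p" "i \<le> p" shows "smap (at_pos i p f) w = take i w @ f (w ! i) # drop (Suc i) w"
  using smap_at_pos[of "take i w" i "drop (Suc i) w" p f "w ! i"] id_take_nth_drop[of i w] assms by simp

lemma lam_map_Br:
  assumes i: "i \<le> p" and f: "f \<in> bhom A (lam (replicate l A))" and c: "c \<in> wchains (replicate (Suc p) A)" "takeuchi (replicate (Suc p) A) c"
  defines "c' \<equiv> frag_extend (\<lambda>w. frag_of (smap (at_pos i p f) w)) c"
  shows "lam_map (at_pos i p f) (replicate (Suc p) A) (Br l i p) (clR (replicate (Suc p) A) c) = clR (Br l i p) c'"
    "c' \<in> wchains (Br l i p)" "clR (Br l i p) c' \<in> carrier (lam (Br l i p))"
proof -
  have b: "bims (replicate (Suc p) A)" "replicate (Suc p) A \<noteq> []" using A by auto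
  note fs = at_pos_bhoms[OF i f]
  show "lam_map (at_pos i p f) (replicate (Suc p) A) (Br l i p) (clR (replicate (Suc p) A) c) = clR (Br l i p) c'"
    unfolding c'_def by (rule lam_map_cl(2)[OF fs b(1) Br_bims[OF i] b(2) c])
  show w: "c' \<in> wchains (Br l i p)"
    unfolding c'_def using bhoms_smap_words[OF fs] by (intro wchains_extend[OF c(1)]) simp
  show "clR (Br l i p) c' \<in> carrier (lam (Br l i p))"
    using takeuchi_smap[OF fs b(1) Br_bims[OF i] b(2) c] Br_eq[OF i, of l] lam_carrier(2)[OF Br_bims[OF i] _ w]
    unfolding c'_def by simp
qed

text \<open>Applying \<open>f\<close> in slot \<open>i\<close> and forgetting the inner brackets
  amounts to substituting a representative of the value for the letter. The bounds on
  \<open>p\<close> and \<open>l\<close> select the third branch of \<open>lam_join\<close>.\<close>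

lemma join_map:
  assumes p: "p > 0" and l: "l \<ge> 2" and i: "i \<le> p" and f: "f \<in> bhom A (lam (replicate l A))"
    and c: "c \<in> wchains (replicate (Suc p) A)" "takeuchi (replicate (Suc p) A) c"
  shows "lam_join (replicate (p + l) A) i l (lam_map (at_pos i p f) (replicate (Suc p) A) (Br l i p) (clR (replicate (Suc p) A) c)) =
    clR (replicate (p + l) A) (frag_extend (subst_at i (\<lambda>a. repw (replicate l A) (f a))) c)"
proof -
  let ?N = "replicate (p + l) A" and ?L = "replicate l A"
  have bN: "bims ?N" "?N \<noteq> []" "bims ?L" "?L \<noteq> []" using A p l by auto
  have bB: "bims (Br l i p)" "Br l i p \<noteq> []" by (rule Br_bims[OF i]) (simp add: Br_eq[OF i])
  interpret T: pres "tensorR ?N" ?N "rl KR ?N" "clR ?N" "repw ?N" by (rule tensorR_pres[OF bN(1,2)])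
  interpret S: pres "tensorR (Br l i p)" "Br l i p" "rl KR (Br l i p)" "clR (Br l i p)" "repw (Br l i p)" by (rule tensorR_pres[OF bB])
  let ?c = "frag_extend (\<lambda>w. frag_of (smap (at_pos i p f) w)) c" and ?s = "subst_at i (repw ?L)"
  note m = lam_map_Br[OF i f c]
  let ?x = "clR (Br l i p) ?c"
  have Neq: "?N = replicate i A @ ?L @ replicate (p - i) A" using i by (simp add: replicate_add[symmetric])
  \<comment> \<open>Expanding the bracketed letter respects relations, so it may be applied to the
    explicit chain in place of the stored representative.\<close>
  have sm: "mor False False KR (Br l i p) ?N ?s"
    unfolding Br_eq[OF i] unfolding Neq
    by (rule mor_cong[OF mor_ctx[OF lam_rep_mor[OF bN(3,4)]]])
      (use A in \<open>auto simp: bimodule_adm subst_at_def words_append words_Cons words_length nth_append\<close>)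
  have len: "length (Br l i p) \<noteq> 1" "length ?N \<noteq> 1" using i p l by (auto simp: Br_eq)
  have r: "repw (Br l i p) ?x = chain_of ?x" using len by (simp add: repw_def)
  have rc: "chain_of ?x \<in> wchains (Br l i p)" using S.rep_closed[OF S.cl_closed[OF m(2)]] r by simp
  have L: "lam_join ?N i l ?x = addext (tensorR ?N) (\<lambda>w. tclass ?N (balR ?N)
          (frag_extend (\<lambda>v. frag_of (take i w @ v @ drop (Suc i) w)) (chain_of (w ! i)))) ?x"
    using m(3) l p unfolding lam_join_def by simp
  have tc: "tclass ?N (balR ?N) (frag_extend (\<lambda>v. frag_of (take i w @ v @ drop (Suc i) w)) (chain_of (w ! i))) = clR ?N (?s w)" for w
  proof -
    have "frag_extend (\<lambda>v. frag_of (take i w @ v @ drop (Suc i) w)) (chain_of (w ! i)) = ?s w"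
      using l by (simp add: subst_at_def repw_def cat_def frag_extend_extend)
    then show ?thesis using len by (simp add: cls_def balR_eq)
  qed
  have "lam_join ?N i l ?x = clR ?N (frag_extend ?s (chain_of ?x))"
    unfolding L tc addext_eq_ext by (rule T.cl_extend[OF mor_wchains[OF sm] rc])
  also have "\<dots> = clR ?N (frag_extend ?s ?c)"
    using mor_eqv[OF sm S.rep_cl[OF m(2)]] mor_extend_wchains[OF sm rc] mor_extend_wchains[OF sm m(2)] r
    by (simp add: T.cl_eq_iff)
  also have "frag_extend ?s ?c = frag_extend (subst_at i (\<lambda>a. repw ?L (f a))) c"
    unfolding frag_extend_extend
  proof (rule frag_extend_cong[OF c(1)])
    fix w assume w: "w \<in> words (replicate (Suc p) A)"
    have lw: "length w = Suc p" using words_length[OF w] by simp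
    show "frag_extend ?s (frag_of (smap (at_pos i p f) w)) = subst_at i (\<lambda>a. repw ?L (f a)) w"
      unfolding smap_at_pos'[OF lw i] using lw i by (simp add: subst_at_def nth_append min_def)
  qed
  finally show ?thesis unfolding m(1) .
qed

text \<open>Absorption is balanced: for a following letter, \<open>lbact\<close> by \<open>r\<close>
  multiplies \<phi>(1) by \<open>r\<close> on the right, so its action is that of \<open>r\<close>
  followed by that of \<phi>(1). The barred action on a preceding letter is treated
  symmetrically.\<close>

lemma absorb_mor:
  assumes p: "p > 0" and i: "i \<le> p"
  shows "mor False False KR (Br 0 i p) (replicate p A) (\<lambda>w. frag_of (absorb (replicate p A) i w))"
proof -
  interpret A: bimodule A by (rule A)
  have E: "bimodule EndR" by (rule EndR_bimodule)
  have B: "Br 0 i p = replicate i A @ [EndR] @ replicate (p - i) A" unfolding Br_eq[OF i] by (simp add: lam_Nil)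
  have ad: "\<forall>M\<in>set (replicate n A) \<union> set (replicate k A). adm KR M" for n k using A by (auto simp: bimodule_adm)
  show ?thesis
  proof (cases "i < p")
    case True
    then obtain q where q: "p - i = Suc q" by (metis Suc_diff_Suc)
    then have pq: "p = i + Suc q" using i by simp
    have "mor True True KR [EndR, A] [A] (\<lambda>w. frag_of [lact A (the_endo (w ! 0) 1) (w ! 1)])"
    proof (rule mor_pair[OF E A A, where h = "\<lambda>f a. lact A (the_endo f 1) a"])
      show "(\<lambda>f. lact A (the_endo f 1) y) \<in> ahom EndR A" if "y \<in> carrier A" for y
        using that A.closed A.add_act by (auto simp: ahom_def EndR_def)
    qed (use A.closed A.act_add A.act_mult A.act_commute in \<open>auto simp: ahom_def EndR_def\<close>)
    note m = mor_ctx[OF this ad, of i q]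
    have Np: "replicate p A = replicate i A @ [A] @ replicate q A" by (simp add: pq replicate_add replicate_append_same)
    have "mor False False KR (Br 0 i p) (replicate p A)
      (\<lambda>w. frag_of (take i w) \<odot> (frag_of [lact A (the_endo (take 2 (drop i w) ! 0) 1) (take 2 (drop i w) ! 1)] \<odot> frag_of (drop (i + 2) w)))"
      unfolding B q unfolding Np using m by simp
    then show ?thesis
    proof (rule mor_cong)
      fix w assume "w \<in> words (Br 0 i p)"
      then obtain u f y v where w: "w = u @ f # y # v" "length u = i"
        unfolding B q by (auto simp: words_append words_Cons dest!: words_length)
      then show "frag_of (take i w) \<odot> (frag_of [lact A (the_endo (take 2 (drop i w) ! 0) 1) (take 2 (drop i w) ! 1)] \<odot> frag_of (drop (i + 2) w))
          = frag_of (absorb (replicate p A) i w)"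
        using True by (simp add: absorb_def Let_def nth_append list_update_append)
    qed
  next
    case False
    then have ip: "i = p" using i by simp
    obtain q where q: "p = Suc q" using p by (cases p) auto
    have rr: "replicate p A = replicate q A @ [A]" by (simp add: q replicate_append_same)
    have "mor True True KR [A, EndR] [A] (\<lambda>w. frag_of [lbact A (the_endo (w ! 1) 1) (w ! 0)])"
    proof (rule mor_pair[OF A E A, where h = "\<lambda>a f. lbact A (the_endo f 1) a"])
      show "(\<lambda>f. lbact A (the_endo f 1) x) \<in> ahom EndR A" if "x \<in> carrier A" for x
        using that A.closed A.add_act by (auto simp: ahom_def EndR_def)
    qed (use A.closed A.act_add A.act_mult A.act_commute in \<open>auto simp: ahom_def EndR_def\<close>)
    note m = mor_ctx[OF this ad, of q 0]
    have "mor False False KR (Br 0 i p) (replicate p A)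
      (\<lambda>w. frag_of (take q w) \<odot> (frag_of [lbact A (the_endo (take 2 (drop q w) ! 1) 1) (take 2 (drop q w) ! 0)] \<odot> frag_of (drop (q + 2) w)))"
      unfolding B unfolding ip rr using m by simp
    then show ?thesis
    proof (rule mor_cong)
      fix w assume "w \<in> words (Br 0 i p)"
      then obtain u y f where w: "w = u @ [y, f]" "length u = q"
        unfolding B unfolding ip rr by (auto simp: words_append words_Cons dest!: words_length)
      then show "frag_of (take q w) \<odot> (frag_of [lbact A (the_endo (take 2 (drop q w) ! 1) 1) (take 2 (drop q w) ! 0)] \<odot> frag_of (drop (q + 2) w))
          = frag_of (absorb (replicate p A) i w)"
        unfolding w(1) ip q using w(2)
        by (simp add: absorb_def Let_def nth_append list_update_append nth_Cons' del: replicate_Suc)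
    qed
  qed
qed

lemma join_map_0:
  assumes p: "p > 0" and i: "i \<le> p" and f: "f \<in> bhom A EndR"
    and c: "c \<in> wchains (replicate (Suc p) A)" "takeuchi (replicate (Suc p) A) c"
  shows "lam_join (replicate p A) i 0 (lam_map (at_pos i p f) (replicate (Suc p) A) (Br 0 i p) (clR (replicate (Suc p) A) c)) =
    clR (replicate p A) (frag_extend (\<lambda>w. frag_of (absorb (replicate p A) i (smap (at_pos i p f) w))) c)"
proof -
  let ?N = "replicate p A"
  have bN: "bims ?N" "?N \<noteq> []" using A p by auto
  have bB: "bims (Br 0 i p)" "Br 0 i p \<noteq> []" by (rule Br_bims[OF i]) (simp add: bracketing_def)
  interpret T: pres "tensorR ?N" ?N "rl KR ?N" "clR ?N" "repw ?N" by (rule tensorR_pres[OF bN(1,2)])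
  interpret S: pres "tensorR (Br 0 i p)" "Br 0 i p" "rl KR (Br 0 i p)" "clR (Br 0 i p)" "repw (Br 0 i p)" by (rule tensorR_pres[OF bB])
  have f': "f \<in> bhom A (lam (replicate 0 A))" using f by (simp add: lam_Nil)
  let ?c = "frag_extend (\<lambda>w. frag_of (smap (at_pos i p f) w)) c" and ?s = "\<lambda>w. frag_of (absorb ?N i w)"
  note m = lam_map_Br[OF i f' c] and sm = absorb_mor[OF p i]
  let ?x = "clR (Br 0 i p) ?c"
  have len: "length (Br 0 i p) \<noteq> 1" using i p Br_eq[OF i, of 0] by auto
  have r: "repw (Br 0 i p) ?x = chain_of ?x" using len unfolding repw_def by simp
  have rc: "chain_of ?x \<in> wchains (Br 0 i p)" using S.rep_closed[OF S.cl_closed[OF m(2)]] r by simp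
  have aw: "absorb ?N i w \<in> words ?N" if "w \<in> words (Br 0 i p)" for w
    using mor_wchains[OF sm that] by simp
  have L: "lam_join ?N i 0 ?x = ext (tensorR ?N) (\<lambda>w. pureR ?N (absorb ?N i w)) (chain_of ?x)"
    using m(3) p unfolding lam_join_def addext_eq_ext by simp
  have "\<dots> = ext (tensorR ?N) (\<lambda>w. clR ?N (frag_of (absorb ?N i w))) (chain_of ?x)"
  proof (rule ext_cong[OF T.T.abelian_group_axioms])
    have kw: "w \<in> words (Br 0 i p)" if "w \<in> Poly_Mapping.keys (chain_of ?x)" for w
      using rc that unfolding wchains_def by blast
    show eq: "pureR ?N (absorb ?N i w) = clR ?N (frag_of (absorb ?N i w))" if "w \<in> Poly_Mapping.keys (chain_of ?x)" for w
      by (rule pureR_eq[OF bN aw[OF kw[OF that]]])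
    show "(\<lambda>w. pureR ?N (absorb ?N i w)) \<in> Poly_Mapping.keys (chain_of ?x) \<rightarrow> carrier (tensorR ?N)"
      by (rule Pi_I) (simp add: eq T.cl_closed aw[OF kw])
  qed
  also have "\<dots> = clR ?N (frag_extend ?s (chain_of ?x))"
    by (rule T.cl_extend[OF mor_wchains[OF sm] rc])
  also have "\<dots> = clR ?N (frag_extend ?s ?c)"
    using mor_eqv[OF sm S.rep_cl[OF m(2)]] mor_extend_wchains[OF sm rc] mor_extend_wchains[OF sm m(2)] r
    by (simp add: T.cl_eq_iff)
  also have "frag_extend ?s ?c = frag_extend (\<lambda>w. frag_of (absorb ?N i (smap (at_pos i p f) w))) c"
    by (simp add: frag_extend_extend)
  finally show ?thesis using L m(1) by simp
qed

text \<open>For \<open>p = 0\<close> the letter \<open>x\<close> would be the only neighbour left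
  and would itself be acted on; hence \<open>p > 0\<close>.\<close>

lemma absorb_Cons:
  assumes "p > 0" "i \<le> p" "length v = Suc p"
  shows "absorb (replicate (Suc p) A) (Suc i) (x # v) = x # absorb (replicate p A) i v"
proof (cases "i < p")
  case True
  then show ?thesis using assms by (simp add: absorb_def Let_def)
next
  case False
  then obtain q where "p = Suc q" "i = Suc q" using assms by (cases p) auto
  then show ?thesis using assms by (simp add: absorb_def Let_def)
qed

end

lemma sact_extend: "sact \<alpha> Ms j r (frag_extend g c) = frag_extend (\<lambda>w. sact \<alpha> Ms j r (g w)) c"
  by (simp add: sact_def frag_extend_extend)

section \<open>The iterated comultiplication of a bialgebroid\<close>

context balg
begin

lemma bAA: "bims [A, A]" "[A, A] \<noteq> []"
  using A by auto

abbreviation "delta_chain a \<equiv> repw [A, A] (\<delta> a)"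

lemma delta_closed: "a \<in> carrier A \<Longrightarrow> \<delta> a \<in> carrier (lam [A, A])"
  by (rule bhom_closed[OF bim_hom_bhom[OF homs(3)]])

lemma delta_chain: assumes "a \<in> carrier A" shows "delta_chain a \<in> wchains [A, A]" "takeuchi [A, A] (delta_chain a)" "clR [A, A] (delta_chain a) = \<delta> a"
  using lam_rep[OF bAA delta_closed[OF assms]] by auto

text \<open>Indexed by the number of comultiplications, so there are \<open>Suc k\<close> letters.
  \<delta> is applied first and the recursion runs on the second letter, which is why the inductions
  below let the element vary. A chain, not a class, is kept so that it can be inserted into
  words.\<close>

primrec comult_chain :: "nat \<Rightarrow> ('r, 'a) univ \<Rightarrow> ('r, 'a) chain" where
  "comult_chain 0 a = frag_of [a]"
| "comult_chain (Suc k) a = frag_extend (\<lambda>w. frag_of [w ! 0] \<odot> comult_chain k (w ! 1)) (delta_chain a)"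

lemma wordsAA: "w \<in> words [A, A] \<longleftrightarrow> (\<exists>x y. w = [x, y] \<and> x \<in> carrier A \<and> y \<in> carrier A)"
  by (auto simp: words_Cons)

lemma delta_mor: "mor True True KR [A] [A, A] (\<lambda>w. delta_chain (hd w))"
proof -
  have L: "bimodule (lam [A, A])" using bAA by (intro lam_bimodule)
  have "mor True True KR [A] [lam [A, A]] (\<lambda>w. frag_of [\<delta> (hd w)])"
    by (rule mor_slot) (use A L bhom_slotmap(1)[OF bim_hom_bhom[OF homs(3)]] in \<open>auto simp: bimodule_adm\<close>)
  from mor_comp[OF this lam_rep_mor[OF bAA]] show ?thesis by simp
qed

lemma idA_mor: "mor True True KR [A] [A] frag_of"
  by (rule mor_id) (auto simp: A bimodule_adm)

lemma cons_mor:
  assumes "mor True True KR [A] (An (Suc k)) (\<lambda>w. f (hd w))"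
  shows "mor True True KR [A, A] (An (Suc (Suc k))) (\<lambda>w. frag_of [w ! 0] \<odot> f (w ! 1))"
proof -
  have "mor True True KR [A, A] (An (Suc (Suc k))) (\<lambda>w. frag_of (take 1 w) \<odot> f (hd (drop 1 w)))"
    using mor_tensor[OF idA_mor assms] by simp
  then show ?thesis by (rule mor_cong) (auto simp: wordsAA)
qed

lemma comult_chain_mor: "mor True True KR [A] (An (Suc k)) (\<lambda>w. comult_chain k (hd w))"
proof (induction k)
  case 0
  have "mor True True KR [A] [A] (\<lambda>w. comult_chain 0 (hd w))"
    by (rule mor_cong[OF idA_mor]) (auto simp: words_Cons)
  then show ?case by simp
next
  case (Suc k)
  show ?case using mor_comp[OF delta_mor cons_mor[OF Suc]] by simp
qed

lemmas ID_mor = cons_mor[OF comult_chain_mor]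

lemma comult_chain_wchains: "a \<in> carrier A \<Longrightarrow> comult_chain k a \<in> wchains (An (Suc k))"
  using mor_wchains[OF comult_chain_mor, of "[a]"] by simp

text \<open>The right actions do not belong to the balancing \<open>KR\<close>, so
  \<open>delta_mor\<close> does not cover them; they enter the Takeuchi condition of the
  iterates.\<close>

lemma delta_chain_acts:
  assumes a: "a \<in> carrier A"
  shows "delta_chain (ra A r a) - sact ra [A, A] 0 r (delta_chain a) \<in> rl KR [A, A]"
    "delta_chain (rb A r a) - sact rb [A, A] 1 r (delta_chain a) \<in> rl KR [A, A]"
proof -
  interpret P: pres "tensorR [A, A]" "[A, A]" "rl KR [A, A]" "clR [A, A]" "repw [A, A]" by (rule tensorR_pres[OF bAA])
  note h = bhom_acts(5,6)[OF bim_hom_bhom[OF homs(3)] a, of r]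
  show "delta_chain (ra A r a) - sact ra [A, A] 0 r (delta_chain a) \<in> rl KR [A, A]"
    using P.rep_cl[OF bims_sact(3)[OF bAA(1) _ delta_chain(1)[OF a]], of 0 r] lam_act_cl(3)[OF bAA delta_chain(1)[OF a], of r] h(1) delta_chain(3)[OF a]
    by (simp add: ra_def[of "lam [A, A]"])
  show "delta_chain (rb A r a) - sact rb [A, A] 1 r (delta_chain a) \<in> rl KR [A, A]"
    using P.rep_cl[OF bims_sact(4)[OF bAA(1) _ delta_chain(1)[OF a]], of 1 r] lam_act_cl(4)[OF bAA delta_chain(1)[OF a], of r] h(2) delta_chain(3)[OF a]
    by (simp add: rb_def[of "lam [A, A]"])
qed

lemma ID_sact_0:
  assumes "c \<in> wchains [A, A]"
  shows "frag_extend (\<lambda>w. frag_of [w ! 0] \<odot> comult_chain k (w ! 1)) (sact \<alpha> [A, A] 0 r c) =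
    sact \<alpha> (An (Suc (Suc k))) 0 r (frag_extend (\<lambda>w. frag_of [w ! 0] \<odot> comult_chain k (w ! 1)) c)"
proof -
  have "frag_of [\<alpha> A r x] \<odot> d = sact \<alpha> (An (Suc (Suc k))) 0 r (frag_of [x] \<odot> d)" if "x \<in> carrier A" for x d
    using sact_cat_left[of "frag_of [x]" "[A]" \<alpha> "An (Suc k)" r d] that by simp
  then show ?thesis
    unfolding sact_extend unfolding sact_def[of \<alpha> "[A, A]"] frag_extend_extend
    by (intro frag_extend_cong[OF assms]) (auto simp: wordsAA)
qed

lemma comult_chain_ra: "a \<in> carrier A \<Longrightarrow> comult_chain k (ra A r a) - sact ra (An (Suc k)) 0 r (comult_chain k a) \<in> rl KR (An (Suc k))"
proof (cases k)
  case (Suc k')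
  assume a: "a \<in> carrier A"
  show ?thesis
    using mor_eqv[OF ID_mor[of k'] delta_chain_acts(1)[OF a, of r]] ID_sact_0[OF delta_chain(1)[OF a], of k' ra r] by (simp add: Suc)
qed simp

lemma sact_cons:
  "x \<in> carrier A \<Longrightarrow> d \<in> wchains (An k) \<Longrightarrow> sact \<alpha> (An (Suc k)) (Suc j) r (frag_of [x] \<odot> d) = frag_of [x] \<odot> sact \<alpha> (An k) j r d"
  using sact_cat_right[of "frag_of [x]" "[A]" d "An k" \<alpha> j r] by simp

lemma cons_rl: "x \<in> carrier A \<Longrightarrow> d - d' \<in> rl KR (An k) \<Longrightarrow> frag_of [x] \<odot> d - frag_of [x] \<odot> d' \<in> rl KR (An (Suc k))"
  using rl_cat_right[of "d - d'" KR "An k" "frag_of [x]" "[A]"] by (simp add: cat_diff_right)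

lemma ID_sact_1:
  assumes c: "c \<in> wchains [A, A]" and h: "\<And>y. y \<in> carrier A \<Longrightarrow> comult_chain k (\<alpha> A r y) - sact \<alpha> (An (Suc k)) j r (comult_chain k y) \<in> rl KR (An (Suc k))"
  shows "frag_extend (\<lambda>w. frag_of [w ! 0] \<odot> comult_chain k (w ! 1)) (sact \<alpha> [A, A] 1 r c) -
    sact \<alpha> (An (Suc (Suc k))) (Suc j) r (frag_extend (\<lambda>w. frag_of [w ! 0] \<odot> comult_chain k (w ! 1)) c) \<in> rl KR (An (Suc (Suc k)))"
  unfolding sact_extend unfolding sact_def[of \<alpha> "[A, A]"] frag_extend_extend
proof (rule rl_extend_fun[OF c])
  fix w assume "w \<in> words [A, A]"
  then obtain x y where w: "w = [x, y]" "x \<in> carrier A" "y \<in> carrier A" by (auto simp: wordsAA)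
  show "frag_extend (\<lambda>w. frag_of [w ! 0] \<odot> comult_chain k (w ! 1)) (frag_of (wact \<alpha> [A, A] 1 r w)) -
      sact \<alpha> (An (Suc (Suc k))) (Suc j) r (frag_of [w ! 0] \<odot> comult_chain k (w ! 1)) \<in> rl KR (An (Suc (Suc k)))"
    using cons_rl[OF w(2) h[OF w(3)]] sact_cons[OF w(2) comult_chain_wchains[OF w(3)], of \<alpha> k j r] w by (simp del: replicate_Suc)
qed

lemma comult_chain_rb: "a \<in> carrier A \<Longrightarrow> comult_chain k (rb A r a) - sact rb (An (Suc k)) k r (comult_chain k a) \<in> rl KR (An (Suc k))"
proof (induction k arbitrary: a)
  case (Suc k)
  note c = delta_chain[OF Suc.prems]
  show ?case
    using rl_trans[OF mor_eqv[OF ID_mor[of k] delta_chain_acts(2)[OF Suc.prems, of r]] ID_sact_1[OF c(1) Suc.IH]] by simp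
qed simp

text \<open>Between the first two letters the condition is inherited from \<delta>; between later
  letters it is the induction hypothesis behind a fixed first letter.\<close>

lemma takeuchi_comult_chain: "a \<in> carrier A \<Longrightarrow> takeuchi (An (Suc k)) (comult_chain k a)"
proof (induction k arbitrary: a)
  case 0
  then show ?case by (simp add: takeuchi_def)
next
  case (Suc k)
  note c = delta_chain[OF Suc.prems]
  let ?I = "frag_extend (\<lambda>w. frag_of [w ! 0] \<odot> comult_chain k (w ! 1))"
  show ?case
    unfolding takeuchi_def
  proof (intro allI impI)
    fix j s assume j: "Suc j < length (An (Suc (Suc k)))"
    show "sact rb (An (Suc (Suc k))) j s (comult_chain (Suc k) a) - sact ra (An (Suc (Suc k))) (Suc j) s (comult_chain (Suc k) a) \<in> rl KR (An (Suc (Suc k)))"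
    proof (cases j)
      case 0
      \<comment> \<open>Expanding the second letter carries its action \<open>ra\<close> to the
        first letter of the expansion by \<open>comult_chain_ra\<close>, while \<open>rb\<close>
        stays on the untouched first letter.\<close>
      have "sact rb [A, A] 0 s (delta_chain a) - sact ra [A, A] 1 s (delta_chain a) \<in> rl KR [A, A]"
        using c(2) by (simp add: takeuchi_def)
      from rl_trans[OF mor_eqv[OF ID_mor[of k] this] ID_sact_1[OF c(1) comult_chain_ra]]
      show ?thesis using ID_sact_0[OF c(1), of k rb s] 0 by simp
    next
      case (Suc i)
      have "sact rb (An (Suc (Suc k))) j s (frag_of [x] \<odot> comult_chain k y) - sact ra (An (Suc (Suc k))) (Suc j) s (frag_of [x] \<odot> comult_chain k y) \<in> rl KR (An (Suc (Suc k)))"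
        if "x \<in> carrier A" "y \<in> carrier A" for x y
      proof -
        have "sact rb (An (Suc k)) i s (comult_chain k y) - sact ra (An (Suc k)) (Suc i) s (comult_chain k y) \<in> rl KR (An (Suc k))"
          using Suc.IH[OF that(2)] j Suc unfolding takeuchi_def by simp
        then show ?thesis
          unfolding Suc sact_cons[OF that(1) comult_chain_wchains[OF that(2)]] by (rule cons_rl[OF that(1)])
      qed
      then show ?thesis
        unfolding comult_chain.simps sact_extend by (intro rl_extend_fun[OF c(1)]) (auto simp: wordsAA)
    qed
  qed
qed

text \<open>Arity 0 is separate because \<open>lam []\<close> is \<open>EndR\<close>; in arity
  \<open>n > 0\<close> the element is split \<open>n - 1\<close> times.\<close>

definition ncomult where
  "ncomult n = (if n = 0 then \<epsilon> else (\<lambda>a\<in>carrier A. clR (An n) (comult_chain (n - 1) a)))"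

lemma ncomult_Suc: "a \<in> carrier A \<Longrightarrow> ncomult (Suc k) a = clR (An (Suc k)) (comult_chain k a)"
  by (simp add: ncomult_def)

lemma An_ne: "An (Suc k) \<noteq> []" by simp

lemma ncomult_hom: "ncomult n \<in> bim_hom A (lam (An n))"
proof (cases n)
  case 0
  then show ?thesis using homs(4) by (simp add: ncomult_def lam_Nil)
next
  case (Suc k)
  note b = bAn[of "Suc k"] An_ne[of k]
  interpret P: pres "tensorR (An (Suc k))" "An (Suc k)" "rl KR (An (Suc k))" "clR (An (Suc k))" "repw (An (Suc k))"
    by (rule tensorR_pres[OF b])
  have len: "0 < length (An (Suc k))" "length (An (Suc k)) - 1 < length (An (Suc k))" by simp_all
  have closed: "ncomult n a \<in> carrier (lam (An n))" if "a \<in> carrier A" for a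
    using lam_carrier(2)[OF b comult_chain_wchains[OF that]] takeuchi_comult_chain[OF that] ncomult_Suc[OF that] Suc by simp
  have add: "ncomult n (a \<oplus>\<^bsub>A\<^esub> a') = ncomult n a \<oplus>\<^bsub>lam (An n)\<^esub> ncomult n a'" if a: "a \<in> carrier A" "a' \<in> carrier A" for a a'
  proof -
    have "frag_of [a \<oplus>\<^bsub>A\<^esub> a'] - frag_of [a] - frag_of [a'] \<in> rl KR [A]" by (rule rl_single_add[OF a])
    from mor_rl[OF comult_chain_mor[of k] this] have "comult_chain k (a \<oplus>\<^bsub>A\<^esub> a') - (comult_chain k a + comult_chain k a') \<in> rl KR (An (Suc k))"
      by (simp add: frag_extend_diff frag_extend_add diff_diff_eq)
    then have "clR (An (Suc k)) (comult_chain k (a \<oplus>\<^bsub>A\<^esub> a')) = clR (An (Suc k)) (comult_chain k a + comult_chain k a')"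
      using comult_chain_wchains a by (subst P.cl_eq_iff) (auto intro!: wchains_add simp del: replicate_Suc)
    then show ?thesis
      unfolding Suc using a comult_chain_wchains
      by (simp add: ncomult_Suc lam_sel[OF b] P.cl_add del: replicate_Suc)
  qed
  have acts: "ncomult n (lact A r a) = lact (lam (An n)) r (ncomult n a) \<and> ncomult n (lbact A r a) = lbact (lam (An n)) r (ncomult n a) \<and>
      ncomult n (ract A a r) = ract (lam (An n)) (ncomult n a) r \<and> ncomult n (rbact A a r) = rbact (lam (An n)) (ncomult n a) r"
    if a: "a \<in> carrier A" for a r
  proof -
    note ac = A.closed[OF a, of r] and w = comult_chain_wchains[OF a, of k]
    have 1: "comult_chain k (lact A r a) - sact lact (An (Suc k)) 0 r (comult_chain k a) \<in> rl KR (An (Suc k))"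
      using mor_left[OF comult_chain_mor[of k], of lbact lact "[a]" r] a by (simp add: KR_iff)
    have 2: "comult_chain k (lbact A r a) - sact lbact (An (Suc k)) (length (An (Suc k)) - 1) r (comult_chain k a) \<in> rl KR (An (Suc k))"
      using mor_right[OF comult_chain_mor[of k], of lbact lact "[a]" r] a by (simp add: KR_iff)
    have 3: "comult_chain k (ract A a r) - sact ra (An (Suc k)) 0 r (comult_chain k a) \<in> rl KR (An (Suc k))"
      using comult_chain_ra[OF a, of k r] by (simp add: ra_def[of A])
    have 4: "comult_chain k (rbact A a r) - sact rb (An (Suc k)) (length (An (Suc k)) - 1) r (comult_chain k a) \<in> rl KR (An (Suc k))"
      using comult_chain_rb[OF a, of k r] by (simp add: rb_def[of A])
    note s = bims_sact[OF b(1) len(1) w] bims_sact[OF b(1) len(2) w]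
    have cl: "clR (An (Suc k)) d = clR (An (Suc k)) d'"
      if "d - d' \<in> rl KR (An (Suc k))" "d \<in> wchains (An (Suc k))" "d' \<in> wchains (An (Suc k))" for d d'
      using P.cl_eq_iff[OF that(2,3)] that(1) by simp
    show ?thesis
      unfolding Suc ncomult_Suc[OF a] ncomult_Suc[OF ac(1)] ncomult_Suc[OF ac(2)] ncomult_Suc[OF ac(3)] ncomult_Suc[OF ac(4)] lam_act_cl[OF b w]
      using cl[OF 1 comult_chain_wchains[OF ac(1)] s(1)] cl[OF 2 comult_chain_wchains[OF ac(2)] s(6)]
        cl[OF 3 comult_chain_wchains[OF ac(3)] s(3)] cl[OF 4 comult_chain_wchains[OF ac(4)] s(8)] by simp
  qed
  show ?thesis
    unfolding bim_hom_iff bhom_def ahom_def using closed add acts Suc by (auto simp: ncomult_def simp del: replicate_Suc)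
qed

lemma ncomult_1: "ncomult 1 = (\<lambda>a\<in>carrier A. a)"
  by (auto simp: ncomult_def cls_def A.ext_of intro!: restrict_ext)

lemma ncomult_2: "ncomult 2 = \<delta>"
proof (rule extensionalityI)
  show "ncomult 2 \<in> extensional (carrier A)" "\<delta> \<in> extensional (carrier A)"
    using homs(3) by (auto simp: bim_hom_iff ncomult_def)
  fix a assume a: "a \<in> carrier A"
  have "frag_extend (\<lambda>w. frag_of [w ! 0] \<odot> frag_of [w ! 1]) (delta_chain a) = frag_extend frag_of (delta_chain a)"
    by (rule frag_extend_cong[OF delta_chain(1)[OF a]]) (auto simp: wordsAA)
  then show "ncomult 2 a = \<delta> a"
    using a ncomult_Suc[of a 1] delta_chain(3)[OF a] by (simp add: numeral_2_eq_2)
qed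

text \<open>The axiom is turned into a congruence of chains, the form in which it can be applied
  inside longer words.\<close>

lemma coassoc:
  assumes a: "a \<in> carrier A"
  shows "frag_extend (subst_at 0 (\<lambda>a. delta_chain a)) (delta_chain a) - frag_extend (subst_at 1 (\<lambda>a. delta_chain a)) (delta_chain a) \<in> rl KR [A, A, A]"
proof -
  note c = delta_chain[OF a]
  have n: "replicate (1 + 2) A = [A, A, A]" "replicate (Suc 1) A = [A, A]" "replicate 2 A = [A, A]" by (simp_all add: eval_nat_numeral)
  have B: "bracketing lam [A, A, A] 0 2 = [lam [A, A], A]" "bracketing lam [A, A, A] 1 2 = [A, lam [A, A]]"
    by (simp_all add: bracketing_def eval_nat_numeral)
  have p: "at_pos 0 1 \<delta> = [\<delta>, id]" "at_pos 1 1 \<delta> = [id, \<delta>]" by (simp_all add: at_pos_def)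
  have f: "\<delta> \<in> bhom A (lam (replicate 2 A))" using bim_hom_bhom[OF homs(3)] by (simp add: n)
  have j: "lam_join [A, A, A] 0 2 (lam_map [\<delta>, id] [A, A] [lam [A, A], A] (\<delta> a)) = clR [A, A, A] (frag_extend (subst_at 0 (\<lambda>a. delta_chain a)) (delta_chain a))"
    "lam_join [A, A, A] 1 2 (lam_map [id, \<delta>] [A, A] [A, lam [A, A]] (\<delta> a)) = clR [A, A, A] (frag_extend (subst_at 1 (\<lambda>a. delta_chain a)) (delta_chain a))"
    using join_map[OF A _ _ _ f, of 1 0, unfolded n B p, OF _ _ _ c(1,2)] join_map[OF A _ _ _ f, of 1 1, unfolded n B p, OF _ _ _ c(1,2)]
      c(3) by simp_all
  interpret P: pres "tensorR [A, A, A]" "[A, A, A]" "rl KR [A, A, A]" "clR [A, A, A]" "repw [A, A, A]"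
    by (rule tensorR_pres) (use A in auto)
  have w: "frag_extend (subst_at i (\<lambda>a. delta_chain a)) (delta_chain a) \<in> wchains [A, A, A]" if "i = 0 \<or> i = 1" for i
  proof (rule wchains_extend[OF c(1)])
    fix w assume "w \<in> words [A, A]"
    then obtain x y where xy: "w = [x, y]" "x \<in> carrier A" "y \<in> carrier A" by (auto simp: wordsAA)
    show "subst_at i (\<lambda>a. delta_chain a) w \<in> wchains [A, A, A]"
      using that cat_wchains[OF delta_chain(1)[OF xy(2)], of "frag_of [y]" "[A]"] cat_wchains[of "frag_of [x]" "[A]", OF _ delta_chain(1)[OF xy(3)]] xy
      by (auto simp: subst_at_def)
  qed
  have "clR [A, A, A] (frag_extend (subst_at 0 (\<lambda>a. delta_chain a)) (delta_chain a)) = clR [A, A, A] (frag_extend (subst_at 1 (\<lambda>a. delta_chain a)) (delta_chain a))"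
    using balg a unfolding bialgebroid_def j[symmetric] by blast
  then show ?thesis using P.cl_eq_iff[OF w w] by simp
qed

definition absorb_counit where "absorb_counit p i w = absorb (An p) i (smap (at_pos i p \<epsilon>) w)"

lemma absorb_counit_0: "absorb_counit (Suc p) 0 (x # y # v) = lact A (the_endo (\<epsilon> x) 1) y # v" if "length v = p"
  using that smap_at_pos[of "[]" 0 "y # v" "Suc p" \<epsilon> x] by (simp add: absorb_counit_def absorb_def Let_def)

lemma absorb_counit_Suc: "absorb_counit (Suc p) (Suc i) (x # v) = x # absorb_counit p i v" if "p > 0" "i \<le> p" "length v = Suc p"
proof -
  have "smap (at_pos (Suc i) (Suc p) \<epsilon>) (x # v) = x # smap (at_pos i p \<epsilon>) v"
    by (simp add: at_pos_def)
  then show ?thesis unfolding absorb_counit_def using absorb_Cons[OF A that(1,2), of "smap (at_pos i p \<epsilon>) v" x] that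
    by (simp add: at_pos_nth)
qed

lemma counit:
  assumes a: "a \<in> carrier A" and i: "i \<le> 1"
  shows "frag_extend (\<lambda>w. frag_of (absorb_counit 1 i w)) (delta_chain a) - frag_of [a] \<in> rl KR [A]"
proof -
  note c = delta_chain[OF a]
  have n: "replicate (Suc 1) A = [A, A]" "replicate 1 A = [A]" "replicate (1 + 0) A = [A]" by simp_all
  have B: "bracketing lam [A] 0 0 = [EndR, A]" "bracketing lam [A] 1 0 = [A, EndR]"
    by (simp_all add: bracketing_def lam_Nil)
  have p: "at_pos 0 1 \<epsilon> = [\<epsilon>, id]" "at_pos 1 1 \<epsilon> = [id, \<epsilon>]" by (simp_all add: at_pos_def)
  have f: "\<epsilon> \<in> bhom A EndR" using bim_hom_bhom[OF homs(4)] .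
  have j: "lam_join [A] 0 0 (lam_map [\<epsilon>, id] [A, A] [EndR, A] (\<delta> a)) = clR [A] (frag_extend (\<lambda>w. frag_of (absorb_counit 1 0 w)) (delta_chain a))"
    "lam_join [A] 1 0 (lam_map [id, \<epsilon>] [A, A] [A, EndR] (\<delta> a)) = clR [A] (frag_extend (\<lambda>w. frag_of (absorb_counit 1 1 w)) (delta_chain a))"
    using join_map_0[OF A _ _ f, of 1 0, unfolded n B p, OF _ _ c(1,2)] join_map_0[OF A _ _ f, of 1 1, unfolded n B p, OF _ _ c(1,2)]
      c(3) unfolding absorb_counit_def n p by simp_all
  have i01: "i = 0 \<or> i = 1" using i by auto
  have ax: "lam_join [A] 0 0 (lam_map [\<epsilon>, id] [A, A] [EndR, A] (\<delta> a)) = a"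
    "lam_join [A] 1 0 (lam_map [id, \<epsilon>] [A, A] [A, EndR] (\<delta> a)) = a"
    using balg a unfolding bialgebroid_def by blast+
  have e: "clR [A] (frag_extend (\<lambda>w. frag_of (absorb_counit 1 i w)) (delta_chain a)) = a"
    using ax[unfolded j] i01 by auto
  interpret P: pres "tensorR [A]" "[A]" "rl KR [A]" "clR [A]" "repw [A]"
    by (rule tensorR_pres) (use A in auto)
  have w: "frag_extend (\<lambda>w. frag_of (absorb_counit 1 i w)) (delta_chain a) \<in> wchains [A]"
  proof (rule wchains_extend[OF c(1)])
    fix w assume "w \<in> words [A, A]"
    then have "smap (at_pos i 1 \<epsilon>) w \<in> words (Br A 0 i 1)"
      using bhoms_smap_words[OF at_pos_bhoms[OF A i, of \<epsilon> 0]] f by (simp add: lam_Nil)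
    then show "frag_of (absorb_counit 1 i w) \<in> wchains [A]"
      using mor_wchains[OF absorb_mor[OF A _ i]] by (simp add: absorb_counit_def)
  qed
  have "clR [A] (frag_of [a]) = a" using a by (simp add: cls_def A.ext_of)
  then show ?thesis using P.cl_eq_iff[OF w, of "frag_of [a]"] e a by simp
qed

text \<open>At position 0 the counit axiom for the outermost \<delta> is used; at later positions
  the first letter is a spectator and the induction hypothesis applies. For \<open>p = 1\<close>
  both positions are the counit axioms.\<close>

lemma absorb_comult_chain:
  "p > 0 \<Longrightarrow> i \<le> p \<Longrightarrow> a \<in> carrier A \<Longrightarrow>
   frag_extend (\<lambda>w. frag_of (absorb_counit p i w)) (comult_chain p a) - comult_chain (p - 1) a \<in> rl KR (An p)"
proof (induction p arbitrary: i a rule: nat_induct_non_zero)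
  case 1
  have "frag_extend (\<lambda>w. frag_of [w ! 0] \<odot> frag_of [w ! 1]) (delta_chain a) = frag_extend frag_of (delta_chain a)"
    by (rule frag_extend_cong[OF delta_chain(1)[OF 1(2)]]) (auto simp: wordsAA)
  then show ?case using counit[OF 1(2,1)] by simp
next
  case (Suc p)
  note a = Suc.prems(2) and c = delta_chain(1)[OF Suc.prems(2)]
  obtain q where q: "p = Suc q" using Suc(1) by (cases p) auto
  show ?case
  proof (cases i)
    case 0
    \<comment> \<open>A left action on the first letter of an iterate is the iterate of the acted
      element, so absorbing after the expansion of the second letter equals absorbing before
      it.\<close>
    have "frag_extend (\<lambda>w. frag_of (absorb_counit (Suc p) 0 w)) (comult_chain (Suc p) a) -
        frag_extend (\<lambda>w. comult_chain p (hd w)) (frag_extend (\<lambda>w. frag_of (absorb_counit 1 0 w)) (delta_chain a)) \<in> rl KR (An (Suc p))"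
      unfolding comult_chain.simps frag_extend_extend
    proof (rule rl_extend_fun[OF c])
      fix w assume "w \<in> words [A, A]"
      then obtain x y where xy: "w = [x, y]" "x \<in> carrier A" "y \<in> carrier A" by (auto simp: wordsAA)
      let ?t = "the_endo (\<epsilon> x) 1"
      have "frag_extend (\<lambda>w. frag_of (absorb_counit (Suc p) 0 w)) (frag_of [x] \<odot> comult_chain p y) = frag_extend (\<lambda>v. frag_of (absorb_counit (Suc p) 0 (x # v))) (comult_chain p y)"
        by (simp add: cat_def frag_extend_extend)
      also have "\<dots> = sact lact (An (Suc p)) 0 ?t (comult_chain p y)"
        unfolding sact_def by (rule frag_extend_cong[OF comult_chain_wchains[OF xy(3)]]) (auto simp: words_Cons absorb_counit_0 words_length)
      finally have e: "frag_extend (\<lambda>w. frag_of (absorb_counit (Suc p) 0 w)) (frag_of [x] \<odot> comult_chain p y) = sact lact (An (Suc p)) 0 ?t (comult_chain p y)" .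
      have "absorb_counit 1 0 [x, y] = [lact A ?t y]" using absorb_counit_0[of "[]" 0 x y] by simp
      moreover have "comult_chain p (lact A ?t y) - sact lact (An (Suc p)) 0 ?t (comult_chain p y) \<in> rl KR (An (Suc p))"
        using mor_left[OF comult_chain_mor[of p], of lbact lact "[y]" ?t] xy by (simp add: KR_iff)
      ultimately show "frag_extend (\<lambda>w. frag_of (absorb_counit (Suc p) 0 w)) (frag_of [w ! 0] \<odot> comult_chain p (w ! 1)) -
          frag_extend (\<lambda>w. comult_chain p (hd w)) (frag_of (absorb_counit 1 0 w)) \<in> rl KR (An (Suc p))"
        using rl_sym e xy by simp
    qed
    from rl_trans[OF this mor_eqv[OF comult_chain_mor[of p] counit[OF a, of 0]]] show ?thesis using 0 by simp
  next
    case (Suc j)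
    have "frag_extend (\<lambda>w. frag_of (absorb_counit (Suc p) i w)) (comult_chain (Suc p) a) - comult_chain (Suc q) a \<in> rl KR (An (Suc p))"
      unfolding comult_chain.simps frag_extend_extend
    proof (rule rl_extend_fun[OF c])
      fix w assume "w \<in> words [A, A]"
      then obtain x y where xy: "w = [x, y]" "x \<in> carrier A" "y \<in> carrier A" by (auto simp: wordsAA)
      have j: "j \<le> p" using Suc.prems(1) Suc by simp
      have "frag_extend (\<lambda>w. frag_of (absorb_counit (Suc p) i w)) (frag_of [x] \<odot> comult_chain p y) = frag_extend (\<lambda>v. frag_of (absorb_counit (Suc p) i (x # v))) (comult_chain p y)"
        by (simp add: cat_def frag_extend_extend)
      also have "\<dots> = frag_extend (\<lambda>v. frag_of [x] \<odot> frag_of (absorb_counit p j v)) (comult_chain p y)"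
        by (rule frag_extend_cong[OF comult_chain_wchains[OF xy(3)]]) (use Suc Suc.hyps j absorb_counit_Suc in \<open>auto dest!: words_length\<close>)
      also have "\<dots> = frag_of [x] \<odot> frag_extend (\<lambda>v. frag_of (absorb_counit p j v)) (comult_chain p y)"
        by (rule cat_extend_right[symmetric])
      finally have e: "frag_extend (\<lambda>w. frag_of (absorb_counit (Suc p) i w)) (frag_of [x] \<odot> comult_chain p y) = frag_of [x] \<odot> frag_extend (\<lambda>v. frag_of (absorb_counit p j v)) (comult_chain p y)" .
      show "frag_extend (\<lambda>w. frag_of (absorb_counit (Suc p) i w)) (frag_of [w ! 0] \<odot> comult_chain p (w ! 1)) - frag_of [w ! 0] \<odot> comult_chain q (w ! 1) \<in> rl KR (An (Suc p))"
        using cons_rl[OF xy(2) Suc.IH[OF j xy(3)]] e xy q by simp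
    qed
    then show ?thesis using q by simp
  qed
qed

text \<open>Induction on the number of comultiplications of the first letter: one use of
  coassociativity moves the outermost of them to the second letter.\<close>

lemma comult_chain_comult_chain:
  "a \<in> carrier A \<Longrightarrow> frag_extend (\<lambda>w. comult_chain k (w ! 0) \<odot> comult_chain p (w ! 1)) (delta_chain a) - comult_chain (Suc (k + p)) a \<in> rl KR (An (Suc (Suc (k + p))))"
proof (induction k arbitrary: a)
  case 0
  then show ?case by simp
next
  case (Suc k)
  note a = Suc.prems and c = delta_chain(1)[OF Suc.prems]
  \<comment> \<open>The expansion of the second and third letters that remains after the two copies
    of \<delta>; applied to the two sides of coassociativity, it gives the two sides of the
    claim.\<close>
  let ?T = "\<lambda>w. frag_of [w ! 0] \<odot> (comult_chain k (w ! 1) \<odot> comult_chain p (w ! 2))" and ?N = "An (Suc (Suc (Suc k + p)))"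
  have N: "?N = [A] @ An (Suc k) @ An (Suc p)" by (simp add: replicate_add replicate_app_Cons_same)
  have "mor True True KR ([A] @ [A] @ [A]) ([A] @ An (Suc k) @ An (Suc p))
      (\<lambda>w. frag_of (take (length [A]) w) \<odot> (comult_chain k (hd (take (length [A]) (drop (length [A]) w))) \<odot> comult_chain p (hd (drop (length [A]) (drop (length [A]) w)))))"
    by (rule mor_tensor[OF idA_mor mor_tensor[OF comult_chain_mor comult_chain_mor]])
  then have T: "mor True True KR [A, A, A] ?N ?T"
    unfolding N unfolding append.simps by (rule mor_cong) (auto simp: words_Cons)
  have 0: "frag_extend (\<lambda>w. comult_chain (Suc k) (w ! 0) \<odot> comult_chain p (w ! 1)) (delta_chain a) = frag_extend ?T (frag_extend (subst_at 0 (\<lambda>a. delta_chain a)) (delta_chain a))"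
    unfolding frag_extend_extend
  proof (rule frag_extend_cong[OF c])
    fix w assume "w \<in> words [A, A]"
    then obtain x y where xy: "w = [x, y]" "x \<in> carrier A" "y \<in> carrier A" by (auto simp: wordsAA)
    have "frag_extend ?T (delta_chain x \<odot> frag_of [y]) = frag_extend (\<lambda>u. ?T (u @ [y])) (delta_chain x)"
      by (simp add: cat_def frag_extend_extend)
    also have "\<dots> = frag_extend (\<lambda>u. (frag_of [u ! 0] \<odot> comult_chain k (u ! 1)) \<odot> comult_chain p y) (delta_chain x)"
      by (rule frag_extend_cong[OF delta_chain(1)[OF xy(2)]]) (auto simp: wordsAA cat_assoc)
    finally show "comult_chain (Suc k) (w ! 0) \<odot> comult_chain p (w ! 1) = frag_extend ?T (subst_at 0 (\<lambda>a. delta_chain a) w)"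
      by (simp add: xy subst_at_0 cat_extend_left)
  qed
  have 1: "frag_extend ?T (frag_extend (subst_at 1 (\<lambda>a. delta_chain a)) (delta_chain a)) - comult_chain (Suc (Suc k + p)) a \<in> rl KR ?N"
    unfolding comult_chain.simps frag_extend_extend
  proof (rule rl_extend_fun[OF c])
    fix w assume "w \<in> words [A, A]"
    then obtain x y where xy: "w = [x, y]" "x \<in> carrier A" "y \<in> carrier A" by (auto simp: wordsAA)
    have "frag_extend ?T (frag_of [x] \<odot> delta_chain y) = frag_extend (\<lambda>u. ?T (x # u)) (delta_chain y)"
      by (simp add: cat_def frag_extend_extend)
    also have "\<dots> = frag_extend (\<lambda>u. frag_of [x] \<odot> (comult_chain k (u ! 0) \<odot> comult_chain p (u ! 1))) (delta_chain y)"
      by (rule frag_extend_cong[OF delta_chain(1)[OF xy(3)]]) (auto simp: wordsAA)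
    also have "\<dots> = frag_of [x] \<odot> frag_extend (\<lambda>u. comult_chain k (u ! 0) \<odot> comult_chain p (u ! 1)) (delta_chain y)"
      by (rule cat_extend_right[symmetric])
    finally have e: "frag_extend ?T (frag_of [x] \<odot> delta_chain y) = frag_of [x] \<odot> frag_extend (\<lambda>u. comult_chain k (u ! 0) \<odot> comult_chain p (u ! 1)) (delta_chain y)" .
    have s1: "subst_at 1 (\<lambda>a. delta_chain a) [x, y] = frag_of [x] \<odot> delta_chain y" by (simp add: subst_at_def)
    have k: "Suc k + p = Suc (k + p)" by simp
    show "frag_extend ?T (subst_at 1 (\<lambda>a. delta_chain a) w) - frag_of [w ! 0] \<odot> comult_chain (Suc k + p) (w ! 1) \<in> rl KR ?N"
      using cons_rl[OF xy(2) Suc.IH[OF xy(3)]] unfolding xy(1) s1 e k by simp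
  qed
  show ?case
    using rl_trans[OF mor_eqv[OF T coassoc[OF a]] 1] 0 by simp
qed

text \<open>A further iterate inserted at position 0 is the preceding lemma. Elsewhere the first
  letter is peeled off and the position decreases.\<close>

lemma subst_at_comult_chain:
  "i \<le> p \<Longrightarrow> a \<in> carrier A \<Longrightarrow> frag_extend (subst_at i (comult_chain k)) (comult_chain p a) - comult_chain (p + k) a \<in> rl KR (An (Suc (p + k)))"
proof (induction p arbitrary: i a)
  case 0
  then show ?case by (simp add: subst_at_0)
next
  case (Suc p)
  note a = Suc.prems(2) and c = delta_chain(1)[OF Suc.prems(2)]
  have subst_at: "frag_extend (subst_at i (comult_chain k)) (frag_of [x] \<odot> comult_chain p y) = frag_extend (\<lambda>v. subst_at i (comult_chain k) (x # v)) (comult_chain p y)" for x y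
    by (simp add: cat_def frag_extend_extend)
  show ?case
  proof (cases i)
    case 0
    have "frag_extend (subst_at i (comult_chain k)) (comult_chain (Suc p) a) = frag_extend (\<lambda>w. comult_chain k (w ! 0) \<odot> comult_chain p (w ! 1)) (delta_chain a)"
      unfolding comult_chain.simps frag_extend_extend
    proof (rule frag_extend_cong[OF c])
      fix w assume "w \<in> words [A, A]"
      then obtain x y where xy: "w = [x, y]" by (auto simp: wordsAA)
      have "frag_extend (\<lambda>v. comult_chain k x \<odot> frag_of v) (comult_chain p y) = comult_chain k x \<odot> comult_chain p y"
        using cat_extend_right[of "comult_chain k x" frag_of "comult_chain p y"] by simp
      then show "frag_extend (subst_at i (comult_chain k)) (frag_of [w ! 0] \<odot> comult_chain p (w ! 1)) = comult_chain k (w ! 0) \<odot> comult_chain p (w ! 1)"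
        using subst_at[of x y] 0 by (simp add: xy subst_at_0)
    qed
    then show ?thesis using comult_chain_comult_chain[OF a, of k p] by (simp add: add.commute)
  next
    case (Suc j)
    have j: "j \<le> p" using Suc.prems(1) Suc by simp
    have "frag_extend (subst_at i (comult_chain k)) (comult_chain (Suc p) a) - comult_chain (Suc (p + k)) a \<in> rl KR (An (Suc (Suc (p + k))))"
      unfolding comult_chain.simps frag_extend_extend
    proof (rule rl_extend_fun[OF c])
      fix w assume "w \<in> words [A, A]"
      then obtain x y where xy: "w = [x, y]" "x \<in> carrier A" "y \<in> carrier A" by (auto simp: wordsAA)
      have "frag_extend (\<lambda>v. frag_of [x] \<odot> subst_at j (comult_chain k) v) (comult_chain p y) = frag_of [x] \<odot> frag_extend (subst_at j (comult_chain k)) (comult_chain p y)"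
        by (rule cat_extend_right[symmetric])
      then show "frag_extend (subst_at i (comult_chain k)) (frag_of [w ! 0] \<odot> comult_chain p (w ! 1)) - frag_of [w ! 0] \<odot> comult_chain (p + k) (w ! 1) \<in> rl KR (An (Suc (Suc (p + k))))"
        using subst_at[of x y] cons_rl[OF xy(2) Suc.IH[OF j xy(3)]] Suc by (simp add: xy subst_at_Suc del: replicate_Suc)
    qed
    then show ?thesis by simp
  qed
qed

lemma ncomult_comonoid: "comonoid_structure A ncomult"
  unfolding comonoid_structure_def
proof (intro conjI allI impI ncomult_hom ncomult_1)
  fix p l i :: nat assume i: "i \<le> p"
  let ?N = "An (p + l)" and ?B = "bracketing lam (An (p + l)) i l"
  have "ncomult (p + l) a = lam_join ?N i l (lam_map (at_pos i p (ncomult l)) (An (Suc p)) ?B (ncomult (Suc p) a))"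
    if a: "a \<in> carrier A" for a
  proof (cases "p = 0")
    \<comment> \<open>The block is everything and \<open>lam_join\<close> is the identity, so the
      axiom says that \<open>ncomult 1\<close> is the identity.\<close>
    case True
    then have B: "?B = [lam (An l)]" and i0: "i = 0" using i by (simp_all add: bracketing_def)
    have d: "ncomult l a \<in> carrier (lam (An l))" by (rule bhom_closed[OF bim_hom_bhom[OF ncomult_hom] a])
    have "lam_map [ncomult l] [A] [lam (An l)] a = ncomult l a"
      using a by (simp add: lam_map_def lift_def pureR_def lam_single)
    then show ?thesis
      using d a ncomult_1 unfolding True B i0 by (simp add: at_pos_def lam_join_def bracketing_def lam_single)
  next
    case False
    then have p: "p > 0" by simp
    note c = comult_chain_wchains[OF a, of p] takeuchi_comult_chain[OF a, of p]
    have fl: "ncomult l \<in> bhom A (lam (An l))" by (rule bim_hom_bhom[OF ncomult_hom])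
    consider "l = 0" | "l = 1" | "l \<ge> 2" by linarith
    then show ?thesis
    proof cases
      case 1
      have fe: "ncomult l \<in> bhom A EndR" using fl 1 by (simp add: lam_Nil)
      obtain q where q: "p = Suc q" using p by (cases p) auto
      interpret P: pres "tensorR (An p)" "An p" "rl KR (An p)" "clR (An p)" "repw (An p)"
        by (rule tensorR_pres[OF bAn]) (use p in simp)
      have "lam_join (An p) i 0 (lam_map (at_pos i p (ncomult 0)) (An (Suc p)) (bracketing lam (An (p + 0)) i 0) (clR (An (Suc p)) (comult_chain p a)))
          = clR (An p) (frag_extend (\<lambda>w. frag_of (absorb_counit p i w)) (comult_chain p a))"
        unfolding absorb_counit_def using join_map_0[OF A p i fe c] 1 by (simp add: ncomult_def)
      also have "\<dots> = clR (An p) (comult_chain (p - 1) a)"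
      proof -
        have ad: "frag_extend (\<lambda>w. frag_of (absorb_counit p i w)) (comult_chain p a) - comult_chain (p - 1) a \<in> rl KR (An p)" by (rule absorb_comult_chain[OF p i a])
        have w: "comult_chain (p - 1) a \<in> wchains (An p)" using comult_chain_wchains[OF a, of q] q by simp
        \<comment> \<open>That the substituted chain consists of words over the right factors
          follows from its congruence with a chain known to do so.\<close>
        have "(frag_extend (\<lambda>w. frag_of (absorb_counit p i w)) (comult_chain p a) - comult_chain (p - 1) a) + comult_chain (p - 1) a \<in> wchains (An p)"
          using ad rl_wchains[OF bims_adm(1)[OF bAn]] by (intro wchains_add[OF _ w]) auto
        then show ?thesis using P.cl_eq_iff[OF _ w] ad by simp
      qed
      finally show ?thesis using 1 ncomult_Suc[OF a, of p] ncomult_Suc[OF a, of q] q by (simp del: replicate_Suc)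
    next
      case 2
      \<comment> \<open>A block of length one leaves the list of factors unchanged, and both
        \<open>lam_map\<close> and \<open>lam_join\<close> are identities.\<close>
      have "?B = An i @ A # An (p - i)" using bracketing_An[OF i, of lam l] 2 by (simp add: lam_single)
      also have "\<dots> = An (Suc p)" using i by (simp add: replicate_app_Cons_same replicate_add[symmetric])
      finally have B: "?B = An (Suc p)" .
      have d: "ncomult (Suc p) a \<in> carrier (lam (An (Suc p)))" by (rule bhom_closed[OF bim_hom_bhom[OF ncomult_hom] a])
      have "lam_map (at_pos i p (ncomult 1)) (An (Suc p)) (An (Suc p)) (ncomult (Suc p) a) = ncomult (Suc p) a"
      proof (rule lam_map_ident[OF bAn _ _ d])
        fix j x assume "j < length (An (Suc p))" "x \<in> carrier (An (Suc p) ! j)"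
        then have "j < Suc p" "x \<in> carrier A" by (simp_all del: replicate_Suc)
        then show "(at_pos i p (ncomult 1) ! j) x = x" unfolding ncomult_1 by (simp add: at_pos_nth)
      qed (simp add: at_pos_nth)
      then show ?thesis using d B 2 by (simp add: lam_join_def del: replicate_Suc)
    next
      case 3
      then obtain k where k: "l = Suc k" by (cases l) auto
      interpret P: pres "tensorR ?N" ?N "rl KR ?N" "clR ?N" "repw ?N"
        by (rule tensorR_pres[OF bAn]) (use p in simp)
      interpret L: pres "tensorR (An l)" "An l" "rl KR (An l)" "clR (An l)" "repw (An l)"
        by (rule tensorR_pres[OF bAn]) (use k in simp)
      \<comment> \<open>The join expands the stored representative of the class, which is only
        congruent to the recursive chain.\<close>
      have e: "repw (An l) (ncomult l b) - comult_chain k b \<in> rl KR (An l)" if "b \<in> carrier A" for b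
        using L.rep_cl[of "comult_chain k b"] comult_chain_wchains[OF that, of k] ncomult_Suc[OF that, of k] k by simp
      have "frag_extend (subst_at i (\<lambda>b. repw (An l) (ncomult l b))) (comult_chain p a) - frag_extend (subst_at i (comult_chain k)) (comult_chain p a) \<in> rl KR ?N"
        by (rule subst_at_eqv[OF i e c(1)])
      moreover have "frag_extend (subst_at i (comult_chain k)) (comult_chain p a) - comult_chain (p + k) a \<in> rl KR ?N"
        using subst_at_comult_chain[OF i a, of k] k by simp
      ultimately have d: "frag_extend (subst_at i (\<lambda>b. repw (An l) (ncomult l b))) (comult_chain p a) - comult_chain (p + k) a \<in> rl KR ?N"
        by (rule rl_trans)
      have w: "comult_chain (p + k) a \<in> wchains ?N" using comult_chain_wchains[OF a, of "p + k"] k by simp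
      have "(frag_extend (subst_at i (\<lambda>b. repw (An l) (ncomult l b))) (comult_chain p a) - comult_chain (p + k) a) + comult_chain (p + k) a \<in> wchains ?N"
        using d rl_wchains[OF bims_adm(1)[OF bAn]] by (intro wchains_add[OF _ w]) auto
      then have "clR ?N (frag_extend (subst_at i (\<lambda>b. repw (An l) (ncomult l b))) (comult_chain p a)) = clR ?N (comult_chain (p + k) a)"
        using P.cl_eq_iff[OF _ w] d by simp
      then show ?thesis
        using join_map[OF A p 3 i fl c] ncomult_Suc[OF a, of p] ncomult_Suc[OF a, of "p + k"] k by simp
    qed
  qed
  then show "ncomult (p + l) = restrict (lam_join ?N i l \<circ> lam_map (at_pos i p (ncomult l)) (An (Suc p)) ?B \<circ> ncomult (Suc p)) (carrier A)"
    using ncomult_hom[of "p + l"] by (intro extensionalityI[where A = "carrier A"]) (auto simp: bim_hom_iff)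
qed

end


section \<open>The unit interchange maps\<close>

abbreviation Rn :: "nat \<Rightarrow> ('r::{ring, monoid_mult}, 'a) ubimod list" where "Rn q \<equiv> replicate q Renv"

definition unit_elt :: "nat \<Rightarrow> ('r::{ring, monoid_mult}, 'a) univ" where
  "unit_elt q = (if q = 0 then Endo id else pureR (Rn q) (replicate q Renv_one))"

lemma Rn_bims: "bims (Rn q)"
  by (simp add: Renv_bimodule)

lemma ones_words: "replicate q Renv_one \<in> words (Rn q)"
  by (simp add: words_iff_nth Renv_one_eq pureS_closed)

lemma unit_elt_eq: "q > 0 \<Longrightarrow> unit_elt q = clR (Rn q) (frag_of (replicate q Renv_one))"
  using pureR_eq[OF Rn_bims _ ones_words, of q] by (simp add: unit_elt_def)

text \<open>At the unit of \<open>R^e\<close> left and right actions agree, so the Takeuchi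
  difference is itself a balancing relator.\<close>

lemma takeuchi_ones: "takeuchi (Rn q :: ('r::{ring, monoid_mult}, 'a) ubimod list) (frag_of (replicate q Renv_one))"
  unfolding takeuchi_def
proof (intro allI impI)
  let ?R = "Rn q :: ('r, 'a) ubimod list"
  fix j s assume j: "Suc j < length ?R"
  have "wact rb ?R j s (replicate q Renv_one) = wact lbact ?R j s (replicate q Renv_one)"
    "wact ra ?R (Suc j) s (replicate q Renv_one) = wact lact ?R (Suc j) s (replicate q Renv_one)"
    using j by (simp_all add: wact_def Renv_one_eq Renv_act ra_def rb_def)
  then show "sact rb ?R j s (frag_of (replicate q Renv_one)) - sact ra ?R (Suc j) s (frag_of (replicate q Renv_one)) \<in> rl KR ?R"
    using rl_balI[OF ones_words j, of lbact lact KR s] by (simp add: KR_iff)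
qed

lemma unit_elt_closed: "unit_elt q \<in> carrier (lam (Rn q :: ('r::{ring, monoid_mult}, 'a) ubimod list))"
proof (cases "q = 0")
  case True
  then show ?thesis by (simp add: unit_elt_def lam_Nil EndR_def)
next
  case False
  let ?R = "Rn q :: ('r, 'a) ubimod list" and ?u = "frag_of (replicate q Renv_one) :: ('r, 'a) chain"
  have "unit_elt q = clR ?R ?u" "?R \<noteq> []" "?u \<in> wchains ?R" using unit_elt_eq[of q] ones_words[of q] False by simp_all
  then show ?thesis
    using lam_carrier(2)[OF Rn_bims, of q ?u] takeuchi_ones[of q] by simp
qed

text \<open>The prescribed value is biadditive in \<open>a\<close> and \<open>b\<close>, and over
  the integers no balancing has to be checked.\<close>

lemma chi_unit_ahom: "chi_unit q \<in> ahom Renv (lam (Rn q :: ('r::{ring, monoid_mult}, 'a) ubimod list))"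
  and chi_unit_pure: "chi_unit q (pureS a b) = lact (lam (Rn q :: ('r, 'a) ubimod list)) a (lbact (lam (Rn q)) b (unit_elt q))"
proof -
  let ?N = "lam (Rn q :: ('r, 'a) ubimod list)"
  have bN: "bimodule ?N" by (rule lam_bimodule[OF Rn_bims])
  interpret N: bimodule ?N by (rule bN)
  interpret P: pres "Renv :: ('r, 'a) ubimod" SS "rl {} SS" clS chain_of by (rule Renv_pres)
  let ?h = "\<lambda>w :: ('r, 'a) univ list. lact ?N (the_scal (w ! 0)) (lbact ?N (the_scal (w ! 1)) (unit_elt q))"
  have u: "unit_elt q \<in> carrier ?N" by (rule unit_elt_closed)
  have hc: "lact ?N a (lbact ?N b (unit_elt q)) \<in> carrier ?N" for a b using N.closed u by simp
  then have hw: "?h \<in> words SS \<rightarrow> carrier ?N" by auto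
  have adm: "\<forall>M\<in>set SS. adm {} (M :: ('r, 'a) ubimod)" by (simp add: adm_scalM)
  have k: "Poly_Mapping.keys c \<subseteq> words SS" if "c \<in> wchains SS" for c :: "('r, 'a) chain" using that by (simp add: wchains_def)
  have eo: "ext ?N ?h (frag_of w) = ?h w" for w by (rule N.ext_of) (rule hc)
  have c: "(frag_of [Scal a, Scal b] :: ('r, 'a) chain) \<in> wchains SS" for a b by (simp add: words_SS)
  have eh: "ext ?N ?h (frag_of u - (frag_of v + frag_of w)) = ?h u \<ominus>\<^bsub>?N\<^esub> (?h v \<oplus>\<^bsub>?N\<^esub> ?h w)"
    if "u \<in> words SS" "v \<in> words SS" "w \<in> words SS" for u v w
  proof -
    have m: "frag_of u \<in> wchains SS" "frag_of v \<in> wchains SS" "frag_of w \<in> wchains SS" using that by simp_all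
    show ?thesis unfolding N.ext_diff[OF k[OF m(1)] k[OF wchains_add[OF m(2,3)]] hw] N.ext_add[OF k[OF m(2)] k[OF m(3)] hw] eo ..
  qed
  have rels: "ext ?N ?h z = \<zero>\<^bsub>?N\<^esub>" if "z \<in> mrel SS \<union> bal {} SS" for z :: "('r, 'a) chain"
  proof -
    \<comment> \<open>Seen as two one-letter blocks, the relators are additive in one of the
      scalars; the crossing case is void for the empty balancing.\<close>
    have "z \<in> mrel ([scalM] @ [scalM]) \<union> bal {} ([scalM] @ [scalM])" using that by simp
    then show ?thesis
    proof (cases rule: rels_append_cases)
      case (left z' v)
      then obtain a a' b where z: "z' = frag_of [Scal (a + a')] - frag_of [Scal a] - frag_of [Scal a']" and v: "v = [Scal b]"
        unfolding rels_single by (auto simp: words_Cons scalM_def)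
      have "ext ?N ?h z = ?h [Scal (a + a'), Scal b] \<ominus>\<^bsub>?N\<^esub> (?h [Scal a, Scal b] \<oplus>\<^bsub>?N\<^esub> ?h [Scal a', Scal b])"
        unfolding left(3) z v using eh[of "[Scal (a + a'), Scal b]" "[Scal a, Scal b]" "[Scal a', Scal b]"] by (simp add: cat_diff_left cat_add_left diff_diff_eq words_SS)
      then show ?thesis using N.add_act(1)[of "lbact ?N b (unit_elt q)" a a'] N.closed u by (simp add: a_minus_def N.r_neg)
    next
      case (right v z')
      then obtain a b b' where z: "z' = frag_of [Scal (b + b')] - frag_of [Scal b] - frag_of [Scal b']" and v: "v = [Scal a]"
        unfolding rels_single by (auto simp: words_Cons scalM_def)
      have "ext ?N ?h z = ?h [Scal a, Scal (b + b')] \<ominus>\<^bsub>?N\<^esub> (?h [Scal a, Scal b] \<oplus>\<^bsub>?N\<^esub> ?h [Scal a, Scal b'])"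
        unfolding right(3) z v using eh[of "[Scal a, Scal (b + b')]" "[Scal a, Scal b]" "[Scal a, Scal b']"] by (simp add: cat_diff_right cat_add_right diff_diff_eq words_SS)
      then show ?thesis using N.add_act(2)[OF u, of b b'] N.act_add(1) N.closed u by (simp add: a_minus_def N.r_neg)
    qed simp
  qed
  note kill = ext_kill[OF N.abelian_group_axioms hw adm rels]
  have e: "chi_unit q x = ext ?N ?h (chain_of x)" if "x \<in> carrier Renv" for x :: "('r, 'a) univ"
    using that by (simp add: chi_unit_def Let_def addext_eq_ext unit_elt_def)
  show "chi_unit q \<in> ahom Renv ?N"
    by (rule ahom_cong[OF P.ext_ahom[OF N.abelian_group_axioms hw kill] _ P.T.abelian_group_axioms]) (simp_all add: e)
  show "chi_unit q (pureS a b) = lact ?N a (lbact ?N b (unit_elt q))"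
    using e[OF pureS_closed, of a b] P.ext_cl[OF N.abelian_group_axioms hw kill c, of a b] eo by simp
qed

lemma smap_replicate: "length w = n \<Longrightarrow> smap (replicate n f) w = map f w"
  by (rule nth_equalityI) auto

lemma bhoms_replicate: "f \<in> bhom M N \<Longrightarrow> bhoms (replicate n f) (replicate n M) (replicate n N)"
  by (simp add: bhoms_def)

context balg
begin


section \<open>Compatibility\<close>

text \<open>The product of the Takeuchi product of copies of \<open>A\<close> at the level of
  chains; its compatibility with relations rests on the Takeuchi condition on the first
  argument.\<close>

definition mul_chain :: "('r, 'a) chain \<Rightarrow> ('r, 'a) chain \<Rightarrow> ('r, 'a) chain" where
  "mul_chain c d = frag_extend (\<lambda>u. frag_extend (\<lambda>v. frag_of (map2 mul u v)) d) c"

lemma mul_chain_extend: "mul_chain (frag_extend f c) (frag_extend g d) = frag_extend (\<lambda>u. frag_extend (\<lambda>v. mul_chain (f u) (g v)) d) c"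
  unfolding mul_chain_def frag_extend_extend by (subst frag_extend_swap) (rule refl)

lemma mul_chain_cons: "mul_chain (frag_of [x] \<odot> c) (frag_of [y] \<odot> d) = frag_of [mul x y] \<odot> mul_chain c d"
proof -
  have "mul_chain (frag_of [x] \<odot> c) (frag_of [y] \<odot> d) = frag_extend (\<lambda>u. frag_extend (\<lambda>v. frag_of [mul x y] \<odot> frag_of (map2 mul u v)) d) c"
    by (simp add: mul_chain_def cat_def frag_extend_extend)
  also have "\<dots> = frag_of [mul x y] \<odot> mul_chain c d"
    unfolding mul_chain_def by (simp only: cat_extend_right)
  finally show ?thesis .
qed

lemma O_bim: "bimodule (omega (An p))"
  by (rule omega_bimodule[OF bAn])

lemma mu_pair_chain:
  assumes "c \<in> wchains (An n)" "d \<in> wchains (An n)"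
  shows "frag_extend (\<lambda>w. frag_of (smap (replicate n \<mu>) w)) (pair_chain (An n) (An n) c d) = mul_chain c d"
  unfolding pair_chain_def mul_chain_def frag_extend_extend frag_extend_of
proof (intro frag_extend_cong[OF assms(1)] frag_extend_cong[OF assms(2)] arg_cong[where f = frag_of])
  fix u v assume uv: "u \<in> words (An n)" "v \<in> words (An n)"
  show "smap (replicate n \<mu>) (pair_word (An n) (An n) u v) = map2 mul u v"
  proof (rule nth_equalityI)
    fix j assume "j < length (smap (replicate n \<mu>) (pair_word (An n) (An n) u v))"
    then have j: "j < n" by (simp add: pair_word_def)
    have "pureE [A, A] [u ! j, v ! j] = pr A A (u ! j) (v ! j)"
      by (rule pureE_eq[OF bAA]) (use words_nth[OF uv(1), of j] words_nth[OF uv(2), of j] j in simp)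
    then show "smap (replicate n \<mu>) (pair_word (An n) (An n) u v) ! j = map2 mul u v ! j"
      using j words_length[OF uv(1)] words_length[OF uv(2)] by (simp add: pair_word_def mul_def)
  qed (use words_length[OF uv(1)] words_length[OF uv(2)] in \<open>simp add: pair_word_def\<close>)
qed

text \<open>The letterwise product is the shuffle followed by \<mu> in each slot, so the claim
  descends from \<open>pair_chain_eqv\<close>.\<close>

lemma mul_chain_eqv:
  assumes n: "n > 0" and c: "c \<in> wchains (An n)" "takeuchi (An n) c" "d \<in> wchains (An n)"
    and c': "c' \<in> wchains (An n)" "c - c' \<in> rl KR (An n)" and d': "d' \<in> wchains (An n)" "d - d' \<in> rl KR (An n)"
  shows "mul_chain c d - mul_chain c' d' \<in> rl KR (An n)"
proof -
  have ne: "An n \<noteq> []" using n by simp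
  have OA: "bimodule (omega [A, A])" using bAA by (intro omega_bimodule)
  have "pair_chain (An n) (An n) c d - pair_chain (An n) (An n) c' d' \<in> rl KR (prods (An n) (An n))"
    by (rule pair_chain_eqv[OF bAn bAn refl ne c(1,2) d'(1) c'(2) d'(2)])
  moreover have "mor True True KR (replicate n (omega [A, A])) (An n) (\<lambda>w. frag_of (smap (replicate n \<mu>) w))"
    by (rule bhoms_mor(1)[OF bhoms_replicate[OF bim_hom_bhom[OF homs(1)]] _ bAn]) (use n OA in auto)
  ultimately show ?thesis
    using mor_eqv mu_pair_chain[OF c(1,3)] mu_pair_chain[OF c'(1) d'(1)] by (fastforce simp: prods_replicate[OF A])
qed

lemma delta_mul:
  assumes ab: "a \<in> carrier A" "b \<in> carrier A"
  shows "delta_chain (mul a b) - mul_chain (delta_chain a) (delta_chain b) \<in> rl KR [A, A]"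
proof -
  let ?x = "pr A A a b" and ?L = "lam [A, A]"
  have L: "bimodule ?L" using bAA by (intro lam_bimodule)
  have OA: "bimodule (omega [A, A])" using bAA by (intro omega_bimodule)
  have x: "?x \<in> carrier (omega [A, A])" by (rule biaddD(1)[OF pr_biadd[OF A A] ab])
  note d = delta_closed[OF ab(1)] delta_closed[OF ab(2)] and ca = delta_chain[OF ab(1)] and cb = delta_chain[OF ab(2)]
  have "omega_map [\<delta>, \<delta>] [A, A] [?L, ?L] ?x = pr ?L ?L (\<delta> a) (\<delta> b)"
    by (rule omega_map_pr[OF A A L L bim_hom_bhom[OF homs(3)] bim_hom_bhom[OF homs(3)] ab])
  then have c2x: "chi2 [A, A] [A, A] (omega_map [\<delta>, \<delta>] [A, A] [?L, ?L] ?x) = clR (prods [A, A] [A, A]) (pair_chain [A, A] [A, A] (delta_chain a) (delta_chain b))"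
    using chi2_bhom_ne(2)[OF bAA(1) bAA(1) refl bAA(2) d] lpair_def[OF bAA(1) bAA(1) refl bAA(2)] by simp
  have PPw: "pair_chain [A, A] [A, A] (delta_chain a) (delta_chain b) \<in> wchains [omega [A, A], omega [A, A]]"
    using pair_chain_wchains[OF bAA(1) bAA(1) refl bAA(2) ca(1) cb(1)] by simp
  have PPt: "takeuchi [omega [A, A], omega [A, A]] (pair_chain [A, A] [A, A] (delta_chain a) (delta_chain b))"
    using takeuchi_pair_chain[OF bAA(1) bAA(1) refl bAA(2) ca(1,2) cb(1,2)] by simp
  have MPe: "frag_extend (\<lambda>w. frag_of (smap [\<mu>, \<mu>] w)) (pair_chain [A, A] [A, A] (delta_chain a) (delta_chain b)) = mul_chain (delta_chain a) (delta_chain b)"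
    using mu_pair_chain[of "delta_chain a" 2 "delta_chain b"] ca cb by (simp add: numeral_2_eq_2)
  have mb: "bhoms [\<mu>, \<mu>] [omega [A, A], omega [A, A]] [A, A]" using bim_hom_bhom[OF homs(1)] by simp
  have bO: "bims [omega [A, A], omega [A, A]]" "[omega [A, A], omega [A, A]] \<noteq> []" using OA by auto
  have "\<delta> (mul a b) = lam_map [\<mu>, \<mu>] [omega [A, A], omega [A, A]] [A, A] (chi2 [A, A] [A, A] (omega_map [\<delta>, \<delta>] [A, A] [?L, ?L] ?x))"
    using balg x unfolding bialgebroid_def mul_def by blast
  also have "\<dots> = clR [A, A] (mul_chain (delta_chain a) (delta_chain b))"
    unfolding c2x using lam_map_cl(2)[OF mb bO(1) bAA(1) bO(2) PPw PPt] MPe by simp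
  finally have e: "clR [A, A] (delta_chain (mul a b)) = clR [A, A] (mul_chain (delta_chain a) (delta_chain b))" using delta_chain(3)[OF mulD(1)[OF ab]] by simp
  have w: "mul_chain (delta_chain a) (delta_chain b) \<in> wchains [A, A]"
    using mor_extend_wchains[OF bhoms_mor(1)[OF mb bO(1) bAA(1) bO(2)] PPw] MPe by simp
  interpret P: pres "tensorR [A, A]" "[A, A]" "rl KR [A, A]" "clR [A, A]" "repw [A, A]" by (rule tensorR_pres[OF bAA])
  show ?thesis using P.cl_eq_iff[OF delta_chain(1)[OF mulD(1)[OF ab]] w] e by simp
qed

text \<open>Multiplicativity of \<delta> gives the first splitting; then the first letters multiply
  directly and the second letters are expanded by the induction hypothesis.\<close>

lemma comult_chain_mul:
  "a \<in> carrier A \<Longrightarrow> b \<in> carrier A \<Longrightarrow> comult_chain k (mul a b) - mul_chain (comult_chain k a) (comult_chain k b) \<in> rl KR (An (Suc k))"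
proof (induction k arbitrary: a b)
  case 0
  then show ?case by (simp add: mul_chain_def)
next
  case (Suc k)
  note ca = delta_chain(1)[OF Suc.prems(1)] and cb = delta_chain(1)[OF Suc.prems(2)]
  let ?I = "\<lambda>w. frag_of [w ! 0] \<odot> comult_chain k (w ! 1)"
  have 1: "comult_chain (Suc k) (mul a b) - frag_extend ?I (mul_chain (delta_chain a) (delta_chain b)) \<in> rl KR (An (Suc (Suc k)))"
    using mor_eqv[OF ID_mor[of k] delta_mul[OF Suc.prems]] by simp
  have "frag_extend ?I (mul_chain (delta_chain a) (delta_chain b)) - mul_chain (comult_chain (Suc k) a) (comult_chain (Suc k) b) \<in> rl KR (An (Suc (Suc k)))"
    unfolding comult_chain.simps mul_chain_extend unfolding mul_chain_def[of "delta_chain a"] frag_extend_extend frag_extend_of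
  proof (rule rl_extend_fun[OF ca], rule rl_extend_fun[OF cb])
    fix u v assume "u \<in> words [A, A]" "v \<in> words [A, A]"
    then obtain x x' y y' where xy: "u = [x, x']" "v = [y, y']" "x \<in> carrier A" "x' \<in> carrier A" "y \<in> carrier A" "y' \<in> carrier A"
      by (auto simp: wordsAA)
    show "?I (map2 mul u v) - mul_chain (frag_of [u ! 0] \<odot> comult_chain k (u ! 1)) (frag_of [v ! 0] \<odot> comult_chain k (v ! 1)) \<in> rl KR (An (Suc (Suc k)))"
      using cons_rl[OF mulD(1)[OF xy(3,5)] Suc.IH[OF xy(4,6)]] by (simp add: xy(1,2) mul_chain_cons)
  qed
  with 1 show ?case by (rule rl_trans)
qed

text \<open>The slotwise content of the recursion for \<open>chi\<close>: on pure tensors,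
  unsplitting and multiplying all letters multiplies the first letter by the product of the
  others.\<close>

lemma nmult_unsp:
  assumes p: "p > 0" and x: "x \<in> carrier A" and z: "z \<in> carrier (omega (An p))"
  shows "nmult (Suc p) (unsp A p (pr A (omega (An p)) x z)) = mul x (nmult p z)"
proof -
  interpret P: pres "omega (An p)" "An p" "rl KE (An p)" "clE (An p)" "repw (An p)" by (rule An_pres[OF p])
  have pa: "pr A (omega (An p)) x \<in> ahom (omega (An p)) (omega [A, omega (An p)])"
    using pr_biadd[OF A O_bim[of p]] x by (simp add: biadd_def)
  have f: "(\<lambda>z. nmult (Suc p) (unsp A p (pr A (omega (An p)) x z))) \<in> ahom (omega (An p)) A"
    by (rule ahom_comp[OF ahom_comp[OF pa bhom_ahom[OF unsp_bhom[OF A p]]] bhom_ahom[OF bim_hom_bhom[OF nmult_hom]]])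
  have g: "(\<lambda>z. mul x (nmult p z)) \<in> ahom (omega (An p)) A"
    by (rule ahom_comp[OF bhom_ahom[OF bim_hom_bhom[OF nmult_hom]]]) (use mul_biadd x in \<open>simp add: biadd_def\<close>)
  show ?thesis
  proof (rule P.eqI[OF A.abelian_group_axioms f g _ z])
    fix w assume w: "w \<in> words (An p)"
    have e: "clE (An p) (frag_of w) = pureE (An p) w" by (rule pureE_eq[OF bAn _ w, symmetric]) (use p in simp)
    show "nmult (Suc p) (unsp A p (pr A (omega (An p)) x (clE (An p) (frag_of w)))) = mul x (nmult p (clE (An p) (frag_of w)))"
      unfolding e unsp_pure[OF A p x w] using nmult_pure[of "x # w" "Suc p"] nmult_pure[OF w] x w by simp
  qed
qed

abbreviation "LA q \<equiv> lam (An q)"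

lemma LA_bim: "bimodule (LA q)"
  by (rule lam_bimodule[OF bAn])

lemma ncomult_closed: "a \<in> carrier A \<Longrightarrow> ncomult q a \<in> carrier (LA q)"
  by (rule bhom_closed[OF bim_hom_bhom[OF ncomult_hom]])

lemma map_ncomult_words: "w \<in> words (An p) \<Longrightarrow> map (ncomult q) w \<in> words (replicate p (LA q))"
  by (auto simp: words_iff_nth ncomult_closed)

text \<open>The step of the induction on the number of rows. \<open>y\<close> stands for the
  interchange of the remaining rows, and \<open>my\<close> is what the induction hypothesis says
  about it.\<close>

lemma chi_product:
  assumes p: "p > 0" and a: "a \<in> carrier A" and z: "z \<in> carrier A"
    and y: "y \<in> carrier (lam (replicate q (omega (An p))))"
    and my: "lam_map (replicate q (nmult p)) (replicate q (omega (An p))) (An q) y = ncomult q z"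
  shows "lam_map (replicate q (nmult (Suc p))) (replicate q (omega (An (Suc p)))) (An q)
     (lam_map (replicate q (unsp A p)) (replicate q (omega [A, omega (An p)])) (replicate q (omega (An (Suc p))))
       (chi2 (An q) (replicate q (omega (An p))) (pr (LA q) (lam (replicate q (omega (An p)))) (ncomult q a) y))) = ncomult q (mul a z)"
proof (cases q)
  case 0
  \<comment> \<open>For empty lists every \<open>lam_map\<close> is the identity on
    \<open>EndR\<close>, and the claim becomes the compatibility of \<epsilon> with \<mu>.\<close>
  have y0: "y \<in> carrier EndR" using y 0 by (simp add: lam_Nil)
  have e: "ncomult 0 = \<epsilon>" by (simp add: ncomult_def)
  have y': "y = \<epsilon> z" using my y0 0 e by (simp add: lam_map_def lam_Nil)
  have ea: "\<epsilon> a \<in> carrier EndR" "\<epsilon> z \<in> carrier EndR" using bhom_closed[OF bim_hom_bhom[OF homs(4)]] a z by auto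
  have E: "bimodule EndR" by (rule EndR_bimodule)
  let ?x = "pr A A a z"
  have x: "?x \<in> carrier (omega [A, A])" by (rule biaddD(1)[OF pr_biadd[OF A A] a z])
  have "\<epsilon> (mul a z) = chi2 [] [] (omega_map [\<epsilon>, \<epsilon>] [A, A] [EndR, EndR] ?x)"
    using balg x unfolding bialgebroid_def mul_def by blast
  also have "omega_map [\<epsilon>, \<epsilon>] [A, A] [EndR, EndR] ?x = pr EndR EndR (\<epsilon> a) (\<epsilon> z)"
    by (rule omega_map_pr[OF A A E E bim_hom_bhom[OF homs(4)] bim_hom_bhom[OF homs(4)] a z])
  finally have m: "chi2 [] [] (pr EndR EndR (\<epsilon> a) (\<epsilon> z)) = \<epsilon> (mul a z)" by simp
  have "\<epsilon> (mul a z) \<in> carrier EndR" using bhom_closed[OF bim_hom_bhom[OF homs(4)]] mulD(1)[OF a z] by simp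
  then show ?thesis using 0 e m y' by (simp add: lam_map_def lam_Nil)
next
  case (Suc k)
  let ?N = "An q" and ?B = "omega (An p)" and ?B' = "omega (An (Suc p))" and ?O = "omega [A, omega (An p)]"
  have O: "bimodule ?O" by (rule omega_bimodule) (simp add: A O_bim)
  have b: "bims (replicate q ?B)" "bims (replicate q ?B')" "bims (replicate q ?O)" using O_bim[of p] O_bim[of "Suc p"] O by (simp_all del: replicate_Suc)
  have ne: "?N \<noteq> []" "replicate q ?B \<noteq> []" "replicate q ?B' \<noteq> []" "replicate q ?O \<noteq> []" using Suc by auto
  note da = ncomult_closed[OF a, of q]
  note c = lam_rep[OF bAn ne(1) da] and d = lam_rep[OF b(1) ne(2) y]
  have ln: "length (replicate q ?B) = length ?N" by simp
  have pe: "prods ?N (replicate q ?B) = replicate q ?O" by (rule prods_replicate[OF A])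
  let ?P = "pair_chain ?N (replicate q ?B) (repw ?N (ncomult q a)) (repw (replicate q ?B) y)"
  let ?U = "frag_extend (\<lambda>w. frag_of (smap (replicate q (unsp A p)) w))"
  let ?M = "frag_extend (\<lambda>w. frag_of (smap (replicate q (nmult (Suc p))) w))"
  let ?m = "frag_extend (\<lambda>w. frag_of (smap (replicate q (nmult p)) w))"
  note bu = bhoms_replicate[OF unsp_bhom[OF A p], of q] and bm = bhoms_replicate[OF bim_hom_bhom[OF nmult_hom[of "Suc p"]], of q]
    and bp = bhoms_replicate[OF bim_hom_bhom[OF nmult_hom[of p]], of q]
  have P: "?P \<in> wchains (replicate q ?O)" "takeuchi (replicate q ?O) ?P"
    using pair_chain_wchains[OF bAn b(1) ln ne(1) c(1) d(1)] takeuchi_pair_chain[OF bAn b(1) ln ne(1) c(1,2) d(1,2)] unfolding pe .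
  have U: "?U ?P \<in> wchains (replicate q ?B')" "takeuchi (replicate q ?B') (?U ?P)"
    using mor_extend_wchains[OF bhoms_mor(1)[OF bu b(3) b(2) ne(4)] P(1)] takeuchi_smap[OF bu b(3) b(2) ne(4) P] .
  have chi2e: "chi2 ?N (replicate q ?B) (pr (LA q) (lam (replicate q ?B)) (ncomult q a) y) = clR (replicate q ?O) ?P"
    using chi2_bhom_ne(2)[OF bAn b(1) ln ne(1) da y] lpair_def[OF bAn b(1) ln ne(1), of "ncomult q a" y] unfolding pe by simp
  have lhs: "lam_map (replicate q (nmult (Suc p))) (replicate q ?B') ?N
     (lam_map (replicate q (unsp A p)) (replicate q ?O) (replicate q ?B')
       (chi2 ?N (replicate q ?B) (pr (LA q) (lam (replicate q ?B)) (ncomult q a) y))) = clR ?N (?M (?U ?P))"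
    unfolding chi2e lam_map_cl(2)[OF bu b(3) b(2) ne(4) P] by (rule lam_map_cl(2)[OF bm b(2) bAn ne(3) U])
  \<comment> \<open>In every slot the pairing, the unsplitting and the product of
    \<open>Suc p\<close> letters combine to one binary product, by
    \<open>nmult_unsp\<close>.\<close>
  have MU: "?M (?U ?P) = mul_chain (repw ?N (ncomult q a)) (?m (repw (replicate q ?B) y))"
    unfolding pair_chain_def mul_chain_def frag_extend_extend frag_extend_of
  proof (intro frag_extend_cong[OF c(1)] frag_extend_cong[OF d(1)] arg_cong[where f = frag_of])
    fix u v assume uv: "u \<in> words ?N" "v \<in> words (replicate q ?B)"
    have l: "length u = q" "length v = q" "length (pair_word ?N (replicate q ?B) u v) = q"
      using words_length[OF uv(1)] words_length[OF uv(2)] by (auto simp: pair_word_def)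
    show "smap (replicate q (nmult (Suc p))) (smap (replicate q (unsp A p)) (pair_word ?N (replicate q ?B) u v)) = map2 mul u (smap (replicate q (nmult p)) v)"
    proof (rule nth_equalityI)
      fix j assume "j < length (smap (replicate q (nmult (Suc p))) (smap (replicate q (unsp A p)) (pair_word ?N (replicate q ?B) u v)))"
      then have j: "j < q" using l by simp
      have uj: "u ! j \<in> carrier A" "v ! j \<in> carrier ?B" using words_nth[OF uv(1), of j] words_nth[OF uv(2), of j] j by auto
      have "pair_word ?N (replicate q ?B) u v ! j = pr A ?B (u ! j) (v ! j)"
        using pair_word_nth[OF bAn b(1) ln ne(1) uv, of j] j by simp
      then show "smap (replicate q (nmult (Suc p))) (smap (replicate q (unsp A p)) (pair_word ?N (replicate q ?B) u v)) ! j = map2 mul u (smap (replicate q (nmult p)) v) ! j"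
        using j l nmult_unsp[OF p uj] by (simp del: replicate_Suc)
    qed (use l in simp)
  qed
  interpret T: pres "tensorR ?N" ?N "rl KR ?N" "clR ?N" "repw ?N" by (rule tensorR_pres[OF bAn ne(1)])
  have mw: "?m (repw (replicate q ?B) y) \<in> wchains ?N"
    by (rule mor_extend_wchains[OF bhoms_mor(1)[OF bp b(1) bAn ne(2)] d(1)])
  have Dw: "comult_chain k a \<in> wchains ?N" "comult_chain k z \<in> wchains ?N" "comult_chain k (mul a z) \<in> wchains ?N"
    using comult_chain_wchains[OF a, of k] comult_chain_wchains[OF z, of k] comult_chain_wchains[OF mulD(1)[OF a z], of k] Suc by auto
  \<comment> \<open>The hypothesis \<open>my\<close> is read as a congruence of chains, so that
    \<open>mul_chain_eqv\<close> can replace both factors by iterated comultiplications.\<close>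
  have "clR ?N (?m (repw (replicate q ?B) y)) = clR ?N (comult_chain k z)"
    using my lam_map_cl(1)[OF bp b(1) bAn ne(2) y] ncomult_Suc[OF z, of k] Suc by simp
  then have 1: "?m (repw (replicate q ?B) y) - comult_chain k z \<in> rl KR ?N" using T.cl_eq_iff[OF mw Dw(2)] by simp
  have 2: "repw ?N (ncomult q a) - comult_chain k a \<in> rl KR ?N" using T.rep_cl[OF Dw(1)] ncomult_Suc[OF a, of k] Suc by simp
  have "mul_chain (repw ?N (ncomult q a)) (?m (repw (replicate q ?B) y)) - mul_chain (comult_chain k a) (comult_chain k z) \<in> rl KR ?N"
    by (rule mul_chain_eqv[OF _ c(1,2) mw Dw(1) 2 Dw(2) 1]) (simp add: Suc)
  moreover have "mul_chain (comult_chain k a) (comult_chain k z) - comult_chain k (mul a z) \<in> rl KR ?N"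
    using rl_sym[OF comult_chain_mul[OF a z, of k]] Suc by simp
  ultimately have r: "?M (?U ?P) - comult_chain k (mul a z) \<in> rl KR ?N" unfolding MU by (rule rl_trans)
  have "?M (?U ?P) \<in> wchains ?N" by (rule mor_extend_wchains[OF bhoms_mor(1)[OF bm b(2) bAn ne(3)] U(1)])
  then have "clR ?N (?M (?U ?P)) = clR ?N (comult_chain k (mul a z))" using T.cl_eq_iff[OF _ Dw(3)] r by simp
  then show ?thesis unfolding lhs using ncomult_Suc[OF mulD(1)[OF a z], of k] Suc by simp
qed

lemma compat_pure:
  "p > 0 \<Longrightarrow> w \<in> words (An p) \<Longrightarrow>
   lam_map (replicate q (nmult p)) (replicate q (omega (An p))) (An q)
     (chi q (replicate p (An q)) (pureE (replicate p (LA q)) (map (ncomult q) w))) = ncomult q (mulw w)"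
proof (induction p arbitrary: w rule: nat_induct_non_zero)
  case 1
  then obtain a where w: "w = [a]" "a \<in> carrier A" by (auto simp: words_Cons)
  have d: "ncomult q a \<in> carrier (LA q)" by (rule ncomult_closed[OF w(2)])
  have "lam_map (replicate q (nmult 1)) (An q) (An q) (ncomult q a) = ncomult q a"
  proof (rule lam_map_ident[OF bAn _ _ d])
    fix i x assume "i < length (An q)" "x \<in> carrier (An q ! i)"
    then show "(replicate q (nmult 1) ! i) x = x" using nmult_1 by simp
  qed simp
  then show ?case using d w by (simp add: omega_single pureE_def mul_unit)
next
  case (Suc p)
  then obtain a w' where w: "w = a # w'" "a \<in> carrier A" "w' \<in> words (An p)" by (auto simp: words_Cons)
  let ?y = "chi q (replicate p (An q)) (pureE (replicate p (LA q)) (map (ncomult q) w'))"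
  have pc: "pureE (replicate p (LA q)) (map (ncomult q) w') \<in> carrier (omega (replicate p (LA q)))"
    by (rule pureE_closed[OF _ map_ncomult_words[OF w(3)]]) (simp add: LA_bim)
  have y: "?y \<in> carrier (lam (replicate q (omega (An p))))"
    by (rule bhom_closed[OF bim_hom_bhom[OF chi_hom[OF A Suc(1)]] pc])
  show ?case
    using chi_step[OF A Suc(1) ncomult_closed[OF w(2)] map_ncomult_words[OF w(3)]]
      chi_product[OF Suc(1) w(2) mulw_closed[OF w(3)] y Suc.IH[OF w(3)]] w(1) by (simp del: chi.simps replicate_Suc)
qed

text \<open>The unit is grouplike: \<open>chi_unit 2\<close> sends the unit of \<open>R^e\<close> to
  the tensor of two units, and \<delta>\<eta> is given by it. Iteration multiplies the copies of
  \<open>e\<close>.\<close>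

lemma comult_chain_e: "comult_chain k e - frag_of (replicate (Suc k) e) \<in> rl KR (An (Suc k))"
proof (induction k)
  case (Suc k)
  have one: "Renv_one \<in> carrier Renv" by (simp add: Renv_one_eq pureS_closed)
  have bh: "bhoms [\<eta>, \<eta>] [Renv, Renv] [A, A]" using bim_hom_bhom[OF homs(2)] by simp
  have bR: "bims [Renv, Renv]" "[Renv, Renv] \<noteq> []" by (auto simp: Renv_bimodule)
  interpret N: bimodule "lam (Rn 2 :: ('r, 'a) ubimod list)" by (rule lam_bimodule[OF Rn_bims])
  have "chi_unit 2 Renv_one = (unit_elt 2 :: ('r, 'a) univ)"
    unfolding Renv_one_eq chi_unit_pure N.act_one(2)[OF unit_elt_closed] by (rule N.act_one(1)[OF unit_elt_closed])
  also have "(unit_elt 2 :: ('r, 'a) univ) = clR [Renv, Renv] (frag_of [Renv_one, Renv_one])"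
    using unit_elt_eq[of 2] by (simp add: numeral_2_eq_2)
  finally have u: "chi_unit 2 Renv_one = (clR [Renv, Renv] (frag_of [Renv_one, Renv_one]) :: ('r, 'a) univ)" .
  have "\<delta> e = lam_map [\<eta>, \<eta>] [Renv, Renv] [A, A] (chi_unit 2 Renv_one)"
    using balg one unfolding bialgebroid_def e_def by blast
  also have "\<dots> = clR [A, A] (frag_of [e, e])"
    unfolding u using lam_map_cl(2)[OF bh bR(1) bAA(1) bR(2), of "frag_of [Renv_one, Renv_one]"] takeuchi_ones[of 2] one
    by (simp add: numeral_2_eq_2 e_def)
  finally have ee: "clR [A, A] (delta_chain e) = clR [A, A] (frag_of [e, e])" using delta_chain(3)[OF e_closed] by simp
  interpret P: pres "tensorR [A, A]" "[A, A]" "rl KR [A, A]" "clR [A, A]" "repw [A, A]" by (rule tensorR_pres[OF bAA])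
  have "delta_chain e - frag_of [e, e] \<in> rl KR [A, A]"
    using ee P.cl_eq_iff[OF delta_chain(1)[OF e_closed], of "frag_of [e, e]"] e_closed by simp
  from mor_eqv[OF ID_mor[of k] this] have "comult_chain (Suc k) e - frag_of [e] \<odot> comult_chain k e \<in> rl KR (An (Suc (Suc k)))" by simp
  from rl_trans[OF this cons_rl[OF e_closed Suc]] show ?case by simp
qed simp

text \<open>Both sides are additive and respect left actions, and pure tensors of \<open>R^e\<close>
  arise from its unit by left actions. At the unit the claim is that \<open>e\<close> is
  grouplike.\<close>

lemma compat_unit:
  assumes x: "x \<in> carrier Renv"
  shows "ncomult q (\<eta> x) = lam_map (replicate q \<eta>) (Rn q) (An q) (chi_unit q x)"
proof (cases q)
  case 0
  have "chi_unit 0 x \<in> carrier EndR" using ahom_closed[OF chi_unit_ahom[of 0] x] by (simp add: lam_Nil)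
  then show ?thesis using balg x 0 unfolding bialgebroid_def by (simp add: ncomult_def lam_map_def lam_Nil)
next
  case (Suc k)
  interpret P: pres "Renv :: ('r, 'a) ubimod" SS "rl {} SS" clS chain_of by (rule Renv_pres)
  interpret L: bimodule "LA q" by (rule LA_bim)
  interpret N: bimodule "lam (Rn q :: ('r, 'a) ubimod list)" by (rule lam_bimodule[OF Rn_bims])
  note bh = bhoms_replicate[OF bim_hom_bhom[OF homs(2)], of q]
  note lh = bim_hom_bhom[OF lam_map_hom[OF bh Rn_bims bAn]] and eh = bim_hom_bhom[OF homs(2)] and dh = bim_hom_bhom[OF ncomult_hom[of q]]
  have one: "Renv_one \<in> carrier (Renv :: ('r, 'a) ubimod)" by (simp add: Renv_one_eq pureS_closed)
  have "clR (An q) (frag_of (replicate q e)) = ncomult q e"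
  proof -
    interpret T: pres "tensorR (An q)" "An q" "rl KR (An q)" "clR (An q)" "repw (An q)"
      by (rule tensorR_pres[OF bAn]) (simp add: Suc)
    have "comult_chain k e \<in> wchains (An q)" "frag_of (replicate q e) \<in> wchains (An q)"
      using comult_chain_wchains[OF e_closed, of k] e_closed Suc by (auto simp: words_iff_nth simp del: replicate_Suc)
    then show ?thesis using T.cl_eq_iff rl_sym[OF comult_chain_e[of k]] ncomult_Suc[OF e_closed, of k] Suc by (simp del: replicate_Suc)
  qed
  moreover have "lam_map (replicate q \<eta>) (Rn q) (An q) (unit_elt q) = clR (An q) (frag_of (replicate q e))"
  proof -
    let ?R = "Rn q :: ('r, 'a) ubimod list" and ?u = "frag_of (replicate q Renv_one) :: ('r, 'a) chain"
    have "unit_elt q = clR ?R ?u" "?R \<noteq> []" "?u \<in> wchains ?R" using unit_elt_eq[of q] ones_words[of q] Suc by simp_all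
    then show ?thesis
      using lam_map_cl(2)[OF bh Rn_bims bAn _ _ takeuchi_ones] by (simp add: smap_replicate e_def del: replicate_Suc)
  qed
  ultimately have u: "lam_map (replicate q \<eta>) (Rn q) (An q) (unit_elt q) = ncomult q e" by simp
  show ?thesis
  proof (rule P.eqI[OF L.abelian_group_axioms ahom_comp[OF bhom_ahom[OF eh] bhom_ahom[OF dh]] ahom_comp[OF chi_unit_ahom bhom_ahom[OF lh]] _ x])
    fix w :: "('r, 'a) univ list" assume "w \<in> words SS"
    then obtain a b :: 'r where w: "w = [Scal a, Scal b]" by (auto simp: words_SS)
    interpret R: bimodule "Renv :: ('r, 'a) ubimod" by (rule Renv_bimodule)
    have "ncomult q (\<eta> (pureS a b :: ('r, 'a) univ)) = lact (LA q) a (lbact (LA q) b (ncomult q e))"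
      unfolding pureS_eq using one R.closed bhom_acts[OF eh] bhom_acts[OF dh] e_closed A.closed by (simp add: e_def)
    also have "\<dots> = lam_map (replicate q \<eta>) (Rn q) (An q) (chi_unit q (pureS a b))"
      unfolding chi_unit_pure u[symmetric]
      by (simp only: bhom_acts[OF lh N.closed(2)[OF unit_elt_closed]] bhom_acts[OF lh unit_elt_closed])
    finally show "ncomult q (\<eta> (clS (frag_of w))) = lam_map (replicate q \<eta>) (Rn q) (An q) (chi_unit q (clS (frag_of w)))" using w by simp
  qed
qed

text \<open>Both sides are additive, so for \<open>p > 0\<close> pure tensors suffice;
  \<open>p = 0\<close> is \<open>compat_unit\<close>.\<close>

lemma compat:
  assumes x: "x \<in> carrier (omega (An p))"
  shows "ncomult q (nmult p x) = lam_map (replicate q (nmult p)) (replicate q (omega (An p))) (An q)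
     (chi q (replicate p (An q)) (omega_map (replicate p (ncomult q)) (An p) (replicate p (LA q)) x))"
proof (cases "p = 0")
  case True
  then show ?thesis using compat_unit[of x q] x by (simp add: omega_Nil omega_map_def nmult_def)
next
  case False
  then have p: "p > 0" "An p \<noteq> []" by auto
  interpret P: pres "omega (An p)" "An p" "rl KE (An p)" "clE (An p)" "repw (An p)" by (rule An_pres[OF p(1)])
  have bL: "bims (replicate p (LA q))" by (simp add: LA_bim)
  note bd = bhoms_replicate[OF bim_hom_bhom[OF ncomult_hom[of q]], of p]
  note h1 = bim_hom_bhom[OF omega_map_hom[OF bd bAn bL]] and h2 = bim_hom_bhom[OF chi_hom[OF A p(1), of q]]
  have bO: "bims (replicate q (omega (An p)))" by (simp add: O_bim)
  note h3 = bim_hom_bhom[OF lam_map_hom[OF bhoms_replicate[OF bim_hom_bhom[OF nmult_hom[of p]]] bO bAn]]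
  show ?thesis
  proof (rule P.eqI[OF bimodule_group[OF LA_bim] ahom_comp[OF bhom_ahom[OF bim_hom_bhom[OF nmult_hom]] bhom_ahom[OF bim_hom_bhom[OF ncomult_hom]]]
      ahom_comp[OF ahom_comp[OF bhom_ahom[OF h1] bhom_ahom[OF h2]] bhom_ahom[OF h3]] _ x])
    fix w assume w: "w \<in> words (An p)"
    have e: "clE (An p) (frag_of w) = pureE (An p) w" by (rule pureE_eq[OF bAn p(2) w, symmetric])
    have "omega_map (replicate p (ncomult q)) (An p) (replicate p (LA q)) (clE (An p) (frag_of w)) = clE (replicate p (LA q)) (frag_of (map (ncomult q) w))"
      using omega_map_cl(2)[OF bd bAn bL p(2), of "frag_of w"] w smap_replicate[of w p "ncomult q"] words_length[OF w] by simp
    also have "\<dots> = pureE (replicate p (LA q)) (map (ncomult q) w)"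
      by (rule pureE_eq[OF bL _ map_ncomult_words[OF w], symmetric]) (use p in simp)
    finally have o: "omega_map (replicate p (ncomult q)) (An p) (replicate p (LA q)) (clE (An p) (frag_of w)) = pureE (replicate p (LA q)) (map (ncomult q) w)" .
    show "ncomult q (nmult p (clE (An p) (frag_of w))) = lam_map (replicate q (nmult p)) (replicate q (omega (An p))) (An q)
       (chi q (replicate p (An q)) (omega_map (replicate p (ncomult q)) (An p) (replicate p (LA q)) (clE (An p) (frag_of w))))"
      unfolding o compat_pure[OF p(1) w] unfolding e nmult_pure[OF w] ..
  qed
qed

lemma nmult_ncomult_bimonoid: "bimonoid A nmult ncomult"
  unfolding bimonoid_def
proof (intro conjI allI nmult_monoid ncomult_comonoid)
  fix p q
  show "restrict (ncomult q \<circ> nmult p) (carrier (omega (An p))) =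
      restrict (lam_map (replicate q (nmult p)) (replicate q (omega (An p))) (An q) \<circ> chi q (replicate p (An q))
         \<circ> omega_map (replicate p (ncomult q)) (An p) (replicate p (LA q))) (carrier (omega (An p)))"
    by (rule restrict_ext) (simp add: compat)
qed

end


section \<open>Bimonoids and bialgebroids\<close>

text \<open>Bracketing the first two of \<open>p + 2\<close> factors expresses
  \<open>m (p + 2)\<close> through \<open>m (Suc p)\<close> and \<open>m 2\<close>;
  \<open>m 1\<close> is the identity by the axioms.\<close>

lemma monoid_structure_unique:
  assumes "monoid_structure A m" "monoid_structure A m'" "m 2 = m' 2" "m 0 = m' 0"
  shows "m = m'"
proof
  fix n show "m n = m' n"
  proof (induction n rule: less_induct)
    case (less n)
    consider "n = 0" | "n = 1" | "n = 2" | p where "n = p + 2" "p > 0"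
      by (metis One_nat_def add_2_eq_Suc' gr0I less_2_cases not_less_eq old.nat.exhaust numeral_2_eq_2)
    then show ?case
    proof cases
      case 4
      then have s: "m (Suc p) = m' (Suc p)" by (intro less.IH) simp
      have "m (p + 2) = restrict (m (Suc p) \<circ> omega_map (at_pos 0 p (m 2)) (bracketing omega (replicate (p + 2) A) 0 2) (replicate (Suc p) A)
           \<circ> omega_split (replicate (p + 2) A) 0 2) (carrier (omega (replicate (p + 2) A)))"
        using assms(1) unfolding monoid_structure_def by blast
      also have "\<dots> = m' (p + 2)"
        using assms(2) unfolding s assms(3) monoid_structure_def by (metis le0)
      finally show ?thesis using 4 by simp
    qed (use assms in \<open>simp_all add: monoid_structure_def\<close>)
  qed
qed

lemma comonoid_structure_unique:
  assumes "comonoid_structure A d" "comonoid_structure A d'" "d 2 = d' 2" "d 0 = d' 0"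
  shows "d = d'"
proof
  fix n show "d n = d' n"
  proof (induction n rule: less_induct)
    case (less n)
    consider "n = 0" | "n = 1" | "n = 2" | p where "n = p + 2" "p > 0"
      by (metis One_nat_def add_2_eq_Suc' gr0I less_2_cases not_less_eq old.nat.exhaust numeral_2_eq_2)
    then show ?case
    proof cases
      case 4
      then have s: "d (Suc p) = d' (Suc p)" by (intro less.IH) simp
      have "d (p + 2) = restrict (lam_join (replicate (p + 2) A) 0 2
           \<circ> lam_map (at_pos 0 p (d 2)) (replicate (Suc p) A) (bracketing lam (replicate (p + 2) A) 0 2) \<circ> d (Suc p)) (carrier A)"
        using assms(1) unfolding comonoid_structure_def by blast
      also have "\<dots> = d' (p + 2)"
        using assms(2) unfolding s assms(3) comonoid_structure_def by (metis le0)
      finally show ?thesis using 4 by simp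
    qed (use assms in \<open>simp_all add: comonoid_structure_def\<close>)
  qed
qed

text \<open>Each bialgebroid axiom compares instances of the bimonoid axioms in low arity; the four
  compatibilities are those with \<open>p\<close> and \<open>q\<close> equal to 0 or 2.\<close>

lemma bimonoid_bialgebroid:
  assumes A: "bimodule A" and bm: "bimonoid A m d"
  shows "bialgebroid A (m 2) (m 0) (d 2) (d 0)"
proof -
  have M: "monoid_structure A m" and D: "comonoid_structure A d"
    and C: "\<And>p q. restrict (d q \<circ> m p) (carrier (omega (replicate p A))) =
        restrict (lam_map (replicate q (m p)) (replicate q (omega (replicate p A))) (replicate q A)
           \<circ> chi q (replicate p (replicate q A)) \<circ> omega_map (replicate p (d q)) (replicate p A) (replicate p (lam (replicate q A))))
          (carrier (omega (replicate p A)))"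
    using bm by (auto simp: bimonoid_def)
  have n: "replicate 2 x = [x, x]" "replicate (1 + 2) x = [x, x, x]" "replicate (Suc 1) x = [x, x]" "replicate (1 + 0) x = [x]" for x :: 'z
    by (simp_all add: eval_nat_numeral)
  have n': "replicate 2 x = [x, x]" for x :: 'y by (simp add: eval_nat_numeral)
  have mh: "m k \<in> bim_hom (omega (replicate k A)) A" and m1: "m 1 = (\<lambda>x\<in>carrier A. x)" for k
    using M by (auto simp: monoid_structure_def)
  have dh: "d k \<in> bim_hom A (lam (replicate k A))" and d1: "d 1 = (\<lambda>x\<in>carrier A. x)" for k
    using D by (auto simp: comonoid_structure_def)
  have pos: "at_pos 0 1 f = [f, id]" "at_pos 1 1 f = [id, f]" for f :: "('a, 'b) univ \<Rightarrow> ('a, 'b) univ"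
    by (simp_all add: at_pos_def)
  have bro: "bracketing omega [A, A, A] 0 2 = [omega [A, A], A]" "bracketing omega [A, A, A] 1 2 = [A, omega [A, A]]"
    "bracketing omega [A] 0 0 = [Renv, A]" "bracketing omega [A] 1 0 = [A, Renv]"
    by (simp_all add: bracketing_def omega_Nil eval_nat_numeral)
  have brl: "bracketing lam [A, A, A] 0 2 = [lam [A, A], A]" "bracketing lam [A, A, A] 1 2 = [A, lam [A, A]]"
    "bracketing lam [A] 0 0 = [EndR, A]" "bracketing lam [A] 1 0 = [A, EndR]"
    by (simp_all add: bracketing_def lam_Nil eval_nat_numeral)
  have Ma: "m (p + l) = restrict (m (Suc p) \<circ> omega_map (at_pos i p (m l)) (bracketing omega (replicate (p + l) A) i l) (replicate (Suc p) A)
           \<circ> omega_split (replicate (p + l) A) i l) (carrier (omega (replicate (p + l) A)))" if "i \<le> p" for p l i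
    using M that unfolding monoid_structure_def by blast
  have Da: "d (p + l) = restrict (lam_join (replicate (p + l) A) i l
           \<circ> lam_map (at_pos i p (d l)) (replicate (Suc p) A) (bracketing lam (replicate (p + l) A) i l) \<circ> d (Suc p)) (carrier A)"
    if "i \<le> p" for p l i
    using D that unfolding comonoid_structure_def by blast
  have s1: "Suc 1 = 2" by simp
  \<comment> \<open>\<open>m 3\<close> and \<open>d 3\<close> are computed with the block of two at
    either position, and \<open>m 1\<close> and \<open>d 1\<close> with an empty block at either
    position.\<close>
  note ma = Ma[of 0 1 2, unfolded n pos bro, unfolded s1] Ma[of 1 1 2, unfolded n pos bro, unfolded s1]
    and mu = Ma[of 0 1 0, unfolded n pos bro, unfolded s1] Ma[of 1 1 0, unfolded n pos bro, unfolded s1]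
    and da = Da[of 0 1 2, unfolded n pos brl, unfolded s1] Da[of 1 1 2, unfolded n pos brl, unfolded s1]
    and du = Da[of 0 1 0, unfolded n pos brl, unfolded s1] Da[of 1 1 0, unfolded n pos brl, unfolded s1]
  have homs: "m 2 \<in> bim_hom (omega [A, A]) A" "m 0 \<in> bim_hom Renv A" "d 2 \<in> bim_hom A (lam [A, A])" "d 0 \<in> bim_hom A EndR"
    using mh[of 2] mh[of 0] dh[of 2] dh[of 0] by (simp_all add: n omega_Nil lam_Nil)
  have L: "bimodule (lam [A, A])" by (rule lam_bimodule) (simp add: A)
  have E: "bimodule (EndR :: ('a, 'b) ubimod)" by (rule EndR_bimodule)
  have OA: "bimodule (omega [A, A])" by (rule omega_bimodule) (simp add: A)
  have assoc: "m 2 (omega_map [m 2, id] [omega [A, A], A] [A, A] (omega_split [A, A, A] 0 2 x)) =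
      m 2 (omega_map [id, m 2] [A, omega [A, A]] [A, A] (omega_split [A, A, A] 1 2 x))"
    if "x \<in> carrier (omega [A, A, A])" for x
    using fun_cong[OF ma(1), of x] fun_cong[OF ma(2), of x] that by simp
  have unit: "m 2 (omega_map [m 0, id] [Renv, A] [A, A] (omega_split [A] 0 0 a)) = a"
    "m 2 (omega_map [id, m 0] [A, Renv] [A, A] (omega_split [A] 1 0 a)) = a" if "a \<in> carrier A" for a
    using fun_cong[OF mu(1), of a] fun_cong[OF mu(2), of a] that m1 by (simp_all add: omega_single)
  have coassoc: "lam_join [A, A, A] 0 2 (lam_map [d 2, id] [A, A] [lam [A, A], A] (d 2 a)) =
      lam_join [A, A, A] 1 2 (lam_map [id, d 2] [A, A] [A, lam [A, A]] (d 2 a))" if "a \<in> carrier A" for a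
    using fun_cong[OF da(1), of a] fun_cong[OF da(2), of a] that by simp
  have counit: "lam_join [A] 0 0 (lam_map [d 0, id] [A, A] [EndR, A] (d 2 a)) = a"
    "lam_join [A] 1 0 (lam_map [id, d 0] [A, A] [A, EndR] (d 2 a)) = a" if "a \<in> carrier A" for a
    using fun_cong[OF du(1), of a] fun_cong[OF du(2), of a] that d1 by simp_all
  have om: "omega_map [d q, d q] [A, A] [lam (replicate q A), lam (replicate q A)] x \<in> carrier (omega [lam (replicate q A), lam (replicate q A)])"
    if "x \<in> carrier (omega [A, A])" for q x
    by (rule bhom_closed[OF bim_hom_bhom[OF omega_map_hom] that])
      (use A dh[of q] lam_bimodule[of "replicate q A"] in \<open>auto intro: bim_hom_bhom\<close>)
  have C2: "d q (m 2 x) = lam_map (replicate q (m 2)) (replicate q (omega [A, A])) (replicate q A)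
      (chi2 (replicate q A) (replicate q A) (omega_map [d q, d q] [A, A] [lam (replicate q A), lam (replicate q A)] x))"
    if x: "x \<in> carrier (omega [A, A])" for q x
    using fun_cong[OF C[of q 2], of x] x chi_two[OF A om[OF x, of q]] by (simp add: n n' del: chi.simps)
  have mult: "d 2 (m 2 x) = lam_map [m 2, m 2] [omega [A, A], omega [A, A]] [A, A]
      (chi2 [A, A] [A, A] (omega_map [d 2, d 2] [A, A] [lam [A, A], lam [A, A]] x))" if "x \<in> carrier (omega [A, A])" for x
    using C2[OF that, of 2] by (simp add: n n')
  \<comment> \<open>For \<open>q = 0\<close> the outer \<open>lam_map\<close> is the identity
    restricted to \<open>EndR\<close>, so the composite must be known to land there.\<close>
  have mult0: "d 0 (m 2 x) = chi2 [] [] (omega_map [d 0, d 0] [A, A] [EndR, EndR] x)" if "x \<in> carrier (omega [A, A])" for x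
    using C2[OF that, of 0] bhom_closed[OF chi2_bhom_0(1), of "omega_map [d 0, d 0] [A, A] [EndR, EndR] x"] om[OF that, of 0]
    by (simp add: lam_map_def lam_Nil)
  have C0: "d q (m 0 x) = lam_map (replicate q (m 0)) (Rn q) (replicate q A) (chi_unit q x)" if "x \<in> carrier Renv" for q x
    using fun_cong[OF C[of q 0], of x] that by (simp add: omega_Nil omega_map_def)
  have un0: "d 0 (m 0 x) = chi_unit 0 x" if "x \<in> carrier Renv" for x
    using C0[OF that, of 0] ahom_closed[OF chi_unit_ahom[of 0] that] by (simp add: lam_map_def lam_Nil)
  have un2: "d 2 (m 0 x) = lam_map [m 0, m 0] [Renv, Renv] [A, A] (chi_unit 2 x)" if "x \<in> carrier Renv" for x
    using C0[OF that, of 2] by (simp add: n n')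
  show ?thesis
    unfolding bialgebroid_def
    by (intro conjI ballI homs assoc unit coassoc counit mult mult0 un0 un2)
qed

theorem mainTheorem8:
  fixes A :: "('r::{ring, monoid_mult}, 'a) ubimod"
  assumes "bimodule A"
  shows "bij_betw (\<lambda>(m, d). (m 2, m 0, d 2, d 0))
    {(m, d). bimonoid A m d}
    {(\<mu>, \<eta>, \<delta>, \<epsilon>). bialgebroid A \<mu> \<eta> \<delta> \<epsilon>}"
proof (rule bij_betw_imageI)
  show "inj_on (\<lambda>(m, d). (m 2, m 0, d 2, d 0)) {(m, d). bimonoid A m d}"
    by (rule inj_onI) (auto simp: bimonoid_def intro: monoid_structure_unique comonoid_structure_unique)
  show "(\<lambda>(m, d). (m 2, m 0, d 2, d 0)) ` {(m, d). bimonoid A m d} = {(\<mu>, \<eta>, \<delta>, \<epsilon>). bialgebroid A \<mu> \<eta> \<delta> \<epsilon>}"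
  proof (intro equalityI subsetI)
    fix t assume "t \<in> (\<lambda>(m, d). (m 2, m 0, d 2, d 0)) ` {(m, d). bimonoid A m d}"
    then show "t \<in> {(\<mu>, \<eta>, \<delta>, \<epsilon>). bialgebroid A \<mu> \<eta> \<delta> \<epsilon>}" using bimonoid_bialgebroid[OF assms] by auto
  next
    fix t assume "t \<in> {(\<mu>, \<eta>, \<delta>, \<epsilon>). bialgebroid A \<mu> \<eta> \<delta> \<epsilon>}"
    then obtain \<mu> \<eta> \<delta> \<epsilon> where t: "t = (\<mu>, \<eta>, \<delta>, \<epsilon>)" and "bialgebroid A \<mu> \<eta> \<delta> \<epsilon>" by auto
    then interpret balg A \<mu> \<eta> \<delta> \<epsilon> using assms by (intro balg.intro)
    \<comment> \<open>The recovered maps agree with the given ones as functions, not just on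
      carriers, because all of them are extensional.\<close>
    have "nmult 0 = \<eta>" "ncomult 0 = \<epsilon>" by (simp_all add: nmult_def ncomult_def)
    then have "t = (nmult 2, nmult 0, ncomult 2, ncomult 0)" by (simp add: t nmult_2 ncomult_2)
    then show "t \<in> (\<lambda>(m, d). (m 2, m 0, d 2, d 0)) ` {(m, d). bimonoid A m d}"
      using nmult_ncomult_bimonoid by (intro image_eqI[of _ _ "(nmult, ncomult)"]) auto
  qed
qed

end
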